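(* Let $d\ge2$ and $\mathbb{R}^d_+=\{(x',x_d):x'\in\mathbb{R}^{d-1},\,x_d>0\}$. Assume that $a\in L^\infty_\vartheta(\mathbb{R}^d_+)$ with $\vartheta>\frac{d+1}{2}$, $\operatorname{div}a=0$ and vanishing normal component $a_d$ on $\partial\mathbb{R}^d_+$, and let $\underline{\vartheta}=\min\{\vartheta;d+1\}$. Then there exist $T>0$ and a unique strong solution $u\in\mathcal{C}_w([0,T);L^\infty_{\underline{\vartheta}}(\mathbb{R}^d_+))$ of the integral Navier--Stokes equation in the half space with Neumann boundary conditions, $$u(t)=e^{-tA'}a-\int_0^te^{-(t-s)A'}\mathbb{P}\operatorname{div}(u\otimes u)(s)\,ds .$$ Such a solution satisfies, as $|x|\to\infty$, $$u(x,t)=e^{-tA'}a(x)+H(x,t)+\mathcal{O}_t\left(|x|^{-\min\{2\vartheta;\,d+2\}}\right),$$ where $H=(H_1,\dots,H_d)$ is homogeneous of degree $-(d+1)$ in $x$ for all $t\in[0,T)$, and such that $$|H_j(x,t)|\le C\,|x'|\cdot|x|^{-(d+2)}\quad(1\le j\le d-1),\qquad |H_d(x,t)|\le C\,|x_d|\cdot|x|^{-(d+2)}.$$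
   Context: Write $u'=(u_1,\dots,u_{d-1})$, $x'=(x_1,\dots,x_{d-1})$, $\partial_d=\partial/\partial x_d$. $\{e^{-tA'}\}_{t\ge0}$ is the semigroup generated by $-A'=\Delta$ on $\mathbb{R}^d_+$ with the boundary conditions $\partial_du'|_{\partial\mathbb{R}^d_+}=0$, $u_d|_{\partial\mathbb{R}^d_+}=0$; concretely, $e^{-tA'}a$ is the restriction to $\mathbb{R}^d_+$ of the heat evolution $e^{t\Delta}\tilde a$ on $\mathbb{R}^d$, where $\tilde a$ extends $a$ by even reflection in $x_d$ of $a_1,\dots,a_{d-1}$ and odd reflection in $x_d$ of $a_d$. $\mathbb{P}$ is the Leray--Hopf projector onto divergence-free vector fields with zero normal component on the boundary of $\mathbb{R}^d_+$ (corresponding under this reflection to $\mathbb{P}f=f-\nabla\Delta^{-1}\operatorname{div}f$ on $\mathbb{R}^d$). $L^\infty_\vartheta(\mathbb{R}^d_+)$ is the space of measurable $f$ on $\mathbb{R}^d_+$ with $\operatorname{ess\,sup}_x(1+|x|)^\vartheta|f(x)|<\infty$. $\mathcal{C}_w([0,T);L^\infty_\vartheta)$ is the space of $u(x,t)$ with $u(t)\in L^\infty_\vartheta$ for all $t\in[0,T)$, continuous in $t>0$ for the $L^\infty_\vartheta$ norm, with $u(t)\to u(0)$ in the distributional sense as $t\to0$; its elements are understood to be bounded in $L^\infty_\vartheta$ on each $[0,T']$, $T'<T$. $f(x,t)=\mathcal{O}_t(\phi(x)^{-1})$ means $|\phi(x)f(x,t)|\le C_t$ (here for large $|x|$) with $t\mapsto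 C_t$ locally bounded. *)

theory Defs
  imports "HOL-Analysis.Analysis" "HOL-Probability.Essential_Supremum"
begin

section \<open>The half space and reflection across its boundary\<close>

text \<open>
  A point of \<open>\<real>\<^sup>d\<close> is a pair \<open>(x', x\<^sub>d)\<close>, so \<open>x' = fst x\<close> and \<open>x\<^sub>d = snd x\<close>. With \<open>x'\<close> of type
  \<open>real ^ 'n\<close> one has \<open>d = CARD('n) + 1\<close>, and \<open>d \<ge> 2\<close> holds automatically. The norm on the
  product type is the Euclidean one.
\<close>

definition half_space :: "('a::euclidean_space \<times> real) set" where
  "half_space = {x. snd x > 0}"

definition reflect :: "'a::euclidean_space \<times> real \<Rightarrow> 'a \<times> real" where
  "reflect x = (fst x, - snd x)"

text \<open>
  Even extension of the tangential components and odd extension of the normal one: for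
  \<open>x\<^sub>d < 0\<close> the value is \<open>(v'(x', -x\<^sub>d), -v\<^sub>d(x', -x\<^sub>d))\<close>. The value on the null set \<open>x\<^sub>d = 0\<close> is
  irrelevant.
\<close>

definition extend :: "('a::euclidean_space \<times> real \<Rightarrow> 'a \<times> real) \<Rightarrow> 'a \<times> real \<Rightarrow> 'a \<times> real" where
  "extend v x = (if snd x > 0 then v x else if snd x < 0 then reflect (v (reflect x)) else 0)"


section \<open>Test functions, divergence and normal trace\<close>

primrec Ck :: "nat \<Rightarrow> ('a::euclidean_space \<Rightarrow> real) \<Rightarrow> bool" where
  "Ck 0 \<phi> \<longleftrightarrow> continuous_on UNIV \<phi>"
| "Ck (Suc k) \<phi> \<longleftrightarrow> (\<forall>x. \<phi> differentiable (at x)) \<and>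
      (\<forall>i\<in>Basis. Ck k (\<lambda>x. frechet_derivative \<phi> (at x) i))"

definition test_function :: "'a::euclidean_space set \<Rightarrow> ('a \<Rightarrow> real) \<Rightarrow> bool" where
  "test_function U \<phi> \<longleftrightarrow> (\<forall>k. Ck k \<phi>) \<and>
      compact (closure {x. \<phi> x \<noteq> 0}) \<and> closure {x. \<phi> x \<noteq> 0} \<subseteq> U"

definition grad :: "('a::euclidean_space \<Rightarrow> real) \<Rightarrow> 'a \<Rightarrow> 'a" where
  "grad \<phi> x = (\<Sum>i\<in>Basis. frechet_derivative \<phi> (at x) i *\<^sub>R i)"

definition div_free :: "('a::euclidean_space \<times> real \<Rightarrow> 'a \<times> real) \<Rightarrow> bool" where
  "div_free a \<longleftrightarrow> (\<forall>\<phi>. test_function half_space \<phi> \<longrightarrow>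
      (LINT x:half_space|lebesgue. a x \<bullet> grad \<phi> x) = 0)"

text \<open>
  The normal trace of a bounded divergence free field is defined by Green's formula,
  \<open>\<integral>\<^bsub>x\<^sub>d>0\<^esub> a \<bullet> \<nabla>\<phi> = - \<integral>\<^bsub>x\<^sub>d=0\<^esub> a\<^sub>d \<phi>\<close>, where \<open>\<phi>\<close> need not vanish on the boundary.
\<close>

definition normal_trace_zero :: "('a::euclidean_space \<times> real \<Rightarrow> 'a \<times> real) \<Rightarrow> bool" where
  "normal_trace_zero a \<longleftrightarrow> (\<forall>\<phi>. test_function UNIV \<phi> \<longrightarrow>
      (LINT x:half_space|lebesgue. a x \<bullet> grad \<phi> x) = 0)"


section \<open>Function spaces\<close>

definition Linf_norm :: "real \<Rightarrow> ('a::euclidean_space \<times> real \<Rightarrow> 'a \<times> real) \<Rightarrow> ereal" where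
  "Linf_norm \<theta> f =
     esssup (lebesgue_on half_space) (\<lambda>x. ereal ((1 + norm x) powr \<theta> * norm (f x)))"

definition Linf :: "real \<Rightarrow> ('a::euclidean_space \<times> real \<Rightarrow> 'a \<times> real) set" where
  "Linf \<theta> = {f \<in> borel_measurable (lebesgue_on half_space). Linf_norm \<theta> f < \<infinity>}"

definition Cw :: "real \<Rightarrow> real \<Rightarrow> (real \<Rightarrow> 'a::euclidean_space \<times> real \<Rightarrow> 'a \<times> real) set" where
  "Cw T \<theta> = {u.
     (\<forall>t\<in>{0..<T}. u t \<in> Linf \<theta>) \<and>
     (\<forall>t\<in>{0<..<T}. ((\<lambda>s. Linf_norm \<theta> (\<lambda>x. u s x - u t x)) \<longlongrightarrow> 0) (at t)) \<and>
     (\<forall>\<phi>. test_function half_space \<phi> \<longrightarrow>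
        ((\<lambda>t. LINT x:half_space|lebesgue. \<phi> x *\<^sub>R u t x) \<longlongrightarrow>
           (LINT x:half_space|lebesgue. \<phi> x *\<^sub>R u 0 x)) (at_right 0)) \<and>
     (\<forall>T'\<in>{0..<T}. \<exists>C::real. \<forall>t\<in>{0..T'}. Linf_norm \<theta> (u t) \<le> ereal C)}"


section \<open>The heat semigroup with Neumann boundary conditions\<close>

definition heat_kernel :: "real \<Rightarrow> 'a::euclidean_space \<Rightarrow> real" where
  "heat_kernel t z = (4 * pi * t) powr (- (real DIM('a) / 2)) * exp (- (norm z)\<^sup>2 / (4 * t))"

definition heat :: "real \<Rightarrow> ('a::euclidean_space \<Rightarrow> 'a) \<Rightarrow> 'a \<Rightarrow> 'a" where
  "heat t f x = (if t = 0 then f x else (LINT y|lebesgue. heat_kernel t (x - y) *\<^sub>R f y))"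

text \<open>\<open>exp(-tA') a\<close>; meaningful at points of the half space.\<close>

definition neumann_heat ::
    "real \<Rightarrow> ('a::euclidean_space \<times> real \<Rightarrow> 'a \<times> real) \<Rightarrow> 'a \<times> real \<Rightarrow> 'a \<times> real" where
  "neumann_heat t a = heat t (extend a)"


section \<open>The nonlinear term\<close>

text \<open>
  For \<open>v \<in> L\<^sup>\<infinity>\<^sub>\<theta>\<close> with \<open>2\<theta> > d\<close> the reflected tensor \<open>v \<otimes> v\<close> is integrable on \<open>\<real>\<^sup>d\<close>, so its
  divergence, a tempered distribution in general, is handled through its Fourier transform, and
  \<open>div\<close>, the Leray projector \<open>f - \<nabla> \<Delta>\<^sup>-\<^sup>1 div f\<close> and the heat semigroup act as Fourier multipliers.
  A vector field is represented on the Fourier side by its components \<open>F j \<xi>\<close> along \<open>j \<in> Basis\<close>.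
\<close>

definition fourier :: "('a::euclidean_space \<Rightarrow> real) \<Rightarrow> 'a \<Rightarrow> complex" where
  "fourier f \<xi> = (LINT y|lebesgue. cis (- (\<xi> \<bullet> y)) * complex_of_real (f y))"

definition tensor_hat :: "('a::euclidean_space \<Rightarrow> 'a) \<Rightarrow> 'a \<Rightarrow> 'a \<Rightarrow> 'a \<Rightarrow> complex" where
  "tensor_hat v h k = fourier (\<lambda>y. (v y \<bullet> h) * (v y \<bullet> k))"

definition div_hat :: "('a::euclidean_space \<Rightarrow> 'a \<Rightarrow> 'a \<Rightarrow> complex) \<Rightarrow> 'a \<Rightarrow> 'a \<Rightarrow> complex" where
  "div_hat W k \<xi> = (\<Sum>h\<in>Basis. \<i> * complex_of_real (\<xi> \<bullet> h) * W h k \<xi>)"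

definition leray_hat :: "('a::euclidean_space \<Rightarrow> 'a \<Rightarrow> complex) \<Rightarrow> 'a \<Rightarrow> 'a \<Rightarrow> complex" where
  "leray_hat F j \<xi> =
     F j \<xi> - complex_of_real ((\<xi> \<bullet> j) / (norm \<xi>)\<^sup>2) * (\<Sum>k\<in>Basis. complex_of_real (\<xi> \<bullet> k) * F k \<xi>)"

definition heat_hat :: "real \<Rightarrow> ('a::euclidean_space \<Rightarrow> 'a \<Rightarrow> complex) \<Rightarrow> 'a \<Rightarrow> 'a \<Rightarrow> complex" where
  "heat_hat \<tau> F j \<xi> = complex_of_real (exp (- \<tau> * (norm \<xi>)\<^sup>2)) * F j \<xi>"

text \<open>The inverse transform of a real field is real, so taking the real part only changes the type.\<close>

definition inverse_fourier :: "('a::euclidean_space \<Rightarrow> 'a \<Rightarrow> complex) \<Rightarrow> 'a \<Rightarrow> 'a" where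
  "inverse_fourier F x =
     (\<Sum>j\<in>Basis. Re ((LINT \<xi>|lebesgue. cis (\<xi> \<bullet> x) * F j \<xi>) / complex_of_real ((2 * pi) ^ DIM('a))) *\<^sub>R j)"

text \<open>\<open>exp(-\<tau>A') \<P> div (v \<otimes> v)\<close> for \<open>\<tau> > 0\<close>; meaningful at points of the half space.\<close>

definition neumann_nonlinear ::
    "real \<Rightarrow> ('a::euclidean_space \<times> real \<Rightarrow> 'a \<times> real) \<Rightarrow> 'a \<times> real \<Rightarrow> 'a \<times> real" where
  "neumann_nonlinear \<tau> v =
     inverse_fourier (heat_hat \<tau> (leray_hat (div_hat (tensor_hat (extend v)))))"


section \<open>Strong solutions and remainder terms\<close>

text \<open>The Duhamel integral is required to converge absolutely at almost every point.\<close>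

definition NS_solution ::
    "('a::euclidean_space \<times> real \<Rightarrow> 'a \<times> real) \<Rightarrow> real \<Rightarrow> real \<Rightarrow>
     (real \<Rightarrow> 'a \<times> real \<Rightarrow> 'a \<times> real) \<Rightarrow> bool" where
  "NS_solution a \<theta> T u \<longleftrightarrow> u \<in> Cw T \<theta> \<and>
     (\<forall>t\<in>{0..<T}. AE x in lebesgue_on half_space.
        set_integrable lebesgue {0<..<t} (\<lambda>s. neumann_nonlinear (t - s) (u s) x) \<and>
        u t x = neumann_heat t a x
                - (LINT s:{0<..<t}|lebesgue. neumann_nonlinear (t - s) (u s) x))"

text \<open>
  \<open>f(x,t) = O\<^sub>t(\<phi>(x)\<^sup>-\<^sup>1)\<close> as \<open>|x| \<rightarrow> \<infinity>\<close> in the half space, for \<open>t \<in> [0,T)\<close>.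
\<close>

definition bigO_t ::
    "real \<Rightarrow> ('a::euclidean_space \<times> real \<Rightarrow> real) \<Rightarrow>
     (real \<Rightarrow> 'a \<times> real \<Rightarrow> 'a \<times> real) \<Rightarrow> bool" where
  "bigO_t T \<phi> f \<longleftrightarrow> (\<exists>(R::real) (C::real \<Rightarrow> real).
     (\<forall>T'\<in>{0..<T}. bounded (C ` {0..T'})) \<and>
     (\<forall>t\<in>{0..<T}. AE x in lebesgue_on half_space. norm x \<ge> R \<longrightarrow> norm (\<phi> x *\<^sub>R f t x) \<le> C t))"

end

theory Submission
  imports Defs "HOL-Probability.Characteristic_Functions"
begin

text \<open>
  After reflection, \<open>e\<^sup>-\<^sup>\<tau>\<^sup>A' \<P> div (v \<otimes> v)\<close> is the integral of \<open>F\<^sub>\<tau>(x - y; v(y))\<close>, where the Oseen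
  kernel \<open>F\<^sub>\<tau>(z; w)\<close> is quadratic in \<open>w\<close> and bounded by a multiple of \<open>|w|\<^sup>2 (\<tau>\<^bsup>1/2\<^esup> + |z|)\<^bsup>-(d+1)\<^esup>\<close>. Since
  \<open>|v|\<^sup>2\<close> decays faster than \<open>|y|\<^bsup>-(d+1)\<^esup>\<close>, the Duhamel term decays like \<open>|x|\<^bsup>-(d+1)\<^esup>\<close> with constant
  \<open>\<tau>\<^bsup>-1/2\<^esup>\<close>, so Picard iteration converges on a short time interval.

  For the profile, \<open>F\<^sub>\<tau>(z; w)\<close> differs from a kernel \<open>F\<^sub>0(z; w)\<close>, homogeneous of degree \<open>-(d+1)\<close> in \<open>z\<close>,
  by at most a multiple of \<open>\<tau> |w|\<^sup>2 |z|\<^bsup>-(d+3)\<^esup>\<close>. Replacing \<open>F\<^bsub>t-s\<^esub>(x - y; u)\<close> by \<open>F\<^sub>0(x; u)\<close> makes an error smaller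
  by up to one power of \<open>|x|\<close>, because \<open>|y| |u(y)|\<^sup>2\<close> is integrable when \<open>2\<theta> > d + 1\<close>; this leaves
  \<open>H(x, t) = - \<integral>\<integral> F\<^sub>0(x; u(y, s)) dy ds\<close>. The reflection symmetry of \<open>u\<close> then removes the products of its
  tangential and normal components, which gives the factors \<open>|x'|\<close> and \<open>|x\<^sub>d|\<close>.
\<close>

section \<open>Weights and convolution\<close>

text \<open>\<open>Cw\<close> controls u only through the single slices u(t) and norm differences
  between them; it does not give joint measurability in (s, y). Time integrals are therefore handled
  for each fixed x: the integrand \<open>oconv (t - s) (u s) x\<close> is shown to be continuous in
  s on (0, t), which requires control of the Oseen kernel in \<tau> as well as in w. The natural
  bound for a time shift costs (\<tau>'-\<tau>)/\<tau> and, multiplied by \<tau>^(-1/2), is not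
  integrable at 0; interpolating it with the size of the kernel gives (\<tau>'-\<tau>)^(1/4)
  \<tau>^(-3/4). Measurability in x comes from the Fourier side, where each slice is the inverse
  transform of an integrable function. The exponent is cut to min(\<theta>, d+1) because the
  estimate for the Duhamel term never exceeds decay of order d+1, however fast the data decay.
  Existence uses iterates defined at every point (\<open>regular\<close>); uniqueness uses almost
  everywhere bounds (\<open>admissible\<close>), since a competing solution is known only up to null
  sets and is bounded only on compact subintervals of [0, T).\<close>

definition wgt :: "real \<Rightarrow> 'a::real_normed_vector \<Rightarrow> real" where
  "wgt p x = (1 + norm x) powr (- p)"

lemma wgt_pos [simp]: "wgt p x > 0"
  unfolding wgt_def by (smt (verit) norm_ge_zero powr_gt_zero)

lemma wgt_nonneg [simp]: "wgt p x \<ge> 0"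
  by (simp add: less_imp_le)

lemma wgt_mono: "q \<le> p \<Longrightarrow> wgt p x \<le> wgt q x"
  unfolding wgt_def by (intro powr_mono) auto

lemma wgt_le_1: "0 \<le> p \<Longrightarrow> wgt p x \<le> 1"
  using wgt_mono[of 0 p x] by (simp add: wgt_def split: if_splits)

lemma wgt_add: "wgt p x * wgt q x = wgt (p + q) x"
  unfolding wgt_def by (simp add: powr_add[symmetric] add.commute)

lemma wgt_inverse: "(1 + norm x) powr p * wgt p x = 1"
  unfolding wgt_def by (simp add: powr_add[symmetric]) (smt (verit) norm_ge_zero)

lemma continuous_wgt [continuous_intros]: "continuous_on S (\<lambda>x. wgt p x)"
  unfolding wgt_def by (intro continuous_intros) (smt (verit) norm_ge_zero)

lemma borel_measurable_wgt [measurable]: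
  "(\<lambda>x::'a::euclidean_space. wgt p x) \<in> borel_measurable borel"
  by (intro borel_measurable_continuous_onI continuous_wgt)

lemma wgt_real: "wgt (real n) x = 1 / (1 + norm x) ^ n"
  unfolding wgt_def by (subst powr_minus, subst powr_realpow) (auto simp: divide_simps, smt (verit) norm_ge_zero)

text \<open>Dyadic comparison: with k the integer part of log_2(1+|z|), the weight is at most
  2^(-kp) and z lies in the ball of radius 2^(k+1). Summing weight times ball volume gives a
  geometric series of ratio 2^(d-p), which is below 1 because p > d.\<close>

lemma integrable_wgt:
  assumes "p > real DIM('a)"
  shows "integrable lborel (\<lambda>z::'a::euclidean_space. wgt p z)"
proof (rule integrableI_bounded)
  let ?d = "DIM('a)"
  let ?f = "\<lambda>k z. ennreal (2 powr (- real k * p)) * indicator (ball (0::'a) (2 ^ (k + 1))) z"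
  show "(\<lambda>z::'a. wgt p z) \<in> borel_measurable lborel" by measurable
  have gen: "F k \<le> (\<Sum>k. F k)" for F :: "nat \<Rightarrow> ennreal" and k
    using sum_le_suminf[of F "{k}"] by simp
  have pt: "ennreal (norm (wgt p z)) \<le> (\<Sum>k. ?f k z)" for z :: 'a
  proof -
    define k where "k = nat \<lfloor>log 2 (1 + norm z)\<rfloor>"
    have pos: "1 + norm z > 0" by (smt (verit) norm_ge_zero)
    have l0: "log 2 (1 + norm z) \<ge> 0"
      using pos by (subst zero_le_log_cancel_iff) auto
    have k1: "real k \<le> log 2 (1 + norm z)" and k2: "log 2 (1 + norm z) < real k + 1"
      unfolding k_def using l0 by linarith+
    have a: "2 powr real k \<le> 1 + norm z"
      using k1 pos by (simp add: le_log_iff)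
    have "1 + norm z < 2 powr (real k + 1)" using k2 pos by (simp add: log_less_iff)
    also have "2 powr (real k + 1) = 2 ^ (k + 1)"
      using powr_realpow[of 2 "k + 1"] by (simp add: add.commute)
    finally have b: "norm z < 2 ^ (k + 1)" by simp
    have "wgt p z = (1 + norm z) powr (- p)" by (simp add: wgt_def)
    also have "\<dots> \<le> (2 powr real k) powr (- p)"
      using a assms by (intro powr_mono2') auto
    also have "\<dots> = 2 powr (- real k * p)" by (simp add: powr_powr)
    finally have "ennreal (norm (wgt p z)) \<le> ?f k z"
      using b by (simp add: ennreal_leI)
    also have "\<dots> \<le> (\<Sum>k. ?f k z)" by (rule gen)
    finally show ?thesis .
  qed
  define r where "r = 2 powr (real ?d - p)"
  have r: "0 < r" "r < 1" using assms unfolding r_def by (auto simp: powr_less_one)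
  have "(\<integral>\<^sup>+ z. ennreal (norm (wgt p (z::'a))) \<partial>lborel) \<le> (\<integral>\<^sup>+ z. (\<Sum>k. ?f k z) \<partial>lborel)"
    by (intro nn_integral_mono pt)
  also have "\<dots> = (\<Sum>k. \<integral>\<^sup>+ z. ?f k z \<partial>lborel)"
    by (rule nn_integral_suminf) (intro borel_measurable_times_ennreal borel_measurable_const borel_measurable_indicator, simp)
  also have "\<dots> = (\<Sum>k. ennreal ((unit_ball_vol (real ?d) * 2 ^ ?d) * r ^ k))"
  proof (intro suminf_cong)
    fix k
    have "(2::real) powr (- real k * p) * (2 ^ (k + 1)) ^ ?d = 2 ^ ?d * r ^ k"
    proof -
      have "((2::real) ^ (k + 1)) ^ ?d = 2 ^ ?d * 2 powr (real k * real ?d)"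
        by (simp add: powr_powr[symmetric] powr_realpow power_mult_distrib)
      moreover have "r ^ k = 2 powr (- real k * p) * 2 powr (real k * real ?d)"
        unfolding r_def by (simp add: powr_power powr_add[symmetric] algebra_simps)
      ultimately show ?thesis by simp
    qed
    then have eq: "(2::real) powr (- real k * p) * (unit_ball_vol (real ?d) * (2 ^ (k + 1)) ^ ?d)
       = (unit_ball_vol (real ?d) * 2 ^ ?d) * r ^ k"
      by (metis mult.assoc mult.left_commute)
    have "(\<integral>\<^sup>+ z. ?f k z \<partial>lborel) = ennreal (2 powr (- real k * p)) * emeasure lborel (ball (0::'a) (2 ^ (k + 1)))"
      by (subst nn_integral_cmult_indicator) auto
    also have "\<dots> = ennreal (2 powr (- real k * p) * (unit_ball_vol (real ?d) * (2 ^ (k + 1)) ^ ?d))"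
      by (subst emeasure_ball) (auto simp: ennreal_mult')
    finally show "(\<integral>\<^sup>+ z. ?f k z \<partial>lborel) = ennreal ((unit_ball_vol (real ?d) * 2 ^ ?d) * r ^ k)"
      by (simp only: eq)
  qed
  also have "\<dots> = ennreal (\<Sum>k. (unit_ball_vol (real ?d) * 2 ^ ?d) * r ^ k)"
    using r by (intro suminf_ennreal2) (auto intro!: summable_mult summable_geometric)
  also have "\<dots> < \<infinity>" by simp
  finally show "(\<integral>\<^sup>+ z. ennreal (norm (wgt p (z::'a))) \<partial>lborel) < \<infinity>" .
qed

lemma integrable_affine_iff:
  fixes f :: "'a::euclidean_space \<Rightarrow> 'v::{banach, second_countable_topology}"
  assumes c: "c \<noteq> 0" and f [measurable]: "f \<in> borel_measurable borel"
  shows "integrable lborel (\<lambda>x. f (t + c *\<^sub>R x)) \<longleftrightarrow> integrable lborel f"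
proof -
  have "integrable lborel f \<longleftrightarrow> integrable lborel (\<lambda>x. \<bar>c\<bar> ^ DIM('a) *\<^sub>R f (t + c *\<^sub>R x))"
  proof -
    have "integrable lborel f \<longleftrightarrow> integrable (density (distr lborel borel (\<lambda>x. t + c *\<^sub>R x)) (\<lambda>_. ennreal (\<bar>c\<bar> ^ DIM('a)))) f"
      using lborel_affine[OF c, of t] by simp
    also have "\<dots> \<longleftrightarrow> integrable (distr lborel borel (\<lambda>x. t + c *\<^sub>R x)) (\<lambda>x. \<bar>c\<bar> ^ DIM('a) *\<^sub>R f x)"
      by (rule integrable_density) auto
    also have "\<dots> \<longleftrightarrow> integrable lborel (\<lambda>x. \<bar>c\<bar> ^ DIM('a) *\<^sub>R f (t + c *\<^sub>R x))"
      by (rule integrable_distr_eq) auto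
    finally show ?thesis .
  qed
  also have "\<dots> \<longleftrightarrow> integrable lborel (\<lambda>x. f (t + c *\<^sub>R x))"
  proof
    assume "integrable lborel (\<lambda>x. \<bar>c\<bar> ^ DIM('a) *\<^sub>R f (t + c *\<^sub>R x))"
    then have "integrable lborel (\<lambda>x. inverse (\<bar>c\<bar> ^ DIM('a)) *\<^sub>R (\<bar>c\<bar> ^ DIM('a) *\<^sub>R f (t + c *\<^sub>R x)))"
      by (rule integrable_scaleR_right)
    then show "integrable lborel (\<lambda>x. f (t + c *\<^sub>R x))" using c by simp
  qed (rule integrable_scaleR_right)
  finally show ?thesis by simp
qed

lemma integral_affine:
  fixes f :: "'a::euclidean_space \<Rightarrow> 'v::{banach, second_countable_topology}"
  assumes c: "c \<noteq> 0" and f [measurable]: "f \<in> borel_measurable borel"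
  shows "(\<integral>x. f x \<partial>lborel) = \<bar>c\<bar> ^ DIM('a) *\<^sub>R (\<integral>x. f (t + c *\<^sub>R x) \<partial>lborel)"
proof -
  have "(\<integral>x. f x \<partial>lborel) = (\<integral>x. f x \<partial>density (distr lborel borel (\<lambda>x. t + c *\<^sub>R x)) (\<lambda>_. ennreal (\<bar>c\<bar> ^ DIM('a))))"
    using lborel_affine[OF c, of t] by simp
  also have "\<dots> = (\<integral>x. \<bar>c\<bar> ^ DIM('a) *\<^sub>R f x \<partial>distr lborel borel (\<lambda>x. t + c *\<^sub>R x))"
    by (rule integral_density) auto
  also have "\<dots> = (\<integral>x. \<bar>c\<bar> ^ DIM('a) *\<^sub>R f (t + c *\<^sub>R x) \<partial>lborel)"
    by (rule integral_distr) auto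
  finally show ?thesis by simp
qed

lemma integrable_reflect_translate:
  fixes f :: "'a::euclidean_space \<Rightarrow> 'v::{banach, second_countable_topology}"
  assumes "f \<in> borel_measurable borel"
  shows "integrable lborel (\<lambda>y. f (x - y)) \<longleftrightarrow> integrable lborel f"
    and "(\<integral>y. f (x - y) \<partial>lborel) = (\<integral>y. f y \<partial>lborel)"
  using integrable_affine_iff[of "-1" f x] integral_affine[of "-1" f x] assms by auto

section \<open>The parabolic majorant of the Oseen kernel and its convolution with a weight\<close>

definition pk :: "real \<Rightarrow> 'a::euclidean_space \<Rightarrow> real" where
  "pk \<tau> z = 1 / (sqrt \<tau> + norm z) ^ (DIM('a) + 1)"

lemma pk_pos: "\<tau> > 0 \<Longrightarrow> pk \<tau> z > 0"
  unfolding pk_def by (simp add: add_pos_nonneg)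

lemma pk_measurable [measurable]: "(\<lambda>z::'a::euclidean_space. pk \<tau> z) \<in> borel_measurable borel"
  unfolding pk_def by measurable

text \<open>\<open>pk\<close> is the parabolic rescaling of \<open>wgt (d+1)\<close>, so its
  integral at every \<tau> reduces to the one at \<tau> = 1.\<close>

lemma pk_scale:
  fixes z :: "'a::euclidean_space"
  assumes "\<tau> > 0"
  shows "pk \<tau> (sqrt \<tau> *\<^sub>R z) = (1 / sqrt \<tau> ^ (DIM('a) + 1)) * wgt (DIM('a) + 1) z"
proof -
  have "sqrt \<tau> + norm (sqrt \<tau> *\<^sub>R z) = sqrt \<tau> * (1 + norm z)"
    using assms by (simp add: algebra_simps)
  then show ?thesis
    using wgt_real[of "DIM('a) + 1" z] by (simp add: pk_def power_mult_distrib)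
qed

text \<open>Substituting sqrt \<tau> z yields sqrt \<tau>^d from the volume and sqrt \<tau>^(-(d+1))
  from the kernel. The surplus \<tau>^(-1/2) is the integrable time singularity of the Duhamel
  integrand.\<close>

lemma pk_integrable:
  assumes "\<tau> > 0"
  shows "integrable lborel (pk \<tau> :: 'a::euclidean_space \<Rightarrow> real)"
    and "(\<integral>z. pk \<tau> (z::'a) \<partial>lborel) = (\<integral>z. wgt (DIM('a) + 1) (z::'a) \<partial>lborel) / sqrt \<tau>"
proof -
  let ?d = "DIM('a)"
  have s: "sqrt \<tau> \<noteq> 0" "sqrt \<tau> > 0" using assms by auto
  have W: "integrable lborel (\<lambda>z::'a. wgt (?d + 1) z)" by (rule integrable_wgt) simp
  show "integrable lborel (pk \<tau> :: 'a \<Rightarrow> real)"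
    using integrable_affine_iff[OF s(1), of "pk \<tau> :: 'a \<Rightarrow> real" 0] W assms by (simp add: pk_scale)
  show "(\<integral>z. pk \<tau> (z::'a) \<partial>lborel) = (\<integral>z. wgt (?d + 1) (z::'a) \<partial>lborel) / sqrt \<tau>"
    using integral_affine[OF s(1), of "pk \<tau> :: 'a \<Rightarrow> real" 0] W assms
    by (simp add: pk_scale power_add divide_simps)
qed

lemma add_power_le:
  fixes a b :: real
  assumes "a \<ge> 0" "b \<ge> 0"
  shows "(a + b) ^ n \<le> 2 ^ n * (a ^ n + b ^ n)"
proof -
  have "(a + b) ^ n \<le> (2 * max a b) ^ n" using assms by (intro power_mono) auto
  also have "\<dots> = 2 ^ n * max a b ^ n" by (simp add: power_mult_distrib)
  also have "max a b ^ n \<le> a ^ n + b ^ n" using assms by (auto simp: max_def)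
  finally show ?thesis by (simp add: mult_left_mono)
qed

text \<open>Since 1+|x| \<le> (1+|y|) + |x-y|, the (d+1)-th power of 1+|x| is paid for either by the
  decay of the weight in y or by that of the kernel in x-y. The product thus becomes decay in x
  times a sum of two integrable functions.\<close>

lemma pk_wgt_le:
  fixes x y :: "'a::euclidean_space"
  assumes "\<tau> > 0" "p \<ge> real DIM('a) + 1"
  shows "pk \<tau> (x - y) * wgt p y \<le> 2 ^ (DIM('a) + 1) * wgt (DIM('a) + 1) x * (pk \<tau> (x - y) + wgt p y)"
proof -
  let ?m = "DIM('a) + 1"
  have xy: "1 + norm x \<le> (1 + norm y) + norm (x - y)" by (smt (verit) norm_triangle_sub)
  have px: "(1 + norm x) ^ ?m > 0" by (smt (verit) norm_ge_zero zero_less_power)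
  have py: "(1 + norm y) ^ ?m > 0" by (smt (verit) norm_ge_zero zero_less_power)
  have "(1 + norm x) ^ ?m \<le> ((1 + norm y) + norm (x - y)) ^ ?m"
    using xy by (intro power_mono) auto
  also have "\<dots> \<le> 2 ^ ?m * ((1 + norm y) ^ ?m + norm (x - y) ^ ?m)"
    by (rule add_power_le) auto
  finally have A: "(1 + norm x) ^ ?m \<le> 2 ^ ?m * ((1 + norm y) ^ ?m + norm (x - y) ^ ?m)" .
  have B: "(1 + norm y) ^ ?m * wgt p y \<le> 1"
  proof -
    have "wgt p y \<le> 1 / (1 + norm y) ^ ?m"
      using wgt_mono[OF assms(2), of y] wgt_real[of ?m y] by (simp add: add.commute)
    then show ?thesis using py by (simp only: pos_le_divide_eq mult.commute)
  qed
  have C: "norm (x - y) ^ ?m * pk \<tau> (x - y) \<le> 1"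
  proof -
    have "norm (x - y) ^ ?m \<le> (sqrt \<tau> + norm (x - y)) ^ ?m"
      using assms(1) by (intro power_mono) auto
    moreover have "(sqrt \<tau> + norm (x - y)) ^ ?m > 0" using assms(1) by (intro zero_less_power add_pos_nonneg) auto
    ultimately show ?thesis unfolding pk_def by (simp only: mult_1_right times_divide_eq_right divide_le_eq_1_pos)
  qed
  have pk0: "pk \<tau> (x - y) \<ge> 0" using pk_pos[OF assms(1)] less_imp_le by blast
  have "(1 + norm x) ^ ?m * (pk \<tau> (x - y) * wgt p y)
      \<le> 2 ^ ?m * ((1 + norm y) ^ ?m + norm (x - y) ^ ?m) * (pk \<tau> (x - y) * wgt p y)"
    by (rule mult_right_mono[OF A]) (simp add: pk0)
  also have "\<dots> = 2 ^ ?m * (pk \<tau> (x - y) * ((1 + norm y) ^ ?m * wgt p y) + wgt p y * (norm (x - y) ^ ?m * pk \<tau> (x - y)))"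
    by (simp only: algebra_simps)
  also have "\<dots> \<le> 2 ^ ?m * (pk \<tau> (x - y) * 1 + wgt p y * 1)"
    using B C pk0 by (intro mult_left_mono add_mono) auto
  finally have "pk \<tau> (x - y) * wgt p y \<le> 2 ^ ?m * (pk \<tau> (x - y) + wgt p y) / (1 + norm x) ^ ?m"
    using px by (simp only: mult_1_right pos_le_divide_eq mult.commute[of _ "(1 + norm x) ^ ?m"])
  moreover have "wgt (real DIM('a) + 1) x = 1 / (1 + norm x) ^ ?m"
    using wgt_real[of ?m x] by (simp add: add.commute)
  ultimately show ?thesis by (simp add: algebra_simps)
qed

lemma conv_bound:
  assumes p: "p \<ge> real DIM('a::euclidean_space) + 1"
  shows "\<exists>C>0. \<forall>\<tau>\<in>{0<..1}. \<forall>x::'a. integrable lborel (\<lambda>y. pk \<tau> (x - y) * wgt p y) \<and>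
     (\<integral>y. pk \<tau> (x - y) * wgt p y \<partial>lborel) \<le> C / sqrt \<tau> * wgt (DIM('a) + 1) x"
proof -
  let ?m = "DIM('a) + 1"
  define I where "I = (\<integral>z. wgt (real ?m) (z::'a) \<partial>lborel)"
  define J where "J = (\<integral>z. wgt p (z::'a) \<partial>lborel)"
  have J: "J \<ge> 0" "I \<ge> 0" unfolding J_def I_def by (auto intro: integral_nonneg_AE)
  have ip: "integrable lborel (\<lambda>z::'a. wgt p z)" using p by (intro integrable_wgt) auto
  define C where "C = 2 ^ ?m * (I + J) + 1"
  have C: "C > 0" unfolding C_def using J by (smt (verit) mult_nonneg_nonneg zero_le_power)
  show ?thesis
  proof (intro exI[of _ C] conjI C ballI allI)
    fix \<tau> :: real and x :: 'a assume t: "\<tau> \<in> {0<..1}"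
    then have t0: "\<tau> > 0" by simp
    have ipk: "integrable lborel (\<lambda>y::'a. pk \<tau> (x - y))"
      by (subst integrable_reflect_translate) (auto simp: pk_integrable t0)
    let ?g = "\<lambda>y. 2 ^ ?m * wgt (real ?m) x * (pk \<tau> (x - y) + wgt p y)"
    have ig: "integrable lborel ?g" using ipk ip by auto
    have le: "pk \<tau> (x - y) * wgt p y \<le> ?g y" for y
      using pk_wgt_le[OF t0 p, of x y] by (simp add: add.commute)
    show i: "integrable lborel (\<lambda>y. pk \<tau> (x - y) * wgt p y)"
    proof (rule Bochner_Integration.integrable_bound[OF ig])
      show "AE y in lborel. norm (pk \<tau> (x - y) * wgt p y) \<le> norm (?g y)"
      proof (rule AE_I2)
        fix y
        have "0 \<le> pk \<tau> (x - y) * wgt p y" using pk_pos[OF t0, of "x - y"] by simp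
        then show "norm (pk \<tau> (x - y) * wgt p y) \<le> norm (?g y)"
          using le[of y] unfolding real_norm_def by linarith
      qed
    qed measurable
    have "(\<integral>y. pk \<tau> (x - y) * wgt p y \<partial>lborel) \<le> (\<integral>y. ?g y \<partial>lborel)"
      by (rule integral_mono[OF i ig le])
    also have "\<dots> = 2 ^ ?m * wgt (real ?m) x * (I / sqrt \<tau> + J)"
      using ipk ip integrable_reflect_translate(2)[of "pk \<tau>" x] pk_integrable(2)[OF t0, where 'a='a]
      by (simp add: I_def J_def)
    \<comment> \<open>Here \<tau> \<le> 1 lets the bounded contribution \<open>J\<close> of the
      weight be absorbed into the factor \<tau>^(-1/2).\<close>
    also have "I / sqrt \<tau> + J \<le> (I + J) / sqrt \<tau>"
      using t J by (simp add: add_divide_distrib pos_le_divide_eq mult_left_le)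
    also have "2 ^ ?m * wgt (real ?m) x * ((I + J) / sqrt \<tau>) \<le> C / sqrt \<tau> * wgt (real ?m) x"
      unfolding C_def using t by (simp add: divide_simps algebra_simps)
    finally show "(\<integral>y. pk \<tau> (x - y) * wgt p y \<partial>lborel) \<le> C / sqrt \<tau> * wgt (real ?m) x"
      by (simp add: mult_left_mono)
  qed
qed

section \<open>The Gaussian and its time integrals\<close>

text \<open>The heat kernel at time \<sigma> in dimension d as a function of the radius r = |z|.
  Radius and dimension are separate arguments and the normalization is a natural power, so that
  scaling and differentiation in \<sigma> become elementary real analysis.\<close>

definition gE :: "nat \<Rightarrow> real \<Rightarrow> real \<Rightarrow> real" where
  "gE d \<sigma> r = exp (- r\<^sup>2 / (4 * \<sigma>)) / sqrt (4 * pi * \<sigma>) ^ d"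

lemma gE_nonneg [simp]: "\<sigma> \<ge> 0 \<Longrightarrow> gE d \<sigma> r \<ge> 0"
  by (simp add: gE_def)

lemma gE_measurable [measurable]: "(\<lambda>\<sigma>. gE d \<sigma> r) \<in> borel_measurable borel"
  "(\<lambda>r. gE d \<sigma> r) \<in> borel_measurable borel"
  unfolding gE_def by measurable

lemma heat_kernel_gE:
  assumes "\<sigma> > 0"
  shows "heat_kernel \<sigma> (z::'a::euclidean_space) = gE DIM('a) \<sigma> (norm z)"
proof -
  define x where "x = 4 * pi * \<sigma>"
  have x: "x > 0" using assms by (simp add: x_def)
  have "sqrt x ^ DIM('a) = sqrt x powr real DIM('a)" using x by (simp only: powr_realpow real_sqrt_gt_zero)
  also have "\<dots> = x powr (1 / 2 * real DIM('a))"
    using x by (simp only: powr_half_sqrt[symmetric] less_imp_le powr_powr)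
  finally have "x powr (- (real DIM('a) / 2)) = 1 / sqrt x ^ DIM('a)"
    by (simp only: powr_minus_divide) simp
  then show ?thesis by (simp add: heat_kernel_def gE_def x_def)
qed

lemma power_le_fact_exp:
  assumes "x \<ge> (0::real)"
  shows "x ^ n \<le> fact n * exp x"
proof -
  have "(\<lambda>n. x ^ n /\<^sub>R fact n) sums exp x" by (rule exp_converges)
  then have s: "summable (\<lambda>n. x ^ n /\<^sub>R fact n)" and e: "exp x = (\<Sum>n. x ^ n /\<^sub>R fact n)"
    by (auto simp: sums_iff)
  have "x ^ n /\<^sub>R fact n \<le> exp x"
    using sum_le_suminf[OF s, of "{n}"] assms e by simp
  then show ?thesis by (simp add: field_simps)
qed

text \<open>By self-similarity only q = r/s matters, and any power of q is beaten by exp(-q^2/4).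
  Stated with s = sqrt \<sigma>, this one bound yields all later trades between powers of r, of s +
  r and of \<sigma>.\<close>

lemma gE_bound:
  "\<exists>C>0. \<forall>s>0. \<forall>r\<ge>0. r ^ m * (s + r) ^ M * gE d (s\<^sup>2) r \<le> C * s ^ (m + M) / s ^ d"
proof -
  define K where "K n = fact n * exp 1 / sqrt (4 * pi) ^ d" for n
  have K: "K n > 0" for n by (simp add: K_def)
  have *: "r ^ n * gE d (s\<^sup>2) r \<le> K n * s ^ n / s ^ d" if "s > 0" "r \<ge> 0" for n s r
  proof -
    define q where "q = r / s"
    have q: "q \<ge> 0" "r = q * s" using that by (auto simp: q_def)
    \<comment> \<open>Gives q \<le> q^2/4 + 1, so the power of q is compared with exp q and then
      with the inverse Gaussian.\<close>
    have "0 \<le> (q / 2 - 1)\<^sup>2" by simp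
    then have "q \<le> q\<^sup>2 / 4 + 1" by (simp add: power2_eq_square field_simps)
    then have "fact n * exp q \<le> fact n * exp (q\<^sup>2 / 4 + 1)" by simp
    with power_le_fact_exp[OF q(1), of n] have "q ^ n \<le> fact n * exp (q\<^sup>2 / 4 + 1)" by (rule order_trans)
    then have "q ^ n \<le> fact n * (exp (q\<^sup>2 / 4) * exp 1)" by (simp only: exp_add)
    then have "q ^ n * exp (- q\<^sup>2 / 4) \<le> fact n * (exp (q\<^sup>2 / 4) * exp 1) * exp (- q\<^sup>2 / 4)"
      by (intro mult_right_mono) auto
    also have "\<dots> = fact n * exp 1" by (simp add: exp_minus)
    finally have a: "q ^ n * exp (- q\<^sup>2 / 4) \<le> fact n * exp 1" .
    have "r ^ n * gE d (s\<^sup>2) r = (q ^ n * exp (- q\<^sup>2 / 4)) * s ^ n / (sqrt (4 * pi) ^ d * s ^ d)"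
      using that unfolding gE_def q(2) by (simp add: real_sqrt_mult power_mult_distrib)
    also have "\<dots> \<le> (fact n * exp 1) * s ^ n / (sqrt (4 * pi) ^ d * s ^ d)"
      using a that by (intro divide_right_mono mult_right_mono) auto
    finally show ?thesis by (simp add: K_def)
  qed
  define C where "C = 2 ^ M * (K m + K (m + M))"
  show ?thesis
  proof (intro exI[of _ C] conjI allI impI)
    show "C > 0" using K by (simp add: C_def add_pos_pos)
    fix s r :: real assume sr: "s > 0" "r \<ge> 0"
    have g: "gE d (s\<^sup>2) r \<ge> 0" by simp
    have "r ^ m * (s + r) ^ M * gE d (s\<^sup>2) r \<le> r ^ m * (2 ^ M * (s ^ M + r ^ M)) * gE d (s\<^sup>2) r"
      using sr g add_power_le[of s r M] by (intro mult_right_mono mult_left_mono) auto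
    also have "\<dots> = 2 ^ M * (s ^ M * (r ^ m * gE d (s\<^sup>2) r) + r ^ (m + M) * gE d (s\<^sup>2) r)"
      by (simp add: algebra_simps power_add)
    also have "\<dots> \<le> 2 ^ M * (s ^ M * (K m * s ^ m / s ^ d) + K (m + M) * s ^ (m + M) / s ^ d)"
      using *[OF sr] sr by (intro mult_left_mono add_mono) auto
    also have "\<dots> = C * s ^ (m + M) / s ^ d"
      by (simp add: C_def power_add add_divide_distrib algebra_simps)
    finally show "r ^ m * (s + r) ^ M * gE d (s\<^sup>2) r \<le> C * s ^ (m + M) / s ^ d" .
  qed
qed

text \<open>The trace in physical space of |\<xi>|^(-2) exp(-\<tau>|\<xi>|^2). The exponent is j + 2
  because a third derivative of the Gaussian consists of terms with one factor z over \<sigma>^2 (j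
  = 0) and terms with three factors z over \<sigma>^3 (j = 1).\<close>

definition gG :: "nat \<Rightarrow> nat \<Rightarrow> real \<Rightarrow> real \<Rightarrow> real" where
  "gG d j \<tau> r = (LINT \<sigma>:{\<tau><..}|lborel. gE d \<sigma> r / \<sigma> ^ (j + 2))"

text \<open>The integrand is the derivative of -2/(sqrt \<sigma> + r). It is the model majorant for
  the tails in \<open>gG\<close>: with d further powers pulled out, decay of order d+2 in sqrt
  \<sigma> + r becomes decay of order d+1 in sqrt \<tau> + r.\<close>

lemma tail_integral:
  assumes r: "r > 0" and t: "\<tau> \<ge> 0"
  shows "set_integrable lborel {\<tau><..} (\<lambda>\<sigma>. 1 / (sqrt \<sigma> * (sqrt \<sigma> + r)\<^sup>2))"
    and "(LINT \<sigma>:{\<tau><..}|lborel. 1 / (sqrt \<sigma> * (sqrt \<sigma> + r)\<^sup>2)) = 2 / (sqrt \<tau> + r)"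
proof -
  have e: "einterval (ereal \<tau>) \<infinity> = {\<tau><..}" by (auto simp: einterval_def)
  let ?F = "\<lambda>\<sigma>. - 2 / (sqrt \<sigma> + r)"
  let ?f = "\<lambda>\<sigma>. 1 / (sqrt \<sigma> * (sqrt \<sigma> + r)\<^sup>2)"
  have D: "(?F has_real_derivative ?f x) (at x)" if "\<tau> < x" for x
  proof -
    have x: "x > 0" using that t by simp
    then have "sqrt x + r \<noteq> 0" using r by (smt (verit) real_sqrt_gt_zero)
    then show ?thesis
      using x by (auto intro!: derivative_eq_intros simp: field_simps power2_eq_square)
  qed
  have c: "isCont ?f x" if "\<tau> < x" for x
  proof -
    have "x > 0" using that t by simp
    then have "sqrt x + r \<noteq> 0" "sqrt x \<noteq> 0" using r by (smt (verit) real_sqrt_gt_zero)+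
    then show ?thesis by (intro continuous_intros) auto
  qed
  have "continuous (at \<tau>) ?F"
    using r t by (intro continuous_intros) (smt (verit) real_sqrt_ge_zero)
  then have A: "((?F \<circ> real_of_ereal) \<longlongrightarrow> - 2 / (sqrt \<tau> + r)) (at_right (ereal \<tau>))"
    unfolding ereal_tendsto_simps1(2) comp_def
    by (intro tendsto_intros) (use r t in \<open>smt (verit) real_sqrt_ge_zero\<close>)+
  have B: "((?F \<circ> real_of_ereal) \<longlongrightarrow> 0) (at_left \<infinity>)"
    unfolding ereal_tendsto_simps1
  proof -
    have "filterlim (\<lambda>\<sigma>. sqrt \<sigma> + r) at_top at_top"
      by (rule filterlim_at_top_mono[OF sqrt_at_top]) (use r in auto)
    then show "(?F \<longlongrightarrow> 0) at_top"
      by (rule tendsto_divide_0[OF tendsto_const filterlim_at_top_imp_at_infinity])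
  qed
  note F = interval_integral_FTC_nonneg[where F="?F" and f="?f" and a="ereal \<tau>" and b=\<infinity>, OF _ _ _ _ A B]
  show "set_integrable lborel {\<tau><..} ?f"
    using F(1) D c r t unfolding e by (auto simp: AE_I2)
  have "(LBINT x=ereal \<tau>..\<infinity>. ?f x) = 0 - (- 2 / (sqrt \<tau> + r))"
    by (rule F(2)) (use D c r t in auto)
  then show "(LINT \<sigma>:{\<tau><..}|lborel. ?f \<sigma>) = 2 / (sqrt \<tau> + r)"
    by (simp add: interval_lebesgue_integral_def e)
qed

text \<open>The factor r^(2j+1) is the size of the polynomial in z that accompanies
  \<open>gG d j\<close> in the kernel, which is why it stands in this and later bounds.
  \<open>gE_bound\<close> leaves s^(2j+3), and division by \<sigma>^(j+2) = s^(2j+4) leaves 1/sqrt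
  \<sigma>.\<close>

lemma gG_integrand_bound:
  "\<exists>C>0. \<forall>\<sigma>>0. \<forall>r\<ge>0. r ^ (2 * j + 1) * (gE d \<sigma> r / \<sigma> ^ (j + 2)) \<le> C / (sqrt \<sigma> * (sqrt \<sigma> + r) ^ (d + 2))"
proof -
  obtain C where C: "C > 0" and b: "\<And>s r. s > 0 \<Longrightarrow> r \<ge> 0 \<Longrightarrow>
      r ^ (2 * j + 1) * (s + r) ^ (d + 2) * gE d (s\<^sup>2) r \<le> C * s ^ (2 * j + 1 + (d + 2)) / s ^ d"
    using gE_bound[of "2 * j + 1" "d + 2" d] by auto
  show ?thesis
  proof (intro exI[of _ C] conjI C allI impI)
    fix \<sigma> r :: real assume a: "\<sigma> > 0" "r \<ge> 0"
    define s where "s = sqrt \<sigma>"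
    have s: "s > 0" "\<sigma> = s\<^sup>2" using a by (auto simp: s_def)
    have p: "(s + r) ^ (d + 2) > 0" using s a by (intro zero_less_power) auto
    have "r ^ (2 * j + 1) * (s + r) ^ (d + 2) * gE d (s\<^sup>2) r \<le> C * s ^ (2 * j + 3)"
      using b[OF s(1) a(2)] s(1) by (simp add: power_add power3_eq_cube mult_ac)
    then have "r ^ (2 * j + 1) * gE d (s\<^sup>2) r \<le> C * s ^ (2 * j + 3) / (s + r) ^ (d + 2)"
      using p by (simp only: pos_le_divide_eq mult.commute mult.left_commute mult.assoc)
    then have "r ^ (2 * j + 1) * gE d (s\<^sup>2) r / (s\<^sup>2) ^ (j + 2) \<le> C * s ^ (2 * j + 3) / (s + r) ^ (d + 2) / (s\<^sup>2) ^ (j + 2)"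
      using s by (intro divide_right_mono) auto
    also have "\<dots> = C / (s * (s + r) ^ (d + 2))"
    proof -
      have "(s\<^sup>2) ^ (j + 2) = s ^ (2 * j + 3) * s"
        by (simp add: power_mult power_add power_mult_distrib power2_eq_square power3_eq_cube mult_ac)
      then show ?thesis using s by simp
    qed
    finally have "r ^ (2 * j + 1) * gE d \<sigma> r / \<sigma> ^ (j + 2) \<le> C / (s * (s + r) ^ (d + 2))"
      unfolding s(2)[symmetric] .
    then show "r ^ (2 * j + 1) * (gE d \<sigma> r / \<sigma> ^ (j + 2)) \<le> C / (sqrt \<sigma> * (sqrt \<sigma> + r) ^ (d + 2))"
      unfolding s_def by (simp only: times_divide_eq_right)
  qed
qed

lemma gG_integrable:
  assumes r: "r > 0" and t: "\<tau> \<ge> 0"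
  shows "set_integrable lborel {\<tau><..} (\<lambda>\<sigma>. gE d \<sigma> r / \<sigma> ^ (j + 2))"
proof -
  obtain C where C: "C > 0" and b: "\<And>\<sigma> r. \<sigma> > 0 \<Longrightarrow> r \<ge> 0 \<Longrightarrow>
     r ^ (2 * j + 1) * (gE d \<sigma> r / \<sigma> ^ (j + 2)) \<le> C / (sqrt \<sigma> * (sqrt \<sigma> + r) ^ (d + 2))"
    using gG_integrand_bound[of j d] by auto
  define K where "K = C / r ^ d / r ^ (2 * j + 1)"
  have le: "gE d \<sigma> r / \<sigma> ^ (j + 2) \<le> K * (1 / (sqrt \<sigma> * (sqrt \<sigma> + r)\<^sup>2))" if "\<sigma> > 0" for \<sigma>
  proof -
    have s: "sqrt \<sigma> > 0" using that by simp
    have sr: "sqrt \<sigma> + r > 0" using s r by linarith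
    have "C / (sqrt \<sigma> * (sqrt \<sigma> + r) ^ (d + 2)) = C / (sqrt \<sigma> + r) ^ d * (1 / (sqrt \<sigma> * (sqrt \<sigma> + r)\<^sup>2))"
      by (simp add: power_add power2_eq_square)
    also have "\<dots> \<le> C / r ^ d * (1 / (sqrt \<sigma> * (sqrt \<sigma> + r)\<^sup>2))"
      using C r s sr by (intro mult_right_mono divide_left_mono power_mono mult_pos_pos zero_less_power) auto
    finally have "r ^ (2 * j + 1) * (gE d \<sigma> r / \<sigma> ^ (j + 2)) \<le> C / r ^ d * (1 / (sqrt \<sigma> * (sqrt \<sigma> + r)\<^sup>2))"
      using b[OF that, of r] r by linarith
    then have "gE d \<sigma> r / \<sigma> ^ (j + 2) \<le> C / r ^ d * (1 / (sqrt \<sigma> * (sqrt \<sigma> + r)\<^sup>2)) / r ^ (2 * j + 1)"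
      using r by (subst pos_le_divide_eq) (auto simp: mult_ac)
    then show ?thesis by (simp add: K_def mult_ac)
  qed
  show ?thesis
  proof (rule set_integrable_bound)
    show "set_integrable lborel {\<tau><..} (\<lambda>\<sigma>. K * (1 / (sqrt \<sigma> * (sqrt \<sigma> + r)\<^sup>2)))"
      using tail_integral(1)[OF r t] by (rule set_integrable_mult_right)
    show "set_borel_measurable lborel {\<tau><..} (\<lambda>\<sigma>. gE d \<sigma> r / \<sigma> ^ (j + 2))"
      unfolding set_borel_measurable_def by measurable
    show "AE \<sigma> in lborel. \<sigma> \<in> {\<tau><..} \<longrightarrow> norm (gE d \<sigma> r / \<sigma> ^ (j + 2)) \<le> norm (K * (1 / (sqrt \<sigma> * (sqrt \<sigma> + r)\<^sup>2)))"
    proof (intro AE_I2 impI)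
      fix \<sigma> assume "\<sigma> \<in> {\<tau><..}"
      then have "\<sigma> > 0" using t by simp
      then have "gE d \<sigma> r / \<sigma> ^ (j + 2) \<ge> 0" by simp
      then show "norm (gE d \<sigma> r / \<sigma> ^ (j + 2)) \<le> norm (K * (1 / (sqrt \<sigma> * (sqrt \<sigma> + r)\<^sup>2)))"
        using le[OF \<open>\<sigma> > 0\<close>] unfolding real_norm_def by linarith
    qed
  qed
qed

lemma gG_nonneg: "\<tau> \<ge> 0 \<Longrightarrow> gG d j \<tau> r \<ge> 0"
  unfolding gG_def set_lebesgue_integral_def
  by (intro integral_nonneg_AE) (auto simp: indicator_def)

text \<open>For \<sigma> > \<tau> the factor (sqrt \<sigma> + r)^(-d) is at most its value at
  \<tau>, and \<open>tail_integral\<close> evaluates the rest. The right side is \<open>pk\<close>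
  up to a constant.\<close>

lemma gG_bound:
  "\<exists>C>0. \<forall>\<tau>\<ge>0. \<forall>r>0. r ^ (2 * j + 1) * gG d j \<tau> r \<le> C / (sqrt \<tau> + r) ^ (d + 1)"
proof -
  obtain C where C: "C > 0" and b: "\<And>\<sigma> r. \<sigma> > 0 \<Longrightarrow> r \<ge> 0 \<Longrightarrow>
     r ^ (2 * j + 1) * (gE d \<sigma> r / \<sigma> ^ (j + 2)) \<le> C / (sqrt \<sigma> * (sqrt \<sigma> + r) ^ (d + 2))"
    using gG_integrand_bound[of j d] by auto
  show ?thesis
  proof (intro exI[of _ "2 * C"] conjI allI impI)
    show "2 * C > 0" using C by simp
    fix \<tau> r :: real assume t: "\<tau> \<ge> 0" and r: "r > 0"
    have tr: "sqrt \<tau> + r > 0" using t r by (simp add: add_nonneg_pos)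
    have le: "r ^ (2 * j + 1) * (gE d \<sigma> r / \<sigma> ^ (j + 2)) \<le> C / (sqrt \<tau> + r) ^ d * (1 / (sqrt \<sigma> * (sqrt \<sigma> + r)\<^sup>2))"
      if "\<sigma> > \<tau>" for \<sigma>
    proof -
      have s: "sqrt \<sigma> > 0" "\<sigma> > 0" using that t by auto
      have sr: "sqrt \<sigma> + r > 0" using s r by linarith
      have "C / (sqrt \<sigma> * (sqrt \<sigma> + r) ^ (d + 2)) = C / (sqrt \<sigma> + r) ^ d * (1 / (sqrt \<sigma> * (sqrt \<sigma> + r)\<^sup>2))"
        by (simp add: power_add power2_eq_square)
      also have "\<dots> \<le> C / (sqrt \<tau> + r) ^ d * (1 / (sqrt \<sigma> * (sqrt \<sigma> + r)\<^sup>2))"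
        using C r s sr tr that t by (intro mult_right_mono divide_left_mono power_mono mult_pos_pos zero_less_power) auto
      finally show ?thesis using b[OF s(2), of r] r by simp
    qed
    have "r ^ (2 * j + 1) * gG d j \<tau> r = (LINT \<sigma>:{\<tau><..}|lborel. r ^ (2 * j + 1) * (gE d \<sigma> r / \<sigma> ^ (j + 2)))"
      unfolding gG_def by (rule set_integral_mult_right[symmetric])
    also have "\<dots> \<le> (LINT \<sigma>:{\<tau><..}|lborel. C / (sqrt \<tau> + r) ^ d * (1 / (sqrt \<sigma> * (sqrt \<sigma> + r)\<^sup>2)))"
      by (intro set_integral_mono set_integrable_mult_right gG_integrable tail_integral r t le) auto
    also have "\<dots> = C / (sqrt \<tau> + r) ^ d * (2 / (sqrt \<tau> + r))"
      by (simp only: set_integral_mult_right tail_integral(2)[OF r t])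
    also have "\<dots> = 2 * C / (sqrt \<tau> + r) ^ (d + 1)" by (simp add: mult_ac)
    finally show "r ^ (2 * j + 1) * gG d j \<tau> r \<le> 2 * C / (sqrt \<tau> + r) ^ (d + 1)" .
  qed
qed

lemma gG_split:
  assumes r: "r > 0" and t: "0 \<le> \<tau>" "\<tau> \<le> \<tau>'"
  shows "gG d j \<tau> r - gG d j \<tau>' r = (LINT \<sigma>:{\<tau><..\<tau>'}|lborel. gE d \<sigma> r / \<sigma> ^ (j + 2))"
proof -
  have e: "{\<tau><..} = {\<tau><..\<tau>'} \<union> {\<tau>'<..}" using t by auto
  have i: "set_integrable lborel {\<tau><..} (\<lambda>\<sigma>. gE d \<sigma> r / \<sigma> ^ (j + 2))"
    by (rule gG_integrable[OF r t(1)])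
  have "gG d j \<tau> r = (LINT \<sigma>:{\<tau><..\<tau>'}|lborel. gE d \<sigma> r / \<sigma> ^ (j + 2)) + gG d j \<tau>' r"
    unfolding gG_def e
    by (intro set_integral_Un set_integrable_subset[OF i]) (use t in auto)
  then show ?thesis by simp
qed

lemma set_integral_Ioc_le:
  fixes f :: "real \<Rightarrow> real"
  assumes "\<And>\<sigma>. \<tau> < \<sigma> \<Longrightarrow> \<sigma> \<le> \<tau>' \<Longrightarrow> f \<sigma> \<le> B" "set_integrable lborel {\<tau><..\<tau>'} f" "\<tau> \<le> \<tau>'"
  shows "(LINT \<sigma>:{\<tau><..\<tau>'}|lborel. f \<sigma>) \<le> B * (\<tau>' - \<tau>)"
proof -
  have "(LINT \<sigma>:{\<tau><..\<tau>'}|lborel. f \<sigma>) \<le> (LINT \<sigma>:{\<tau><..\<tau>'}|lborel. B)"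
    using assms by (intro set_integral_mono) (auto simp: set_integrable_def)
  also have "\<dots> = B * (\<tau>' - \<tau>)" using assms(3) by (simp add: set_lebesgue_integral_def)
  finally show ?thesis .
qed

text \<open>Only the interval (\<tau>, \<tau>'] contributes. There sqrt \<sigma> and one of the
  factors sqrt \<sigma> + r are at least sqrt \<tau>, so the integrand times r^(2j+1) is at most a
  multiple of \<open>pk\<close> divided by \<tau>, and a time shift costs its relative size.\<close>

lemma gG_diff_bound:
  "\<exists>C>0. \<forall>\<tau>>0. \<forall>\<tau>'\<ge>\<tau>. \<forall>r>0. r ^ (2 * j + 1) * \<bar>gG d j \<tau>' r - gG d j \<tau> r\<bar> \<le> C * ((\<tau>' - \<tau>) / \<tau>) / (sqrt \<tau> + r) ^ (d + 1)"
proof -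
  obtain C where C: "C > 0" and b: "\<And>\<sigma> r. \<sigma> > 0 \<Longrightarrow> r \<ge> 0 \<Longrightarrow>
     r ^ (2 * j + 1) * (gE d \<sigma> r / \<sigma> ^ (j + 2)) \<le> C / (sqrt \<sigma> * (sqrt \<sigma> + r) ^ (d + 2))"
    using gG_integrand_bound[of j d] by auto
  show ?thesis
  proof (intro exI[of _ C] conjI allI impI C)
    fix \<tau> \<tau>' r :: real assume t: "\<tau> > 0" "\<tau> \<le> \<tau>'" and r: "r > 0"
    have i: "set_integrable lborel {\<tau><..\<tau>'} (\<lambda>\<sigma>. gE d \<sigma> r / \<sigma> ^ (j + 2))"
      by (rule set_integrable_subset[OF gG_integrable[OF r, of \<tau>]]) (use t in auto)
    have le: "r ^ (2 * j + 1) * (gE d \<sigma> r / \<sigma> ^ (j + 2)) \<le> C / \<tau> / (sqrt \<tau> + r) ^ (d + 1)"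
      if "\<sigma> > \<tau>" for \<sigma>
    proof -
      have s: "sqrt \<sigma> \<ge> sqrt \<tau>" "\<sigma> > 0" "sqrt \<tau> > 0" "sqrt \<sigma> > 0" using that t by auto
      have sr: "sqrt \<tau> \<le> sqrt \<sigma> + r" "sqrt \<tau> + r \<le> sqrt \<sigma> + r" "0 \<le> sqrt \<sigma> + r" "0 \<le> sqrt \<tau> + r"
          "0 < sqrt \<sigma> + r" "0 < sqrt \<tau> + r"
        using s r by linarith+
      have "\<tau> * (sqrt \<tau> + r) ^ (d + 1) = sqrt \<tau> * (sqrt \<tau> * (sqrt \<tau> + r) ^ (d + 1))"
        using t by simp
      also have "\<dots> \<le> sqrt \<sigma> * ((sqrt \<sigma> + r) * (sqrt \<sigma> + r) ^ (d + 1))"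
        by (rule mult_mono[OF s(1) mult_mono[OF sr(1) power_mono[OF sr(2) sr(4)]]]) (use s sr in auto)
      also have "\<dots> = sqrt \<sigma> * (sqrt \<sigma> + r) ^ (d + 2)" by simp
      finally have "C / (sqrt \<sigma> * (sqrt \<sigma> + r) ^ (d + 2)) \<le> C / (\<tau> * (sqrt \<tau> + r) ^ (d + 1))"
        using C t s r sr by (intro divide_left_mono mult_pos_pos zero_less_power) auto
      then show ?thesis using b[OF s(2), of r] r by simp
    qed
    have "gG d j \<tau> r - gG d j \<tau>' r \<ge> 0"
      using t r unfolding gG_split[OF r less_imp_le[OF t(1)] t(2)] set_lebesgue_integral_def
      by (intro integral_nonneg_AE) (auto simp: indicator_def)
    then have "r ^ (2 * j + 1) * \<bar>gG d j \<tau>' r - gG d j \<tau> r\<bar> = r ^ (2 * j + 1) * (LINT \<sigma>:{\<tau><..\<tau>'}|lborel. gE d \<sigma> r / \<sigma> ^ (j + 2))"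
      using gG_split[OF r less_imp_le[OF t(1)] t(2), of d j] by simp
    also have "\<dots> = (LINT \<sigma>:{\<tau><..\<tau>'}|lborel. r ^ (2 * j + 1) * (gE d \<sigma> r / \<sigma> ^ (j + 2)))"
      by (rule set_integral_mult_right[symmetric])
    also have "\<dots> \<le> C / \<tau> / (sqrt \<tau> + r) ^ (d + 1) * (\<tau>' - \<tau>)"
      by (intro set_integral_Ioc_le le set_integrable_mult_right i t)
    finally show "r ^ (2 * j + 1) * \<bar>gG d j \<tau>' r - gG d j \<tau> r\<bar> \<le> C * ((\<tau>' - \<tau>) / \<tau>) / (sqrt \<tau> + r) ^ (d + 1)"
      by (simp add: field_simps)
  qed
qed

text \<open>On the missing interval (0, \<tau>] the integrand is bounded: for r > 0 the Gaussian
  absorbs every negative power of \<sigma>, at the price of r^(-(d+2j+4)). Compared with the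
  homogeneous size of \<open>gG d j 0\<close> this gains two powers of r per factor \<tau>.\<close>

lemma gG_zero_diff_bound:
  "\<exists>C>0. \<forall>\<tau>>0. \<forall>r>0. r ^ (d + 2 * (j + 2)) * \<bar>gG d j \<tau> r - gG d j 0 r\<bar> \<le> C * \<tau>"
proof -
  obtain C where C: "C > 0" and b: "\<And>s r. s > 0 \<Longrightarrow> r \<ge> 0 \<Longrightarrow>
      r ^ (d + 2 * (j + 2)) * (s + r) ^ 0 * gE d (s\<^sup>2) r \<le> C * s ^ (d + 2 * (j + 2) + 0) / s ^ d"
    using gE_bound[of "d + 2 * (j + 2)" 0 d] by blast
  show ?thesis
  proof (intro exI[of _ C] conjI allI impI C)
    fix \<tau> r :: real assume t: "\<tau> > 0" and r: "r > 0"
    have i: "set_integrable lborel {0<..\<tau>} (\<lambda>\<sigma>. gE d \<sigma> r / \<sigma> ^ (j + 2))"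
      by (rule set_integrable_subset[OF gG_integrable[OF r, of 0]]) auto
    have le: "r ^ (d + 2 * (j + 2)) * (gE d \<sigma> r / \<sigma> ^ (j + 2)) \<le> C" if "\<sigma> > 0" for \<sigma>
    proof -
      have "r ^ (d + 2 * (j + 2)) * gE d \<sigma> r \<le> C * (sqrt \<sigma>) ^ (2 * (j + 2))"
        using b[of "sqrt \<sigma>" r] that r by (simp add: power_add)
      also have "(sqrt \<sigma>) ^ (2 * (j + 2)) = \<sigma> ^ (j + 2)"
        using that by (simp only: power_mult real_sqrt_pow2 less_imp_le)
      finally show ?thesis using that by (simp add: divide_le_eq)
    qed
    have s: "gG d j 0 r - gG d j \<tau> r = (LINT \<sigma>:{0<..\<tau>}|lborel. gE d \<sigma> r / \<sigma> ^ (j + 2))"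
      by (rule gG_split) (use r t in auto)
    have "gG d j 0 r - gG d j \<tau> r \<ge> 0"
      unfolding s set_lebesgue_integral_def
      by (intro integral_nonneg_AE) (auto simp: indicator_def)
    then have "r ^ (d + 2 * (j + 2)) * \<bar>gG d j \<tau> r - gG d j 0 r\<bar> = r ^ (d + 2 * (j + 2)) * (LINT \<sigma>:{0<..\<tau>}|lborel. gE d \<sigma> r / \<sigma> ^ (j + 2))"
      using s by simp
    also have "\<dots> = (LINT \<sigma>:{0<..\<tau>}|lborel. r ^ (d + 2 * (j + 2)) * (gE d \<sigma> r / \<sigma> ^ (j + 2)))"
      by (rule set_integral_mult_right[symmetric])
    also have "\<dots> \<le> C * (\<tau> - 0)"
      by (intro set_integral_Ioc_le le set_integrable_mult_right i) (use t in auto)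
    finally show "r ^ (d + 2 * (j + 2)) * \<bar>gG d j \<tau> r - gG d j 0 r\<bar> \<le> C * \<tau>" by simp
  qed
qed

text \<open>Parabolic substitution in the integral over all positive \<sigma>. Together with the
  2j+1 factors z it makes every term of the limit kernel homogeneous of degree -(d+1).\<close>

lemma gG_zero_scale:
  assumes r: "r > 0"
  shows "gG d j 0 r = gG d j 0 1 / r ^ (d + 2 * (j + 1))"
proof -
  have sc: "gE d (r\<^sup>2 * \<sigma>) r / (r\<^sup>2 * \<sigma>) ^ (j + 2) = (gE d \<sigma> 1 / \<sigma> ^ (j + 2)) / r ^ (d + 2 * (j + 2))" for \<sigma>
  proof -
    have "sqrt (4 * pi * (r\<^sup>2 * \<sigma>)) = r * sqrt (4 * pi * \<sigma>)"
      using r by (simp add: real_sqrt_mult)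
    moreover have "- r\<^sup>2 / (4 * (r\<^sup>2 * \<sigma>)) = - 1\<^sup>2 / (4 * \<sigma>)" using r by simp
    ultimately show ?thesis
      unfolding gE_def by (simp only: power_mult_distrib power_add power_mult) (simp add: field_simps)
  qed
  have "gG d j 0 r = (\<integral>\<sigma>. indicator {0<..} \<sigma> *\<^sub>R (gE d \<sigma> r / \<sigma> ^ (j + 2)) \<partial>lborel)"
    by (simp add: gG_def set_lebesgue_integral_def)
  also have "\<dots> = \<bar>r\<^sup>2\<bar> *\<^sub>R (\<integral>\<sigma>. indicator {0<..} (0 + r\<^sup>2 * \<sigma>) *\<^sub>R (gE d (0 + r\<^sup>2 * \<sigma>) r / (0 + r\<^sup>2 * \<sigma>) ^ (j + 2)) \<partial>lborel)"
    by (rule lborel_integral_real_affine) (use r in auto)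
  also have "\<dots> = r\<^sup>2 * (\<integral>\<sigma>. (indicator {0<..} \<sigma> *\<^sub>R (gE d \<sigma> 1 / \<sigma> ^ (j + 2))) / r ^ (d + 2 * (j + 2)) \<partial>lborel)"
    using r by (simp only: add_0 sc) (auto simp: indicator_def zero_less_mult_iff intro!: Bochner_Integration.integral_cong)
  also have "\<dots> = r\<^sup>2 * (gG d j 0 1 / r ^ (d + 2 * (j + 2)))"
    by (simp only: gG_def set_lebesgue_integral_def integral_divide_zero)
  also have "\<dots> = gG d j 0 1 / r ^ (d + 2 * (j + 1))"
    using r by (simp add: power_add power2_eq_square)
  finally show ?thesis .
qed

text \<open>The kernel also contains a Gaussian without time integration, from the part of the
  symbol that the projector leaves alone. The first estimate majorizes it by \<open>pk\<close>; the
  second shows that it is O(\<tau>) away from the origin, so it leaves no trace in the limit \<tau>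
  = 0.\<close>

lemma gE_ratio_bound:
  "\<exists>C>0. \<forall>\<tau>>0. \<forall>r\<ge>0. r * (gE d \<tau> r / \<tau>) \<le> C / (sqrt \<tau> + r) ^ (d + 1) \<and> r ^ (d + 4) * (gE d \<tau> r / \<tau>) \<le> C * \<tau>"
proof -
  obtain C where C: "C > 0" and b: "\<And>s r. s > 0 \<Longrightarrow> r \<ge> 0 \<Longrightarrow>
      r ^ 1 * (s + r) ^ (d + 1) * gE d (s\<^sup>2) r \<le> C * s ^ (1 + (d + 1)) / s ^ d"
    using gE_bound[of 1 "d + 1" d] by blast
  obtain D where D: "D > 0" and bd: "\<And>s r. s > 0 \<Longrightarrow> r \<ge> 0 \<Longrightarrow>
      r ^ (d + 4) * (s + r) ^ 0 * gE d (s\<^sup>2) r \<le> D * s ^ (d + 4 + 0) / s ^ d"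
    using gE_bound[of "d + 4" 0 d] by blast
  show ?thesis
  proof (intro exI[of _ "C + D"] conjI allI impI)
    show "C + D > 0" using C D by simp
    fix \<tau> r :: real assume t: "\<tau> > 0" and r: "r \<ge> 0"
    have p: "(sqrt \<tau> + r) ^ (d + 1) > 0" using t r by (intro zero_less_power) (simp add: add_pos_nonneg)
    have "r * (sqrt \<tau> + r) ^ (d + 1) * gE d \<tau> r \<le> C * \<tau>"
      using b[of "sqrt \<tau>" r] t r by (simp add: power_add power2_eq_square[symmetric] flip: mult.assoc)
    then have "(r * (gE d \<tau> r / \<tau>)) * (sqrt \<tau> + r) ^ (d + 1) \<le> C"
      using t by (simp add: divide_le_eq mult_ac)
    then have "(r * (gE d \<tau> r / \<tau>)) * (sqrt \<tau> + r) ^ (d + 1) \<le> C + D"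
      using D by simp
    then show "r * (gE d \<tau> r / \<tau>) \<le> (C + D) / (sqrt \<tau> + r) ^ (d + 1)"
      using p by (subst pos_le_divide_eq) auto
    have "sqrt \<tau> ^ 4 = \<tau> * \<tau>" using t power_mult[of "sqrt \<tau>" 2 2] by (simp add: power2_eq_square)
    then have "r ^ (d + 4) * gE d \<tau> r \<le> D * (\<tau> * \<tau>)"
      using bd[of "sqrt \<tau>" r] t r by (simp add: power_add)
    also have "\<dots> \<le> (C + D) * (\<tau> * \<tau>)" using C t by (intro mult_right_mono) auto
    finally show "r ^ (d + 4) * (gE d \<tau> r / \<tau>) \<le> (C + D) * \<tau>"
      using t by (simp add: divide_le_eq mult_ac)
  qed
qed

text \<open>Mean value theorem in \<sigma>: the function is a multiple of \<sigma>^(-d/2-1)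
  exp(-r^2/(4\<sigma>)), so its logarithmic derivative is r^2/(4\<sigma>^2) -
  (d/2+1)/\<sigma>.\<close>

lemma gE_ratio_diff_bound:
  "\<exists>C>0. \<forall>\<tau>>0. \<forall>\<tau>'\<ge>\<tau>. \<forall>r\<ge>0. r * \<bar>gE d \<tau>' r / \<tau>' - gE d \<tau> r / \<tau>\<bar> \<le> C * ((\<tau>' - \<tau>) / \<tau>) / (sqrt \<tau> + r) ^ (d + 1)"
proof -
  obtain C where C: "C > 0" and b: "\<And>s r. s > 0 \<Longrightarrow> r \<ge> 0 \<Longrightarrow>
      r ^ 1 * (s + r) ^ (d + 1) * gE d (s\<^sup>2) r \<le> C * s ^ (1 + (d + 1)) / s ^ d"
    using gE_bound[of 1 "d + 1" d] by blast
  obtain D where D: "D > 0" and bd: "\<And>s r. s > 0 \<Longrightarrow> r \<ge> 0 \<Longrightarrow>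
      r ^ 3 * (s + r) ^ (d + 1) * gE d (s\<^sup>2) r \<le> D * s ^ (3 + (d + 1)) / s ^ d"
    using gE_bound[of 3 "d + 1" d] by blast
  \<comment> \<open>The two summands pay for the two terms of the logarithmic derivative:
    \<open>C\<close> for the one with 1/\<sigma>, and \<open>D\<close>, obtained with two more
    powers of r, for the one with r^2/\<sigma>^2.\<close>
  define K where "K = (real d / 2 + 1) * C + D / 4"
  show ?thesis
  proof (intro exI[of _ K] conjI allI impI)
    show "K > 0" using C D by (simp add: K_def add_pos_pos add_nonneg_pos)
    fix \<tau> \<tau>' r :: real assume t: "\<tau> > 0" "\<tau> \<le> \<tau>'" and r: "r \<ge> 0"
    define f' where "f' \<sigma> = (gE d \<sigma> r / \<sigma>) * (r\<^sup>2 / (4 * \<sigma>\<^sup>2) - (real d / 2 + 1) / \<sigma>)" for \<sigma>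
    have der: "((\<lambda>\<sigma>. gE d \<sigma> r / \<sigma>) has_real_derivative f' \<sigma>) (at \<sigma>)" if "\<sigma> > 0" for \<sigma>
    proof -
      have s: "sqrt (4 * pi * \<sigma>) > 0" using that by simp
      have sd: "((\<lambda>\<sigma>. sqrt (4 * pi * \<sigma>) ^ d) has_real_derivative (real d / (2 * \<sigma>)) * sqrt (4 * pi * \<sigma>) ^ d) (at \<sigma>)"
      proof -
        define S where "S = sqrt (4 * pi * \<sigma>)"
        have S: "S > 0" "S * S = 4 * pi * \<sigma>" using that by (auto simp: S_def)
        have "((\<lambda>\<sigma>. sqrt (4 * pi * \<sigma>)) has_real_derivative 4 * pi * (inverse S / 2)) (at \<sigma>)"
          unfolding S_def using that by (auto intro!: derivative_eq_intros simp: mult_less_0_iff)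
        also have "4 * pi * (inverse S / 2) = S / (2 * \<sigma>)"
          using S that by (simp add: field_simps)
        finally have "((\<lambda>\<sigma>. sqrt (4 * pi * \<sigma>) ^ d) has_real_derivative real d * (S / (2 * \<sigma>) * S ^ (d - Suc 0))) (at \<sigma>)"
          unfolding S_def by (rule DERIV_power)
        moreover have "real d * (S / (2 * \<sigma>) * S ^ (d - Suc 0)) = (real d / (2 * \<sigma>)) * S ^ d"
          by (cases d) auto
        ultimately show ?thesis by (simp only: S_def)
      qed
      define h where "h = (\<lambda>\<sigma>. sqrt (4 * pi * \<sigma>) ^ d)"
      have h: "h \<sigma> \<noteq> 0" "(h has_real_derivative (real d / (2 * \<sigma>)) * h \<sigma>) (at \<sigma>)"
        using s sd by (auto simp: h_def)
      have "((\<lambda>\<sigma>. exp (- r\<^sup>2 / (4 * \<sigma>)) / h \<sigma> / \<sigma>) has_real_derivative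
          (exp (- r\<^sup>2 / (4 * \<sigma>)) / h \<sigma> / \<sigma>) * (r\<^sup>2 / (4 * \<sigma>\<^sup>2) - (real d / 2 + 1) / \<sigma>)) (at \<sigma>)"
        using h(1) that
        by (auto intro!: derivative_eq_intros h(2) simp: divide_simps) (simp add: algebra_simps power2_eq_square)
      then show ?thesis by (simp add: gE_def f'_def h_def)
    qed
    have fb: "r * \<bar>f' \<sigma>\<bar> \<le> K / \<tau> / (sqrt \<tau> + r) ^ (d + 1)" if "\<sigma> \<ge> \<tau>" for \<sigma>
    proof -
      have s: "sqrt \<sigma> \<ge> sqrt \<tau>" "\<sigma> > 0" "sqrt \<tau> > 0" "sqrt \<sigma> > 0" using that t by auto
      have sr: "0 < sqrt \<sigma> + r" "0 < sqrt \<tau> + r" "sqrt \<tau> + r \<le> sqrt \<sigma> + r" using s r by linarith+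
      define P where "P = (sqrt \<sigma> + r) ^ (d + 1)"
      have P: "P > 0" unfolding P_def using sr by (intro zero_less_power)
      have e1: "r * P * gE d \<sigma> r \<le> C * \<sigma>"
        using b[of "sqrt \<sigma>" r] s r by (simp add: P_def power_add power2_eq_square[symmetric] flip: mult.assoc)
      have q: "sqrt \<sigma> * (sqrt \<sigma> * \<sigma>) = \<sigma> * \<sigma>" using s by (simp flip: mult.assoc)
      have e2: "r ^ 3 * P * gE d \<sigma> r \<le> D * \<sigma>\<^sup>2"
        using bd[of "sqrt \<sigma>" r] s r by (simp add: P_def power_add eval_nat_numeral q)
      have "\<bar>f' \<sigma>\<bar> \<le> (gE d \<sigma> r / \<sigma>) * (r\<^sup>2 / (4 * \<sigma>\<^sup>2) + (real d / 2 + 1) / \<sigma>)"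
        unfolding f'_def abs_mult using s(2)
        by (intro mult_mono) (auto simp: abs_le_iff)
      then have "P * (r * \<bar>f' \<sigma>\<bar>) \<le> P * (r * ((gE d \<sigma> r / \<sigma>) * (r\<^sup>2 / (4 * \<sigma>\<^sup>2) + (real d / 2 + 1) / \<sigma>)))"
        using P r by (intro mult_left_mono) auto
      also have "\<dots> = (r ^ 3 * P * gE d \<sigma> r) / (4 * \<sigma> * \<sigma>\<^sup>2) + (real d / 2 + 1) * (r * P * gE d \<sigma> r) / \<sigma>\<^sup>2"
        using s by (simp add: field_simps power3_eq_cube power2_eq_square)
      also have "\<dots> \<le> (D * \<sigma>\<^sup>2) / (4 * \<sigma> * \<sigma>\<^sup>2) + (real d / 2 + 1) * (C * \<sigma>) / \<sigma>\<^sup>2"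
        using e1 e2 s by (intro add_mono divide_right_mono mult_left_mono) auto
      also have "\<dots> = K / \<sigma>" using s by (simp add: K_def field_simps power2_eq_square)
      finally have "r * \<bar>f' \<sigma>\<bar> \<le> K / \<sigma> / P" using P by (subst pos_le_divide_eq) (auto simp: mult_ac)
      also have "\<dots> \<le> K / \<tau> / (sqrt \<tau> + r) ^ (d + 1)"
        unfolding P_def using that t s r \<open>K > 0\<close> sr
        by (intro frac_le divide_nonneg_pos power_mono zero_less_power less_imp_le[OF sr(2)] sr) auto
      finally show ?thesis .
    qed
    show "r * \<bar>gE d \<tau>' r / \<tau>' - gE d \<tau> r / \<tau>\<bar> \<le> K * ((\<tau>' - \<tau>) / \<tau>) / (sqrt \<tau> + r) ^ (d + 1)"
    proof (cases "\<tau>' = \<tau>")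
      case False
      then have lt: "\<tau> < \<tau>'" using t by simp
      have "\<exists>z>\<tau>. z < \<tau>' \<and> gE d \<tau>' r / \<tau>' - gE d \<tau> r / \<tau> = (\<tau>' - \<tau>) * f' z"
        by (rule MVT2[OF lt]) (rule der, use t in linarith)
      then obtain z where z: "z > \<tau>" "z < \<tau>'" "gE d \<tau>' r / \<tau>' - gE d \<tau> r / \<tau> = (\<tau>' - \<tau>) * f' z"
        by blast
      have "r * \<bar>gE d \<tau>' r / \<tau>' - gE d \<tau> r / \<tau>\<bar> = (\<tau>' - \<tau>) * (r * \<bar>f' z\<bar>)"
        using lt by (simp add: z(3) abs_mult)
      also have "\<dots> \<le> (\<tau>' - \<tau>) * (K / \<tau> / (sqrt \<tau> + r) ^ (d + 1))"
        using fb[of z] z lt by (intro mult_left_mono) auto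
      finally show ?thesis by (simp add: mult.commute)
    qed simp
  qed
qed

section \<open>The Oseen kernel\<close>

lemma sigma_finite_lebesgue: "sigma_finite_measure (lebesgue :: 'a::euclidean_space measure)"
proof
  show "\<exists>A::'a set set. countable A \<and> A \<subseteq> sets lebesgue \<and> \<Union> A = space lebesgue \<and> (\<forall>a\<in>A. emeasure lebesgue a \<noteq> \<infinity>)"
    by (intro exI[of _ "range (\<lambda>n::nat. box (- real n *\<^sub>R One) (real n *\<^sub>R One))"])
       (auto simp: emeasure_lborel_box_eq UN_box_eq_UNIV)
qed

text \<open>Fubini is used on this mixed product: the first variable, a frequency or a target point,
  enters only through Borel functions, while y carries a velocity field that is merely Lebesgue
  measurable.\<close>

lemma pair_sigma_finite_lborel_lebesgue:
  "pair_sigma_finite (lborel :: 'a::euclidean_space measure) (lebesgue :: 'b::euclidean_space measure)"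
  by (simp add: pair_sigma_finite_def sigma_finite_lebesgue lborel.sigma_finite_measure_axioms)

lemma cis_measurable [measurable]: "f \<in> borel_measurable M \<Longrightarrow> (\<lambda>x. cis (f x)) \<in> borel_measurable M"
  by (rule measurable_compose[of f M borel]) (auto intro!: borel_measurable_continuous_onI continuous_intros)

text \<open>The rescaled characteristic function of the standard normal distribution; c =
  sqrt(2\<sigma>) turns x^2/2 into \<sigma> x^2.\<close>

lemma gauss_fourier_1:
  assumes s: "\<sigma> > 0"
  shows "integrable lborel (\<lambda>x::real. cis (x * z) * complex_of_real (exp (- \<sigma> * x\<^sup>2)))"
    and "(\<integral>x. cis (x * z) * complex_of_real (exp (- \<sigma> * x\<^sup>2)) \<partial>lborel)
           = complex_of_real (sqrt (pi / \<sigma>) * exp (- z\<^sup>2 / (4 * \<sigma>)))"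
proof -
  define c where "c = sqrt (2 * \<sigma>)"
  have c: "c > 0" "c\<^sup>2 = 2 * \<sigma>" using s by (auto simp: c_def)
  let ?f = "\<lambda>x. std_normal_density x *\<^sub>R cis (z / c * x)"
  have eq: "?f (0 + c * x) = complex_of_real (1 / sqrt (2 * pi)) * (cis (x * z) * complex_of_real (exp (- \<sigma> * x\<^sup>2)))" for x
  proof -
    have "- (c * x)\<^sup>2 / 2 = - \<sigma> * x\<^sup>2" using c by (simp add: power_mult_distrib)
    moreover have "z / c * (c * x) = x * z" using c by simp
    ultimately show ?thesis
      by (simp only: std_normal_density_def add_0 scaleR_conv_of_real of_real_mult mult_ac)
  qed
  have i: "integrable lborel ?f"
  proof -
    have "integrable lborel (\<lambda>x. std_normal_density x)" by simp
    then show ?thesis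
      by (rule Bochner_Integration.integrable_bound) (auto intro!: borel_measurable_scaleR cis_measurable)
  qed
  define k where "k = complex_of_real (1 / sqrt (2 * pi))"
  have k: "k \<noteq> 0" by (simp add: k_def)
  have "integrable lborel (\<lambda>x. k * (cis (x * z) * complex_of_real (exp (- \<sigma> * x\<^sup>2))))"
    using lborel_integrable_real_affine[OF i, of c 0] c unfolding eq k_def by simp
  then have "integrable lborel (\<lambda>x. inverse k * (k * (cis (x * z) * complex_of_real (exp (- \<sigma> * x\<^sup>2)))))"
    by (rule integrable_mult_right)
  then show "integrable lborel (\<lambda>x::real. cis (x * z) * complex_of_real (exp (- \<sigma> * x\<^sup>2)))"
    using k by (simp flip: mult.assoc)
  have "char std_normal_distribution (z / c) = (\<integral>x. std_normal_density x *\<^sub>R iexp (z / c * x) \<partial>lborel)"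
    unfolding char_def by (rule integral_density) (auto intro!: borel_measurable_continuous_onI continuous_intros)
  also have "\<dots> = (\<integral>x. ?f x \<partial>lborel)" by (simp only: cis_conv_exp)
  also have "\<dots> = \<bar>c\<bar> *\<^sub>R (\<integral>x. ?f (0 + c * x) \<partial>lborel)"
    by (rule lborel_integral_real_affine) (use c in auto)
  also have "\<dots> = c *\<^sub>R (complex_of_real (1 / sqrt (2 * pi)) * (\<integral>x. cis (x * z) * complex_of_real (exp (- \<sigma> * x\<^sup>2)) \<partial>lborel))"
    using c unfolding eq by simp
  finally have e: "complex_of_real (exp (- (z / c)\<^sup>2 / 2)) = complex_of_real (c / sqrt (2 * pi)) * (\<integral>x. cis (x * z) * complex_of_real (exp (- \<sigma> * x\<^sup>2)) \<partial>lborel)"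
    by (simp add: char_std_normal_distribution scaleR_conv_of_real)
  have "complex_of_real (sqrt (pi / \<sigma>)) * (complex_of_real (c / sqrt (2 * pi)) * (\<integral>x. cis (x * z) * complex_of_real (exp (- \<sigma> * x\<^sup>2)) \<partial>lborel))
     = complex_of_real (sqrt (pi / \<sigma>) * (c / sqrt (2 * pi))) * (\<integral>x. cis (x * z) * complex_of_real (exp (- \<sigma> * x\<^sup>2)) \<partial>lborel)"
    by simp
  also have "sqrt (pi / \<sigma>) * (c / sqrt (2 * pi)) = 1"
    using s by (simp add: c_def real_sqrt_mult real_sqrt_divide)
  finally have "(\<integral>x. cis (x * z) * complex_of_real (exp (- \<sigma> * x\<^sup>2)) \<partial>lborel) = complex_of_real (sqrt (pi / \<sigma>)) * complex_of_real (exp (- (z / c)\<^sup>2 / 2))"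
    using e by simp
  also have "- (z / c)\<^sup>2 / 2 = - z\<^sup>2 / (4 * \<sigma>)" using c by (simp add: power_divide)
  finally show "(\<integral>x. cis (x * z) * complex_of_real (exp (- \<sigma> * x\<^sup>2)) \<partial>lborel)
           = complex_of_real (sqrt (pi / \<sigma>) * exp (- z\<^sup>2 / (4 * \<sigma>)))" by simp
qed

lemma prod_cis: "finite A \<Longrightarrow> (\<Prod>b\<in>A. cis (f b)) = cis (\<Sum>b\<in>A. f b)"
  by (induction A rule: finite_induct) (auto simp: cis_mult)

text \<open>Lebesgue measure is the image of a product of one-dimensional measures over
  \<open>Basis\<close>, and the integrand factorizes along it.\<close>

lemma gauss_fourier:
  fixes z :: "'a::euclidean_space"
  assumes s: "\<sigma> > 0"
  shows "(\<integral>\<xi>. cis (\<xi> \<bullet> z) * complex_of_real (exp (- \<sigma> * (norm \<xi>)\<^sup>2)) \<partial>lborel)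
           = complex_of_real ((2 * pi) ^ DIM('a) * gE DIM('a) \<sigma> (norm z))"
proof -
  interpret product_sigma_finite "\<lambda>_::'a. lborel :: real measure" ..
  let ?T = "\<lambda>f. \<Sum>b\<in>Basis. f b *\<^sub>R (b::'a)"
  let ?g = "\<lambda>b x. cis (x * (z \<bullet> b)) * complex_of_real (exp (- \<sigma> * x\<^sup>2))"
  have T: "?T f \<bullet> b = f b" if "b \<in> Basis" for f b
    using that by (simp add: inner_sum_left inner_Basis if_distrib sum.delta cong: if_cong)
  have eq: "cis (?T f \<bullet> z) * complex_of_real (exp (- \<sigma> * (norm (?T f))\<^sup>2)) = (\<Prod>b\<in>Basis. ?g b (f b))" for f
  proof -
    have "?T f \<bullet> z = (\<Sum>b\<in>Basis. f b * (z \<bullet> b))"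
      by (subst euclidean_inner) (simp add: T)
    moreover have "(norm (?T f))\<^sup>2 = (\<Sum>b\<in>Basis. (f b)\<^sup>2)"
      by (subst power2_norm_eq_inner, subst euclidean_inner) (simp add: T power2_eq_square)
    ultimately show ?thesis
      by (simp add: prod.distrib prod_cis sum_distrib_left sum_negf[symmetric] exp_sum flip: of_real_prod)
  qed
  have "(\<integral>\<xi>. cis (\<xi> \<bullet> z) * complex_of_real (exp (- \<sigma> * (norm \<xi>)\<^sup>2)) \<partial>lborel)
     = (\<integral>f. cis (?T f \<bullet> z) * complex_of_real (exp (- \<sigma> * (norm (?T f))\<^sup>2)) \<partial>(\<Pi>\<^sub>M b\<in>Basis. lborel))"
    by (subst lborel_eq, rule integral_distr)
       (auto intro!: borel_measurable_continuous_onI continuous_intros)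
  also have "\<dots> = (\<Prod>b\<in>Basis. \<integral>x. ?g b x \<partial>lborel)"
    unfolding eq by (rule product_integral_prod) (use gauss_fourier_1(1)[OF s] in auto)
  also have "\<dots> = (\<Prod>b\<in>Basis. complex_of_real (sqrt (pi / \<sigma>) * exp (- (z \<bullet> b)\<^sup>2 / (4 * \<sigma>))))"
    using gauss_fourier_1(2)[OF s] by simp
  also have "\<dots> = complex_of_real (sqrt (pi / \<sigma>) ^ DIM('a) * exp (\<Sum>b\<in>Basis. - (z \<bullet> b)\<^sup>2 / (4 * \<sigma>)))"
    by (simp add: prod.distrib exp_sum)
  also have "(\<Sum>b\<in>Basis. - (z \<bullet> b)\<^sup>2 / (4 * \<sigma>)) = - (norm z)\<^sup>2 / (4 * \<sigma>)"
    by (subst power2_norm_eq_inner, subst euclidean_inner) (simp add: sum_divide_distrib sum_negf power2_eq_square)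
  also have "sqrt (pi / \<sigma>) = 2 * pi / sqrt (4 * pi * \<sigma>)"
  proof -
    have "sqrt (4 * pi * \<sigma>) = 2 * sqrt pi * sqrt \<sigma>" by (simp add: real_sqrt_mult)
    then show ?thesis using s by (simp add: real_sqrt_divide field_simps)
  qed
  finally show ?thesis by (simp add: gE_def power_divide)
qed

text \<open>Completing the square gives r - \<sigma> r^2 \<le> 1/(4\<sigma>), so a power bounded by
  a factorial times exp(1 + r) is harmless against the Gaussian.\<close>

lemma poly_exp_bound:
  assumes "\<sigma> > 0" "r \<ge> (0::real)"
  shows "(1 + r) ^ n * exp (- \<sigma> * r\<^sup>2) \<le> fact n * exp (1 + 1 / (4 * \<sigma>))"
proof -
  have "0 \<le> (2 * \<sigma> * r - 1)\<^sup>2" by simp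
  then have "4 * \<sigma> * (r - \<sigma> * r\<^sup>2) \<le> 1" by (simp add: power2_eq_square algebra_simps)
  then have "r - \<sigma> * r\<^sup>2 \<le> 1 / (4 * \<sigma>)" using assms by (simp add: field_simps)
  then have e: "exp (1 + r + - \<sigma> * r\<^sup>2) \<le> exp (1 + 1 / (4 * \<sigma>))" by simp
  have "(1 + r) ^ n * exp (- \<sigma> * r\<^sup>2) \<le> fact n * exp (1 + r) * exp (- \<sigma> * r\<^sup>2)"
    by (intro mult_right_mono power_le_fact_exp) (use assms in auto)
  also have "\<dots> = fact n * exp (1 + r + - \<sigma> * r\<^sup>2)" by (simp only: exp_add mult.assoc)
  also have "\<dots> \<le> fact n * exp (1 + 1 / (4 * \<sigma>))" using e by simp
  finally show ?thesis .
qed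

lemma gauss_moment_integrable:
  assumes s: "\<sigma> > 0"
  shows "integrable lborel (\<lambda>\<xi>::'a::euclidean_space. norm \<xi> ^ m * exp (- \<sigma> * (norm \<xi>)\<^sup>2))"
proof -
  let ?d = "DIM('a) + 1"
  define K where "K = fact (m + ?d) * exp (1 + 1 / (4 * \<sigma>))"
  have "integrable lborel (\<lambda>\<xi>::'a. K * wgt (real ?d) \<xi>)"
    by (intro integrable_mult_right integrable_wgt) simp
  then show ?thesis
  proof (rule Bochner_Integration.integrable_bound)
    show "AE \<xi> in lborel. norm (norm (\<xi>::'a) ^ m * exp (- \<sigma> * (norm \<xi>)\<^sup>2)) \<le> norm (K * wgt (real ?d) \<xi>)"
    proof (intro AE_I2)
      fix \<xi> :: 'a
      have p: "(1 + norm \<xi>) ^ ?d > 0" by (intro zero_less_power) (simp add: add_pos_nonneg)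
      have "norm \<xi> ^ m * exp (- \<sigma> * (norm \<xi>)\<^sup>2) * (1 + norm \<xi>) ^ ?d \<le> (1 + norm \<xi>) ^ m * exp (- \<sigma> * (norm \<xi>)\<^sup>2) * (1 + norm \<xi>) ^ ?d"
        using p by (intro mult_right_mono power_mono) auto
      also have "\<dots> \<le> K"
        using poly_exp_bound[OF s, of "norm \<xi>" "m + ?d"] by (simp add: K_def power_add mult_ac)
      finally have "norm \<xi> ^ m * exp (- \<sigma> * (norm \<xi>)\<^sup>2) \<le> K * wgt (real ?d) \<xi>"
        unfolding wgt_real using p by (simp add: pos_le_divide_eq)
      then show "norm (norm \<xi> ^ m * exp (- \<sigma> * (norm \<xi>)\<^sup>2)) \<le> norm (K * wgt (real ?d) \<xi>)"
        by (simp add: K_def)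
    qed
  qed measurable
qed

lemma norm_cis_minus_1_le: "norm (cis t - 1) \<le> \<bar>t\<bar>"
  using iexp_approx1[of t 0] by (simp add: cis_conv_exp)

text \<open>Differentiation under the integral sign in direction c, read backwards: a known
  transform g supplies the transform of the next moment by one real derivative. The difference
  quotients are dominated by |c| |\<xi>| |f(\<xi>)| because |cis t - 1| \<le> |t|.\<close>

lemma fourier_derivative:
  fixes f :: "'a::euclidean_space \<Rightarrow> complex" and g :: "'a \<Rightarrow> real"
  assumes f: "integrable lborel f" and nf: "integrable lborel (\<lambda>\<xi>. norm \<xi> * norm (f \<xi>))"
    and eq: "\<And>z. (\<integral>\<xi>. cis (\<xi> \<bullet> z) * f \<xi> \<partial>lborel) = complex_of_real (g z)"
    and g': "((\<lambda>s. g (z + s *\<^sub>R c)) has_real_derivative g') (at 0)"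
  shows "(\<integral>\<xi>. cis (\<xi> \<bullet> z) * (\<i> * complex_of_real (\<xi> \<bullet> c) * f \<xi>) \<partial>lborel) = complex_of_real g'"
proof -
  note fm [measurable] = borel_measurable_integrable[OF f]
  define X where "X n = 1 / real (Suc n)" for n
  have X0: "X n \<noteq> 0" for n by (simp add: X_def)
  have Xl: "X \<longlonglongrightarrow> 0" unfolding X_def by (rule LIMSEQ_Suc[OF lim_1_over_n])
  have Xat: "filterlim X (at 0) sequentially" using Xl X0 by (simp add: filterlim_at)
  let ?q = "\<lambda>n \<xi>. cis (\<xi> \<bullet> z) * ((cis (X n * (\<xi> \<bullet> c)) - 1) / complex_of_real (X n)) * f \<xi>"
  have int: "integrable lborel (\<lambda>\<xi>. cis (\<xi> \<bullet> y) * f \<xi>)" for y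
    by (rule Bochner_Integration.integrable_bound[OF f]) (auto simp: norm_mult)
  have "(\<lambda>n. \<integral>\<xi>. ?q n \<xi> \<partial>lborel) \<longlonglongrightarrow> (\<integral>\<xi>. cis (\<xi> \<bullet> z) * (\<i> * complex_of_real (\<xi> \<bullet> c) * f \<xi>) \<partial>lborel)"
  proof (rule integral_dominated_convergence)
    show "integrable lborel (\<lambda>\<xi>. norm c * (norm \<xi> * norm (f \<xi>)))" using nf by simp
    show "AE \<xi> in lborel. (\<lambda>n. ?q n \<xi>) \<longlonglongrightarrow> cis (\<xi> \<bullet> z) * (\<i> * complex_of_real (\<xi> \<bullet> c) * f \<xi>)"
    proof (rule AE_I2)
      fix \<xi>
      let ?A = "\<i> * complex_of_real (\<xi> \<bullet> c)"
      have "((\<lambda>w. exp (w * ?A)) has_field_derivative ?A) (at 0)"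
        by (auto intro!: derivative_eq_intros)
      then have L: "(\<lambda>h. (exp (h * ?A) - 1) / h) \<midarrow>0\<rightarrow> ?A" by (simp add: DERIV_def)
      have "filterlim (\<lambda>n. complex_of_real (X n)) (at 0) sequentially"
        using tendsto_of_real[OF Xl, where 'a=complex] X0 by (simp add: filterlim_at)
      from filterlim_compose[OF L this]
      have "(\<lambda>n. (cis (X n * (\<xi> \<bullet> c)) - 1) / complex_of_real (X n)) \<longlonglongrightarrow> ?A"
        by (simp add: cis_conv_exp mult_ac)
      then have "(\<lambda>n. ?q n \<xi>) \<longlonglongrightarrow> cis (\<xi> \<bullet> z) * (\<i> * complex_of_real (\<xi> \<bullet> c)) * f \<xi>"
        by (intro tendsto_intros)
      then show "(\<lambda>n. ?q n \<xi>) \<longlonglongrightarrow> cis (\<xi> \<bullet> z) * (\<i> * complex_of_real (\<xi> \<bullet> c) * f \<xi>)"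
        by (simp add: mult.assoc)
    qed
    show "AE \<xi> in lborel. norm (?q n \<xi>) \<le> norm c * (norm \<xi> * norm (f \<xi>))" for n
    proof (rule AE_I2)
      fix \<xi>
      have "norm (cis (X n * (\<xi> \<bullet> c)) - 1) \<le> \<bar>X n\<bar> * \<bar>\<xi> \<bullet> c\<bar>"
        using norm_cis_minus_1_le[of "X n * (\<xi> \<bullet> c)"] by (simp add: abs_mult)
      also have "\<dots> \<le> \<bar>X n\<bar> * (norm \<xi> * norm c)"
        by (intro mult_left_mono Cauchy_Schwarz_ineq2) auto
      finally have "norm ((cis (X n * (\<xi> \<bullet> c)) - 1) / complex_of_real (X n)) \<le> norm \<xi> * norm c"
        using X0[of n] by (simp add: norm_divide divide_le_eq mult.commute)
      then have "norm ((cis (X n * (\<xi> \<bullet> c)) - 1) / complex_of_real (X n)) * norm (f \<xi>) \<le> norm \<xi> * norm c * norm (f \<xi>)"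
        by (rule mult_right_mono) simp
      then show "norm (?q n \<xi>) \<le> norm c * (norm \<xi> * norm (f \<xi>))"
        by (simp only: norm_mult norm_cis mult_1_left mult_ac)
    qed
  qed measurable
  moreover have "(\<integral>\<xi>. ?q n \<xi> \<partial>lborel) = complex_of_real ((g (z + X n *\<^sub>R c) - g z) / X n)" for n
  proof -
    have "?q n \<xi> = (cis (\<xi> \<bullet> (z + X n *\<^sub>R c)) * f \<xi> - cis (\<xi> \<bullet> z) * f \<xi>) / complex_of_real (X n)" for \<xi>
      by (simp add: inner_add_right cis_mult[symmetric] algebra_simps diff_divide_distrib)
    then have "(\<integral>\<xi>. ?q n \<xi> \<partial>lborel) = (\<integral>\<xi>. (cis (\<xi> \<bullet> (z + X n *\<^sub>R c)) * f \<xi> - cis (\<xi> \<bullet> z) * f \<xi>) / complex_of_real (X n) \<partial>lborel)"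
      by (simp only:)
    also have "\<dots> = (complex_of_real (g (z + X n *\<^sub>R c)) - complex_of_real (g z)) / complex_of_real (X n)"
      using int by (simp add: eq)
    finally show ?thesis by simp
  qed
  ultimately have A: "(\<lambda>n. complex_of_real ((g (z + X n *\<^sub>R c) - g z) / X n)) \<longlonglongrightarrow> (\<integral>\<xi>. cis (\<xi> \<bullet> z) * (\<i> * complex_of_real (\<xi> \<bullet> c) * f \<xi>) \<partial>lborel)"
    by (simp only:)
  have "(\<lambda>s. (g (z + s *\<^sub>R c) - g z) / s) \<midarrow>0\<rightarrow> g'"
    using g' by (simp add: has_field_derivative_iff)
  from filterlim_compose[OF this Xat] have "(\<lambda>n. (g (z + X n *\<^sub>R c) - g z) / X n) \<longlonglongrightarrow> g'" .
  then have "(\<lambda>n. complex_of_real ((g (z + X n *\<^sub>R c) - g z) / X n)) \<longlonglongrightarrow> complex_of_real g'"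
    by (rule tendsto_of_real)
  with A show ?thesis by (rule LIMSEQ_unique)
qed

lemma gE_directional_derivative:
  fixes z c :: "'a::euclidean_space"
  assumes s: "\<sigma> > 0"
  shows "((\<lambda>s. gE d \<sigma> (norm (z + s *\<^sub>R c))) has_real_derivative - (z \<bullet> c) / (2 * \<sigma>) * gE d \<sigma> (norm z)) (at 0)"
proof -
  have n: "(norm (z + s *\<^sub>R c))\<^sup>2 = z \<bullet> z + 2 * s * (z \<bullet> c) + s\<^sup>2 * (c \<bullet> c)" for s
    unfolding power2_norm_eq_inner by (simp add: inner_add_left inner_add_right inner_commute power2_eq_square algebra_simps)
  have m: "gE d \<sigma> (norm z) = exp (- (z \<bullet> z) / (4 * \<sigma>)) / sqrt (4 * pi * \<sigma>) ^ d"
    by (simp add: gE_def power2_norm_eq_inner)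
  show ?thesis unfolding m unfolding gE_def n
    using s by (auto intro!: derivative_eq_intros simp: field_simps)
qed

text \<open>Three successive applications of \<open>fourier_derivative\<close>, starting from
  \<open>gauss_fourier\<close>. The facts \<open>i0\<close>, \<open>i1\<close>, \<open>i2\<close>
  and \<open>j0\<close>, \<open>j1\<close>, \<open>j2\<close> supply the moment integrability that
  each application demands.\<close>

lemma gauss_fourier_moments:
  fixes z a b c :: "'a::euclidean_space"
  assumes s: "\<sigma> > 0"
  defines "e \<equiv> \<lambda>\<xi>::'a. complex_of_real (exp (- \<sigma> * (norm \<xi>)\<^sup>2))"
    and "G \<equiv> \<lambda>z::'a. (2 * pi) ^ DIM('a) * gE DIM('a) \<sigma> (norm z)"
  shows "(\<integral>\<xi>. cis (\<xi> \<bullet> z) * (\<i> * complex_of_real (\<xi> \<bullet> a) * e \<xi>) \<partial>lborel)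
      = complex_of_real (- (z \<bullet> a) / (2 * \<sigma>) * G z)"
    and "(\<integral>\<xi>. cis (\<xi> \<bullet> z) * (\<i> * complex_of_real (\<xi> \<bullet> c) * (\<i> * complex_of_real (\<xi> \<bullet> b) * (\<i> * complex_of_real (\<xi> \<bullet> a) * e \<xi>))) \<partial>lborel)
      = complex_of_real ((((a \<bullet> b) * (z \<bullet> c) + (a \<bullet> c) * (z \<bullet> b) + (b \<bullet> c) * (z \<bullet> a)) / (4 * \<sigma>\<^sup>2) - (z \<bullet> a) * (z \<bullet> b) * (z \<bullet> c) / (8 * \<sigma> ^ 3)) * G z)"
proof -
  let ?m = "\<lambda>a \<xi>. \<i> * complex_of_real (\<xi> \<bullet> a)"
  have dG: "((\<lambda>s. G (z + s *\<^sub>R c)) has_real_derivative - (z \<bullet> c) / (2 * \<sigma>) * G z) (at 0)" for z c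
    unfolding G_def using DERIV_cmult[OF gE_directional_derivative[OF s, of "DIM('a)" z c], of "(2 * pi) ^ DIM('a)"]
    by (simp add: mult_ac)
  have ne: "norm (e \<xi>) = exp (- \<sigma> * (norm \<xi>)\<^sup>2)" for \<xi> by (simp add: e_def)
  have [measurable]: "e \<in> borel_measurable borel" unfolding e_def by measurable
  have M: "integrable lborel (\<lambda>\<xi>::'a. C * (norm \<xi> ^ k * exp (- \<sigma> * (norm \<xi>)\<^sup>2)))" for C k
    by (intro integrable_mult_right gauss_moment_integrable s)
  have bd1: "norm (?m a \<xi> * e \<xi>) \<le> norm a * (norm \<xi> ^ 1 * exp (- \<sigma> * (norm \<xi>)\<^sup>2))" for a \<xi>
    using Cauchy_Schwarz_ineq2[of \<xi> a] by (simp add: norm_mult ne mult_ac mult_right_mono del: mult_minus_left)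
  have bd2: "norm (?m b \<xi> * (?m a \<xi> * e \<xi>)) \<le> norm b * norm a * (norm \<xi> ^ 2 * exp (- \<sigma> * (norm \<xi>)\<^sup>2))" for a b \<xi>
  proof -
    have "norm (?m b \<xi> * (?m a \<xi> * e \<xi>)) = \<bar>\<xi> \<bullet> b\<bar> * norm (?m a \<xi> * e \<xi>)" by (simp add: norm_mult)
    also have "\<dots> \<le> (norm \<xi> * norm b) * (norm a * (norm \<xi> ^ 1 * exp (- \<sigma> * (norm \<xi>)\<^sup>2)))"
      by (intro mult_mono Cauchy_Schwarz_ineq2 bd1) auto
    finally show ?thesis by (simp add: power2_eq_square mult_ac)
  qed
  have i0: "integrable lborel e"
    by (rule Bochner_Integration.integrable_bound[OF M[of 1 0]]) (auto simp: ne)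
  have j0: "integrable lborel (\<lambda>\<xi>. norm \<xi> * norm (e \<xi>))"
    using M[of 1 1] by (simp add: ne)
  have i1: "integrable lborel (\<lambda>\<xi>. ?m a \<xi> * e \<xi>)" for a
    by (rule Bochner_Integration.integrable_bound[OF M[of "norm a" 1]]) (use bd1 in \<open>auto simp del: norm_mult intro: order_trans[OF _ abs_ge_self]\<close>)
  have j1: "integrable lborel (\<lambda>\<xi>. norm \<xi> * norm (?m a \<xi> * e \<xi>))" for a
  proof (rule Bochner_Integration.integrable_bound[OF M[of "norm a" 2]])
    show "AE \<xi> in lborel. norm (norm \<xi> * norm (?m a \<xi> * e \<xi>)) \<le> norm (norm a * (norm \<xi> ^ 2 * exp (- \<sigma> * (norm \<xi>)\<^sup>2)))"
    proof (rule AE_I2)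
      fix \<xi>
      have "norm \<xi> * norm (?m a \<xi> * e \<xi>) \<le> norm \<xi> * (norm a * (norm \<xi> ^ 1 * exp (- \<sigma> * (norm \<xi>)\<^sup>2)))"
        by (intro mult_left_mono bd1) auto
      then show "norm (norm \<xi> * norm (?m a \<xi> * e \<xi>)) \<le> norm (norm a * (norm \<xi> ^ 2 * exp (- \<sigma> * (norm \<xi>)\<^sup>2)))"
        by (simp add: power2_eq_square mult_ac)
    qed
  qed measurable
  have i2: "integrable lborel (\<lambda>\<xi>. ?m b \<xi> * (?m a \<xi> * e \<xi>))" for a b
    by (rule Bochner_Integration.integrable_bound[OF M[of "norm b * norm a" 2]]) (use bd2 in \<open>auto simp del: norm_mult intro: order_trans[OF _ abs_ge_self]\<close>)
  have j2: "integrable lborel (\<lambda>\<xi>. norm \<xi> * norm (?m b \<xi> * (?m a \<xi> * e \<xi>)))" for a b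
  proof (rule Bochner_Integration.integrable_bound[OF M[of "norm b * norm a" 3]])
    show "AE \<xi> in lborel. norm (norm \<xi> * norm (?m b \<xi> * (?m a \<xi> * e \<xi>))) \<le> norm (norm b * norm a * (norm \<xi> ^ 3 * exp (- \<sigma> * (norm \<xi>)\<^sup>2)))"
    proof (rule AE_I2)
      fix \<xi>
      have "norm \<xi> * norm (?m b \<xi> * (?m a \<xi> * e \<xi>)) \<le> norm \<xi> * (norm b * norm a * (norm \<xi> ^ 2 * exp (- \<sigma> * (norm \<xi>)\<^sup>2)))"
        by (intro mult_left_mono bd2) auto
      then show "norm (norm \<xi> * norm (?m b \<xi> * (?m a \<xi> * e \<xi>))) \<le> norm (norm b * norm a * (norm \<xi> ^ 3 * exp (- \<sigma> * (norm \<xi>)\<^sup>2)))"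
        by (simp add: power2_eq_square power3_eq_cube mult_ac)
    qed
  qed measurable
  have e0: "(\<integral>\<xi>. cis (\<xi> \<bullet> z) * e \<xi> \<partial>lborel) = complex_of_real (G z)" for z
    unfolding e_def G_def by (rule gauss_fourier[OF s])
  have e1: "(\<integral>\<xi>. cis (\<xi> \<bullet> z) * (?m a \<xi> * e \<xi>) \<partial>lborel) = complex_of_real (- (z \<bullet> a) / (2 * \<sigma>) * G z)" for z a
    by (rule fourier_derivative[OF i0 j0 e0 dG])
  then show "(\<integral>\<xi>. cis (\<xi> \<bullet> z) * (?m a \<xi> * e \<xi>) \<partial>lborel) = complex_of_real (- (z \<bullet> a) / (2 * \<sigma>) * G z)" .
  have e2: "(\<integral>\<xi>. cis (\<xi> \<bullet> z) * (?m b \<xi> * (?m a \<xi> * e \<xi>)) \<partial>lborel)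
      = complex_of_real ((- (a \<bullet> b) / (2 * \<sigma>) + (z \<bullet> a) * (z \<bullet> b) / (4 * \<sigma>\<^sup>2)) * G z)" for z
  proof (rule fourier_derivative[OF i1 j1 e1])
    show "((\<lambda>s. - ((z + s *\<^sub>R b) \<bullet> a) / (2 * \<sigma>) * G (z + s *\<^sub>R b)) has_real_derivative
         (- (a \<bullet> b) / (2 * \<sigma>) + (z \<bullet> a) * (z \<bullet> b) / (4 * \<sigma>\<^sup>2)) * G z) (at 0)"
    proof -
      have "((\<lambda>s. - ((z + s *\<^sub>R b) \<bullet> a) / (2 * \<sigma>)) has_real_derivative - (b \<bullet> a) / (2 * \<sigma>)) (at 0)"
        unfolding inner_add_left inner_scaleR_left using s by (auto intro!: derivative_eq_intros)
      from DERIV_mult[OF this dG[of z b]] show ?thesis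
        by (rule DERIV_cong) (use s in \<open>simp add: field_simps power2_eq_square inner_commute\<close>)
    qed
  qed
  show "(\<integral>\<xi>. cis (\<xi> \<bullet> z) * (?m c \<xi> * (?m b \<xi> * (?m a \<xi> * e \<xi>))) \<partial>lborel)
      = complex_of_real ((((a \<bullet> b) * (z \<bullet> c) + (a \<bullet> c) * (z \<bullet> b) + (b \<bullet> c) * (z \<bullet> a)) / (4 * \<sigma>\<^sup>2) - (z \<bullet> a) * (z \<bullet> b) * (z \<bullet> c) / (8 * \<sigma> ^ 3)) * G z)"
  proof (rule fourier_derivative[OF i2 j2 e2])
    show "((\<lambda>s. (- (a \<bullet> b) / (2 * \<sigma>) + ((z + s *\<^sub>R c) \<bullet> a) * ((z + s *\<^sub>R c) \<bullet> b) / (4 * \<sigma>\<^sup>2)) * G (z + s *\<^sub>R c)) has_real_derivative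
         (((a \<bullet> b) * (z \<bullet> c) + (a \<bullet> c) * (z \<bullet> b) + (b \<bullet> c) * (z \<bullet> a)) / (4 * \<sigma>\<^sup>2) - (z \<bullet> a) * (z \<bullet> b) * (z \<bullet> c) / (8 * \<sigma> ^ 3)) * G z) (at 0)"
    proof -
      have "((\<lambda>s. - (a \<bullet> b) / (2 * \<sigma>) + ((z + s *\<^sub>R c) \<bullet> a) * ((z + s *\<^sub>R c) \<bullet> b) / (4 * \<sigma>\<^sup>2)) has_real_derivative
          ((c \<bullet> a) * (z \<bullet> b) + (z \<bullet> a) * (c \<bullet> b)) / (4 * \<sigma>\<^sup>2)) (at 0)"
        unfolding inner_add_left inner_scaleR_left using s
        by (auto intro!: derivative_eq_intros simp: field_simps eval_nat_numeral)
      from DERIV_mult[OF this dG[of z c]] show ?thesis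
        by (rule DERIV_cong) (use s in \<open>simp add: field_simps power2_eq_square power3_eq_cube inner_commute\<close>)
    qed
  qed
qed

text \<open>
  Writing \<open>|\<xi>|\<^sup>-\<^sup>2 exp (- \<tau> |\<xi>|\<^sup>2)\<close> as the integral of \<open>exp (- \<sigma> |\<xi>|\<^sup>2)\<close> over \<open>\<sigma> > \<tau>\<close> reduces the inverse transform
  of the symbol below to third derivatives of Gaussians, integrated in \<open>\<sigma>\<close>; these produce \<open>gG d 0\<close> and \<open>gG d 1\<close>.
\<close>

definition oseen :: "real \<Rightarrow> 'a::euclidean_space \<Rightarrow> 'a \<Rightarrow> 'a" where
  "oseen \<tau> z w = (gG DIM('a) 0 \<tau> (norm z) / 4) *\<^sub>R ((2 * (z \<bullet> w)) *\<^sub>R w + (w \<bullet> w) *\<^sub>R z)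
     - (gG DIM('a) 1 \<tau> (norm z) / 8 * (z \<bullet> w)\<^sup>2) *\<^sub>R z
     - (gE DIM('a) \<tau> (norm z) / \<tau> / 2 * (z \<bullet> w)) *\<^sub>R w"

text \<open>Divergence, Leray projection and heat flow at frequency \<xi>, applied to the constant
  tensor with entries (w \<bullet> h)(w \<bullet> k): apart from the Gaussian it is the vector i
  (\<xi> \<bullet> w) (w - \<xi> (\<xi> \<bullet> w)/|\<xi>|^2) in direction j. At \<xi> = 0
  division by zero makes the value 0.\<close>

definition oseen_symbol :: "real \<Rightarrow> 'a::euclidean_space \<Rightarrow> 'a \<Rightarrow> 'a \<Rightarrow> complex" where
  "oseen_symbol \<tau> \<xi> w j = complex_of_real (exp (- \<tau> * (norm \<xi>)\<^sup>2)) *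
     (\<i> * complex_of_real ((\<xi> \<bullet> w) * (w \<bullet> j)) - \<i> * complex_of_real ((\<xi> \<bullet> j) * (\<xi> \<bullet> w)\<^sup>2 / (norm \<xi>)\<^sup>2))"

section \<open>The inverse transform of the Oseen symbol\<close>

lemma exp_tail_integral:
  fixes \<tau> q :: real
  assumes q: "q > 0"
  shows "set_integrable lborel {\<tau><..} (\<lambda>\<sigma>. exp (- \<sigma> * q))"
    and "(LINT \<sigma>:{\<tau><..}|lborel. exp (- \<sigma> * q)) = exp (- \<tau> * q) / q"
proof -
  have e: "einterval (ereal \<tau>) \<infinity> = {\<tau><..}" by (auto simp: einterval_def)
  let ?F = "\<lambda>\<sigma>. - exp (- \<sigma> * q) / q"
  let ?f = "\<lambda>\<sigma>. exp (- \<sigma> * q)"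
  have D: "(?F has_real_derivative ?f x) (at x)" for x
    using q by (auto intro!: derivative_eq_intros)
  have A: "((?F \<circ> real_of_ereal) \<longlongrightarrow> - exp (- \<tau> * q) / q) (at_right (ereal \<tau>))"
    unfolding ereal_tendsto_simps1(2) comp_def by (intro tendsto_intros) (use q in auto)
  have B: "((?F \<circ> real_of_ereal) \<longlongrightarrow> 0) (at_left \<infinity>)"
    unfolding ereal_tendsto_simps1
  proof -
    have "filterlim (\<lambda>\<sigma>. \<sigma> * q) at_top at_top"
      by (rule filterlim_at_top_mult_tendsto_pos[OF tendsto_const q filterlim_ident])
    then have "((\<lambda>\<sigma>. exp (- (\<sigma> * q))) \<longlongrightarrow> 0) at_top"
      by (intro filterlim_compose[OF exp_at_bot] filterlim_compose[OF filterlim_uminus_at_bot_at_top])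
    then have "((\<lambda>\<sigma>. - exp (- (\<sigma> * q)) / q) \<longlongrightarrow> - 0 / q) at_top"
      using q by (intro tendsto_intros) auto
    then show "(?F \<longlongrightarrow> 0) at_top" by simp
  qed
  note F = interval_integral_FTC_nonneg[where F="?F" and f="?f" and a="ereal \<tau>" and b=\<infinity>, OF _ _ _ _ A B]
  show "set_integrable lborel {\<tau><..} ?f"
    using F(1) D unfolding e by (auto simp: AE_I2)
  have "(LBINT x=ereal \<tau>..\<infinity>. ?f x) = 0 - (- exp (- \<tau> * q) / q)"
    by (rule F(2)) (use D in auto)
  then show "(LINT \<sigma>:{\<tau><..}|lborel. ?f \<sigma>) = exp (- \<tau> * q) / q"
    by (simp add: interval_lebesgue_integral_def e)
qed

lemma (in pair_sigma_finite) integrable_mult_fst_snd: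
  fixes a :: "'a \<Rightarrow> real" and b :: "'b \<Rightarrow> real"
  assumes a: "integrable M1 a" and b: "integrable M2 b"
  shows "integrable (M1 \<Otimes>\<^sub>M M2) (\<lambda>p. a (fst p) * b (snd p))"
proof (rule Fubini_integrable)
  have [measurable]: "a \<in> borel_measurable M1" "b \<in> borel_measurable M2" using a b by auto
  show "(\<lambda>p. a (fst p) * b (snd p)) \<in> borel_measurable (M1 \<Otimes>\<^sub>M M2)" by measurable
  have "integrable M1 (\<lambda>x. \<bar>a x\<bar> * (\<integral>y. \<bar>b y\<bar> \<partial>M2))" using a by auto
  then show "integrable M1 (\<lambda>x. \<integral>y. norm (a (fst (x, y)) * b (snd (x, y))) \<partial>M2)"
    by (simp add: abs_mult)
  show "AE x in M1. integrable M2 (\<lambda>y. a (fst (x, y)) * b (snd (x, y)))"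
    using b by simp
qed

lemma oseen_symbol_measurable [measurable]:
  fixes f w :: "'c \<Rightarrow> 'a::euclidean_space"
  assumes [measurable]: "f \<in> borel_measurable M" "w \<in> borel_measurable M"
  shows "(\<lambda>p. oseen_symbol \<tau> (f p) (w p) j) \<in> borel_measurable M"
  unfolding oseen_symbol_def by measurable

text \<open>The quotient by |\<xi>|^2 is harmless since its numerator has three factors \<xi>. The
  bound separates into a Gaussian moment in \<xi> and |w|^2, the form that Fubini in (\<xi>, y)
  needs.\<close>

lemma norm_oseen_symbol_le:
  fixes \<xi> w j :: "'a::euclidean_space"
  shows "norm (oseen_symbol \<tau> \<xi> w j) \<le> 2 * norm j * (norm \<xi> ^ 1 * exp (- \<tau> * (norm \<xi>)\<^sup>2)) * (norm w)\<^sup>2"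
proof -
  have a: "\<bar>(\<xi> \<bullet> w) * (w \<bullet> j)\<bar> \<le> (norm \<xi> * norm w) * (norm w * norm j)"
    unfolding abs_mult by (intro mult_mono Cauchy_Schwarz_ineq2) auto
  have b: "\<bar>(\<xi> \<bullet> j) * (\<xi> \<bullet> w)\<^sup>2 / (norm \<xi>)\<^sup>2\<bar> \<le> norm \<xi> * norm j * (norm w)\<^sup>2"
  proof (cases "\<xi> = 0")
    case False
    have "\<bar>(\<xi> \<bullet> j) * (\<xi> \<bullet> w)\<^sup>2\<bar> \<le> (norm \<xi> * norm j) * (norm \<xi> * norm w)\<^sup>2"
      unfolding abs_mult power_abs by (intro mult_mono power_mono Cauchy_Schwarz_ineq2) auto
    also have "\<dots> = (norm \<xi> * norm j * (norm w)\<^sup>2) * (norm \<xi>)\<^sup>2" by (simp add: power_mult_distrib)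
    finally show ?thesis using False by (simp add: abs_divide divide_le_eq)
  qed simp
  have "norm (oseen_symbol \<tau> \<xi> w j) = exp (- \<tau> * (norm \<xi>)\<^sup>2) *
     norm (\<i> * complex_of_real ((\<xi> \<bullet> w) * (w \<bullet> j)) - \<i> * complex_of_real ((\<xi> \<bullet> j) * (\<xi> \<bullet> w)\<^sup>2 / (norm \<xi>)\<^sup>2))"
    unfolding oseen_symbol_def norm_mult by simp
  also have "\<dots> \<le> exp (- \<tau> * (norm \<xi>)\<^sup>2) * ((norm \<xi> * norm w) * (norm w * norm j) + norm \<xi> * norm j * (norm w)\<^sup>2)"
  proof (intro mult_left_mono order_trans[OF norm_triangle_ineq4] add_mono)
    show "norm (\<i> * complex_of_real ((\<xi> \<bullet> w) * (w \<bullet> j))) \<le> (norm \<xi> * norm w) * (norm w * norm j)"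
      using a by (simp only: norm_mult norm_ii norm_of_real mult_1_left)
    show "norm (\<i> * complex_of_real ((\<xi> \<bullet> j) * (\<xi> \<bullet> w)\<^sup>2 / (norm \<xi>)\<^sup>2)) \<le> norm \<xi> * norm j * (norm w)\<^sup>2"
      using b by (simp only: norm_mult norm_ii norm_of_real mult_1_left)
  qed simp
  also have "\<dots> = 2 * norm j * (norm \<xi> ^ 1 * exp (- \<tau> * (norm \<xi>)\<^sup>2)) * (norm w)\<^sup>2"
    by (simp add: power2_eq_square algebra_simps)
  finally show ?thesis .
qed

lemma oseen_symbol_integrable:
  fixes w j :: "'a::euclidean_space"
  assumes "\<tau> > 0"
  shows "integrable lborel (\<lambda>\<xi>. cis (\<xi> \<bullet> z) * oseen_symbol \<tau> \<xi> w j)"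
proof (rule Bochner_Integration.integrable_bound)
  show "integrable lborel (\<lambda>\<xi>::'a. 2 * norm j * (norm \<xi> ^ 1 * exp (- \<tau> * (norm \<xi>)\<^sup>2)) * (norm w)\<^sup>2)"
    by (intro integrable_mult_left integrable_mult_right gauss_moment_integrable assms)
  show "AE \<xi> in lborel. norm (cis (\<xi> \<bullet> z) * oseen_symbol \<tau> \<xi> w j) \<le> norm (2 * norm j * (norm \<xi> ^ 1 * exp (- \<tau> * (norm \<xi>)\<^sup>2)) * (norm w)\<^sup>2)"
    using norm_oseen_symbol_le[of \<tau> _ w j] by (intro AE_I2) (simp add: norm_mult)
qed measurable

text \<open>Fubini in (\<xi>, \<sigma>). Integrating \<sigma> first returns the symbol and proves
  absolute integrability, since three factors \<xi> against |\<xi>|^(-2) leave a first Gaussian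
  moment; integrating \<xi> first produces third moments of Gaussians and hence the tails
  \<open>gG\<close>.\<close>

lemma oseen_symbol_tail:
  fixes z w j :: "'a::euclidean_space"
  assumes t: "\<tau> > 0" and z: "z \<noteq> 0"
  shows "(\<integral>\<xi>. cis (\<xi> \<bullet> z) * (- \<i> * complex_of_real ((\<xi> \<bullet> j) * (\<xi> \<bullet> w)\<^sup>2 / (norm \<xi>)\<^sup>2 * exp (- \<tau> * (norm \<xi>)\<^sup>2))) \<partial>lborel)
     = complex_of_real ((2 * pi) ^ DIM('a) * ((2 * (z \<bullet> w) * (w \<bullet> j) + (w \<bullet> w) * (z \<bullet> j)) / 4 * gG DIM('a) 0 \<tau> (norm z)
          - (z \<bullet> w)\<^sup>2 * (z \<bullet> j) / 8 * gG DIM('a) 1 \<tau> (norm z)))"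
proof -
  let ?d = "DIM('a)"
  let ?m = "\<lambda>a \<xi>. \<i> * complex_of_real (\<xi> \<bullet> a)"
  let ?e = "\<lambda>\<sigma> \<xi>::'a. complex_of_real (exp (- \<sigma> * (norm \<xi>)\<^sup>2))"
  define h where "h = (\<lambda>\<xi> \<sigma>. indicator {\<tau><..} \<sigma> *\<^sub>R (cis (\<xi> \<bullet> z) * (?m j \<xi> * (?m w \<xi> * (?m w \<xi> * ?e \<sigma> \<xi>)))))"
  have nh: "norm (h \<xi> \<sigma>) = \<bar>\<xi> \<bullet> j\<bar> * (\<xi> \<bullet> w)\<^sup>2 * (indicator {\<tau><..} \<sigma> *\<^sub>R exp (- \<sigma> * (norm \<xi>)\<^sup>2))" for \<xi> \<sigma>
    unfolding h_def norm_scaleR norm_mult by (simp add: indicator_def power2_eq_square)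
  have h2: "h \<xi> \<sigma> = cis (\<xi> \<bullet> z) * (- \<i> * complex_of_real ((\<xi> \<bullet> j) * (\<xi> \<bullet> w)\<^sup>2)) * complex_of_real (indicator {\<tau><..} \<sigma> *\<^sub>R exp (- \<sigma> * (norm \<xi>)\<^sup>2))" for \<xi> \<sigma>
  proof -
    have "?m j \<xi> * (?m w \<xi> * (?m w \<xi> * ?e \<sigma> \<xi>)) = - \<i> * complex_of_real ((\<xi> \<bullet> j) * (\<xi> \<bullet> w)\<^sup>2) * ?e \<sigma> \<xi>"
      by (simp add: power2_eq_square algebra_simps)
    then show ?thesis unfolding h_def by (simp add: scaleR_conv_of_real power2_eq_square mult_ac)
  qed
  have tail: "integrable lborel (\<lambda>\<sigma>. indicator {\<tau><..} \<sigma> *\<^sub>R exp (- \<sigma> * (norm \<xi>)\<^sup>2))"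
      "(\<integral>\<sigma>. indicator {\<tau><..} \<sigma> *\<^sub>R exp (- \<sigma> * (norm \<xi>)\<^sup>2) \<partial>lborel) = exp (- \<tau> * (norm \<xi>)\<^sup>2) / (norm \<xi>)\<^sup>2"
    if "\<xi> \<noteq> 0" for \<xi> :: 'a
    using exp_tail_integral[of "(norm \<xi>)\<^sup>2" \<tau>] that by (auto simp: set_integrable_def set_lebesgue_integral_def)
  have hm: "case_prod h \<in> borel_measurable (lborel \<Otimes>\<^sub>M lborel)"
  proof -
    have "(\<lambda>p. indicator {\<tau><..} (snd p) *\<^sub>R (cis (fst p \<bullet> z) * (?m j (fst p) * (?m w (fst p) * (?m w (fst p) * ?e (snd p) (fst p)))))) \<in> borel_measurable (lborel \<Otimes>\<^sub>M lborel)"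
      by measurable
    then show ?thesis by (simp add: h_def case_prod_beta')
  qed
  \<comment> \<open>At \<xi> = 0 the exponential is constant in \<sigma> and not integrable over the
    tail, but the polynomial factors vanish there.\<close>
  have hin: "integrable lborel (\<lambda>\<sigma>. h \<xi> \<sigma>)" for \<xi>
  proof (cases "\<xi> = 0")
    case True
    then have "h \<xi> = (\<lambda>_. 0)" by (auto simp: h_def)
    then show ?thesis by simp
  next
    case False
    show ?thesis unfolding h2
      by (intro integrable_mult_right integrable_of_real tail False)
  qed
  have hint: "(\<integral>\<sigma>. h \<xi> \<sigma> \<partial>lborel) = cis (\<xi> \<bullet> z) * (- \<i> * complex_of_real ((\<xi> \<bullet> j) * (\<xi> \<bullet> w)\<^sup>2 / (norm \<xi>)\<^sup>2 * exp (- \<tau> * (norm \<xi>)\<^sup>2)))" for \<xi>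
  proof (cases "\<xi> = 0")
    case True
    then have "h \<xi> = (\<lambda>_. 0)" by (auto simp: h_def)
    then show ?thesis using True by simp
  next
    case False
    have "(\<integral>\<sigma>. h \<xi> \<sigma> \<partial>lborel) = cis (\<xi> \<bullet> z) * (- \<i> * complex_of_real ((\<xi> \<bullet> j) * (\<xi> \<bullet> w)\<^sup>2)) *
       complex_of_real (\<integral>\<sigma>. indicator {\<tau><..} \<sigma> *\<^sub>R exp (- \<sigma> * (norm \<xi>)\<^sup>2) \<partial>lborel)"
      unfolding h2 by (simp only: integral_mult_right_zero integral_complex_of_real)
    then show ?thesis unfolding tail(2)[OF False] by (simp add: mult_ac)
  qed
  have H: "integrable (lborel \<Otimes>\<^sub>M lborel) (case_prod h)"
  proof (rule lborel_pair.Fubini_integrable[OF hm])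
    show "AE \<xi> in lborel. integrable lborel (\<lambda>\<sigma>. case_prod h (\<xi>, \<sigma>))" using hin by simp
    have n: "(\<integral>\<sigma>. norm (h \<xi> \<sigma>) \<partial>lborel) = \<bar>\<xi> \<bullet> j\<bar> * (\<xi> \<bullet> w)\<^sup>2 * (exp (- \<tau> * (norm \<xi>)\<^sup>2) / (norm \<xi>)\<^sup>2)" for \<xi>
    proof (cases "\<xi> = 0")
      case True
      then show ?thesis by (simp add: nh)
    next
      case False
      show ?thesis unfolding nh by (simp only: integral_mult_right_zero tail(2)[OF False])
    qed
    have "integrable lborel (\<lambda>\<xi>::'a. \<bar>\<xi> \<bullet> j\<bar> * (\<xi> \<bullet> w)\<^sup>2 * (exp (- \<tau> * (norm \<xi>)\<^sup>2) / (norm \<xi>)\<^sup>2))"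
    proof (rule Bochner_Integration.integrable_bound)
      show "integrable lborel (\<lambda>\<xi>::'a. (norm j * (norm w)\<^sup>2) * (norm \<xi> ^ 1 * exp (- \<tau> * (norm \<xi>)\<^sup>2)))"
        by (intro integrable_mult_right gauss_moment_integrable t)
      show "AE \<xi> in lborel. norm (\<bar>\<xi> \<bullet> j\<bar> * (\<xi> \<bullet> w)\<^sup>2 * (exp (- \<tau> * (norm \<xi>)\<^sup>2) / (norm \<xi>)\<^sup>2)) \<le> norm ((norm j * (norm w)\<^sup>2) * (norm \<xi> ^ 1 * exp (- \<tau> * (norm \<xi>)\<^sup>2)))"
      proof (rule AE_I2)
        fix \<xi> :: 'a
        show "norm (\<bar>\<xi> \<bullet> j\<bar> * (\<xi> \<bullet> w)\<^sup>2 * (exp (- \<tau> * (norm \<xi>)\<^sup>2) / (norm \<xi>)\<^sup>2)) \<le> norm ((norm j * (norm w)\<^sup>2) * (norm \<xi> ^ 1 * exp (- \<tau> * (norm \<xi>)\<^sup>2)))"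
        proof (cases "\<xi> = 0")
          case False
          have "\<bar>\<xi> \<bullet> j\<bar> * (\<xi> \<bullet> w)\<^sup>2 \<le> (norm \<xi> * norm j) * (norm \<xi> * norm w)\<^sup>2"
            unfolding power2_abs[of "\<xi> \<bullet> w", symmetric] by (intro mult_mono power_mono Cauchy_Schwarz_ineq2) auto
          then have "\<bar>\<xi> \<bullet> j\<bar> * (\<xi> \<bullet> w)\<^sup>2 * (exp (- \<tau> * (norm \<xi>)\<^sup>2) / (norm \<xi>)\<^sup>2) \<le> (norm \<xi> * norm j) * (norm \<xi> * norm w)\<^sup>2 * (exp (- \<tau> * (norm \<xi>)\<^sup>2) / (norm \<xi>)\<^sup>2)"
            by (rule mult_right_mono) simp
          also have "\<dots> = (norm j * (norm w)\<^sup>2) * (norm \<xi> ^ 1 * exp (- \<tau> * (norm \<xi>)\<^sup>2))"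
            using False by (simp add: power_mult_distrib field_simps)
          finally show ?thesis by (simp add: abs_mult)
        qed simp
      qed
    qed measurable
    then show "integrable lborel (\<lambda>\<xi>. \<integral>\<sigma>. norm (case_prod h (\<xi>, \<sigma>)) \<partial>lborel)"
      by (simp only: prod.case n)
  qed
  define P where "P = 2 * (z \<bullet> w) * (w \<bullet> j) + (w \<bullet> w) * (z \<bullet> j)"
  define Q where "Q = (z \<bullet> w)\<^sup>2 * (z \<bullet> j)"
  have inner: "(\<integral>\<xi>. h \<xi> \<sigma> \<partial>lborel) = complex_of_real ((2 * pi) ^ ?d * (P / 4 * (indicator {\<tau><..} \<sigma> *\<^sub>R (gE ?d \<sigma> (norm z) / \<sigma> ^ (0 + 2)))
       - Q / 8 * (indicator {\<tau><..} \<sigma> *\<^sub>R (gE ?d \<sigma> (norm z) / \<sigma> ^ (1 + 2)))))" for \<sigma>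
  proof (cases "\<sigma> > \<tau>")
    case True
    then have s: "\<sigma> > 0" using t by simp
    have "(\<integral>\<xi>. h \<xi> \<sigma> \<partial>lborel) = (\<integral>\<xi>. cis (\<xi> \<bullet> z) * (?m j \<xi> * (?m w \<xi> * (?m w \<xi> * ?e \<sigma> \<xi>))) \<partial>lborel)"
      using True by (simp add: h_def)
    also have "\<dots> = complex_of_real ((((w \<bullet> w) * (z \<bullet> j) + (w \<bullet> j) * (z \<bullet> w) + (w \<bullet> j) * (z \<bullet> w)) / (4 * \<sigma>\<^sup>2) - (z \<bullet> w) * (z \<bullet> w) * (z \<bullet> j) / (8 * \<sigma> ^ 3)) * ((2 * pi) ^ ?d * gE ?d \<sigma> (norm z)))"
      by (rule gauss_fourier_moments(2)[OF s])
    also have "\<dots> = complex_of_real ((2 * pi) ^ ?d * (P / 4 * (gE ?d \<sigma> (norm z) / \<sigma>\<^sup>2) - Q / 8 * (gE ?d \<sigma> (norm z) / \<sigma> ^ 3)))"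
      by (rule arg_cong[where f=complex_of_real]) (simp add: P_def Q_def power2_eq_square algebra_simps add_divide_distrib)
    finally show ?thesis using True by (simp add: numeral_2_eq_2 numeral_3_eq_3)
  qed (simp add: h_def)
  have zi: "norm z > 0" using z by simp
  note gi = gG_integrable[OF zi less_imp_le[OF t], unfolded set_integrable_def]
  have "(\<integral>\<xi>. cis (\<xi> \<bullet> z) * (- \<i> * complex_of_real ((\<xi> \<bullet> j) * (\<xi> \<bullet> w)\<^sup>2 / (norm \<xi>)\<^sup>2 * exp (- \<tau> * (norm \<xi>)\<^sup>2))) \<partial>lborel)
      = (\<integral>\<xi>. (\<integral>\<sigma>. h \<xi> \<sigma> \<partial>lborel) \<partial>lborel)"
    by (simp only: hint)
  also have "\<dots> = (\<integral>\<sigma>. (\<integral>\<xi>. h \<xi> \<sigma> \<partial>lborel) \<partial>lborel)"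
    by (rule lborel_pair.Fubini_integral[OF H, symmetric])
  also have "\<dots> = complex_of_real ((2 * pi) ^ ?d * (P / 4 * gG ?d 0 \<tau> (norm z) - Q / 8 * gG ?d 1 \<tau> (norm z)))"
  proof -
    define f where "f j = (\<lambda>\<sigma>. indicator {\<tau><..} \<sigma> *\<^sub>R (gE ?d \<sigma> (norm z) / \<sigma> ^ (j + 2)))" for j
    have f: "integrable lborel (f j)" "gG ?d j \<tau> (norm z) = (\<integral>\<sigma>. f j \<sigma> \<partial>lborel)" for j
      using gi[of ?d j] by (auto simp: f_def gG_def set_lebesgue_integral_def)
    have "(\<integral>\<sigma>. (\<integral>\<xi>. h \<xi> \<sigma> \<partial>lborel) \<partial>lborel) = (\<integral>\<sigma>. complex_of_real ((2 * pi) ^ ?d * (P / 4 * f 0 \<sigma> - Q / 8 * f 1 \<sigma>)) \<partial>lborel)"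
      unfolding inner f_def ..
    also have "\<dots> = complex_of_real ((2 * pi) ^ ?d * (P / 4 * (\<integral>\<sigma>. f 0 \<sigma> \<partial>lborel) - Q / 8 * (\<integral>\<sigma>. f 1 \<sigma> \<partial>lborel)))"
      by (simp only: integral_complex_of_real integral_mult_right_zero Bochner_Integration.integral_diff integrable_mult_right f(1))
    finally show ?thesis by (simp only: f(2))
  qed
  finally show ?thesis by (simp add: P_def Q_def)
qed

lemma oseen_symbol_fourier:
  fixes z w j :: "'a::euclidean_space"
  assumes t: "\<tau> > 0"
  shows "(\<integral>\<xi>. cis (\<xi> \<bullet> z) * oseen_symbol \<tau> \<xi> w j \<partial>lborel) = complex_of_real ((2 * pi) ^ DIM('a) * (oseen \<tau> z w \<bullet> j))"
proof (cases "z = 0")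
  case True
  let ?f = "\<lambda>\<xi>::'a. cis (\<xi> \<bullet> z) * oseen_symbol \<tau> \<xi> w j"
  have m: "?f \<in> borel_measurable borel" by measurable
  have "?f (0 + (- 1) *\<^sub>R \<xi>) = - ?f \<xi>" for \<xi>
    by (simp add: True oseen_symbol_def algebra_simps)
  then have "(\<integral>\<xi>. ?f \<xi> \<partial>lborel) = - (\<integral>\<xi>. ?f \<xi> \<partial>lborel)"
    using integral_affine[of "- 1" ?f 0, OF _ m] by simp
  then have "(\<integral>\<xi>. ?f \<xi> \<partial>lborel) = 0" by simp
  then show ?thesis by (simp add: True oseen_def)
next
  case False
  let ?A = "\<lambda>\<xi>. complex_of_real (w \<bullet> j) * (cis (\<xi> \<bullet> z) * (\<i> * complex_of_real (\<xi> \<bullet> w) * complex_of_real (exp (- \<tau> * (norm \<xi>)\<^sup>2))))"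
  let ?B = "\<lambda>\<xi>. cis (\<xi> \<bullet> z) * (- \<i> * complex_of_real ((\<xi> \<bullet> j) * (\<xi> \<bullet> w)\<^sup>2 / (norm \<xi>)\<^sup>2 * exp (- \<tau> * (norm \<xi>)\<^sup>2)))"
  have s: "cis (\<xi> \<bullet> z) * oseen_symbol \<tau> \<xi> w j = ?A \<xi> + ?B \<xi>" for \<xi>
    by (simp add: oseen_symbol_def algebra_simps)
  have iA: "integrable lborel ?A"
  proof (rule Bochner_Integration.integrable_bound)
    show "integrable lborel (\<lambda>\<xi>::'a. norm w * \<bar>w \<bullet> j\<bar> * (norm \<xi> ^ 1 * exp (- \<tau> * (norm \<xi>)\<^sup>2)))"
      by (intro integrable_mult_right gauss_moment_integrable t)
    show "AE \<xi> in lborel. norm (?A \<xi>) \<le> norm (norm w * \<bar>w \<bullet> j\<bar> * (norm \<xi> ^ 1 * exp (- \<tau> * (norm \<xi>)\<^sup>2)))"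
    proof (rule AE_I2)
      fix \<xi> :: 'a
      have "norm (?A \<xi>) = \<bar>w \<bullet> j\<bar> * \<bar>\<xi> \<bullet> w\<bar> * exp (- \<tau> * (norm \<xi>)\<^sup>2)" by (simp add: norm_mult)
      also have "\<dots> \<le> \<bar>w \<bullet> j\<bar> * (norm \<xi> * norm w) * exp (- \<tau> * (norm \<xi>)\<^sup>2)"
        by (intro mult_right_mono mult_left_mono Cauchy_Schwarz_ineq2) auto
      finally show "norm (?A \<xi>) \<le> norm (norm w * \<bar>w \<bullet> j\<bar> * (norm \<xi> ^ 1 * exp (- \<tau> * (norm \<xi>)\<^sup>2)))"
        by (simp add: mult_ac abs_mult)
    qed
  qed measurable
  have iB: "integrable lborel ?B"
    using Bochner_Integration.integrable_diff[OF oseen_symbol_integrable[OF t, of z w j] iA] unfolding s by simp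
  have "(\<integral>\<xi>. cis (\<xi> \<bullet> z) * oseen_symbol \<tau> \<xi> w j \<partial>lborel) = (\<integral>\<xi>. ?A \<xi> \<partial>lborel) + (\<integral>\<xi>. ?B \<xi> \<partial>lborel)"
    unfolding s by (rule Bochner_Integration.integral_add[OF iA iB])
  also have "(\<integral>\<xi>. ?A \<xi> \<partial>lborel) = complex_of_real (w \<bullet> j) * complex_of_real (- (z \<bullet> w) / (2 * \<tau>) * ((2 * pi) ^ DIM('a) * gE DIM('a) \<tau> (norm z)))"
    by (simp only: integral_mult_right_zero gauss_fourier_moments(1)[OF t])
  finally have I: "(\<integral>\<xi>. cis (\<xi> \<bullet> z) * oseen_symbol \<tau> \<xi> w j \<partial>lborel) = complex_of_real ((w \<bullet> j) * (- (z \<bullet> w) / (2 * \<tau>) * ((2 * pi) ^ DIM('a) * gE DIM('a) \<tau> (norm z)))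
      + (2 * pi) ^ DIM('a) * ((2 * (z \<bullet> w) * (w \<bullet> j) + (w \<bullet> w) * (z \<bullet> j)) / 4 * gG DIM('a) 0 \<tau> (norm z)
          - (z \<bullet> w)\<^sup>2 * (z \<bullet> j) / 8 * gG DIM('a) 1 \<tau> (norm z)))"
    unfolding oseen_symbol_tail[OF t False] of_real_mult[symmetric] of_real_add[symmetric] .
  define c g0 g1 e where "c = (2 * pi) ^ DIM('a)" and "g0 = gG DIM('a) 0 \<tau> (norm z)" and "g1 = gG DIM('a) 1 \<tau> (norm z)"
    and "e = gE DIM('a) \<tau> (norm z)"
  show ?thesis
    unfolding I oseen_def inner_diff_left inner_add_left inner_scaleR_left
    unfolding c_def[symmetric] g0_def[symmetric] g1_def[symmetric] e_def[symmetric]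
    using t by (intro arg_cong[where f=complex_of_real]) (simp add: divide_simps, simp add: algebra_simps)
qed

section \<open>From Fourier multipliers to a convolution\<close>

lemma integrable_cis_mult:
  fixes f :: "'a::euclidean_space \<Rightarrow> complex"
  assumes f: "integrable lborel f"
  shows "integrable lborel (\<lambda>\<xi>. cis (\<xi> \<bullet> x) * f \<xi>)"
proof -
  have [measurable]: "f \<in> borel_measurable borel" using borel_measurable_integrable[OF f] by simp
  show ?thesis by (rule Bochner_Integration.integrable_bound[OF f]) (auto simp: norm_mult)
qed

text \<open>The multipliers act on the transform of the tensor, which is itself an integral over y.
  Exchanging the order puts the inverse transform onto the symbol of the constant tensor at each y,
  and that is the Oseen kernel at x - y. The third claim serves continuity in x.\<close>

lemma neumann_nonlinear_eq:
  fixes v :: "'a::euclidean_space \<Rightarrow> 'a"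
  assumes t: "\<tau> > 0" and v [measurable]: "v \<in> borel_measurable lebesgue"
    and v2: "integrable lebesgue (\<lambda>y. (norm (v y))\<^sup>2)"
  shows "integrable lebesgue (\<lambda>y. oseen \<tau> (x - y) (v y))"
    and "inverse_fourier (heat_hat \<tau> (leray_hat (div_hat (tensor_hat v)))) x = (LINT y|lebesgue. oseen \<tau> (x - y) (v y))"
    and "j \<in> Basis \<Longrightarrow> integrable lborel (\<lambda>\<xi>. heat_hat \<tau> (leray_hat (div_hat (tensor_hat v))) j \<xi>)"
proof -
  interpret P: pair_sigma_finite "lborel :: 'a measure" "lebesgue :: 'a measure"
    by (rule pair_sigma_finite_lborel_lebesgue)
  let ?F = "heat_hat \<tau> (leray_hat (div_hat (tensor_hat v)))"
  have idm [measurable]: "(\<lambda>y::'a. y) \<in> borel_measurable lebesgue"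
    by (rule measurable_completion) simp
  \<comment> \<open>Finite sums over \<open>Basis\<close> are moved inside the integral over y and
    collapse to inner products with \<xi>, leaving the symbol evaluated at v(y).\<close>
  have S: "?F j \<xi> = (LINT y|lebesgue. cis (- (\<xi> \<bullet> y)) * oseen_symbol \<tau> \<xi> (v y) j)" if j: "j \<in> Basis" for j \<xi>
  proof -
    let ?g = "\<lambda>h k y. cis (- (\<xi> \<bullet> y)) * complex_of_real ((v y \<bullet> h) * (v y \<bullet> k))"
    have ig: "integrable lebesgue (?g h k)" if "h \<in> Basis" "k \<in> Basis" for h k
    proof (rule Bochner_Integration.integrable_bound[OF v2])
      show "AE y in lebesgue. norm (?g h k y) \<le> norm ((norm (v y))\<^sup>2)"
      proof (rule AE_I2)
        fix y
        have "\<bar>v y \<bullet> h\<bar> * \<bar>v y \<bullet> k\<bar> \<le> norm (v y) * norm (v y)"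
          using that by (intro mult_mono Basis_le_norm) auto
        then show "norm (?g h k y) \<le> norm ((norm (v y))\<^sup>2)" by (simp add: norm_mult abs_mult power2_eq_square)
      qed
    qed measurable
    have T: "tensor_hat v h k \<xi> = (LINT y|lebesgue. ?g h k y)" for h k
      by (simp add: tensor_hat_def fourier_def)
    let ?c = "\<lambda>h. \<i> * complex_of_real (\<xi> \<bullet> h)"
    have D: "div_hat (tensor_hat v) k \<xi> = (LINT y|lebesgue. (\<Sum>h\<in>Basis. ?c h * ?g h k y))" if "k \<in> Basis" for k
      unfolding div_hat_def T using that
      by (subst Bochner_Integration.integral_sum) (auto intro!: integrable_mult_right ig simp del: of_real_mult)
    have iD: "integrable lebesgue (\<lambda>y. \<Sum>h\<in>Basis. ?c h * ?g h k y)" if "k \<in> Basis" for k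
      using that by (intro Bochner_Integration.integrable_sum integrable_mult_right ig)
    have Dv: "(\<Sum>h\<in>Basis. ?c h * ?g h k y) = cis (- (\<xi> \<bullet> y)) * (\<i> * complex_of_real ((\<xi> \<bullet> v y) * (v y \<bullet> k)))" for k y
    proof -
      have "\<xi> \<bullet> v y = (\<Sum>h\<in>Basis. (\<xi> \<bullet> h) * (v y \<bullet> h))" by (rule euclidean_inner)
      then show ?thesis by (simp add: sum_distrib_left sum_distrib_right mult_ac)
    qed
    have iD2: "integrable lebesgue (\<lambda>y. cis (- (\<xi> \<bullet> y)) * (\<i> * complex_of_real ((\<xi> \<bullet> v y) * (v y \<bullet> k))))" if "k \<in> Basis" for k
      using iD[OF that] unfolding Dv .
    have "?F j \<xi> = complex_of_real (exp (- \<tau> * (norm \<xi>)\<^sup>2)) * (div_hat (tensor_hat v) j \<xi> - complex_of_real ((\<xi> \<bullet> j) / (norm \<xi>)\<^sup>2) *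
        (\<Sum>k\<in>Basis. complex_of_real (\<xi> \<bullet> k) * div_hat (tensor_hat v) k \<xi>))"
      by (simp add: heat_hat_def leray_hat_def)
    also have "(\<Sum>k\<in>Basis. complex_of_real (\<xi> \<bullet> k) * div_hat (tensor_hat v) k \<xi>)
       = (LINT y|lebesgue. (\<Sum>k\<in>Basis. complex_of_real (\<xi> \<bullet> k) * (cis (- (\<xi> \<bullet> y)) * (\<i> * complex_of_real ((\<xi> \<bullet> v y) * (v y \<bullet> k))))))"
      by (subst Bochner_Integration.integral_sum) (auto intro!: integrable_mult_right iD2 simp: D Dv simp del: of_real_mult)
    also have "(\<lambda>y. \<Sum>k\<in>Basis. complex_of_real (\<xi> \<bullet> k) * (cis (- (\<xi> \<bullet> y)) * (\<i> * complex_of_real ((\<xi> \<bullet> v y) * (v y \<bullet> k)))))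
       = (\<lambda>y. cis (- (\<xi> \<bullet> y)) * (\<i> * complex_of_real ((\<xi> \<bullet> v y)\<^sup>2)))"
    proof
      fix y
      have "\<xi> \<bullet> v y = (\<Sum>h\<in>Basis. (\<xi> \<bullet> h) * (v y \<bullet> h))" by (rule euclidean_inner)
      then have "(\<xi> \<bullet> v y)\<^sup>2 = (\<xi> \<bullet> v y) * (\<Sum>h\<in>Basis. (\<xi> \<bullet> h) * (v y \<bullet> h))" by (simp add: power2_eq_square)
      then show "(\<Sum>k\<in>Basis. complex_of_real (\<xi> \<bullet> k) * (cis (- (\<xi> \<bullet> y)) * (\<i> * complex_of_real ((\<xi> \<bullet> v y) * (v y \<bullet> k)))))
          = cis (- (\<xi> \<bullet> y)) * (\<i> * complex_of_real ((\<xi> \<bullet> v y)\<^sup>2))"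
        by (simp add: sum_distrib_left mult_ac)
    qed
    also have "div_hat (tensor_hat v) j \<xi> = (LINT y|lebesgue. cis (- (\<xi> \<bullet> y)) * (\<i> * complex_of_real ((\<xi> \<bullet> v y) * (v y \<bullet> j))))"
      using D[OF j] unfolding Dv .
    also have "complex_of_real (exp (- \<tau> * (norm \<xi>)\<^sup>2)) *
       ((LINT y|lebesgue. cis (- (\<xi> \<bullet> y)) * (\<i> * complex_of_real ((\<xi> \<bullet> v y) * (v y \<bullet> j))))
         - complex_of_real ((\<xi> \<bullet> j) / (norm \<xi>)\<^sup>2) * (LINT y|lebesgue. cis (- (\<xi> \<bullet> y)) * (\<i> * complex_of_real ((\<xi> \<bullet> v y)\<^sup>2))))
      = (LINT y|lebesgue. complex_of_real (exp (- \<tau> * (norm \<xi>)\<^sup>2)) * (cis (- (\<xi> \<bullet> y)) * (\<i> * complex_of_real ((\<xi> \<bullet> v y) * (v y \<bullet> j)))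
         - complex_of_real ((\<xi> \<bullet> j) / (norm \<xi>)\<^sup>2) * (cis (- (\<xi> \<bullet> y)) * (\<i> * complex_of_real ((\<xi> \<bullet> v y)\<^sup>2)))))"
    proof -
      have "integrable lebesgue (\<lambda>y. cis (- (\<xi> \<bullet> y)) * (\<i> * complex_of_real ((\<xi> \<bullet> v y)\<^sup>2)))"
      proof (rule Bochner_Integration.integrable_bound)
        show "integrable lebesgue (\<lambda>y. (norm \<xi>)\<^sup>2 * (norm (v y))\<^sup>2)" using v2 by simp
        show "AE y in lebesgue. norm (cis (- (\<xi> \<bullet> y)) * (\<i> * complex_of_real ((\<xi> \<bullet> v y)\<^sup>2))) \<le> norm ((norm \<xi>)\<^sup>2 * (norm (v y))\<^sup>2)"
        proof (rule AE_I2)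
          fix y
          have "(\<xi> \<bullet> v y)\<^sup>2 \<le> (norm \<xi> * norm (v y))\<^sup>2"
            unfolding power2_abs[of "\<xi> \<bullet> v y", symmetric] by (intro power_mono Cauchy_Schwarz_ineq2) auto
          then show "norm (cis (- (\<xi> \<bullet> y)) * (\<i> * complex_of_real ((\<xi> \<bullet> v y)\<^sup>2))) \<le> norm ((norm \<xi>)\<^sup>2 * (norm (v y))\<^sup>2)"
            unfolding norm_mult norm_of_real by (simp add: power_mult_distrib)
        qed
      qed measurable
      then show ?thesis
        using iD2[OF j]
        by (simp only: integral_mult_right_zero Bochner_Integration.integral_diff integrable_mult_right)
    qed
    also have "\<dots> = (LINT y|lebesgue. cis (- (\<xi> \<bullet> y)) * oseen_symbol \<tau> \<xi> (v y) j)"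
      by (intro Bochner_Integration.integral_cong refl) (simp add: oseen_symbol_def algebra_simps)
    finally show ?thesis .
  qed
  define G where "G j = (\<lambda>\<xi> y. cis (\<xi> \<bullet> x) * (cis (- (\<xi> \<bullet> y)) * oseen_symbol \<tau> \<xi> (v y) j))" for j
  \<comment> \<open>The majorant is a product of a Gaussian moment in \<xi> and |v(y)|^2, so square
    integrability of v gives the absolute convergence behind the exchange.\<close>
  have iG: "integrable (lborel \<Otimes>\<^sub>M lebesgue) (case_prod (G j))" for j
  proof (rule Bochner_Integration.integrable_bound)
    show "integrable (lborel \<Otimes>\<^sub>M lebesgue) (\<lambda>p::'a \<times> 'a. (2 * norm j * (norm (fst p) ^ 1 * exp (- \<tau> * (norm (fst p))\<^sup>2))) * (norm (v (snd p)))\<^sup>2)"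
      by (rule P.integrable_mult_fst_snd[OF _ v2]) (intro integrable_mult_right gauss_moment_integrable t)
    have [measurable]: "(\<lambda>p. snd p) \<in> borel_measurable (lborel \<Otimes>\<^sub>M (lebesgue :: 'a measure))"
      "(\<lambda>p. v (snd p)) \<in> borel_measurable (lborel \<Otimes>\<^sub>M (lebesgue :: 'a measure))"
      "(\<lambda>p. fst p) \<in> borel_measurable ((lborel :: 'a measure) \<Otimes>\<^sub>M (lebesgue :: 'a measure))"
      by (rule measurable_compose[OF measurable_snd idm], rule measurable_compose[OF measurable_snd v], rule measurable_compose[OF measurable_fst]) simp
    have "(\<lambda>p. cis (fst p \<bullet> x) * (cis (- (fst p \<bullet> snd p)) * oseen_symbol \<tau> (fst p) (v (snd p)) j)) \<in> borel_measurable (lborel \<Otimes>\<^sub>M (lebesgue :: 'a measure))"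
      by measurable
    then show "case_prod (G j) \<in> borel_measurable (lborel \<Otimes>\<^sub>M lebesgue)" by (simp add: G_def case_prod_beta')
    show "AE p in lborel \<Otimes>\<^sub>M lebesgue. norm (case_prod (G j) p) \<le> norm ((2 * norm j * (norm (fst p) ^ 1 * exp (- \<tau> * (norm (fst p))\<^sup>2))) * (norm (v (snd p)))\<^sup>2)"
    proof (rule AE_I2)
      fix p :: "'a \<times> 'a"
      have "norm (case_prod (G j) p) = norm (oseen_symbol \<tau> (fst p) (v (snd p)) j)"
        by (simp add: G_def case_prod_beta' norm_mult)
      also have "\<dots> \<le> (2 * norm j * (norm (fst p) ^ 1 * exp (- \<tau> * (norm (fst p))\<^sup>2))) * (norm (v (snd p)))\<^sup>2"
        by (rule norm_oseen_symbol_le)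
      finally show "norm (case_prod (G j) p) \<le> norm ((2 * norm j * (norm (fst p) ^ 1 * exp (- \<tau> * (norm (fst p))\<^sup>2))) * (norm (v (snd p)))\<^sup>2)"
        by (simp add: abs_mult)
    qed
  qed
  show "integrable lborel (\<lambda>\<xi>. ?F j \<xi>)" if j: "j \<in> Basis"
  proof -
    have I: "integrable lborel (\<lambda>\<xi>. cis (\<xi> \<bullet> x) * ?F j \<xi>)"
      using P.integrable_fst[OF iG[of j]] by (simp add: S[OF j] G_def)
    \<comment> \<open>A phase of modulus one does not affect integrability; the opposite phase
      removes the one that was introduced with \<open>G\<close>.\<close>
    have "integrable lborel (\<lambda>\<xi>. cis (- (\<xi> \<bullet> x)) * (cis (\<xi> \<bullet> x) * ?F j \<xi>))"
      using integrable_cis_mult[OF I, of "- x"] by simp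
    moreover have "cis (- (\<xi> \<bullet> x)) * (cis (\<xi> \<bullet> x) * ?F j \<xi>) = ?F j \<xi>" for \<xi>
      by (simp add: cis_mult flip: mult.assoc)
    ultimately show ?thesis by simp
  qed
  have Gi: "(\<integral>\<xi>. G j \<xi> y \<partial>lborel) = complex_of_real ((2 * pi) ^ DIM('a) * (oseen \<tau> (x - y) (v y) \<bullet> j))" for j y
  proof -
    have "G j \<xi> y = cis (\<xi> \<bullet> (x - y)) * oseen_symbol \<tau> \<xi> (v y) j" for \<xi>
      by (simp add: G_def inner_diff_right cis_mult flip: mult.assoc)
    then show ?thesis using oseen_symbol_fourier[OF t, of "x - y" "v y" j] by simp
  qed
  have pi0: "(2 * pi) ^ DIM('a) > 0" by simp
  have icomp: "integrable lebesgue (\<lambda>y. oseen \<tau> (x - y) (v y) \<bullet> j)" for j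
  proof -
    have "integrable lebesgue (\<lambda>y. complex_of_real ((2 * pi) ^ DIM('a) * (oseen \<tau> (x - y) (v y) \<bullet> j)))"
      using P.integrable_snd[OF iG[of j]] unfolding Gi .
    then have "integrable lebesgue (\<lambda>y. (2 * pi) ^ DIM('a) * (oseen \<tau> (x - y) (v y) \<bullet> j))"
      by (simp only: complex_of_real_integrable_eq)
    then have "integrable lebesgue (\<lambda>y. inverse ((2 * pi) ^ DIM('a)) * ((2 * pi) ^ DIM('a) * (oseen \<tau> (x - y) (v y) \<bullet> j)))"
      by (rule integrable_mult_right)
    then show ?thesis using pi0 by (simp flip: mult.assoc)
  qed
  have rep: "oseen \<tau> (x - y) (v y) = (\<Sum>j\<in>Basis. (oseen \<tau> (x - y) (v y) \<bullet> j) *\<^sub>R j)" for y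
    by (rule euclidean_representation[symmetric])
  show iO: "integrable lebesgue (\<lambda>y. oseen \<tau> (x - y) (v y))"
    by (subst rep) (intro Bochner_Integration.integrable_sum integrable_scaleR_left icomp)
  show "inverse_fourier ?F x = (LINT y|lebesgue. oseen \<tau> (x - y) (v y))"
  proof (rule euclidean_eqI)
    fix j :: 'a assume j: "j \<in> Basis"
    have "(LINT \<xi>|lebesgue. cis (\<xi> \<bullet> x) * ?F j \<xi>) = (LINT \<xi>|lebesgue. (LINT y|lebesgue. G j \<xi> y))"
      unfolding S[OF j] G_def by simp
    also have "\<dots> = (\<integral>\<xi>. (LINT y|lebesgue. G j \<xi> y) \<partial>lborel)"
      using P.integrable_fst[OF iG[of j]] by (intro integral_completion borel_measurable_integrable)
    also have "\<dots> = (LINT y|lebesgue. (\<integral>\<xi>. G j \<xi> y \<partial>lborel))"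
      by (rule P.Fubini_integral[OF iG, symmetric])
    also have "\<dots> = complex_of_real ((2 * pi) ^ DIM('a) * (LINT y|lebesgue. oseen \<tau> (x - y) (v y) \<bullet> j))"
      unfolding Gi by (simp only: integral_complex_of_real integral_mult_right_zero)
    finally have "Re ((LINT \<xi>|lebesgue. cis (\<xi> \<bullet> x) * ?F j \<xi>) / complex_of_real ((2 * pi) ^ DIM('a))) = (LINT y|lebesgue. oseen \<tau> (x - y) (v y) \<bullet> j)"
      using pi0 by (simp only: of_real_divide[symmetric] Re_complex_of_real) simp
    moreover have "inverse_fourier ?F x \<bullet> j = Re ((LINT \<xi>|lebesgue. cis (\<xi> \<bullet> x) * ?F j \<xi>) / complex_of_real ((2 * pi) ^ DIM('a)))"
      unfolding inverse_fourier_def inner_sum_left using j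
      by (simp add: inner_Basis if_distrib sum.delta cong: if_cong)
    moreover have "(LINT y|lebesgue. oseen \<tau> (x - y) (v y)) \<bullet> j = (LINT y|lebesgue. oseen \<tau> (x - y) (v y) \<bullet> j)"
      by (rule integral_inner_left[symmetric]) (rule iO)
    ultimately show "inverse_fourier ?F x \<bullet> j = (LINT y|lebesgue. oseen \<tau> (x - y) (v y)) \<bullet> j" by simp
  qed
qed

lemma tendsto_integral_cis:
  fixes f :: "'a::euclidean_space \<Rightarrow> complex"
  assumes f: "integrable lborel f"
  shows "continuous_on UNIV (\<lambda>x. \<integral>\<xi>. cis (\<xi> \<bullet> x) * f \<xi> \<partial>lborel)"
  unfolding continuous_on_sequentially
proof (intro allI ballI impI)
  fix X :: "nat \<Rightarrow> 'a" and x :: 'a assume X: "(\<forall>n. X n \<in> UNIV) \<and> X \<longlonglongrightarrow> x"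
  have [measurable]: "f \<in> borel_measurable borel" using borel_measurable_integrable[OF f] by simp
  have "(\<lambda>n. \<integral>\<xi>. cis (\<xi> \<bullet> X n) * f \<xi> \<partial>lborel) \<longlonglongrightarrow> (\<integral>\<xi>. cis (\<xi> \<bullet> x) * f \<xi> \<partial>lborel)"
  proof (rule integral_dominated_convergence)
    show "integrable lborel (\<lambda>\<xi>. norm (f \<xi>))" using f by simp
    show "AE \<xi> in lborel. (\<lambda>n. cis (\<xi> \<bullet> X n) * f \<xi>) \<longlonglongrightarrow> cis (\<xi> \<bullet> x) * f \<xi>"
      using X by (intro AE_I2 tendsto_intros) auto
  qed (auto simp: norm_mult)
  then show "((\<lambda>x. \<integral>\<xi>. cis (\<xi> \<bullet> x) * f \<xi> \<partial>lborel) \<circ> X) \<longlonglongrightarrow> (\<integral>\<xi>. cis (\<xi> \<bullet> x) * f \<xi> \<partial>lborel)"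
    by (simp add: comp_def)
qed

text \<open>Continuity in x is read off the Fourier side, since the inverse transform of an
  integrable function is continuous; this avoids dominating all translates of the kernel at once. It
  later supplies Borel measurability in x.\<close>

lemma continuous_oseen_convolution:
  fixes v :: "'a::euclidean_space \<Rightarrow> 'a"
  assumes t: "\<tau> > 0" and v: "v \<in> borel_measurable lebesgue"
    and v2: "integrable lebesgue (\<lambda>y. (norm (v y))\<^sup>2)"
  shows "continuous_on UNIV (\<lambda>x. LINT y|lebesgue. oseen \<tau> (x - y) (v y))"
proof -
  let ?F = "heat_hat \<tau> (leray_hat (div_hat (tensor_hat v)))"
  note E = neumann_nonlinear_eq[OF t v v2]
  have "(LINT \<xi>|lebesgue. cis (\<xi> \<bullet> x) * ?F j \<xi>) = (\<integral>\<xi>. cis (\<xi> \<bullet> x) * ?F j \<xi> \<partial>lborel)" if "j \<in> Basis" for j x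
    by (intro integral_completion borel_measurable_integrable integrable_cis_mult E(3) that)
  then have "inverse_fourier ?F = (\<lambda>x. \<Sum>j\<in>Basis. Re ((\<integral>\<xi>. cis (\<xi> \<bullet> x) * ?F j \<xi> \<partial>lborel) / complex_of_real ((2 * pi) ^ DIM('a))) *\<^sub>R j)"
    unfolding inverse_fourier_def by (intro ext sum.cong refl) simp
  moreover have "continuous_on UNIV (\<lambda>x. \<Sum>j\<in>Basis. Re ((\<integral>\<xi>. cis (\<xi> \<bullet> x) * ?F j \<xi> \<partial>lborel) / complex_of_real ((2 * pi) ^ DIM('a))) *\<^sub>R j)"
    by (intro continuous_intros tendsto_integral_cis E(3)) auto
  ultimately show ?thesis using E(2) by simp
qed

section \<open>The algebraic form of the kernel and pointwise kernel estimates\<close>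

definition oseen_form :: "real \<Rightarrow> real \<Rightarrow> real \<Rightarrow> 'a::euclidean_space \<Rightarrow> 'a \<Rightarrow> 'a" where
  "oseen_form g0 g1 e z w = (g0 / 4) *\<^sub>R ((2 * (z \<bullet> w)) *\<^sub>R w + (w \<bullet> w) *\<^sub>R z)
     - (g1 / 8 * (z \<bullet> w)\<^sup>2) *\<^sub>R z - (e / 2 * (z \<bullet> w)) *\<^sub>R w"

lemma oseen_eq_form:
  "oseen \<tau> (z::'a::euclidean_space) w = oseen_form (gG DIM('a) 0 \<tau> (norm z)) (gG DIM('a) 1 \<tau> (norm z)) (gE DIM('a) \<tau> (norm z) / \<tau>) z w"
  by (simp add: oseen_def oseen_form_def)

text \<open>Linearity in the three coefficients: comparing two times, or a time with the limit
  \<tau> = 0, gives the same form with coefficient differences, so a single norm bound serves all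
  comparisons.\<close>

lemma oseen_form_diff:
  "oseen_form g0 g1 e z w - oseen_form g0' g1' e' z w = oseen_form (g0 - g0') (g1 - g1') (e - e') z w"
  by (simp add: oseen_form_def algebra_simps diff_divide_distrib)

lemma norm_inner_diff_le:
  fixes z w w' :: "'a::real_inner"
  shows "norm ((z \<bullet> w) *\<^sub>R w - (z \<bullet> w') *\<^sub>R w') \<le> norm z * ((norm w + norm w') * norm (w - w'))"
proof -
  have "(z \<bullet> w) *\<^sub>R w - (z \<bullet> w') *\<^sub>R w' = (z \<bullet> w) *\<^sub>R (w - w') + (z \<bullet> (w - w')) *\<^sub>R w'"
    by (simp add: algebra_simps)
  also have "norm \<dots> \<le> norm ((z \<bullet> w) *\<^sub>R (w - w')) + norm ((z \<bullet> (w - w')) *\<^sub>R w')" by (rule norm_triangle_ineq)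
  also have "\<dots> = \<bar>z \<bullet> w\<bar> * norm (w - w') + \<bar>z \<bullet> (w - w')\<bar> * norm w'" by simp
  also have "\<dots> \<le> (norm z * norm w) * norm (w - w') + (norm z * norm (w - w')) * norm w'"
    by (intro add_mono mult_right_mono Cauchy_Schwarz_ineq2) auto
  finally show ?thesis by (simp add: algebra_simps)
qed

lemma abs_inner_self_diff_le:
  fixes w w' :: "'a::real_inner"
  shows "\<bar>w \<bullet> w - w' \<bullet> w'\<bar> \<le> (norm w + norm w') * norm (w - w')"
proof -
  have "w \<bullet> w - w' \<bullet> w' = (w + w') \<bullet> (w - w')"
    by (simp add: algebra_simps inner_commute)
  also have "\<bar>\<dots>\<bar> \<le> norm (w + w') * norm (w - w')" by (rule Cauchy_Schwarz_ineq2)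
  also have "\<dots> \<le> (norm w + norm w') * norm (w - w')" by (intro mult_right_mono norm_triangle_ineq) auto
  finally show ?thesis .
qed

lemma abs_inner_square_diff_le:
  fixes z w w' :: "'a::real_inner"
  shows "\<bar>(z \<bullet> w)\<^sup>2 - (z \<bullet> w')\<^sup>2\<bar> \<le> (norm z)\<^sup>2 * ((norm w + norm w') * norm (w - w'))"
proof -
  have "(z \<bullet> w)\<^sup>2 - (z \<bullet> w')\<^sup>2 = (z \<bullet> (w + w')) * (z \<bullet> (w - w'))"
    by (simp add: power2_eq_square algebra_simps)
  also have "\<bar>\<dots>\<bar> \<le> (norm z * norm (w + w')) * (norm z * norm (w - w'))"
    unfolding abs_mult by (intro mult_mono Cauchy_Schwarz_ineq2) auto
  also have "\<dots> \<le> (norm z * (norm w + norm w')) * (norm z * norm (w - w'))"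
    by (intro mult_right_mono mult_left_mono norm_triangle_ineq) auto
  finally show ?thesis by (simp add: power2_eq_square mult_ac)
qed

text \<open>The form is quadratic in w, whence the factor (|w|+|w'|) |w-w'|. The powers |z|, |z|^3
  and |z| are those with which the bounds on \<open>gG d 0\<close>, \<open>gG d 1\<close> and the
  Gaussian coefficient were stated.\<close>

lemma norm_oseen_form_diff_le:
  fixes z w w' :: "'a::euclidean_space"
  shows "norm (oseen_form g0 g1 e z w - oseen_form g0 g1 e z w')
    \<le> (norm z * \<bar>g0\<bar> + norm z ^ 3 * \<bar>g1\<bar> + norm z * \<bar>e\<bar>) * ((norm w + norm w') * norm (w - w'))"
proof -
  define D where "D = (norm w + norm w') * norm (w - w')"
  have D: "D \<ge> 0" by (simp add: D_def)
  let ?q = "(z \<bullet> w) *\<^sub>R w - (z \<bullet> w') *\<^sub>R w'"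
  have q: "norm ?q \<le> norm z * D" unfolding D_def by (rule norm_inner_diff_le)
  have s: "\<bar>w \<bullet> w - w' \<bullet> w'\<bar> \<le> D" unfolding D_def by (rule abs_inner_self_diff_le)
  have p: "\<bar>(z \<bullet> w)\<^sup>2 - (z \<bullet> w')\<^sup>2\<bar> \<le> (norm z)\<^sup>2 * D" unfolding D_def by (rule abs_inner_square_diff_le)
  let ?a = "(g0 / 2) *\<^sub>R ?q" and ?b = "(g0 / 4 * (w \<bullet> w - w' \<bullet> w')) *\<^sub>R z"
  let ?c = "(g1 / 8 * ((z \<bullet> w)\<^sup>2 - (z \<bullet> w')\<^sup>2)) *\<^sub>R z" and ?d = "(e / 2) *\<^sub>R ?q"
  have "oseen_form g0 g1 e z w - oseen_form g0 g1 e z w' = ?a + ?b - ?c - ?d"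
    by (simp add: oseen_form_def algebra_simps)
  also have "norm \<dots> \<le> norm ?a + norm ?b + norm ?c + norm ?d"
    by (intro order_trans[OF norm_triangle_ineq4] add_mono norm_triangle_ineq order_refl)
  also have "norm ?a \<le> \<bar>g0\<bar> / 2 * (norm z * D)" using q by (simp add: mult_left_mono)
  also have "norm ?b \<le> \<bar>g0\<bar> / 4 * D * norm z"
    using s by (simp add: abs_mult mult_left_mono mult_right_mono)
  also have "norm ?c \<le> \<bar>g1\<bar> / 8 * ((norm z)\<^sup>2 * D) * norm z"
    using p by (simp add: abs_mult mult_left_mono mult_right_mono)
  also have "norm ?d \<le> \<bar>e\<bar> / 2 * (norm z * D)" using q by (simp add: mult_left_mono)
  also have "\<bar>g0\<bar> / 2 * (norm z * D) + \<bar>g0\<bar> / 4 * D * norm z + \<bar>g1\<bar> / 8 * ((norm z)\<^sup>2 * D) * norm z + \<bar>e\<bar> / 2 * (norm z * D)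
      \<le> (norm z * \<bar>g0\<bar> + norm z ^ 3 * \<bar>g1\<bar> + norm z * \<bar>e\<bar>) * D"
  proof -
    have "0 \<le> norm z * \<bar>g0\<bar> * D" "0 \<le> norm z ^ 3 * \<bar>g1\<bar> * D" "0 \<le> norm z * \<bar>e\<bar> * D" using D by auto
    then show ?thesis by (simp add: algebra_simps power2_eq_square power3_eq_cube)
  qed
  finally show ?thesis by (simp add: D_def)
qed

lemma norm_oseen_form_le:
  fixes z w :: "'a::euclidean_space"
  shows "norm (oseen_form g0 g1 e z w) \<le> (norm z * \<bar>g0\<bar> + norm z ^ 3 * \<bar>g1\<bar> + norm z * \<bar>e\<bar>) * (norm w)\<^sup>2"
  using norm_oseen_form_diff_le[of g0 g1 e z w 0] by (simp add: oseen_form_def power2_eq_square)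

lemma oseen_0_left [simp]: "oseen \<tau> 0 w = 0"
  by (simp add: oseen_def)

lemma oseen_0_right [simp]: "oseen \<tau> z 0 = 0"
  by (simp add: oseen_def)

lemma oseen_diff_le:
  "\<exists>C>0. \<forall>\<tau>>0. \<forall>z w w' :: 'a::euclidean_space. norm (oseen \<tau> z w - oseen \<tau> z w') \<le> C * pk \<tau> z * ((norm w + norm w') * norm (w - w'))"
proof -
  let ?d = "DIM('a)"
  obtain C0 where C0: "C0 > 0" and b0: "\<And>\<tau> r. \<tau> \<ge> 0 \<Longrightarrow> r > 0 \<Longrightarrow> r ^ (2 * 0 + 1) * gG ?d 0 \<tau> r \<le> C0 / (sqrt \<tau> + r) ^ (?d + 1)"
    using gG_bound[of 0 ?d] by blast
  obtain C1 where C1: "C1 > 0" and b1: "\<And>\<tau> r. \<tau> \<ge> 0 \<Longrightarrow> r > 0 \<Longrightarrow> r ^ (2 * 1 + 1) * gG ?d 1 \<tau> r \<le> C1 / (sqrt \<tau> + r) ^ (?d + 1)"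
    using gG_bound[of 1 ?d] by blast
  obtain C2 where C2: "C2 > 0" and b2: "\<And>\<tau> r. \<tau> > 0 \<Longrightarrow> r \<ge> 0 \<Longrightarrow> r * (gE ?d \<tau> r / \<tau>) \<le> C2 / (sqrt \<tau> + r) ^ (?d + 1)"
    using gE_ratio_bound[of ?d] by blast
  show ?thesis
  proof (intro exI[of _ "C0 + C1 + C2"] conjI allI impI)
    show "C0 + C1 + C2 > 0" using C0 C1 C2 by simp
    fix \<tau> :: real and z w w' :: 'a assume t: "\<tau> > 0"
    define D where "D = (norm w + norm w') * norm (w - w')"
    have D: "D \<ge> 0" by (simp add: D_def)
    show "norm (oseen \<tau> z w - oseen \<tau> z w') \<le> (C0 + C1 + C2) * pk \<tau> z * ((norm w + norm w') * norm (w - w'))"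
    proof (cases "z = 0")
      case True
      then show ?thesis using C0 C1 C2 pk_pos[OF t, of z] by (simp add: less_imp_le)
    next
      case False
      then have r: "norm z > 0" by simp
      have "norm (oseen \<tau> z w - oseen \<tau> z w') \<le> (norm z * \<bar>gG ?d 0 \<tau> (norm z)\<bar> + norm z ^ 3 * \<bar>gG ?d 1 \<tau> (norm z)\<bar> + norm z * \<bar>gE ?d \<tau> (norm z) / \<tau>\<bar>) * D"
        unfolding oseen_eq_form D_def by (rule norm_oseen_form_diff_le)
      also have "\<dots> \<le> (C0 * pk \<tau> z + C1 * pk \<tau> z + C2 * pk \<tau> z) * D"
        using b0[of \<tau> "norm z"] b1[of \<tau> "norm z"] b2[of \<tau> "norm z"] t r D
        by (intro mult_right_mono add_mono) (auto simp: pk_def gG_nonneg less_imp_le abs_of_nonneg numeral_3_eq_3)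
      finally show ?thesis by (simp add: D_def algebra_simps)
    qed
  qed
qed

lemma oseen_time_diff_le:
  "\<exists>C>0. \<forall>\<tau>>0. \<forall>\<tau>'\<ge>\<tau>. \<forall>z w :: 'a::euclidean_space. norm (oseen \<tau>' z w - oseen \<tau> z w) \<le> C * ((\<tau>' - \<tau>) / \<tau>) * pk \<tau> z * (norm w)\<^sup>2"
proof -
  let ?d = "DIM('a)"
  obtain C0 where C0: "C0 > 0" and b0: "\<And>\<tau> \<tau>' r. \<tau> > 0 \<Longrightarrow> \<tau>' \<ge> \<tau> \<Longrightarrow> r > 0 \<Longrightarrow> r ^ (2 * 0 + 1) * \<bar>gG ?d 0 \<tau>' r - gG ?d 0 \<tau> r\<bar> \<le> C0 * ((\<tau>' - \<tau>) / \<tau>) / (sqrt \<tau> + r) ^ (?d + 1)"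
    using gG_diff_bound[of 0 ?d] by blast
  obtain C1 where C1: "C1 > 0" and b1: "\<And>\<tau> \<tau>' r. \<tau> > 0 \<Longrightarrow> \<tau>' \<ge> \<tau> \<Longrightarrow> r > 0 \<Longrightarrow> r ^ (2 * 1 + 1) * \<bar>gG ?d 1 \<tau>' r - gG ?d 1 \<tau> r\<bar> \<le> C1 * ((\<tau>' - \<tau>) / \<tau>) / (sqrt \<tau> + r) ^ (?d + 1)"
    using gG_diff_bound[of 1 ?d] by blast
  obtain C2 where C2: "C2 > 0" and b2: "\<And>\<tau> \<tau>' r. \<tau> > 0 \<Longrightarrow> \<tau>' \<ge> \<tau> \<Longrightarrow> r \<ge> 0 \<Longrightarrow> r * \<bar>gE ?d \<tau>' r / \<tau>' - gE ?d \<tau> r / \<tau>\<bar> \<le> C2 * ((\<tau>' - \<tau>) / \<tau>) / (sqrt \<tau> + r) ^ (?d + 1)"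
    using gE_ratio_diff_bound[of ?d] by blast
  show ?thesis
  proof (intro exI[of _ "C0 + C1 + C2"] conjI allI impI)
    show "C0 + C1 + C2 > 0" using C0 C1 C2 by simp
    fix \<tau> \<tau>' :: real and z w :: 'a assume t: "\<tau> > 0" "\<tau> \<le> \<tau>'"
    define q where "q = (\<tau>' - \<tau>) / \<tau>"
    have q: "q \<ge> 0" using t by (simp add: q_def)
    show "norm (oseen \<tau>' z w - oseen \<tau> z w) \<le> (C0 + C1 + C2) * ((\<tau>' - \<tau>) / \<tau>) * pk \<tau> z * (norm w)\<^sup>2"
    proof (cases "z = 0")
      case True
      then show ?thesis using C0 C1 C2 pk_pos[OF t(1), of z] t by (simp add: less_imp_le)
    next
      case False
      then have r: "norm z > 0" by simp
      have "norm (oseen \<tau>' z w - oseen \<tau> z w) \<le> (norm z * \<bar>gG ?d 0 \<tau>' (norm z) - gG ?d 0 \<tau> (norm z)\<bar> + norm z ^ 3 * \<bar>gG ?d 1 \<tau>' (norm z) - gG ?d 1 \<tau> (norm z)\<bar>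
          + norm z * \<bar>gE ?d \<tau>' (norm z) / \<tau>' - gE ?d \<tau> (norm z) / \<tau>\<bar>) * (norm w)\<^sup>2"
        unfolding oseen_eq_form oseen_form_diff by (rule norm_oseen_form_le)
      also have "\<dots> \<le> (C0 * q * pk \<tau> z + C1 * q * pk \<tau> z + C2 * q * pk \<tau> z) * (norm w)\<^sup>2"
        using b0[OF t r] b1[OF t r] b2[OF t less_imp_le[OF r]]
        by (intro mult_right_mono add_mono) (auto simp: pk_def q_def numeral_3_eq_3)
      finally show ?thesis unfolding q_def[symmetric] by (simp add: algebra_simps)
    qed
  qed
qed

text \<open>The limit \<open>\<tau> = 0\<close> of the Oseen kernel away from the origin; the Gaussian coefficient \<open>e\<close> disappears.\<close>

definition oseen0 :: "'a::euclidean_space \<Rightarrow> 'a \<Rightarrow> 'a" where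
  "oseen0 z w = oseen_form (gG DIM('a) 0 0 (norm z)) (gG DIM('a) 1 0 (norm z)) 0 z w"

section \<open>Homogeneity, size and Lipschitz dependence of the limit kernel\<close>

lemma oseen0_power:
  fixes z w :: "'a::euclidean_space"
  assumes "z \<noteq> 0"
  shows "oseen0 z w = oseen_form (gG DIM('a) 0 0 1 / norm z ^ (DIM('a) + 2)) (gG DIM('a) 1 0 1 / norm z ^ (DIM('a) + 4)) 0 z w"
  using assms gG_zero_scale[of "norm z" "DIM('a)" 0] gG_zero_scale[of "norm z" "DIM('a)" 1]
  by (simp add: oseen0_def)

lemma oseen_form_scale:
  fixes z w :: "'a::euclidean_space"
  shows "oseen_form g0 g1 e (c *\<^sub>R z) w = oseen_form (c * g0) (c ^ 3 * g1) (c * e) z w"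
  by (simp add: oseen_form_def algebra_simps power2_eq_square power3_eq_cube)

text \<open>The exponents 1 - (d+2) and 3 - (d+4) agree, so both terms of the form scale by
  c^(-(d+1)).\<close>

lemma oseen0_homogeneous:
  fixes z w :: "'a::euclidean_space"
  assumes "c > 0"
  shows "oseen0 (c *\<^sub>R z) w = (1 / c ^ (DIM('a) + 1)) *\<^sub>R oseen0 z w"
proof (cases "z = 0")
  case True
  then show ?thesis by (simp add: oseen0_def oseen_form_def)
next
  case False
  have m: "oseen_form (k * g0) (k * g1) 0 z w = k *\<^sub>R oseen_form g0 g1 0 z w" for k g0 g1
    by (simp add: oseen_form_def algebra_simps)
  have "oseen0 (c *\<^sub>R z) w = oseen_form (c * (gG DIM('a) 0 0 1 / (c * norm z) ^ (DIM('a) + 2))) (c ^ 3 * (gG DIM('a) 1 0 1 / (c * norm z) ^ (DIM('a) + 4))) 0 z w"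
    using assms False by (subst oseen0_power) (simp_all add: oseen_form_scale)
  also have "c * (gG DIM('a) 0 0 1 / (c * norm z) ^ (DIM('a) + 2)) = (1 / c ^ (DIM('a) + 1)) * (gG DIM('a) 0 0 1 / norm z ^ (DIM('a) + 2))"
    using assms by (simp add: power_mult_distrib)
  also have "c ^ 3 * (gG DIM('a) 1 0 1 / (c * norm z) ^ (DIM('a) + 4)) = (1 / c ^ (DIM('a) + 1)) * (gG DIM('a) 1 0 1 / norm z ^ (DIM('a) + 4))"
    using assms by (simp add: power_mult_distrib power_add eval_nat_numeral)
  finally show ?thesis unfolding m oseen0_power[OF False] .
qed

lemma oseen0_le:
  "\<exists>C>0. \<forall>z w :: 'a::euclidean_space. norm (oseen0 z w) \<le> C / norm z ^ (DIM('a) + 1) * (norm w)\<^sup>2"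
proof -
  let ?d = "DIM('a)"
  define C where "C = gG ?d 0 0 1 + gG ?d 1 0 1 + 1"
  have g: "gG ?d 0 0 1 \<ge> 0" "gG ?d 1 0 1 \<ge> 0" by (simp_all add: gG_nonneg)
  show ?thesis
  proof (intro exI[of _ C] conjI allI)
    show "C > 0" using g by (simp add: C_def)
    fix z w :: 'a
    show "norm (oseen0 z w) \<le> C / norm z ^ (?d + 1) * (norm w)\<^sup>2"
    proof (cases "z = 0")
      case True
      then show ?thesis by (simp add: oseen0_def oseen_form_def)
    next
      case False
      have "norm (oseen0 z w) \<le> (norm z * \<bar>gG ?d 0 0 1 / norm z ^ (?d + 2)\<bar> + norm z ^ 3 * \<bar>gG ?d 1 0 1 / norm z ^ (?d + 4)\<bar> + norm z * \<bar>0\<bar>) * (norm w)\<^sup>2"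
        unfolding oseen0_power[OF False] by (rule norm_oseen_form_le)
      also have "norm z * \<bar>gG ?d 0 0 1 / norm z ^ (?d + 2)\<bar> + norm z ^ 3 * \<bar>gG ?d 1 0 1 / norm z ^ (?d + 4)\<bar> + norm z * \<bar>0\<bar>
          = (gG ?d 0 0 1 + gG ?d 1 0 1) / norm z ^ (?d + 1)"
        using False g by (simp add: power_add eval_nat_numeral add_divide_distrib)
      also have "\<dots> \<le> C / norm z ^ (?d + 1)" by (intro divide_right_mono) (auto simp: C_def)
      finally show ?thesis by (simp add: mult_right_mono)
    qed
  qed
qed

lemma oseen_oseen0_le:
  "\<exists>C>0. \<forall>\<tau>>0. \<forall>z w :: 'a::euclidean_space. z \<noteq> 0 \<longrightarrow> norm (oseen \<tau> z w - oseen0 z w) \<le> C * \<tau> / norm z ^ (DIM('a) + 3) * (norm w)\<^sup>2"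
proof -
  let ?d = "DIM('a)"
  obtain C0 where C0: "C0 > 0" and b0: "\<And>\<tau> r. \<tau> > 0 \<Longrightarrow> r > 0 \<Longrightarrow> r ^ (?d + 2 * (0 + 2)) * \<bar>gG ?d 0 \<tau> r - gG ?d 0 0 r\<bar> \<le> C0 * \<tau>"
    using gG_zero_diff_bound[of ?d 0] by blast
  obtain C1 where C1: "C1 > 0" and b1: "\<And>\<tau> r. \<tau> > 0 \<Longrightarrow> r > 0 \<Longrightarrow> r ^ (?d + 2 * (1 + 2)) * \<bar>gG ?d 1 \<tau> r - gG ?d 1 0 r\<bar> \<le> C1 * \<tau>"
    using gG_zero_diff_bound[of ?d 1] by blast
  obtain C2 where C2: "C2 > 0" and b2: "\<And>\<tau> r. \<tau> > 0 \<Longrightarrow> r \<ge> 0 \<Longrightarrow> r ^ (?d + 4) * (gE ?d \<tau> r / \<tau>) \<le> C2 * \<tau>"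
    using gE_ratio_bound[of ?d] by blast
  show ?thesis
  proof (intro exI[of _ "C0 + C1 + C2"] conjI allI impI)
    show "C0 + C1 + C2 > 0" using C0 C1 C2 by simp
    fix \<tau> :: real and z w :: 'a assume t: "\<tau> > 0" and z: "z \<noteq> 0"
    define r where "r = norm z"
    have r: "r > 0" using z by (simp add: r_def)
    have p: "r ^ (?d + 3) > 0" using r by simp
    have "norm (oseen \<tau> z w - oseen0 z w) \<le> (r * \<bar>gG ?d 0 \<tau> r - gG ?d 0 0 r\<bar> + r ^ 3 * \<bar>gG ?d 1 \<tau> r - gG ?d 1 0 r\<bar> + r * \<bar>gE ?d \<tau> r / \<tau> - 0\<bar>) * (norm w)\<^sup>2"
      unfolding oseen_eq_form oseen0_def oseen_form_diff r_def by (rule norm_oseen_form_le)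
    also have "\<dots> \<le> (C0 * \<tau> / r ^ (?d + 3) + C1 * \<tau> / r ^ (?d + 3) + C2 * \<tau> / r ^ (?d + 3)) * (norm w)\<^sup>2"
    proof (intro mult_right_mono add_mono)
      show "r * \<bar>gG ?d 0 \<tau> r - gG ?d 0 0 r\<bar> \<le> C0 * \<tau> / r ^ (?d + 3)"
        using b0[OF t r] p by (subst pos_le_divide_eq) (auto simp: eval_nat_numeral mult_ac)
      show "r ^ 3 * \<bar>gG ?d 1 \<tau> r - gG ?d 1 0 r\<bar> \<le> C1 * \<tau> / r ^ (?d + 3)"
        using b1[OF t r] p by (subst pos_le_divide_eq) (auto simp: eval_nat_numeral mult_ac)
      show "r * \<bar>gE ?d \<tau> r / \<tau> - 0\<bar> \<le> C2 * \<tau> / r ^ (?d + 3)"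
        using b2[OF t less_imp_le[OF r]] p t by (subst pos_le_divide_eq) (auto simp: eval_nat_numeral mult_ac)
    qed simp
    finally show "norm (oseen \<tau> z w - oseen0 z w) \<le> (C0 + C1 + C2) * \<tau> / norm z ^ (?d + 3) * (norm w)\<^sup>2"
      by (simp add: r_def add_divide_distrib algebra_simps)
  qed
qed

text \<open>Induction on m, splitting the difference of products 1/r times 1/r^m; r \<ge> R/2 keeps
  every 1/r comparable with 1/R.\<close>

lemma inverse_power_diff_le:
  "\<exists>K\<ge>0. \<forall>r R \<delta>. R > 0 \<longrightarrow> r \<ge> R / 2 \<longrightarrow> \<bar>r - R\<bar> \<le> \<delta> \<longrightarrow> \<bar>1 / r ^ m - 1 / R ^ m\<bar> \<le> K * \<delta> / (R ^ (m + 1) :: real)"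
proof (induction m)
  case 0
  then show ?case by (intro exI[of _ 0]) auto
next
  case (Suc m)
  then obtain K where K: "K \<ge> 0" and b: "\<And>r R \<delta>. R > 0 \<Longrightarrow> r \<ge> R / 2 \<Longrightarrow> \<bar>r - R\<bar> \<le> \<delta> \<Longrightarrow> \<bar>1 / r ^ m - 1 / R ^ m\<bar> \<le> K * \<delta> / (R ^ (m + 1) :: real)"
    by blast
  show ?case
  proof (intro exI[of _ "2 * K + 2"] conjI allI impI)
    show "0 \<le> 2 * K + 2" using K by simp
    fix r R \<delta> :: real assume R: "R > 0" and r: "r \<ge> R / 2" and dl: "\<bar>r - R\<bar> \<le> \<delta>"
    have r0: "r > 0" using R r by simp
    have d0: "\<delta> \<ge> 0" using dl by simp
    have a: "1 / r \<le> 2 / R" using R r r0 by (simp add: field_simps)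
    have "1 / r - 1 / R = (R - r) * (1 / r) * (1 / R)" using R r0 by (simp add: field_simps)
    then have "\<bar>1 / r - 1 / R\<bar> = \<bar>R - r\<bar> * (1 / r) * (1 / R)" using R r0 by (simp add: abs_mult)
    also have "\<dots> \<le> \<delta> * (2 / R) * (1 / R)"
      using a dl R r0 d0 by (intro mult_right_mono mult_mono) auto
    finally have c: "\<bar>1 / r - 1 / R\<bar> \<le> 2 * \<delta> / R\<^sup>2" by (simp add: power2_eq_square mult_ac)
    have "1 / r ^ Suc m - 1 / R ^ Suc m = (1 / r) * (1 / r ^ m - 1 / R ^ m) + (1 / r - 1 / R) * (1 / R ^ m)"
      by (simp add: algebra_simps)
    also have "\<bar>\<dots>\<bar> \<le> \<bar>1 / r\<bar> * \<bar>1 / r ^ m - 1 / R ^ m\<bar> + \<bar>1 / r - 1 / R\<bar> * \<bar>1 / R ^ m\<bar>"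
      by (rule order_trans[OF abs_triangle_ineq]) (simp only: abs_mult order_refl)
    also have "\<dots> \<le> (2 / R) * (K * \<delta> / R ^ (m + 1)) + (2 * \<delta> / R\<^sup>2) * (1 / R ^ m)"
      using a b[OF R r dl] c R r0 by (intro add_mono mult_mono) auto
    also have "\<dots> = (2 * K + 2) * \<delta> / R ^ (Suc m + 1)"
      using R by (simp add: field_simps power2_eq_square)
    finally show "\<bar>1 / r ^ Suc m - 1 / R ^ Suc m\<bar> \<le> (2 * K + 2) * \<delta> / R ^ (Suc m + 1)" .
  qed
qed

lemma norm_oseen_form_diff_left_le:
  fixes x z w :: "'a::euclidean_space"
  shows "norm (oseen_form g0 g1 0 z w - oseen_form g0 g1 0 x w)
    \<le> (\<bar>g0\<bar> + (norm x + norm z)\<^sup>2 * \<bar>g1\<bar>) * norm (z - x) * (norm w)\<^sup>2"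
proof -
  let ?a = "(g0 / 2 * ((z - x) \<bullet> w)) *\<^sub>R w" and ?b = "(g0 / 4 * (w \<bullet> w)) *\<^sub>R (z - x)"
  let ?c = "(g1 / 8 * (z \<bullet> w)\<^sup>2) *\<^sub>R (z - x)" and ?d = "(g1 / 8 * ((z \<bullet> w)\<^sup>2 - (x \<bullet> w)\<^sup>2)) *\<^sub>R x"
  have "oseen_form g0 g1 0 z w - oseen_form g0 g1 0 x w = ?a + ?b - ?c - ?d"
    by (simp add: oseen_form_def algebra_simps)
  also have "norm \<dots> \<le> norm ?a + norm ?b + norm ?c + norm ?d"
    by (intro order_trans[OF norm_triangle_ineq4] add_mono norm_triangle_ineq order_refl)
  also have "norm ?a \<le> \<bar>g0\<bar> / 2 * (norm (z - x) * norm w) * norm w"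
    using Cauchy_Schwarz_ineq2[of "z - x" w] by (simp add: abs_mult mult_left_mono mult_right_mono)
  also have "norm ?b = \<bar>g0\<bar> / 4 * (norm w)\<^sup>2 * norm (z - x)" by (simp add: abs_mult power2_norm_eq_inner)
  also have "norm ?c \<le> \<bar>g1\<bar> / 8 * ((norm z)\<^sup>2 * (norm w)\<^sup>2) * norm (z - x)"
  proof -
    have "(z \<bullet> w)\<^sup>2 \<le> (norm z * norm w)\<^sup>2"
      unfolding power2_abs[of "z \<bullet> w", symmetric] by (intro power_mono Cauchy_Schwarz_ineq2) auto
    then show ?thesis by (simp add: abs_mult mult_left_mono mult_right_mono power_mult_distrib)
  qed
  also have "norm ?d \<le> \<bar>g1\<bar> / 8 * ((norm w)\<^sup>2 * ((norm z + norm x) * norm (z - x))) * norm x"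
    using abs_inner_square_diff_le[of w z x] by (simp add: abs_mult mult_left_mono mult_right_mono inner_commute)
  also have "\<bar>g0\<bar> / 2 * (norm (z - x) * norm w) * norm w + \<bar>g0\<bar> / 4 * (norm w)\<^sup>2 * norm (z - x)
      + \<bar>g1\<bar> / 8 * ((norm z)\<^sup>2 * (norm w)\<^sup>2) * norm (z - x) + \<bar>g1\<bar> / 8 * ((norm w)\<^sup>2 * ((norm z + norm x) * norm (z - x))) * norm x
     \<le> (\<bar>g0\<bar> + (norm x + norm z)\<^sup>2 * \<bar>g1\<bar>) * norm (z - x) * (norm w)\<^sup>2"
  proof -
    define k where "k = norm (z - x) * (norm w)\<^sup>2"
    have k: "k \<ge> 0" by (simp add: k_def)
    have "0 \<le> \<bar>g0\<bar> * k" "0 \<le> \<bar>g1\<bar> * k * (norm z)\<^sup>2" "0 \<le> \<bar>g1\<bar> * k * (norm x)\<^sup>2" "0 \<le> \<bar>g1\<bar> * k * (norm x * norm z)"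
      using k by auto
    moreover have "\<bar>g0\<bar> / 2 * (norm (z - x) * norm w) * norm w + \<bar>g0\<bar> / 4 * (norm w)\<^sup>2 * norm (z - x)
      + \<bar>g1\<bar> / 8 * ((norm z)\<^sup>2 * (norm w)\<^sup>2) * norm (z - x) + \<bar>g1\<bar> / 8 * ((norm w)\<^sup>2 * ((norm z + norm x) * norm (z - x))) * norm x
      = 3 / 4 * (\<bar>g0\<bar> * k) + 1 / 8 * (\<bar>g1\<bar> * k * (norm z)\<^sup>2) + 1 / 8 * (\<bar>g1\<bar> * k * (norm x * norm z)) + 1 / 8 * (\<bar>g1\<bar> * k * (norm x)\<^sup>2)"
      by (simp add: k_def algebra_simps power2_eq_square)
    moreover have "(\<bar>g0\<bar> + (norm x + norm z)\<^sup>2 * \<bar>g1\<bar>) * norm (z - x) * (norm w)\<^sup>2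
      = \<bar>g0\<bar> * k + \<bar>g1\<bar> * k * (norm z)\<^sup>2 + 2 * (\<bar>g1\<bar> * k * (norm x * norm z)) + \<bar>g1\<bar> * k * (norm x)\<^sup>2"
      by (simp add: k_def algebra_simps power2_eq_square)
    ultimately show ?thesis by linarith
  qed
  finally show ?thesis by simp
qed

text \<open>Two changes in turn: first the radial coefficients pass from |x-y| to |x| while the
  vector argument stays x-y, then the vector argument moves to x with frozen coefficients. For |y|
  \<le> |x|/2 all radii are comparable, and each change costs a factor |y|/|x|.\<close>

lemma oseen0_lipschitz:
  "\<exists>C>0. \<forall>x y w :: 'a::euclidean_space. x \<noteq> 0 \<longrightarrow> norm y \<le> norm x / 2 \<longrightarrow>
     norm (oseen0 (x - y) w - oseen0 x w) \<le> C * norm y / norm x ^ (DIM('a) + 2) * (norm w)\<^sup>2"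
proof -
  let ?d = "DIM('a)"
  define a where "a = gG ?d 0 0 1"
  define b where "b = gG ?d 1 0 1"
  have ab: "a \<ge> 0" "b \<ge> 0" by (simp_all add: a_def b_def gG_nonneg)
  obtain K where K: "K \<ge> 0" and kb: "\<And>r R \<delta>. R > 0 \<Longrightarrow> r \<ge> R / 2 \<Longrightarrow> \<bar>r - R\<bar> \<le> \<delta> \<Longrightarrow> \<bar>1 / r ^ (?d + 2) - 1 / R ^ (?d + 2)\<bar> \<le> K * \<delta> / (R ^ (?d + 2 + 1) :: real)"
    using inverse_power_diff_le[of "?d + 2"] by blast
  obtain L where L: "L \<ge> 0" and lb: "\<And>r R \<delta>. R > 0 \<Longrightarrow> r \<ge> R / 2 \<Longrightarrow> \<bar>r - R\<bar> \<le> \<delta> \<Longrightarrow> \<bar>1 / r ^ (?d + 4) - 1 / R ^ (?d + 4)\<bar> \<le> L * \<delta> / (R ^ (?d + 4 + 1) :: real)"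
    using inverse_power_diff_le[of "?d + 4"] by blast
  have scale: "\<bar>k / p - k / q\<bar> \<le> k * B" if "k \<ge> 0" "\<bar>1 / p - 1 / q\<bar> \<le> B" for k p q B :: real
  proof -
    have "k / p - k / q = k * (1 / p - 1 / q)" by (simp add: right_diff_distrib)
    then have "\<bar>k / p - k / q\<bar> = k * \<bar>1 / p - 1 / q\<bar>" using that(1) by (simp add: abs_mult)
    then show ?thesis using that by (simp add: mult_left_mono)
  qed
  define C where "C = 2 * a * K + 8 * b * L + a + 9 * b + 1"
  show ?thesis
  proof (intro exI[of _ C] conjI allI impI)
    show "C > 0" using ab K L by (simp add: C_def add_nonneg_pos)
    fix x y w :: 'a assume x: "x \<noteq> 0" and y: "norm y \<le> norm x / 2"
    define R where "R = norm x"
    define r where "r = norm (x - y)"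
    define \<delta> where "\<delta> = norm y"
    have R: "R > 0" using x by (simp add: R_def)
    have dl: "\<bar>r - R\<bar> \<le> \<delta>" unfolding r_def R_def \<delta>_def
      using norm_triangle_ineq3[of "x - y" x] by simp
    have r: "r \<ge> R / 2" "r \<le> 2 * R" "r > 0" "\<delta> \<ge> 0" using dl y R unfolding R_def \<delta>_def by linarith+
    have xy: "x - y \<noteq> 0" using r(3) by (auto simp: r_def)
    let ?g = "a / R ^ (?d + 2)" and ?h = "b / R ^ (?d + 4)"
    have g: "\<bar>a / r ^ (?d + 2) - ?g\<bar> \<le> a * (K * \<delta> / R ^ (?d + 3))"
      using scale[OF ab(1) kb[OF R r(1) dl]] by (simp add: numeral_3_eq_3)
    have h: "\<bar>b / r ^ (?d + 4) - ?h\<bar> \<le> b * (L * \<delta> / R ^ (?d + 5))"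
      using scale[OF ab(2) lb[OF R r(1) dl]] by (simp add: eval_nat_numeral)
    have "oseen0 (x - y) w - oseen0 x w = oseen_form (a / r ^ (?d + 2) - ?g) (b / r ^ (?d + 4) - ?h) (0 - 0) (x - y) w
       + (oseen_form ?g ?h 0 (x - y) w - oseen_form ?g ?h 0 x w)"
      unfolding oseen0_power[OF x] oseen0_power[OF xy] a_def b_def r_def R_def oseen_form_diff[symmetric] by simp
    also have "norm \<dots> \<le> (r * \<bar>a / r ^ (?d + 2) - ?g\<bar> + r ^ 3 * \<bar>b / r ^ (?d + 4) - ?h\<bar> + r * \<bar>0 - 0\<bar>) * (norm w)\<^sup>2
       + (\<bar>?g\<bar> + (R + r)\<^sup>2 * \<bar>?h\<bar>) * norm (x - y - x) * (norm w)\<^sup>2"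
      unfolding r_def R_def
      by (rule order_trans[OF norm_triangle_ineq add_mono[OF norm_oseen_form_le norm_oseen_form_diff_left_le]])
    also have "\<dots> = ((r * \<bar>a / r ^ (?d + 2) - ?g\<bar> + r ^ 3 * \<bar>b / r ^ (?d + 4) - ?h\<bar>) + (?g + (R + r)\<^sup>2 * ?h) * \<delta>) * (norm w)\<^sup>2"
      using ab R by (simp add: \<delta>_def algebra_simps)
    also have "\<dots> \<le> (((2 * R) * (a * (K * \<delta> / R ^ (?d + 3))) + (2 * R) ^ 3 * (b * (L * \<delta> / R ^ (?d + 5)))) + (?g + (3 * R)\<^sup>2 * ?h) * \<delta>) * (norm w)\<^sup>2"
      using g h r R ab K L by (intro mult_right_mono add_mono mult_mono power_mono order_refl) auto
    also have "(((2 * R) * (a * (K * \<delta> / R ^ (?d + 3))) + (2 * R) ^ 3 * (b * (L * \<delta> / R ^ (?d + 5)))) + (?g + (3 * R)\<^sup>2 * ?h) * \<delta>)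
       = (C - 1) * \<delta> / R ^ (?d + 2)"
    proof -
      have "(2 * R) * (a * (K * \<delta> / R ^ (?d + 3))) = 2 * a * K * \<delta> / R ^ (?d + 2)"
        using R by (simp add: eval_nat_numeral)
      moreover have "(2 * R) ^ 3 * (b * (L * \<delta> / R ^ (?d + 5))) = 8 * b * L * \<delta> / R ^ (?d + 2)"
        using R by (simp add: eval_nat_numeral)
      moreover have "(3 * R)\<^sup>2 * ?h = 9 * b / R ^ (?d + 2)"
        using R by (simp add: eval_nat_numeral)
      ultimately show ?thesis by (simp only:) (simp add: C_def add_divide_distrib algebra_simps)
    qed
    also have "\<dots> * (norm w)\<^sup>2 \<le> C * \<delta> / R ^ (?d + 2) * (norm w)\<^sup>2"
      using r R by (intro mult_right_mono divide_right_mono) auto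
    finally show "norm (oseen0 (x - y) w - oseen0 x w) \<le> C * norm y / norm x ^ (?d + 2) * (norm w)\<^sup>2"
      by (simp add: \<delta>_def R_def)
  qed
qed

section \<open>The bilinear operator and the Duhamel integral\<close>

lemma norm_integral_le_AE:
  fixes f :: "'a \<Rightarrow> 'v::{banach, second_countable_topology}"
  assumes f: "integrable M f" and g: "integrable M g" and le: "AE x in M. norm (f x) \<le> g x"
  shows "norm (\<integral>x. f x \<partial>M) \<le> (\<integral>x. g x \<partial>M)"
proof -
  have "norm (\<integral>x. f x \<partial>M) \<le> (\<integral>x. norm (f x) \<partial>M)" by (rule integral_norm_bound)
  also have "\<dots> \<le> (\<integral>x. g x \<partial>M)" using f by (intro integral_mono_AE g le) simp
  finally show ?thesis .
qed

lemma powr_minus_half: "\<tau> > 0 \<Longrightarrow> \<tau> powr (-1/2) = 1 / sqrt (\<tau>::real)"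
  using powr_minus_divide[of \<tau> "1/2"] powr_half_sqrt[of \<tau>] by simp

lemma conv_dominated:
  assumes p: "p \<ge> real DIM('a::euclidean_space) + 1"
  shows "\<exists>C>0. \<forall>\<tau>\<in>{0<..1}. \<forall>(G::'a \<Rightarrow> 'v::{banach, second_countable_topology}) B x. G \<in> borel_measurable lebesgue \<longrightarrow> 0 \<le> B \<longrightarrow>
     (AE y in lebesgue. norm (G y) \<le> B * (pk \<tau> (x - y) * wgt p y)) \<longrightarrow>
     integrable lebesgue G \<and> norm (LINT y|lebesgue. G y) \<le> C * B * \<tau> powr (-1/2) * wgt (DIM('a) + 1) x"
proof -
  obtain C where C: "C > 0" and b: "\<And>\<tau> x::'a. \<tau> \<in> {0<..1} \<Longrightarrow> integrable lborel (\<lambda>y. pk \<tau> (x - y) * wgt p y) \<and>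
     (\<integral>y. pk \<tau> (x - y) * wgt p y \<partial>lborel) \<le> C / sqrt \<tau> * wgt (DIM('a) + 1) x"
    using conv_bound[OF p] by blast
  show ?thesis
  proof (intro exI[of _ C] conjI[OF C] ballI allI impI)
    fix \<tau> B :: real and G :: "'a \<Rightarrow> 'v" and x :: 'a
    assume t: "\<tau> \<in> {0<..1}" and G: "G \<in> borel_measurable lebesgue" and B: "0 \<le> B"
      and le: "AE y in lebesgue. norm (G y) \<le> B * (pk \<tau> (x - y) * wgt p y)"
    have m: "(\<lambda>y. pk \<tau> (x - y) * wgt p y) \<in> borel_measurable lborel" by measurable
    have i: "integrable lebesgue (\<lambda>y. B * (pk \<tau> (x - y) * wgt p y))"
      using b[OF t, of x] by (intro integrable_mult_right) (simp add: integrable_completion[OF m])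
    have iG: "integrable lebesgue G"
      by (rule Bochner_Integration.integrable_bound[OF i G])
         (use le in \<open>eventually_elim, auto intro: order_trans[OF _ abs_ge_self]\<close>)
    have "norm (LINT y|lebesgue. G y) \<le> (LINT y|lebesgue. B * (pk \<tau> (x - y) * wgt p y))"
      by (rule norm_integral_le_AE[OF iG i le])
    also have "\<dots> = B * (\<integral>y. pk \<tau> (x - y) * wgt p y \<partial>lborel)"
      by (simp add: integral_completion[OF m])
    also have "\<dots> \<le> B * (C / sqrt \<tau> * wgt (DIM('a) + 1) x)"
      using b[OF t, of x] B by (intro mult_left_mono) auto
    finally have calculation: "norm (LINT y|lebesgue. G y) \<le> B * (C / sqrt \<tau> * wgt (DIM('a) + 1) x)" .
    show "integrable lebesgue G \<and> norm (LINT y|lebesgue. G y) \<le> C * B * \<tau> powr (-1/2) * wgt (DIM('a) + 1) x"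
    proof -
      have e: "\<tau> powr (-1/2) = 1 / sqrt \<tau>" using t by (intro powr_minus_half) simp
      show ?thesis unfolding e using iG calculation by (simp add: mult_ac)
    qed
  qed
qed

definition dominated :: "real \<Rightarrow> real \<Rightarrow> ('a::euclidean_space \<Rightarrow> 'a) \<Rightarrow> bool" where
  "dominated \<theta> A v \<longleftrightarrow> v \<in> borel_measurable lebesgue \<and> (AE y in lebesgue. norm (v y) \<le> A * wgt \<theta> y)"

lemma dominated_square_integrable:
  fixes v :: "'a::euclidean_space \<Rightarrow> 'a"
  assumes v: "dominated \<theta> A v" and \<theta>: "2 * \<theta> > real DIM('a)"
  shows "integrable lebesgue (\<lambda>y. (norm (v y))\<^sup>2)"
proof (rule Bochner_Integration.integrable_bound)
  show "integrable lebesgue (\<lambda>y::'a. A\<^sup>2 * wgt (2 * \<theta>) y)"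
    using integrable_wgt[OF \<theta>] by (intro integrable_mult_right) (simp add: integrable_completion)
  have [measurable]: "v \<in> borel_measurable lebesgue" using v by (simp add: dominated_def)
  show "(\<lambda>y. (norm (v y))\<^sup>2) \<in> borel_measurable lebesgue" by measurable
  have "AE y in lebesgue. norm (v y) \<le> A * wgt \<theta> y" using v by (simp add: dominated_def)
  then show "AE y in lebesgue. norm ((norm (v y))\<^sup>2) \<le> norm (A\<^sup>2 * wgt (2 * \<theta>) y)"
  proof eventually_elim
    case (elim y)
    have "(norm (v y))\<^sup>2 \<le> (A * wgt \<theta> y)\<^sup>2" using elim by (intro power_mono) auto
    also have "\<dots> = A\<^sup>2 * wgt (2 * \<theta>) y"
      using wgt_add[of \<theta> y \<theta>] by (simp add: power2_eq_square mult_ac)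
    finally show ?case by simp
  qed
qed

text \<open>The nonlinear operator for a field already reflected to the whole space;
  \<open>neumann_nonlinear_oconv\<close> identifies it with the Fourier definition.\<close>

definition oconv :: "real \<Rightarrow> ('a::euclidean_space \<Rightarrow> 'a) \<Rightarrow> 'a \<Rightarrow> 'a" where
  "oconv \<tau> v x = (LINT y|lebesgue. oseen \<tau> (x - y) (v y))"

lemma dominated_zero: "dominated \<theta> 0 (\<lambda>_. 0)"
  by (simp add: dominated_def)

text \<open>One weight \<theta> comes from the sizes and one from the difference, so the kernel is
  convolved with \<open>wgt (2 * \<theta>)\<close>; 2\<theta> \<ge> d+1 is the condition under which
  \<open>conv_bound\<close> returns decay of order d+1.\<close>

lemma oconv_diff_le:
  fixes \<theta> :: real
  assumes \<theta>: "2 * \<theta> \<ge> real DIM('a::euclidean_space) + 1"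
  shows "\<exists>C>0. \<forall>\<tau>\<in>{0<..1}. \<forall>(v::'a \<Rightarrow> 'a) w A B D x. dominated \<theta> A v \<longrightarrow> dominated \<theta> B w \<longrightarrow>
     (AE y in lebesgue. norm (v y - w y) \<le> D * wgt \<theta> y) \<longrightarrow> 0 \<le> A \<longrightarrow> 0 \<le> B \<longrightarrow> 0 \<le> D \<longrightarrow>
     norm (oconv \<tau> v x - oconv \<tau> w x) \<le> C * ((A + B) * D) * \<tau> powr (-1/2) * wgt (DIM('a) + 1) x"
proof -
  obtain K where K: "K > 0" and kb: "\<And>\<tau> (z::'a) w w'. \<tau> > 0 \<Longrightarrow> norm (oseen \<tau> z w - oseen \<tau> z w') \<le> K * pk \<tau> z * ((norm w + norm w') * norm (w - w'))"
    using oseen_diff_le by blast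
  obtain C where C: "C > 0" and cb: "\<And>\<tau> (G::'a \<Rightarrow> 'a) B x. \<tau> \<in> {0<..1} \<Longrightarrow> G \<in> borel_measurable lebesgue \<Longrightarrow> 0 \<le> B \<Longrightarrow>
     (AE y in lebesgue. norm (G y) \<le> B * (pk \<tau> (x - y) * wgt (2 * \<theta>) y)) \<Longrightarrow>
     integrable lebesgue G \<and> norm (LINT y|lebesgue. G y) \<le> C * B * \<tau> powr (-1/2) * wgt (DIM('a) + 1) x"
    using conv_dominated[OF \<theta>] by blast
  show ?thesis
  proof (intro exI[of _ "C * K"] conjI ballI allI impI)
    show "C * K > 0" using C K by simp
    fix \<tau> A B D :: real and v w :: "'a \<Rightarrow> 'a" and x :: 'a
    assume t: "\<tau> \<in> {0<..1}" and v: "dominated \<theta> A v" and w: "dominated \<theta> B w"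
      and vw: "AE y in lebesgue. norm (v y - w y) \<le> D * wgt \<theta> y" and nn: "0 \<le> A" "0 \<le> B" "0 \<le> D"
    have t0: "\<tau> > 0" using t by simp
    have \<theta>': "2 * \<theta> > real DIM('a)" using \<theta> by simp
    have iv: "integrable lebesgue (\<lambda>y. oseen \<tau> (x - y) (v y))"
      by (rule neumann_nonlinear_eq(1)[OF t0 _ dominated_square_integrable[OF v \<theta>']]) (use v in \<open>simp add: dominated_def\<close>)
    have iw: "integrable lebesgue (\<lambda>y. oseen \<tau> (x - y) (w y))"
      by (rule neumann_nonlinear_eq(1)[OF t0 _ dominated_square_integrable[OF w \<theta>']]) (use w in \<open>simp add: dominated_def\<close>)
    let ?G = "\<lambda>y. oseen \<tau> (x - y) (v y) - oseen \<tau> (x - y) (w y)"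
    have "AE y in lebesgue. norm (?G y) \<le> (K * ((A + B) * D)) * (pk \<tau> (x - y) * wgt (2 * \<theta>) y)"
    proof -
      have "AE y in lebesgue. norm (v y) \<le> A * wgt \<theta> y" "AE y in lebesgue. norm (w y) \<le> B * wgt \<theta> y"
        using v w by (auto simp: dominated_def)
      with vw show ?thesis
      proof eventually_elim
        case (elim y)
        have "norm (?G y) \<le> K * pk \<tau> (x - y) * ((norm (v y) + norm (w y)) * norm (v y - w y))"
          by (rule kb[OF t0])
        also have "\<dots> \<le> K * pk \<tau> (x - y) * ((A * wgt \<theta> y + B * wgt \<theta> y) * (D * wgt \<theta> y))"
          using elim nn K pk_pos[OF t0, of "x - y"] by (intro mult_left_mono mult_mono add_mono) auto
        also have "\<dots> = (K * ((A + B) * D)) * (pk \<tau> (x - y) * (wgt \<theta> y * wgt \<theta> y))"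
          by (simp add: algebra_simps)
        finally show ?case by (simp add: wgt_add)
      qed
    qed
    from cb[OF t _ _ this] have "norm (LINT y|lebesgue. ?G y) \<le> C * (K * ((A + B) * D)) * \<tau> powr (-1/2) * wgt (DIM('a) + 1) x"
      using iv iw K nn by (auto intro!: borel_measurable_diff)
    then show "norm (oconv \<tau> v x - oconv \<tau> w x) \<le> C * K * ((A + B) * D) * \<tau> powr (-1/2) * wgt (DIM('a) + 1) x"
      unfolding oconv_def using iv iw by (simp add: mult_ac)
  qed
qed

text \<open>For q = (\<tau>'-\<tau>)/\<tau> at most 1 the Lipschitz bound in time is used, for
  larger q the sizes of the two kernels separately; both are at most a multiple of q^(1/4). Any
  positive exponent below 1/2 would leave an integrable power of \<tau>, and 1/4 is a convenient
  choice.\<close>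

lemma oconv_time_diff_le:
  fixes \<theta> :: real
  assumes \<theta>: "2 * \<theta> \<ge> real DIM('a::euclidean_space) + 1"
  shows "\<exists>C>0. \<forall>\<tau>>0. \<forall>\<tau>'\<in>{\<tau>..1}. \<forall>(v::'a \<Rightarrow> 'a) A x. dominated \<theta> A v \<longrightarrow> 0 \<le> A \<longrightarrow>
     norm (oconv \<tau>' v x - oconv \<tau> v x) \<le> C * A\<^sup>2 * (\<tau>' - \<tau>) powr (1/4) * \<tau> powr (-3/4) * wgt (DIM('a) + 1) x"
proof -
  obtain K where K: "K > 0" and kb: "\<And>\<tau> (z::'a) w w'. \<tau> > 0 \<Longrightarrow> norm (oseen \<tau> z w - oseen \<tau> z w') \<le> K * pk \<tau> z * ((norm w + norm w') * norm (w - w'))"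
    using oseen_diff_le by blast
  obtain L where L: "L > 0" and lb': "\<forall>\<tau>>0. \<forall>\<tau>'\<ge>\<tau>. \<forall>z w :: 'a. norm (oseen \<tau>' z w - oseen \<tau> z w) \<le> L * ((\<tau>' - \<tau>) / \<tau>) * pk \<tau> z * (norm w)\<^sup>2"
    using oseen_time_diff_le[where 'a='a] by (elim exE conjE) (rule that)
  have lb: "norm (oseen \<tau>' z w - oseen \<tau> z w) \<le> L * ((\<tau>' - \<tau>) / \<tau>) * pk \<tau> z * (norm w)\<^sup>2"
    if "\<tau> > 0" "\<tau>' \<ge> \<tau>" for \<tau> \<tau>' and z w :: 'a
    using lb' that by simp
  obtain C where C: "C > 0" and cb: "\<And>\<tau> (G::'a \<Rightarrow> 'a) B x. \<tau> \<in> {0<..1} \<Longrightarrow> G \<in> borel_measurable lebesgue \<Longrightarrow> 0 \<le> B \<Longrightarrow>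
     (AE y in lebesgue. norm (G y) \<le> B * (pk \<tau> (x - y) * wgt (2 * \<theta>) y)) \<Longrightarrow>
     integrable lebesgue G \<and> norm (LINT y|lebesgue. G y) \<le> C * B * \<tau> powr (-1/2) * wgt (DIM('a) + 1) x"
    using conv_dominated[OF \<theta>] by blast
  define M where "M = 2 * K + L"
  have M: "M > 0" using K L by (simp add: M_def)
  show ?thesis
  proof (intro exI[of _ "C * M"] conjI ballI allI impI)
    show "C * M > 0" using C M by simp
    fix \<tau> \<tau>' A :: real and v :: "'a \<Rightarrow> 'a" and x :: 'a
    assume t0: "\<tau> > 0" and t': "\<tau>' \<in> {\<tau>..1}" and v: "dominated \<theta> A v" and A: "0 \<le> A"
    have t: "\<tau> \<in> {0<..1}" "\<tau>' > 0" "\<tau> \<le> \<tau>'" using t0 t' by auto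
    have \<theta>': "2 * \<theta> > real DIM('a)" using \<theta> by simp
    have i: "integrable lebesgue (\<lambda>y. oseen \<tau> (x - y) (v y))" if "\<tau> > 0" for \<tau>
      by (rule neumann_nonlinear_eq(1)[OF that _ dominated_square_integrable[OF v \<theta>']]) (use v in \<open>simp add: dominated_def\<close>)
    let ?G = "\<lambda>y. oseen \<tau>' (x - y) (v y) - oseen \<tau> (x - y) (v y)"
    define q where "q = (\<tau>' - \<tau>) / \<tau>"
    have q: "q \<ge> 0" using t t0 by (simp add: q_def)
    have pt: "norm (oseen \<tau>' z w - oseen \<tau> z w) \<le> M * q powr (1/4) * pk \<tau> z * (norm w)\<^sup>2" for z w :: 'a
    proof (cases "q \<le> 1")
      case True
      have P: "pk \<tau> z * (norm w)\<^sup>2 \<ge> 0" using pk_pos[OF t0, of z] by simp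
      have "q \<le> q powr (1/4)"
      proof (cases "q = 0")
        case False
        then have "q powr 1 \<le> q powr (1/4)" using True q by (intro powr_mono') auto
        then show ?thesis using q by simp
      qed simp
      then have "L * q \<le> M * q powr (1/4)" using L K q by (intro mult_mono) (auto simp: M_def)
      then have "L * q * (pk \<tau> z * (norm w)\<^sup>2) \<le> M * q powr (1/4) * (pk \<tau> z * (norm w)\<^sup>2)"
        by (rule mult_right_mono[OF _ P])
      then show ?thesis using lb[OF t0 t(3), of z w] by (simp add: q_def mult_ac)
    next
      case False
      have P: "pk \<tau> z * (norm w)\<^sup>2 \<ge> 0" using pk_pos[OF t0, of z] by simp
      have "1 \<le> q powr (1/4)" using False by (intro ge_one_powr_ge_zero) auto
      then have M1: "2 * K * 1 \<le> M * q powr (1/4)" using L K by (intro mult_mono) (auto simp: M_def)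
      have pkm: "pk \<tau>' z \<le> pk \<tau> z"
        unfolding pk_def using t t0 by (intro divide_left_mono power_mono add_mono mult_pos_pos zero_less_power) (auto intro: add_pos_nonneg)
      have "norm (oseen \<tau>' z w - oseen \<tau> z w) \<le> norm (oseen \<tau>' z w) + norm (oseen \<tau> z w)" by (rule norm_triangle_ineq4)
      also have "\<dots> \<le> K * pk \<tau>' z * (norm w)\<^sup>2 + K * pk \<tau> z * (norm w)\<^sup>2"
        using kb[OF t(2), of z w 0] kb[OF t0, of z w 0] by (intro add_mono) (auto simp: power2_eq_square)
      also have "\<dots> \<le> K * pk \<tau> z * (norm w)\<^sup>2 + K * pk \<tau> z * (norm w)\<^sup>2"
        using K pkm by (intro add_mono mult_right_mono mult_left_mono order_refl) auto
      also have "\<dots> = 2 * K * 1 * (pk \<tau> z * (norm w)\<^sup>2)" by simp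
      also have "\<dots> \<le> M * q powr (1/4) * (pk \<tau> z * (norm w)\<^sup>2)" by (rule mult_right_mono[OF M1 P])
      finally show ?thesis by (simp add: mult_ac)
    qed
    have "AE y in lebesgue. norm (?G y) \<le> (M * q powr (1/4) * A\<^sup>2) * (pk \<tau> (x - y) * wgt (2 * \<theta>) y)"
    proof -
      have "AE y in lebesgue. norm (v y) \<le> A * wgt \<theta> y" using v by (auto simp: dominated_def)
      then show ?thesis
      proof eventually_elim
        case (elim y)
        have "(norm (v y))\<^sup>2 \<le> (A * wgt \<theta> y)\<^sup>2" using elim by (intro power_mono) auto
        also have "\<dots> = A\<^sup>2 * wgt (2 * \<theta>) y"
          using wgt_add[of \<theta> y \<theta>] by (simp add: power2_eq_square mult_ac)
        finally have s: "(norm (v y))\<^sup>2 \<le> A\<^sup>2 * wgt (2 * \<theta>) y" .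
        have "norm (?G y) \<le> M * q powr (1/4) * pk \<tau> (x - y) * (norm (v y))\<^sup>2" by (rule pt)
        also have "\<dots> \<le> M * q powr (1/4) * pk \<tau> (x - y) * (A\<^sup>2 * wgt (2 * \<theta>) y)"
          using s M pk_pos[OF t0, of "x - y"] by (intro mult_left_mono) auto
        finally show ?case by (simp add: mult_ac)
      qed
    qed
    from cb[OF t(1) _ _ this] have "norm (LINT y|lebesgue. ?G y) \<le> C * (M * q powr (1/4) * A\<^sup>2) * \<tau> powr (-1/2) * wgt (DIM('a) + 1) x"
      using i[OF t0] i[OF t(2)] M by (auto intro!: borel_measurable_diff)
    then have n: "norm (oconv \<tau>' v x - oconv \<tau> v x) \<le> C * (M * q powr (1/4) * A\<^sup>2) * \<tau> powr (-1/2) * wgt (DIM('a) + 1) x"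
      unfolding oconv_def using i[OF t0] i[OF t(2)] by simp
    have "\<tau> powr (-1/2) = \<tau> powr (1/4) * \<tau> powr (-3/4)" by (simp flip: powr_add)
    moreover have "q powr (1/4) * \<tau> powr (1/4) = (\<tau>' - \<tau>) powr (1/4)"
      using t t0 by (simp add: q_def flip: powr_mult)
    ultimately have e: "q powr (1/4) * \<tau> powr (-1/2) = (\<tau>' - \<tau>) powr (1/4) * \<tau> powr (-3/4)"
      by (simp only: mult.assoc[symmetric])
    have "C * (M * q powr (1/4) * A\<^sup>2) * \<tau> powr (-1/2) * wgt (DIM('a) + 1) x = C * M * A\<^sup>2 * (q powr (1/4) * \<tau> powr (-1/2)) * wgt (DIM('a) + 1) x"
      by (simp only: mult_ac)
    with n show "norm (oconv \<tau>' v x - oconv \<tau> v x) \<le> C * M * A\<^sup>2 * (\<tau>' - \<tau>) powr (1/4) * \<tau> powr (-3/4) * wgt (DIM('a) + 1) x"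
      unfolding e by (simp only: mult.assoc)
  qed
qed

section \<open>Singular time integrals and the Duhamel operator\<close>

lemma powr_tail_integral:
  fixes a b e :: real
  assumes e: "e > 0" and ab: "a < b"
  shows "set_integrable lebesgue {a<..<b} (\<lambda>s. (b - s) powr (e - 1))"
    and "(LINT s:{a<..<b}|lebesgue. (b - s) powr (e - 1)) = (b - a) powr e / e"
proof -
  have ei: "einterval (ereal a) (ereal b) = {a<..<b}" by (simp add: einterval_eq)
  let ?F = "\<lambda>s. - ((b - s) powr e) / e"
  let ?f = "\<lambda>s. (b - s) powr (e - 1)"
  have D: "(?F has_real_derivative ?f x) (at x)" if "x < b" for x
    using that e by (auto intro!: derivative_eq_intros)
  have c: "isCont ?f x" if "x < b" for x
    using that by (intro continuous_intros) auto
  have A: "((?F \<circ> real_of_ereal) \<longlongrightarrow> - ((b - a) powr e) / e) (at_right (ereal a))"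
    unfolding ereal_tendsto_simps1 comp_def by (intro tendsto_intros) (use e ab in auto)
  have "((\<lambda>s. (b - s) powr e) \<longlongrightarrow> 0 powr e) (at_left b)"
  proof (rule tendsto_powr')
    show "((\<lambda>s. b - s) \<longlongrightarrow> 0) (at_left b)" by (auto intro!: tendsto_eq_intros)
    show "((\<lambda>s. e) \<longlongrightarrow> e) (at_left b)" by simp
    show "0 \<noteq> (0::real) \<or> 0 < e \<and> (\<forall>\<^sub>F s in at_left b. 0 \<le> b - s)"
      using e by (auto simp: eventually_at_filter)
  qed
  then have "((\<lambda>s. - ((b - s) powr e) / e) \<longlongrightarrow> - 0 / e) (at_left b)"
    using e by (intro tendsto_intros) auto
  then have B: "((?F \<circ> real_of_ereal) \<longlongrightarrow> 0) (at_left (ereal b))"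
    unfolding ereal_tendsto_simps1 by simp
  note F = interval_integral_FTC_nonneg[where F="?F" and f="?f" and a="ereal a" and b="ereal b", OF _ _ _ _ A B]
  have i: "set_integrable lborel {a<..<b} ?f"
    using F(1) D c ab unfolding ei by (auto simp: AE_I2)
  have m: "(\<lambda>s. indicator {a<..<b} s *\<^sub>R (b - s) powr (e - 1)) \<in> borel_measurable lborel" by measurable
  show "set_integrable lebesgue {a<..<b} ?f"
    using i unfolding set_integrable_def integrable_completion[OF m] .
  have "(LBINT x=ereal a..ereal b. ?f x) = 0 - (- ((b - a) powr e) / e)"
    by (rule F(2)) (use D c ab in auto)
  then have "(LINT s:{a<..<b}|lborel. ?f s) = (b - a) powr e / e"
    using ab by (simp add: interval_lebesgue_integral_def ei)
  then show "(LINT s:{a<..<b}|lebesgue. ?f s) = (b - a) powr e / e"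
    unfolding set_lebesgue_integral_def integral_completion[OF m] .
qed

text \<open>Measurability in s is derived from continuity on S, which is how a curve with norm
  continuity can be integrated in time at each fixed x.\<close>

lemma set_integral_dominated:
  fixes f :: "real \<Rightarrow> 'v::{banach, second_countable_topology}"
  assumes S: "S \<in> sets borel" and f: "continuous_on S f" and g: "set_integrable lebesgue S g"
    and le: "\<And>s. s \<in> S \<Longrightarrow> norm (f s) \<le> g s"
  shows "set_integrable lebesgue S f" and "norm (LINT s:S|lebesgue. f s) \<le> (LINT s:S|lebesgue. g s)"
proof -
  have m: "(\<lambda>s. indicator S s *\<^sub>R f s) \<in> borel_measurable borel"
    by (rule borel_measurable_continuous_on_indicator[OF S f])
  then have m': "(\<lambda>s. indicator S s *\<^sub>R f s) \<in> borel_measurable lebesgue"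
    by (intro measurable_completion) simp
  have b: "norm (indicator S s *\<^sub>R f s) \<le> indicator S s *\<^sub>R g s" for s
    using le by (auto simp: indicator_def)
  show i: "set_integrable lebesgue S f"
    unfolding set_integrable_def
    by (rule Bochner_Integration.integrable_bound[OF g[unfolded set_integrable_def] m'])
       (use b in \<open>auto intro!: AE_I2 intro: order_trans[OF _ abs_ge_self]\<close>)
  show "norm (LINT s:S|lebesgue. f s) \<le> (LINT s:S|lebesgue. g s)"
    unfolding set_lebesgue_integral_def
    by (rule norm_integral_le_AE) (use i g b in \<open>auto simp: set_integrable_def\<close>)
qed

definition duhamel :: "(real \<Rightarrow> 'a::euclidean_space \<Rightarrow> 'a) \<Rightarrow> real \<Rightarrow> 'a \<Rightarrow> 'a" where
  "duhamel u t x = (LINT s:{0<..<t}|lebesgue. oconv (t - s) (u s) x)"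

text \<open>Bound and norm continuity in almost everywhere form, on the open interval only: an
  arbitrary solution is known up to null sets, and at time 0 it converges merely in the
  distributional sense.\<close>

definition admissible :: "real \<Rightarrow> real \<Rightarrow> real \<Rightarrow> (real \<Rightarrow> 'a::euclidean_space \<Rightarrow> 'a) \<Rightarrow> bool" where
  "admissible \<theta> T R u \<longleftrightarrow> 0 \<le> R \<and> (\<forall>s\<in>{0<..<T}. dominated \<theta> R (u s) \<and>
     (\<forall>\<epsilon>>0. \<exists>\<delta>>0. \<forall>r\<in>{0<..<T}. \<bar>r - s\<bar> < \<delta> \<longrightarrow> (AE y in lebesgue. norm (u r y - u s y) \<le> \<epsilon> * wgt \<theta> y)))"

text \<open>Freezes one constant for all slice estimates. The output weight \<open>W\<close> has
  exponent d+1 whatever \<theta> is; for \<theta> \<le> d+1 it is at most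
  \<open>wgt \<theta>\<close>, and this closes the fixed point argument.\<close>

locale oseen_bounds =
  fixes \<theta> C :: real and W :: "'a::euclidean_space \<Rightarrow> real"
  assumes W_def: "W = wgt (real (DIM('a) + 1))" and two_theta: "2 * \<theta> \<ge> real DIM('a) + 1" and C_pos: "C > 0"
    and oconv_diff: "\<And>\<tau> (v::'a \<Rightarrow> 'a) w A B D x. \<tau> > 0 \<Longrightarrow> \<tau> \<le> 1 \<Longrightarrow> dominated \<theta> A v \<Longrightarrow> dominated \<theta> B w \<Longrightarrow>
      (AE y in lebesgue. norm (v y - w y) \<le> D * wgt \<theta> y) \<Longrightarrow> 0 \<le> A \<Longrightarrow> 0 \<le> B \<Longrightarrow> 0 \<le> D \<Longrightarrow>
      norm (oconv \<tau> v x - oconv \<tau> w x) \<le> C * ((A + B) * D) * \<tau> powr (-1/2) * W x"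
    and oconv_time_diff: "\<And>\<tau> \<tau>' (v::'a \<Rightarrow> 'a) A x. \<tau> > 0 \<Longrightarrow> \<tau> \<le> \<tau>' \<Longrightarrow> \<tau>' \<le> 1 \<Longrightarrow> dominated \<theta> A v \<Longrightarrow> 0 \<le> A \<Longrightarrow>
      norm (oconv \<tau>' v x - oconv \<tau> v x) \<le> C * A\<^sup>2 * (\<tau>' - \<tau>) powr (1/4) * \<tau> powr (-3/4) * W x"

lemma oseen_bounds_exist:
  assumes "2 * \<theta> \<ge> real DIM('a::euclidean_space) + 1"
  shows "\<exists>C. oseen_bounds \<theta> C (wgt (real (DIM('a) + 1)) :: 'a \<Rightarrow> real)"
proof -
  obtain C1 where C1: "C1 > 0" and b1: "\<forall>\<tau>\<in>{0<..1}. \<forall>(v::'a \<Rightarrow> 'a) w A B D x. dominated \<theta> A v \<longrightarrow> dominated \<theta> B w \<longrightarrow>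
     (AE y in lebesgue. norm (v y - w y) \<le> D * wgt \<theta> y) \<longrightarrow> 0 \<le> A \<longrightarrow> 0 \<le> B \<longrightarrow> 0 \<le> D \<longrightarrow>
     norm (oconv \<tau> v x - oconv \<tau> w x) \<le> C1 * ((A + B) * D) * \<tau> powr (-1/2) * wgt (DIM('a) + 1) x"
    using oconv_diff_le[OF assms] by (elim exE conjE) (rule that)
  obtain C2 where C2: "C2 > 0" and b2: "\<forall>\<tau>>0. \<forall>\<tau>'\<in>{\<tau>..1}. \<forall>(v::'a \<Rightarrow> 'a) A x. dominated \<theta> A v \<longrightarrow> 0 \<le> A \<longrightarrow>
     norm (oconv \<tau>' v x - oconv \<tau> v x) \<le> C2 * A\<^sup>2 * (\<tau>' - \<tau>) powr (1/4) * \<tau> powr (-3/4) * wgt (DIM('a) + 1) x"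
    using oconv_time_diff_le[OF assms] by (elim exE conjE) (rule that)
  have "oseen_bounds \<theta> (max C1 C2) (wgt (real (DIM('a) + 1)) :: 'a \<Rightarrow> real)"
  proof
    show "(wgt (real (DIM('a) + 1)) :: 'a \<Rightarrow> real) = wgt (real (DIM('a) + 1))" ..
    show "2 * \<theta> \<ge> real DIM('a) + 1" by fact
    show "max C1 C2 > 0" using C1 by simp
    fix \<tau> A B D :: real and v w :: "'a \<Rightarrow> 'a" and x :: 'a
    assume a: "\<tau> > 0" "\<tau> \<le> 1" "dominated \<theta> A v" "dominated \<theta> B w"
      "AE y in lebesgue. norm (v y - w y) \<le> D * wgt \<theta> y" "0 \<le> A" "0 \<le> B" "0 \<le> D"
    have "norm (oconv \<tau> v x - oconv \<tau> w x) \<le> C1 * ((A + B) * D) * \<tau> powr (-1/2) * wgt (DIM('a) + 1) x"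
      using b1[rule_format, of \<tau> A v B w D x] a by simp
    also have "\<dots> \<le> max C1 C2 * ((A + B) * D) * \<tau> powr (-1/2) * wgt (DIM('a) + 1) x"
      using a by (intro mult_right_mono) auto
    finally show "norm (oconv \<tau> v x - oconv \<tau> w x) \<le> max C1 C2 * ((A + B) * D) * \<tau> powr (-1/2) * wgt (DIM('a) + 1) x" .
  next
    fix \<tau> \<tau>' A :: real and v :: "'a \<Rightarrow> 'a" and x :: 'a
    assume a: "\<tau> > 0" "\<tau> \<le> \<tau>'" "\<tau>' \<le> 1" "dominated \<theta> A v" "0 \<le> A"
    have "norm (oconv \<tau>' v x - oconv \<tau> v x) \<le> C2 * A\<^sup>2 * (\<tau>' - \<tau>) powr (1/4) * \<tau> powr (-3/4) * wgt (DIM('a) + 1) x"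
      using b2[rule_format, of \<tau> \<tau>' A v x] a by simp
    also have "\<dots> \<le> max C1 C2 * A\<^sup>2 * (\<tau>' - \<tau>) powr (1/4) * \<tau> powr (-3/4) * wgt (DIM('a) + 1) x"
      by (intro mult_right_mono) auto
    finally show "norm (oconv \<tau>' v x - oconv \<tau> v x) \<le> max C1 C2 * A\<^sup>2 * (\<tau>' - \<tau>) powr (1/4) * \<tau> powr (-3/4) * wgt (DIM('a) + 1) x" .
  qed
  then show ?thesis ..
qed

context oseen_bounds
begin

lemma W_nonneg [simp]: "0 \<le> W x"
  by (simp add: W_def)

lemma W_le_1: "W x \<le> 1"
  unfolding W_def by (rule wgt_le_1) simp

lemma oconv_bound:
  fixes v :: "'a \<Rightarrow> 'a"
  assumes "\<tau> > 0" "\<tau> \<le> 1" "dominated \<theta> A v" "0 \<le> A"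
  shows "norm (oconv \<tau> v x) \<le> C * A\<^sup>2 * \<tau> powr (-1/2) * W x"
proof -
  have "norm (oconv \<tau> v x - oconv \<tau> (\<lambda>_. 0) x) \<le> C * ((A + 0) * A) * \<tau> powr (-1/2) * W x"
    by (rule oconv_diff[OF assms(1-3) dominated_zero]) (use assms in \<open>auto simp: dominated_def\<close>)
  then show ?thesis by (simp add: oconv_def power2_eq_square)
qed

lemma oconv_time_diff_abs:
  fixes v :: "'a \<Rightarrow> 'a"
  assumes c: "c > 0" "c \<le> \<tau>" "c \<le> \<tau>'" "\<tau> \<le> 1" "\<tau>' \<le> 1" and v: "dominated \<theta> A v" "0 \<le> A"
  shows "norm (oconv \<tau>' v x - oconv \<tau> v x) \<le> C * A\<^sup>2 * \<bar>\<tau>' - \<tau>\<bar> powr (1/4) * c powr (-3/4) * W x"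
proof -
  have le: "norm (oconv \<tau>' v x - oconv \<tau> v x) \<le> C * A\<^sup>2 * \<bar>\<tau>' - \<tau>\<bar> powr (1/4) * c powr (-3/4) * W x"
    if "\<tau> \<le> \<tau>'" "c \<le> \<tau>" "\<tau>' \<le> 1" for \<tau> \<tau>'
  proof -
    have "norm (oconv \<tau>' v x - oconv \<tau> v x) \<le> C * A\<^sup>2 * (\<tau>' - \<tau>) powr (1/4) * \<tau> powr (-3/4) * W x"
      using that c v by (intro oconv_time_diff) auto
    also have "\<dots> \<le> C * A\<^sup>2 * (\<tau>' - \<tau>) powr (1/4) * c powr (-3/4) * W x"
      using that c C_pos by (intro mult_right_mono mult_left_mono powr_mono2') auto
    finally show ?thesis using that(1) by simp
  qed
  show ?thesis
  proof (cases "\<tau> \<le> \<tau>'")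
    case True
    then show ?thesis using c by (intro le) auto
  next
    case False
    then have "norm (oconv \<tau> v x - oconv \<tau>' v x) \<le> C * A\<^sup>2 * \<bar>\<tau> - \<tau>'\<bar> powr (1/4) * c powr (-3/4) * W x"
      using c by (intro le) auto
    then show ?thesis by (simp only: norm_minus_commute abs_minus_commute)
  qed
qed

text \<open>Field and elapsed time both vary with s. They are changed one after the other: first the
  field, at elapsed time t - r, then the elapsed time with the field u(s) fixed, each at cost
  e/2.\<close>

lemma oconv_continuous_time:
  fixes u :: "real \<Rightarrow> 'a \<Rightarrow> 'a"
  assumes u: "admissible \<theta> T R u" and t: "t \<le> T" "t \<le> 1"
  shows "continuous_on {0<..<t} (\<lambda>s. oconv (t - s) (u s) x)"
  unfolding continuous_on_iff
proof (intro ballI allI impI)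
  fix s e :: real assume s: "s \<in> {0<..<t}" and e: "e > 0"
  have R: "R \<ge> 0" using u by (simp add: admissible_def)
  \<comment> \<open>Half the distance to the singular endpoint: for |r-s| < c all elapsed times stay
    at least c.\<close>
  define c where "c = (t - s) / 2"
  have c: "c > 0" using s by (simp add: c_def)
  define K1 where "K1 = C * ((R + R) * 1) * c powr (-1/2) + 1"
  define K2 where "K2 = C * R\<^sup>2 * c powr (-3/4) + 1"
  have K: "K1 \<ge> 1" "K2 \<ge> 1" using C_pos R by (auto simp: K1_def K2_def)
  define \<epsilon> where "\<epsilon> = e / (2 * K1)"
  \<comment> \<open>The fourth power inverts the exponent 1/4 of the time estimate. The summand 1 in
    \<open>K1\<close> and \<open>K2\<close> keeps the divisors positive even when R = 0.\<close>
  define \<eta> where "\<eta> = (e / (2 * K2)) ^ 4"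
  have pos: "\<epsilon> > 0" "\<eta> > 0" using e K by (auto simp: \<epsilon>_def \<eta>_def)
  have "s \<in> {0<..<T}" using s t by simp
  then obtain \<delta> where \<delta>: "\<delta> > 0" and cont: "\<And>r. r \<in> {0<..<T} \<Longrightarrow> \<bar>r - s\<bar> < \<delta> \<Longrightarrow> AE y in lebesgue. norm (u r y - u s y) \<le> \<epsilon> * wgt \<theta> y"
    and us: "dominated \<theta> R (u s)"
    using u pos(1) unfolding admissible_def by blast
  show "\<exists>d>0. \<forall>r\<in>{0<..<t}. dist r s < d \<longrightarrow> dist (oconv (t - r) (u r) x) (oconv (t - s) (u s) x) < e"
  proof (intro exI[of _ "min \<delta> (min c \<eta>)"] conjI ballI impI)
    show "min \<delta> (min c \<eta>) > 0" using \<delta> c pos by simp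
    fix r assume r: "r \<in> {0<..<t}" and d: "dist r s < min \<delta> (min c \<eta>)"
    have rs: "\<bar>r - s\<bar> < \<delta>" "\<bar>r - s\<bar> < c" "\<bar>r - s\<bar> < \<eta>" using d by (auto simp: dist_real_def)
    have rT: "r \<in> {0<..<T}" using r t by simp
    then have ur: "dominated \<theta> R (u r)" using u by (simp add: admissible_def)
    have tr: "c \<le> t - r" "t - r \<le> 1" "c \<le> t - s" "t - s \<le> 1" "t - r > 0"
    proof -
      have "0 < s" "s < t" "0 < r" "r < t" using s r by auto
      moreover have "r - s < c" by (rule le_less_trans[OF abs_ge_self rs(2)])
      moreover have "2 * c = t - s" by (simp add: c_def)
      ultimately show "c \<le> t - r" "t - r \<le> 1" "c \<le> t - s" "t - s \<le> 1" "t - r > 0"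
        using t c by linarith+
    qed
    have "norm (oconv (t - r) (u r) x - oconv (t - r) (u s) x) \<le> C * ((R + R) * \<epsilon>) * (t - r) powr (-1/2) * W x"
      by (rule oconv_diff[OF tr(5) tr(2) ur us cont[OF rT rs(1)] R R]) (use pos in simp)
    also have "\<dots> \<le> C * ((R + R) * \<epsilon>) * c powr (-1/2) * 1"
      using tr c C_pos R pos W_le_1 by (intro mult_mono mult_left_mono powr_mono2') auto
    also have "\<dots> = (K1 - 1) * \<epsilon>" by (simp add: K1_def)
    also have "\<dots> < K1 * \<epsilon>" using pos by simp
    also have "\<dots> = e / 2" using K by (simp add: \<epsilon>_def)
    finally have A: "norm (oconv (t - r) (u r) x - oconv (t - r) (u s) x) < e / 2" .
    have "norm (oconv (t - r) (u s) x - oconv (t - s) (u s) x) \<le> C * R\<^sup>2 * \<bar>(t - r) - (t - s)\<bar> powr (1/4) * c powr (-3/4) * W x"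
      by (rule oconv_time_diff_abs[OF c tr(3) tr(1) tr(4) tr(2) us R])
    also have "\<dots> \<le> C * R\<^sup>2 * \<eta> powr (1/4) * c powr (-3/4) * 1"
      using rs C_pos R W_le_1 by (intro mult_mono mult_left_mono mult_right_mono powr_mono2) auto
    also have "\<dots> = (K2 - 1) * \<eta> powr (1/4)" by (simp add: K2_def)
    also have "\<dots> \<le> K2 * \<eta> powr (1/4)" by (intro mult_right_mono) auto
    also have "\<eta> powr (1/4) = e / (2 * K2)"
    proof -
      have p: "e / (2 * K2) > 0" using e K by simp
      have "\<eta> = (e / (2 * K2)) powr (real 4)" unfolding \<eta>_def by (rule powr_realpow[OF p, symmetric])
      then have "\<eta> powr (1/4) = (e / (2 * K2)) powr (real 4 * (1/4))" by (simp only: powr_powr)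
      then show ?thesis using p e K by simp
    qed
    also have "K2 * (e / (2 * K2)) = e / 2" using K by simp
    finally have B: "norm (oconv (t - r) (u s) x - oconv (t - s) (u s) x) \<le> e / 2" .
    have "norm (oconv (t - r) (u r) x - oconv (t - s) (u s) x) < e"
      using norm_triangle_ineq[of "oconv (t - r) (u r) x - oconv (t - r) (u s) x" "oconv (t - r) (u s) x - oconv (t - s) (u s) x"] A B
      by simp
    then show "dist (oconv (t - r) (u r) x) (oconv (t - s) (u s) x) < e" by (simp add: dist_norm)
  qed
qed

lemma half_integral:
  fixes t :: real
  assumes "0 \<le> t"
  shows "set_integrable lebesgue {0<..<t} (\<lambda>s. (t - s) powr (-1/2))"
    and "(LINT s:{0<..<t}|lebesgue. (t - s) powr (-1/2)) = 2 * t powr (1/2)"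
proof -
  have "set_integrable lebesgue {0<..<t} (\<lambda>s. (t - s) powr (-1/2)) \<and> (LINT s:{0<..<t}|lebesgue. (t - s) powr (-1/2)) = 2 * t powr (1/2)"
  proof (cases "t = 0")
    case False
    then show ?thesis using powr_tail_integral[of "1/2" 0 t] assms by simp
  qed (simp add: set_integrable_def set_lebesgue_integral_def)
  then show "set_integrable lebesgue {0<..<t} (\<lambda>s. (t - s) powr (-1/2))"
    "(LINT s:{0<..<t}|lebesgue. (t - s) powr (-1/2)) = 2 * t powr (1/2)" by auto
qed

lemma quarter_integral:
  fixes t :: real
  assumes "0 \<le> t"
  shows "set_integrable lebesgue {0<..<t} (\<lambda>s. (t - s) powr (-3/4))"
    and "(LINT s:{0<..<t}|lebesgue. (t - s) powr (-3/4)) = 4 * t powr (1/4)"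
proof -
  have "set_integrable lebesgue {0<..<t} (\<lambda>s. (t - s) powr (-3/4)) \<and> (LINT s:{0<..<t}|lebesgue. (t - s) powr (-3/4)) = 4 * t powr (1/4)"
  proof (cases "t = 0")
    case False
    then show ?thesis using powr_tail_integral[of "1/4" 0 t] assms by simp
  qed (simp add: set_integrable_def set_lebesgue_integral_def)
  then show "set_integrable lebesgue {0<..<t} (\<lambda>s. (t - s) powr (-3/4))"
    "(LINT s:{0<..<t}|lebesgue. (t - s) powr (-3/4)) = 4 * t powr (1/4)" by auto
qed

lemma duhamel_integrable:
  fixes u :: "real \<Rightarrow> 'a \<Rightarrow> 'a"
  assumes u: "admissible \<theta> T R u" and t: "0 \<le> t" "t \<le> T" "t \<le> 1"
  shows "set_integrable lebesgue {0<..<t} (\<lambda>s. oconv (t - s) (u s) x)"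
    and "norm (duhamel u t x) \<le> 2 * C * R\<^sup>2 * t powr (1/2) * W x"
proof -
  have R: "R \<ge> 0" using u by (simp add: admissible_def)
  have b: "norm (oconv (t - s) (u s) x) \<le> C * R\<^sup>2 * W x * (t - s) powr (-1/2)" if "s \<in> {0<..<t}" for s
    using oconv_bound[of "t - s" R "u s" x] that t u R by (auto simp: admissible_def mult_ac)
  have g: "set_integrable lebesgue {0<..<t} (\<lambda>s. C * R\<^sup>2 * W x * (t - s) powr (-1/2))"
    by (intro set_integrable_mult_right half_integral t)
  note D = set_integral_dominated[OF _ oconv_continuous_time[OF u t(2) t(3)] g b]
  show "set_integrable lebesgue {0<..<t} (\<lambda>s. oconv (t - s) (u s) x)" by (rule D) auto
  have "norm (duhamel u t x) \<le> (LINT s:{0<..<t}|lebesgue. C * R\<^sup>2 * W x * (t - s) powr (-1/2))"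
    unfolding duhamel_def by (rule D) auto
  also have "\<dots> = C * R\<^sup>2 * W x * (2 * t powr (1/2))"
    by (simp only: set_integral_mult_right half_integral(2)[OF t(1)])
  finally show "norm (duhamel u t x) \<le> 2 * C * R\<^sup>2 * t powr (1/2) * W x" by (simp add: mult_ac)
qed

text \<open>The gap D may depend on s: the uniqueness proof inserts an exponential, the contraction
  of the iteration a constant.\<close>

lemma duhamel_diff_le:
  fixes u v :: "real \<Rightarrow> 'a \<Rightarrow> 'a"
  assumes u: "admissible \<theta> T R u" and v: "admissible \<theta> T S v" and t: "0 \<le> t" "t \<le> T" "t \<le> 1"
    and uv: "\<And>s. s \<in> {0<..<t} \<Longrightarrow> AE y in lebesgue. norm (u s y - v s y) \<le> D s * wgt \<theta> y"
    and D: "\<And>s. s \<in> {0<..<t} \<Longrightarrow> 0 \<le> D s" "set_integrable lebesgue {0<..<t} (\<lambda>s. D s * (t - s) powr (-1/2))"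
  shows "norm (duhamel u t x - duhamel v t x) \<le> C * (R + S) * (LINT s:{0<..<t}|lebesgue. D s * (t - s) powr (-1/2)) * W x"
proof -
  have R: "R \<ge> 0" "S \<ge> 0" using u v by (auto simp: admissible_def)
  have b: "norm (oconv (t - s) (u s) x - oconv (t - s) (v s) x) \<le> C * (R + S) * W x * (D s * (t - s) powr (-1/2))" if s: "s \<in> {0<..<t}" for s
  proof -
    have "norm (oconv (t - s) (u s) x - oconv (t - s) (v s) x) \<le> C * ((R + S) * D s) * (t - s) powr (-1/2) * W x"
      by (rule oconv_diff[OF _ _ _ _ uv[OF s] R D(1)[OF s]]) (use s t u v in \<open>auto simp: admissible_def\<close>)
    then show ?thesis by (simp add: mult_ac)
  qed
  have g: "set_integrable lebesgue {0<..<t} (\<lambda>s. C * (R + S) * W x * (D s * (t - s) powr (-1/2)))"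
    by (intro set_integrable_mult_right D)
  have "duhamel u t x - duhamel v t x = (LINT s:{0<..<t}|lebesgue. oconv (t - s) (u s) x - oconv (t - s) (v s) x)"
    unfolding duhamel_def using duhamel_integrable(1)[OF u t] duhamel_integrable(1)[OF v t]
    by (rule set_integral_diff(2)[symmetric])
  also have "norm \<dots> \<le> (LINT s:{0<..<t}|lebesgue. C * (R + S) * W x * (D s * (t - s) powr (-1/2)))"
    by (rule set_integral_dominated(2)[OF _ _ g b])
       (auto intro!: continuous_on_diff oconv_continuous_time[OF u] oconv_continuous_time[OF v] t)
  also have "\<dots> = C * (R + S) * W x * (LINT s:{0<..<t}|lebesgue. D s * (t - s) powr (-1/2))"
    by (rule set_integral_mult_right)
  finally show ?thesis by (simp add: mult_ac)
qed

lemma duhamel_diff_le_const: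
  fixes u v :: "real \<Rightarrow> 'a \<Rightarrow> 'a"
  assumes u: "admissible \<theta> T R u" and v: "admissible \<theta> T S v" and t: "0 \<le> t" "t \<le> T" "t \<le> 1"
    and uv: "\<And>s. s \<in> {0<..<t} \<Longrightarrow> AE y in lebesgue. norm (u s y - v s y) \<le> D * wgt \<theta> y" and D: "0 \<le> D"
  shows "norm (duhamel u t x - duhamel v t x) \<le> 2 * C * (R + S) * D * t powr (1/2) * W x"
proof -
  have "norm (duhamel u t x - duhamel v t x) \<le> C * (R + S) * (LINT s:{0<..<t}|lebesgue. D * (t - s) powr (-1/2)) * W x"
    by (rule duhamel_diff_le[OF u v t uv D]) (assumption | intro set_integrable_mult_right half_integral t)+
  also have "(LINT s:{0<..<t}|lebesgue. D * (t - s) powr (-1/2)) = D * (2 * t powr (1/2))"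
    by (simp only: set_integral_mult_right half_integral(2)[OF t(1)])
  finally show ?thesis by (simp only: mult_ac)
qed

text \<open>On (0, t) the kernels at the two elapsed times are compared, which gives 4 (t'-t)^(1/4);
  on (t, t') the size bound gives 2 (t'-t)^(1/2), at most 2 (t'-t)^(1/4) as t' \<le> 1. Hence the
  constant 6.\<close>

lemma duhamel_time_diff_le:
  fixes u :: "real \<Rightarrow> 'a \<Rightarrow> 'a"
  assumes u: "admissible \<theta> T R u" and t: "0 < t" "t < t'" "t' \<le> T" "t' \<le> 1"
  shows "norm (duhamel u t' x - duhamel u t x) \<le> 6 * C * R\<^sup>2 * (t' - t) powr (1/4) * W x"
proof -
  have R: "R \<ge> 0" using u by (simp add: admissible_def)
  have i': "set_integrable lebesgue {0<..<t'} (\<lambda>s. oconv (t' - s) (u s) x)"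
    by (rule duhamel_integrable(1)[OF u]) (use t in auto)
  have i: "set_integrable lebesgue {0<..<t} (\<lambda>s. oconv (t - s) (u s) x)"
    by (rule duhamel_integrable(1)[OF u]) (use t in auto)
  have i1: "set_integrable lebesgue {0<..<t} (\<lambda>s. oconv (t' - s) (u s) x)"
    by (rule set_integrable_subset[OF i']) (use t in auto)
  have i2: "set_integrable lebesgue {t..<t'} (\<lambda>s. oconv (t' - s) (u s) x)"
    by (rule set_integrable_subset[OF i']) (use t in auto)
  have e: "{0<..<t'} = {0<..<t} \<union> {t..<t'}" using t by auto
  have s1: "duhamel u t' x = (LINT s:{0<..<t}|lebesgue. oconv (t' - s) (u s) x) + (LINT s:{t..<t'}|lebesgue. oconv (t' - s) (u s) x)"
    unfolding duhamel_def e by (rule set_integral_Un[OF _ i1 i2]) auto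
  \<comment> \<open>The endpoint t is a null set; without it the interval is open, as the integral
    of the singular power requires.\<close>
  have s2: "(LINT s:{t..<t'}|lebesgue. oconv (t' - s) (u s) x) = (LINT s:{t<..<t'}|lebesgue. oconv (t' - s) (u s) x)"
  proof -
    have "AE s in lebesgue. s \<noteq> t" using AE_lborel_singleton[of t] by (simp add: AE_completion)
    then have "AE s in lebesgue. indicator {t..<t'} s *\<^sub>R oconv (t' - s) (u s) x = indicator {t<..<t'} s *\<^sub>R oconv (t' - s) (u s) x"
      by eventually_elim (auto simp: indicator_def)
    moreover have "set_integrable lebesgue {t<..<t'} (\<lambda>s. oconv (t' - s) (u s) x)"
      by (rule set_integrable_subset[OF i']) (use t in auto)
    ultimately show ?thesis unfolding set_lebesgue_integral_def using i2
      by (intro integral_cong_AE) (auto simp: set_integrable_def)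
  qed
  have b2: "norm (oconv (t' - s) (u s) x) \<le> C * R\<^sup>2 * W x * (t' - s) powr (1/2 - 1)" if "s \<in> {t<..<t'}" for s
    using oconv_bound[of "t' - s" R "u s" x] that t u R by (auto simp: admissible_def mult_ac)
  have c2: "continuous_on {t<..<t'} (\<lambda>s. oconv (t' - s) (u s) x)"
    by (rule continuous_on_subset[OF oconv_continuous_time[OF u t(3,4)]]) (use t in auto)
  have g2: "set_integrable lebesgue {t<..<t'} (\<lambda>s. C * R\<^sup>2 * W x * (t' - s) powr (1/2 - 1))"
    by (intro set_integrable_mult_right powr_tail_integral t) auto
  have "norm (LINT s:{t<..<t'}|lebesgue. oconv (t' - s) (u s) x) \<le> (LINT s:{t<..<t'}|lebesgue. C * R\<^sup>2 * W x * (t' - s) powr (1/2 - 1))"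
    by (rule set_integral_dominated(2)[OF _ c2 g2 b2]) auto
  also have "\<dots> = C * R\<^sup>2 * W x * ((t' - t) powr (1/2) / (1/2))"
    by (subst set_integral_mult_right, subst powr_tail_integral(2)) (use t in auto)
  also have "\<dots> \<le> C * R\<^sup>2 * W x * (2 * (t' - t) powr (1/4))"
  proof -
    have "(t' - t) powr (1/2) \<le> (t' - t) powr (1/4)" using t by (intro powr_mono') auto
    then show ?thesis using C_pos by (intro mult_left_mono) auto
  qed
  finally have A: "norm (LINT s:{t<..<t'}|lebesgue. oconv (t' - s) (u s) x) \<le> C * R\<^sup>2 * W x * (2 * (t' - t) powr (1/4))" .
  have b1: "norm (oconv (t' - s) (u s) x - oconv (t - s) (u s) x) \<le> C * R\<^sup>2 * (t' - t) powr (1/4) * W x * (t - s) powr (-3/4)" if s: "s \<in> {0<..<t}" for s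
  proof -
    have "norm (oconv (t' - s) (u s) x - oconv (t - s) (u s) x) \<le> C * R\<^sup>2 * ((t' - s) - (t - s)) powr (1/4) * (t - s) powr (-3/4) * W x"
      by (rule oconv_time_diff) (use s t u R in \<open>auto simp: admissible_def\<close>)
    then show ?thesis by (simp add: mult_ac)
  qed
  have c1: "continuous_on {0<..<t} (\<lambda>s. oconv (t' - s) (u s) x - oconv (t - s) (u s) x)"
    using t by (intro continuous_on_diff oconv_continuous_time[OF u] continuous_on_subset[OF oconv_continuous_time[OF u t(3,4)]]) auto
  have g1: "set_integrable lebesgue {0<..<t} (\<lambda>s. C * R\<^sup>2 * (t' - t) powr (1/4) * W x * (t - s) powr (-3/4))"
    by (intro set_integrable_mult_right quarter_integral) (use t in auto)
  have "norm (LINT s:{0<..<t}|lebesgue. oconv (t' - s) (u s) x - oconv (t - s) (u s) x) \<le> (LINT s:{0<..<t}|lebesgue. C * R\<^sup>2 * (t' - t) powr (1/4) * W x * (t - s) powr (-3/4))"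
    by (rule set_integral_dominated(2)[OF _ c1 g1 b1]) auto
  also have "\<dots> = C * R\<^sup>2 * (t' - t) powr (1/4) * W x * (4 * t powr (1/4))"
    by (simp only: set_integral_mult_right quarter_integral(2)[OF less_imp_le[OF t(1)]])
  also have "\<dots> \<le> C * R\<^sup>2 * (t' - t) powr (1/4) * W x * (4 * 1)"
  proof -
    have "t powr (1/4) \<le> 1 powr (1/4)" using t by (intro powr_mono2) auto
    then show ?thesis using C_pos by (intro mult_left_mono) auto
  qed
  finally have B: "norm (LINT s:{0<..<t}|lebesgue. oconv (t' - s) (u s) x - oconv (t - s) (u s) x) \<le> C * R\<^sup>2 * (t' - t) powr (1/4) * W x * 4"
    by simp
  have "duhamel u t' x - duhamel u t x = (LINT s:{0<..<t}|lebesgue. oconv (t' - s) (u s) x - oconv (t - s) (u s) x) + (LINT s:{t<..<t'}|lebesgue. oconv (t' - s) (u s) x)"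
    unfolding s1 s2 set_integral_diff(2)[OF i1 i] by (simp add: duhamel_def)
  also have "norm \<dots> \<le> C * R\<^sup>2 * (t' - t) powr (1/4) * W x * 4 + C * R\<^sup>2 * W x * (2 * (t' - t) powr (1/4))"
    by (rule order_trans[OF norm_triangle_ineq add_mono[OF B A]])
  also have "\<dots> = 6 * C * R\<^sup>2 * (t' - t) powr (1/4) * W x" by (simp add: algebra_simps)
  finally show ?thesis .
qed

lemma continuous_oconv:
  fixes v :: "'a \<Rightarrow> 'a"
  assumes "\<tau> > 0" "dominated \<theta> A v"
  shows "continuous_on UNIV (oconv \<tau> v)"
proof -
  have "2 * \<theta> > real DIM('a)" using two_theta by simp
  then show ?thesis unfolding oconv_def[abs_def]
    using assms dominated_square_integrable[OF assms(2)]
    by (intro continuous_oseen_convolution) (auto simp: dominated_def)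
qed

text \<open>Dominated convergence under the time integral, from the continuity of each slice. Its
  use is Borel measurability in x of the Picard iterates.\<close>

lemma continuous_duhamel:
  fixes u :: "real \<Rightarrow> 'a \<Rightarrow> 'a"
  assumes u: "admissible \<theta> T R u" and t: "0 \<le> t" "t \<le> T" "t \<le> 1"
  shows "continuous_on UNIV (duhamel u t)"
  unfolding continuous_on_sequentially
proof (intro allI ballI impI)
  fix X :: "nat \<Rightarrow> 'a" and x :: 'a assume X: "(\<forall>n. X n \<in> UNIV) \<and> X \<longlonglongrightarrow> x"
  have R: "R \<ge> 0" using u by (simp add: admissible_def)
  have "(\<lambda>n. LINT s|lebesgue. indicator {0<..<t} s *\<^sub>R oconv (t - s) (u s) (X n)) \<longlonglongrightarrow> (LINT s|lebesgue. indicator {0<..<t} s *\<^sub>R oconv (t - s) (u s) x)"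
  proof (rule integral_dominated_convergence)
    show "(\<lambda>s. indicator {0<..<t} s *\<^sub>R oconv (t - s) (u s) y) \<in> borel_measurable lebesgue" for y
      using duhamel_integrable(1)[OF u t, of y] by (auto simp: set_integrable_def)
    show "(\<lambda>s. indicator {0<..<t} s *\<^sub>R oconv (t - s) (u s) y) \<in> borel_measurable lebesgue" for y
      using duhamel_integrable(1)[OF u t, of y] by (auto simp: set_integrable_def)
    show "integrable lebesgue (\<lambda>s. indicator {0<..<t} s *\<^sub>R (C * R\<^sup>2 * (t - s) powr (-1/2)))"
      using set_integrable_mult_right[OF half_integral(1)[OF t(1)], of "C * R\<^sup>2"] by (simp add: set_integrable_def)
    show "AE s in lebesgue. (\<lambda>n. indicator {0<..<t} s *\<^sub>R oconv (t - s) (u s) (X n)) \<longlonglongrightarrow> indicator {0<..<t} s *\<^sub>R oconv (t - s) (u s) x"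
    proof (rule AE_I2)
      fix s
      show "(\<lambda>n. indicator {0<..<t} s *\<^sub>R oconv (t - s) (u s) (X n)) \<longlonglongrightarrow> indicator {0<..<t} s *\<^sub>R oconv (t - s) (u s) x"
      proof (cases "s \<in> {0<..<t}")
        case True
        then have "continuous_on UNIV (oconv (t - s) (u s))"
          using u t by (intro continuous_oconv[of _ R]) (auto simp: admissible_def)
        then have "(\<lambda>n. oconv (t - s) (u s) (X n)) \<longlonglongrightarrow> oconv (t - s) (u s) x"
          using X by (auto intro: continuous_on_tendsto_compose)
        then show ?thesis by (intro tendsto_intros)
      qed simp
    qed
    show "AE s in lebesgue. norm (indicator {0<..<t} s *\<^sub>R oconv (t - s) (u s) (X n)) \<le> indicator {0<..<t} s *\<^sub>R (C * R\<^sup>2 * (t - s) powr (-1/2))" for n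
    proof (rule AE_I2)
      fix s
      show "norm (indicator {0<..<t} s *\<^sub>R oconv (t - s) (u s) (X n)) \<le> indicator {0<..<t} s *\<^sub>R (C * R\<^sup>2 * (t - s) powr (-1/2))"
      proof (cases "s \<in> {0<..<t}")
        case True
        have "norm (oconv (t - s) (u s) (X n)) \<le> C * R\<^sup>2 * (t - s) powr (-1/2) * W (X n)"
          by (rule oconv_bound) (use True t u R in \<open>auto simp: admissible_def\<close>)
        also have "\<dots> \<le> C * R\<^sup>2 * (t - s) powr (-1/2) * 1"
          using C_pos W_le_1 by (intro mult_left_mono) auto
        finally show ?thesis using True by simp
      qed simp
    qed
  qed
  then show "(duhamel u t \<circ> X) \<longlonglongrightarrow> duhamel u t x"
    by (simp add: comp_def duhamel_def[abs_def] set_lebesgue_integral_def)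
qed

end

section \<open>Reflection and the heat semigroup\<close>

lemma norm_reflect [simp]: "norm (reflect x) = norm x"
  by (simp add: reflect_def norm_prod_def)

lemma reflect_reflect [simp]: "reflect (reflect x) = x"
  by (simp add: reflect_def)

lemma reflect_diff: "reflect (x - y) = reflect x - reflect y"
  by (simp add: reflect_def)

lemma snd_reflect [simp]: "snd (reflect x) = - snd x"
  by (simp add: reflect_def)

lemma wgt_reflect [simp]: "wgt p (reflect x) = wgt p x"
  by (simp add: wgt_def)

text \<open>Writes the reflection as a diagonal affine map in the standard basis, the shape in which
  the change of variables for Lebesgue measure is stated.\<close>

lemma reflect_eq_sum:
  "reflect (x :: 'a::euclidean_space \<times> real) = 0 + (\<Sum>j\<in>Basis. ((if j = (0, 1) then - 1 else 1) * (x \<bullet> j)) *\<^sub>R j)"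
proof (rule euclidean_eqI)
  fix b :: "'a \<times> real" assume b: "b \<in> Basis"
  have "(0 + (\<Sum>j\<in>Basis. ((if j = (0, 1) then - 1 else 1) * (x \<bullet> j)) *\<^sub>R j)) \<bullet> b = (if b = (0, 1) then - 1 else 1) * (x \<bullet> b)"
    using b by (simp add: inner_sum_left inner_Basis if_distrib sum.delta cong: if_cong)
  also have "\<dots> = reflect x \<bullet> b"
    using b by (auto simp: Basis_prod_def reflect_def inner_prod_def)
  finally show "reflect x \<bullet> b = (0 + (\<Sum>j\<in>Basis. ((if j = (0, 1) then - 1 else 1) * (x \<bullet> j)) *\<^sub>R j)) \<bullet> b" by simp
qed

lemma reflect_borel_measurable [measurable]:
  "reflect \<in> borel_measurable (borel :: ('a::euclidean_space \<times> real) measure)"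
  unfolding reflect_def[abs_def] by (intro borel_measurable_continuous_onI continuous_intros)

lemma distr_lborel_reflect: "distr lborel borel reflect = (lborel :: ('a::euclidean_space \<times> real) measure)"
proof -
  let ?c = "\<lambda>j::'a \<times> real. if j = (0, 1) then - 1 else 1 :: real"
  have "(lborel :: ('a \<times> real) measure) = density (distr lborel borel (\<lambda>x. 0 + (\<Sum>j\<in>Basis. (?c j * (x \<bullet> j)) *\<^sub>R j))) (\<lambda>_. (\<Prod>j\<in>Basis. \<bar>?c j\<bar>))"
    by (rule lborel_affine_euclidean) auto
  also have "(\<lambda>x. 0 + (\<Sum>j\<in>Basis. (?c j * (x \<bullet> j)) *\<^sub>R j)) = reflect"
    by (rule ext) (rule reflect_eq_sum[symmetric])
  also have "(\<Prod>j\<in>Basis. \<bar>?c j\<bar>) = 1" by (rule prod.neutral) auto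
  finally show ?thesis by (simp add: density_1)
qed

lemma reflect_lebesgue_measurable: "reflect \<in> lebesgue \<rightarrow>\<^sub>M (lebesgue :: ('a::euclidean_space \<times> real) measure)"
proof -
  let ?c = "\<lambda>j::'a \<times> real. if j = (0, 1) then - 1 else 1 :: real"
  have "(\<lambda>x. 0 + (\<Sum>j\<in>Basis. (?c j * (x \<bullet> j)) *\<^sub>R j)) \<in> lebesgue \<rightarrow>\<^sub>M lebesgue"
    by (rule lebesgue_affine_measurable) auto
  also have "(\<lambda>x. 0 + (\<Sum>j\<in>Basis. (?c j * (x \<bullet> j)) *\<^sub>R j)) = reflect"
    by (rule ext) (rule reflect_eq_sum[symmetric])
  finally show ?thesis .
qed

lemma AE_lebesgue_reflect:
  assumes "AE x in lebesgue. P (x :: 'a::euclidean_space \<times> real)"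
  shows "AE x in lebesgue. P (reflect x)"
proof -
  have "AE x in lborel. P x" using assms by (simp only: AE_completion_iff)
  then have "AE x in distr lborel borel reflect. P x" by (subst distr_lborel_reflect)
  then have "AE x in lborel. P (reflect x)" by (rule AE_distrD[rotated]) simp
  then show ?thesis by (simp add: AE_completion_iff)
qed

lemma integral_lborel_reflect:
  fixes f :: "'a::euclidean_space \<times> real \<Rightarrow> 'v::{banach, second_countable_topology}"
  assumes "f \<in> borel_measurable borel"
  shows "(\<integral>x. f (reflect x) \<partial>lborel) = (\<integral>x. f x \<partial>lborel)"
  using integral_distr[of reflect lborel borel f] assms by (simp add: distr_lborel_reflect)

lemma half_space_borel [measurable]: "half_space \<in> sets borel"
  unfolding half_space_def by (intro borel_open open_Collect_less continuous_intros)

lemma half_space_lebesgue [simp]: "half_space \<in> sets lebesgue"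
  using half_space_borel by (simp add: sets_completionI_sets)

lemma AE_half_space_iff:
  "(AE x in lebesgue_on half_space. P x) \<longleftrightarrow> (AE x in lebesgue. x \<in> half_space \<longrightarrow> P x)"
  by (rule AE_restrict_space_iff) simp

lemma extend_measurable:
  fixes v :: "'a::euclidean_space \<times> real \<Rightarrow> 'a \<times> real"
  assumes "v \<in> borel_measurable (lebesgue_on half_space)"
  shows "extend v \<in> borel_measurable lebesgue"
proof -
  have m: "(\<lambda>x. indicator half_space x *\<^sub>R v x) \<in> borel_measurable lebesgue"
    using assms by (simp add: borel_measurable_restrict_space_iff)
  have "reflect \<in> borel_measurable (borel :: ('a \<times> real) measure)" by simp
  then have "(\<lambda>x. reflect (indicator half_space (reflect x) *\<^sub>R v (reflect x))) \<in> borel_measurable lebesgue"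
    by (intro measurable_compose[OF measurable_compose[OF reflect_lebesgue_measurable m]])
  with m have "(\<lambda>x. indicator half_space x *\<^sub>R v x + reflect (indicator half_space (reflect x) *\<^sub>R v (reflect x))) \<in> borel_measurable lebesgue"
    by (rule borel_measurable_add)
  also have "(\<lambda>x. indicator half_space x *\<^sub>R v x + reflect (indicator half_space (reflect x) *\<^sub>R v (reflect x))) = extend v"
    by (rule ext) (auto simp: extend_def half_space_def indicator_def reflect_def zero_prod_def)
  finally show ?thesis .
qed

lemma extend_diff: "extend v x - extend w x = extend (\<lambda>x. v x - w x) x"
  by (simp add: extend_def reflect_diff)

lemma AE_extend_le:
  fixes v :: "'a::euclidean_space \<times> real \<Rightarrow> 'a \<times> real"
  assumes "AE x in lebesgue_on half_space. norm (v x) \<le> A * wgt \<theta> x" "0 \<le> A"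
  shows "AE x in lebesgue. norm (extend v x) \<le> A * wgt \<theta> x"
proof -
  have a: "AE x in lebesgue. x \<in> half_space \<longrightarrow> norm (v x) \<le> A * wgt \<theta> x"
    using assms(1) by (simp add: AE_half_space_iff)
  from a AE_lebesgue_reflect[OF a] show ?thesis
    by eventually_elim (use assms(2) in \<open>auto simp: extend_def half_space_def\<close>)
qed

lemma dominated_extend:
  fixes v :: "'a::euclidean_space \<times> real \<Rightarrow> 'a \<times> real"
  assumes "v \<in> borel_measurable (lebesgue_on half_space)"
    "AE x in lebesgue_on half_space. norm (v x) \<le> A * wgt \<theta> x" "0 \<le> A"
  shows "dominated \<theta> A (extend v)"
  using extend_measurable[OF assms(1)] AE_extend_le[OF assms(2,3)] by (simp add: dominated_def)

section \<open>Weighted norms as almost everywhere bounds\<close>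

lemma le_wgt_iff: "(1 + norm x) powr \<theta> * c \<le> A \<longleftrightarrow> c \<le> A * wgt \<theta> x"
proof -
  have p: "(1 + norm x) powr \<theta> > 0" by (smt (verit) norm_ge_zero powr_gt_zero)
  have "A * wgt \<theta> x = A / (1 + norm x) powr \<theta>" by (simp add: wgt_def powr_minus divide_inverse)
  then show ?thesis using p by (simp add: pos_le_divide_eq mult.commute)
qed

lemma Linf_norm_le_iff:
  fixes f :: "'a::euclidean_space \<times> real \<Rightarrow> 'a \<times> real"
  assumes f: "f \<in> borel_measurable (lebesgue_on half_space)"
  shows "Linf_norm \<theta> f \<le> ereal A \<longleftrightarrow> (AE x in lebesgue_on half_space. norm (f x) \<le> A * wgt \<theta> x)"
proof
  let ?g = "\<lambda>x. ereal ((1 + norm x) powr \<theta> * norm (f x))"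
  assume L: "Linf_norm \<theta> f \<le> ereal A"
  have "AE x in lebesgue_on half_space. ?g x \<le> Linf_norm \<theta> f"
    unfolding Linf_norm_def by (rule esssup_AE)
  then show "AE x in lebesgue_on half_space. norm (f x) \<le> A * wgt \<theta> x"
  proof eventually_elim
    case (elim x)
    have "?g x \<le> ereal A" using elim L by (rule order_trans)
    then show ?case by (simp add: le_wgt_iff)
  qed
next
  let ?g = "\<lambda>x. ereal ((1 + norm x) powr \<theta> * norm (f x))"
  assume le: "AE x in lebesgue_on half_space. norm (f x) \<le> A * wgt \<theta> x"
  have "(\<lambda>x::'a \<times> real. (1 + norm x) powr \<theta>) \<in> borel_measurable lebesgue"
    by (intro measurable_completion) simp
  then have [measurable]: "(\<lambda>x::'a \<times> real. (1 + norm x) powr \<theta>) \<in> borel_measurable (lebesgue_on half_space)"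
    by (rule measurable_restrict_space1)
  note f [measurable]
  have "?g \<in> borel_measurable (lebesgue_on half_space)" by measurable
  then show "Linf_norm \<theta> f \<le> ereal A"
    unfolding Linf_norm_def using le by (intro esssup_I) (auto simp: le_wgt_iff)
qed

lemma LinfD:
  assumes "f \<in> Linf \<theta>"
  obtains A where "0 \<le> A" "f \<in> borel_measurable (lebesgue_on half_space)"
    "AE x in lebesgue_on half_space. norm (f x) \<le> A * wgt \<theta> x"
proof -
  have m: "f \<in> borel_measurable (lebesgue_on half_space)" and lt: "Linf_norm \<theta> f < \<infinity>"
    using assms by (auto simp: Linf_def)
  obtain A where A: "Linf_norm \<theta> f \<le> ereal A"
    using lt by (cases "Linf_norm \<theta> f") auto
  then have "Linf_norm \<theta> f \<le> ereal \<bar>A\<bar>" by (rule order_trans) simp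
  then show ?thesis using that[of "\<bar>A\<bar>"] m Linf_norm_le_iff[OF m] by auto
qed

lemma LinfI:
  assumes "f \<in> borel_measurable (lebesgue_on half_space)"
    "AE x in lebesgue_on half_space. norm (f x) \<le> A * wgt \<theta> x"
  shows "f \<in> Linf \<theta>"
proof -
  have "Linf_norm \<theta> f \<le> ereal A" using assms Linf_norm_le_iff by blast
  then show ?thesis using assms(1) by (auto simp: Linf_def intro: le_less_trans)
qed

section \<open>The heat evolution in weighted spaces\<close>

lemma heat_kernel_nonneg [simp]: "0 \<le> heat_kernel t z"
  by (simp add: heat_kernel_def)

lemma heat_kernel_measurable [measurable]: "heat_kernel t \<in> borel_measurable borel"
  unfolding heat_kernel_def[abs_def] by measurable

lemma heat_kernel_scale:
  fixes z :: "'a::euclidean_space"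
  assumes "t > 0"
  shows "sqrt t ^ DIM('a) * heat_kernel t (sqrt t *\<^sub>R z) = heat_kernel 1 z"
  using assms by (simp add: heat_kernel_gE gE_def real_sqrt_mult power_mult_distrib)

text \<open>On [c, 1] the exponential increases with time and the prefactor is largest at c, so one
  multiple of the kernel at time 1 majorizes the whole family.\<close>

lemma heat_kernel_le:
  fixes z :: "'a::euclidean_space"
  assumes "0 < c" "c \<le> t" "t \<le> 1"
  shows "heat_kernel t z \<le> (1 / sqrt c ^ DIM('a)) * heat_kernel 1 z"
proof -
  have t: "t > 0" using assms by simp
  have "exp (- (norm z)\<^sup>2 / (4 * t)) \<le> exp (- (norm z)\<^sup>2 / (4 * 1))"
  proof -
    have "(norm z)\<^sup>2 / (4 * 1) \<le> (norm z)\<^sup>2 / (4 * t)"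
      using assms t by (intro divide_left_mono) auto
    then show ?thesis by simp
  qed
  moreover have "sqrt (4 * pi * 1) ^ DIM('a) * sqrt c ^ DIM('a) \<le> sqrt (4 * pi * t) ^ DIM('a)"
    using assms unfolding power_mult_distrib[symmetric] by (intro power_mono) (auto simp: real_sqrt_mult)
  ultimately have "exp (- (norm z)\<^sup>2 / (4 * t)) / sqrt (4 * pi * t) ^ DIM('a) \<le> exp (- (norm z)\<^sup>2 / (4 * 1)) / (sqrt (4 * pi * 1) ^ DIM('a) * sqrt c ^ DIM('a))"
    using assms by (intro frac_le mult_pos_pos) auto
  then show ?thesis
    using t by (simp add: heat_kernel_gE gE_def mult_ac)
qed

text \<open>Submultiplicativity of 1 + |x|, a form of Peetre's inequality. It transfers the weight
  from y to x at the price of a moment of the convolution kernel.\<close>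

lemma wgt_submult: "wgt \<theta> y \<le> (1 + norm (x - y)) powr \<theta> * wgt \<theta> x" if "\<theta> \<ge> 0"
proof -
  have "1 + norm x \<le> (1 + norm y) + norm (x - y)" by (smt (verit) norm_triangle_sub)
  also have "\<dots> \<le> (1 + norm y) * (1 + norm (x - y))" by (simp add: algebra_simps)
  finally have "(1 + norm x) powr \<theta> \<le> ((1 + norm y) * (1 + norm (x - y))) powr \<theta>"
    using that by (intro powr_mono2) (auto intro: add_nonneg_nonneg)
  also have "\<dots> = (1 + norm y) powr \<theta> * (1 + norm (x - y)) powr \<theta>"
    by (rule powr_mult)
  finally have "(1 + norm x) powr \<theta> * (wgt \<theta> x * wgt \<theta> y) \<le> (1 + norm y) powr \<theta> * (1 + norm (x - y)) powr \<theta> * (wgt \<theta> x * wgt \<theta> y)"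
    by (rule mult_right_mono) simp
  then have "((1 + norm x) powr \<theta> * wgt \<theta> x) * wgt \<theta> y \<le> ((1 + norm y) powr \<theta> * wgt \<theta> y) * ((1 + norm (x - y)) powr \<theta> * wgt \<theta> x)"
    by (simp only: mult_ac)
  then show ?thesis by (simp only: wgt_inverse mult_1_left)
qed

lemma heat_kernel_moment_integrable:
  "integrable lborel (\<lambda>z::'a::euclidean_space. heat_kernel 1 z * (1 + norm z) powr \<theta>)"
proof -
  let ?d = "DIM('a) + 1"
  define n where "n = nat \<lceil>\<theta>\<rceil>"
  have n: "\<theta> \<le> real n" unfolding n_def by linarith
  define K where "K = fact (n + ?d) * exp (1 + 1 / (4 * (1/4))) / sqrt (4 * pi) ^ DIM('a)"
  have "integrable lborel (\<lambda>z::'a. K * wgt (real ?d) z)"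
    by (intro integrable_mult_right integrable_wgt) simp
  then show ?thesis
  proof (rule Bochner_Integration.integrable_bound)
    show "AE z in lborel. norm (heat_kernel 1 (z::'a) * (1 + norm z) powr \<theta>) \<le> norm (K * wgt (real ?d) z)"
    proof (rule AE_I2)
      fix z :: 'a
      have p: "(1 + norm z) ^ ?d > 0" by (intro zero_less_power) (simp add: add_pos_nonneg)
      have "(1 + norm z) powr \<theta> \<le> (1 + norm z) powr real n" using n by (intro powr_mono) auto
      also have "\<dots> = (1 + norm z) ^ n" by (rule powr_realpow) (simp add: add_pos_nonneg)
      finally have a: "(1 + norm z) powr \<theta> \<le> (1 + norm z) ^ n" .
      have "(1 + norm z) ^ (n + ?d) * exp (- (1/4) * (norm z)\<^sup>2) \<le> fact (n + ?d) * exp (1 + 1 / (4 * (1/4)))"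
        by (rule poly_exp_bound) auto
      then have "(1 + norm z) ^ n * exp (- (1/4) * (norm z)\<^sup>2) \<le> fact (n + ?d) * exp (1 + 1 / (4 * (1/4))) / (1 + norm z) ^ ?d"
        using p by (subst pos_le_divide_eq) (auto simp: power_add mult_ac)
      then have "(1 + norm z) ^ n * exp (- (1/4) * (norm z)\<^sup>2) / sqrt (4 * pi) ^ DIM('a) \<le> fact (n + ?d) * exp (1 + 1 / (4 * (1/4))) / (1 + norm z) ^ ?d / sqrt (4 * pi) ^ DIM('a)"
        by (rule divide_right_mono) simp
      also have "\<dots> = K * wgt (real ?d) z" unfolding K_def wgt_real by simp
      also have "(1 + norm z) ^ n * exp (- (1/4) * (norm z)\<^sup>2) / sqrt (4 * pi) ^ DIM('a) = heat_kernel 1 z * (1 + norm z) ^ n"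
        by (simp add: heat_kernel_gE gE_def)
      finally have "heat_kernel 1 z * (1 + norm z) ^ n \<le> K * wgt (real ?d) z" .
      moreover have "heat_kernel 1 z * (1 + norm z) powr \<theta> \<le> heat_kernel 1 z * (1 + norm z) ^ n"
        by (intro mult_left_mono a) simp
      ultimately have "heat_kernel 1 z * (1 + norm z) powr \<theta> \<le> K * wgt (real ?d) z" by simp
      then show "norm (heat_kernel 1 z * (1 + norm z) powr \<theta>) \<le> norm (K * wgt (real ?d) z)"
        by (simp add: K_def)
    qed
  qed measurable
qed

text \<open>Rescaling replaces the kernel at time t by the one at time 1, with the weight evaluated
  at sqrt t z; for t \<le> 1 this weight is not larger, hence a bound uniform in t.\<close>

lemma heat_kernel_moment:
  assumes t: "0 < t" "t \<le> 1" and \<theta>: "\<theta> \<ge> 0"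
  shows "integrable lborel (\<lambda>z::'a::euclidean_space. heat_kernel t z * (1 + norm z) powr \<theta>)"
    and "(\<integral>z. heat_kernel t (z::'a) * (1 + norm z) powr \<theta> \<partial>lborel) \<le> (\<integral>z. heat_kernel 1 (z::'a) * (1 + norm z) powr \<theta> \<partial>lborel)"
proof -
  let ?f = "\<lambda>t (z::'a). heat_kernel t z * (1 + norm z) powr \<theta>"
  show i: "integrable lborel (?f t)"
  proof (rule Bochner_Integration.integrable_bound)
    show "integrable lborel (\<lambda>z::'a. (1 / sqrt t ^ DIM('a)) * ?f 1 z)"
      by (intro integrable_mult_right heat_kernel_moment_integrable)
    show "AE z in lborel. norm (?f t z) \<le> norm ((1 / sqrt t ^ DIM('a)) * ?f 1 z)"
    proof (rule AE_I2)
      fix z :: 'a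
      have "?f t z \<le> ((1 / sqrt t ^ DIM('a)) * heat_kernel 1 z) * (1 + norm z) powr \<theta>"
        by (rule mult_right_mono[OF heat_kernel_le[OF t(1) order_refl t(2)]]) simp
      then show "norm (?f t z) \<le> norm ((1 / sqrt t ^ DIM('a)) * ?f 1 z)"
        using t by (simp add: abs_mult mult_ac)
    qed
  qed measurable
  have s: "sqrt t \<noteq> 0" using t by simp
  have "(\<integral>z. ?f t z \<partial>lborel) = \<bar>sqrt t\<bar> ^ DIM('a) *\<^sub>R (\<integral>z. ?f t (0 + sqrt t *\<^sub>R z) \<partial>lborel)"
    by (rule integral_affine[OF s]) measurable
  also have "\<dots> = (\<integral>z. heat_kernel 1 z * (1 + norm (sqrt t *\<^sub>R (z::'a))) powr \<theta> \<partial>lborel)"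
  proof -
    have "\<bar>sqrt t\<bar> ^ DIM('a) * ?f t (0 + sqrt t *\<^sub>R z) = heat_kernel 1 z * (1 + norm (sqrt t *\<^sub>R z)) powr \<theta>" for z :: 'a
      using heat_kernel_scale[OF t(1), of z] t by (simp flip: mult.assoc)
    then show ?thesis by (simp only: real_scaleR_def integral_mult_right_zero[symmetric])
  qed
  also have "\<dots> \<le> (\<integral>z. ?f 1 z \<partial>lborel)"
  proof (rule integral_mono)
    have le: "heat_kernel 1 z * (1 + norm (sqrt t *\<^sub>R z)) powr \<theta> \<le> ?f 1 z" for z :: 'a
    proof -
      have "sqrt t * norm z \<le> 1 * norm z" using t by (intro mult_right_mono) auto
      then have "(1 + norm (sqrt t *\<^sub>R z)) powr \<theta> \<le> (1 + norm z) powr \<theta>"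
        using \<theta> t by (intro powr_mono2) (auto intro: add_nonneg_nonneg)
      then show ?thesis by (rule mult_left_mono) simp
    qed
    then show "heat_kernel 1 z * (1 + norm (sqrt t *\<^sub>R z)) powr \<theta> \<le> ?f 1 z" for z :: 'a .
    show "integrable lborel (?f 1)" by (rule heat_kernel_moment_integrable)
    show "integrable lborel (\<lambda>z::'a. heat_kernel 1 z * (1 + norm (sqrt t *\<^sub>R z)) powr \<theta>)"
      by (rule Bochner_Integration.integrable_bound[OF heat_kernel_moment_integrable[of \<theta>]])
         (use le in \<open>auto simp: abs_mult intro!: AE_I2\<close>)
  qed
  finally show "(\<integral>z. ?f t z \<partial>lborel) \<le> (\<integral>z. ?f 1 z \<partial>lborel)" .
qed

text \<open>Stated for a signed kernel so that it applies both to the heat kernel and to the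
  difference of two heat kernels.\<close>

lemma convolution_dominated:
  fixes k :: "'a::euclidean_space \<Rightarrow> real" and f :: "'a \<Rightarrow> 'a"
  assumes \<theta>: "\<theta> \<ge> 0" and k [measurable]: "k \<in> borel_measurable borel"
    and ki: "integrable lborel (\<lambda>z. \<bar>k z\<bar> * (1 + norm z) powr \<theta>)" and f: "dominated \<theta> A f"
  shows "integrable lebesgue (\<lambda>y. k (x - y) *\<^sub>R f y)"
    and "norm (LINT y|lebesgue. k (x - y) *\<^sub>R f y) \<le> A * (\<integral>z. \<bar>k z\<bar> * (1 + norm z) powr \<theta> \<partial>lborel) * wgt \<theta> x"
proof -
  have [measurable]: "f \<in> borel_measurable lebesgue" and fb: "AE y in lebesgue. norm (f y) \<le> A * wgt \<theta> y"
    using f by (auto simp: dominated_def)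
  let ?h = "\<lambda>z. \<bar>k z\<bar> * (1 + norm z) powr \<theta>"
  let ?g = "\<lambda>y. (A * wgt \<theta> x) * ?h (x - y)"
  have gi: "integrable lborel ?g"
    using ki by (intro integrable_mult_right) (subst integrable_reflect_translate(1)[of ?h], auto)
  have gl: "integrable lebesgue ?g" using gi borel_measurable_integrable[OF gi] by (simp add: integrable_completion)
  have [measurable]: "(\<lambda>y. k (x - y)) \<in> borel_measurable lebesgue"
    by (intro measurable_completion) measurable
  have A: "AE y in lebesgue. norm (k (x - y) *\<^sub>R f y) \<le> ?g y"
    using fb
  proof eventually_elim
    case (elim y)
    then have A0: "0 \<le> A" using order_trans[OF norm_ge_zero elim] wgt_pos[of \<theta> y] by (simp add: zero_le_mult_iff)
    have "norm (k (x - y) *\<^sub>R f y) \<le> \<bar>k (x - y)\<bar> * (A * wgt \<theta> y)" using elim by (simp add: mult_left_mono)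
    also have "\<dots> \<le> \<bar>k (x - y)\<bar> * (A * ((1 + norm (x - y)) powr \<theta> * wgt \<theta> x))"
      using A0 \<theta> by (intro mult_left_mono wgt_submult) auto
    finally show ?case by (simp add: mult_ac)
  qed
  show i: "integrable lebesgue (\<lambda>y. k (x - y) *\<^sub>R f y)"
    by (rule Bochner_Integration.integrable_bound[OF gl])
       (intro borel_measurable_scaleR, fact, fact, use A in \<open>eventually_elim, auto intro: order_trans[OF _ abs_ge_self]\<close>)
  have "norm (LINT y|lebesgue. k (x - y) *\<^sub>R f y) \<le> (LINT y|lebesgue. ?g y)"
    by (rule norm_integral_le_AE[OF i gl A])
  also have "\<dots> = (\<integral>y. ?g y \<partial>lborel)" by (rule integral_completion) measurable
  also have "\<dots> = (A * wgt \<theta> x) * (\<integral>z. ?h z \<partial>lborel)"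
    by (subst integral_mult_right_zero, subst integrable_reflect_translate(2)[of ?h]) auto
  finally show "norm (LINT y|lebesgue. k (x - y) *\<^sub>R f y) \<le> A * (\<integral>z. ?h z \<partial>lborel) * wgt \<theta> x"
    by (simp add: mult_ac)
qed

lemma heat_bound:
  fixes f :: "'a::euclidean_space \<Rightarrow> 'a"
  assumes \<theta>: "\<theta> \<ge> 0" and f: "dominated \<theta> A f" "0 \<le> A" and t: "0 < t" "t \<le> 1"
  shows "norm (heat t f x) \<le> A * (\<integral>z. heat_kernel 1 (z::'a) * (1 + norm z) powr \<theta> \<partial>lborel) * wgt \<theta> x"
proof -
  have "norm (heat t f x) \<le> A * (\<integral>z. heat_kernel t (z::'a) * (1 + norm z) powr \<theta> \<partial>lborel) * wgt \<theta> x"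
    using convolution_dominated(2)[OF \<theta>, of "heat_kernel t" A f x] heat_kernel_moment(1)[OF t \<theta>, where 'a='a] f t
    by (simp add: heat_def)
  also have "\<dots> \<le> A * (\<integral>z. heat_kernel 1 (z::'a) * (1 + norm z) powr \<theta> \<partial>lborel) * wgt \<theta> x"
    using f heat_kernel_moment(2)[OF t \<theta>, where 'a='a] by (intro mult_right_mono mult_left_mono) auto
  finally show ?thesis .
qed

lemma heat_measurable:
  fixes f :: "'a::euclidean_space \<Rightarrow> 'a"
  assumes f [measurable]: "f \<in> borel_measurable lebesgue" and t: "t > 0"
  shows "heat t f \<in> borel_measurable borel"
proof -
  interpret P: pair_sigma_finite "lborel :: 'a measure" "lebesgue :: 'a measure"
    by (rule pair_sigma_finite_lborel_lebesgue)
  have idm: "(\<lambda>y::'a. y) \<in> borel_measurable lebesgue" by (rule measurable_completion) simp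
  have [measurable]: "(\<lambda>p. snd p) \<in> borel_measurable (lborel \<Otimes>\<^sub>M (lebesgue :: 'a measure))"
    "(\<lambda>p. f (snd p)) \<in> borel_measurable (lborel \<Otimes>\<^sub>M (lebesgue :: 'a measure))"
    "(\<lambda>p. fst p) \<in> borel_measurable ((lborel :: 'a measure) \<Otimes>\<^sub>M (lebesgue :: 'a measure))"
    by (rule measurable_compose[OF measurable_snd idm], rule measurable_compose[OF measurable_snd f], rule measurable_compose[OF measurable_fst]) simp
  have "(\<lambda>p. heat_kernel t (fst p - snd p) *\<^sub>R f (snd p)) \<in> borel_measurable (lborel \<Otimes>\<^sub>M (lebesgue :: 'a measure))"
    by measurable
  then have "(\<lambda>x. LINT y|lebesgue. heat_kernel t (x - y) *\<^sub>R f y) \<in> borel_measurable lborel"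
    by (intro P.M2.borel_measurable_lebesgue_integral) (simp add: case_prod_beta')
  then show ?thesis using t by (simp add: heat_def[abs_def])
qed

lemma heat_kernel_continuous_time:
  fixes z :: "'a::euclidean_space"
  assumes "t > 0"
  shows "isCont (\<lambda>t. heat_kernel t z) t"
  unfolding heat_kernel_def using assms by (intro continuous_intros) auto

text \<open>The difference is a convolution with a difference of kernels, whose weighted integral
  norm \<open>\<omega> s\<close> tends to 0 as s tends to t. This controls all x at once.\<close>

lemma heat_time_continuous:
  fixes f :: "'a::euclidean_space \<Rightarrow> 'a"
  assumes \<theta>: "\<theta> \<ge> 0" and f: "dominated \<theta> A f" "0 \<le> A" and t: "0 < t" "t \<le> 1" and e: "e > 0"
  shows "\<exists>\<delta>>0. \<forall>s\<in>{0<..1}. \<bar>s - t\<bar> < \<delta> \<longrightarrow> (\<forall>x. norm (heat s f x - heat t f x) \<le> e * wgt \<theta> x)"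
proof -
  let ?k = "\<lambda>s z. heat_kernel s z - heat_kernel t (z::'a)"
  define \<omega> where "\<omega> s = (\<integral>z. \<bar>?k s z\<bar> * (1 + norm z) powr \<theta> \<partial>lborel)" for s
  have ki: "integrable lborel (\<lambda>z. \<bar>?k s z\<bar> * (1 + norm z) powr \<theta>)" if "0 < s" "s \<le> 1" for s
  proof (rule Bochner_Integration.integrable_bound)
    show "integrable lborel (\<lambda>z::'a. heat_kernel s z * (1 + norm z) powr \<theta> + heat_kernel t z * (1 + norm z) powr \<theta>)"
      using that t \<theta> by (intro Bochner_Integration.integrable_add heat_kernel_moment)
    show "AE z in lborel. norm (\<bar>?k s z\<bar> * (1 + norm z) powr \<theta>) \<le> norm (heat_kernel s z * (1 + norm z) powr \<theta> + heat_kernel t z * (1 + norm z) powr \<theta>)"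
    proof (rule AE_I2)
      fix z :: 'a
      have "\<bar>?k s z\<bar> \<le> heat_kernel s z + heat_kernel t z"
        using heat_kernel_nonneg[of s z] heat_kernel_nonneg[of t z] by linarith
      then have "\<bar>?k s z\<bar> * (1 + norm z) powr \<theta> \<le> (heat_kernel s z + heat_kernel t z) * (1 + norm z) powr \<theta>"
        by (rule mult_right_mono) simp
      then show "norm (\<bar>?k s z\<bar> * (1 + norm z) powr \<theta>) \<le> norm (heat_kernel s z * (1 + norm z) powr \<theta> + heat_kernel t z * (1 + norm z) powr \<theta>)"
        by (simp add: distrib_right abs_mult)
    qed
  qed measurable
  \<comment> \<open>Restricting to s \<ge> t/2 gives a dominating function through
    \<open>heat_kernel_le\<close>.\<close>
  have "(\<omega> \<longlongrightarrow> 0) (at t within {t/2..1})"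
    unfolding tendsto_at_iff_sequentially
  proof (intro allI impI)
    fix X assume X: "\<forall>i. X i \<in> {t/2..1} - {t}" and Xt: "X \<longlonglongrightarrow> t"
    have "(\<lambda>n. \<omega> (X n)) \<longlonglongrightarrow> (\<integral>z. (\<lambda>_::'a. 0) z \<partial>lborel)"
      unfolding \<omega>_def
    proof (rule integral_dominated_convergence)
      show "integrable lborel (\<lambda>z::'a. (2 / sqrt (t/2) ^ DIM('a)) * (heat_kernel 1 z * (1 + norm z) powr \<theta>))"
        by (intro integrable_mult_right heat_kernel_moment_integrable)
      show "AE z in lborel. (\<lambda>n. \<bar>?k (X n) z\<bar> * (1 + norm z) powr \<theta>) \<longlonglongrightarrow> 0"
      proof (rule AE_I2)
        fix z :: 'a
        have "(\<lambda>n. heat_kernel (X n) z) \<longlonglongrightarrow> heat_kernel t z"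
          by (rule isCont_tendsto_compose[OF heat_kernel_continuous_time[OF t(1)] Xt])
        then have "(\<lambda>n. \<bar>?k (X n) z\<bar> * (1 + norm z) powr \<theta>) \<longlonglongrightarrow> \<bar>heat_kernel t z - heat_kernel t z\<bar> * (1 + norm z) powr \<theta>"
          by (intro tendsto_intros)
        then show "(\<lambda>n. \<bar>?k (X n) z\<bar> * (1 + norm z) powr \<theta>) \<longlonglongrightarrow> 0" by simp
      qed
      show "AE z in lborel. norm (\<bar>?k (X n) z\<bar> * (1 + norm z) powr \<theta>) \<le> (2 / sqrt (t/2) ^ DIM('a)) * (heat_kernel 1 z * (1 + norm z) powr \<theta>)" for n
      proof (rule AE_I2)
        fix z :: 'a
        have a: "heat_kernel (X n) z \<le> (1 / sqrt (t/2) ^ DIM('a)) * heat_kernel 1 z"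
          using X t by (intro heat_kernel_le) auto
        have b: "heat_kernel t z \<le> (1 / sqrt (t/2) ^ DIM('a)) * heat_kernel 1 z"
          using t by (intro heat_kernel_le) auto
        have "\<bar>?k (X n) z\<bar> \<le> (2 / sqrt (t/2) ^ DIM('a)) * heat_kernel 1 z"
        proof -
          have "(2 / sqrt (t/2) ^ DIM('a)) * heat_kernel 1 z = 2 * ((1 / sqrt (t/2) ^ DIM('a)) * heat_kernel 1 z)" by simp
          then show ?thesis
            using heat_kernel_nonneg[of "X n" z] heat_kernel_nonneg[of t z] a b by linarith
        qed
        then have "\<bar>?k (X n) z\<bar> * (1 + norm z) powr \<theta> \<le> (2 / sqrt (t/2) ^ DIM('a)) * heat_kernel 1 z * (1 + norm z) powr \<theta>"
          by (rule mult_right_mono) simp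
        then show "norm (\<bar>?k (X n) z\<bar> * (1 + norm z) powr \<theta>) \<le> (2 / sqrt (t/2) ^ DIM('a)) * (heat_kernel 1 z * (1 + norm z) powr \<theta>)"
          by (simp add: abs_mult mult.assoc)
      qed
    qed measurable
    then show "(\<omega> \<circ> X) \<longlonglongrightarrow> 0" by (simp add: comp_def)
  qed
  \<comment> \<open>Dividing by A + 1 instead of A covers A = 0.\<close>
  then have "eventually (\<lambda>s. dist (\<omega> s) 0 < e / (A + 1)) (at t within {t/2..1})"
    using e f(2) by (intro tendstoD) auto
  then obtain \<delta> where \<delta>: "\<delta> > 0" and d: "\<And>s. s \<in> {t/2..1} \<Longrightarrow> s \<noteq> t \<Longrightarrow> dist s t < \<delta> \<Longrightarrow> dist (\<omega> s) 0 < e / (A + 1)"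
    unfolding eventually_at by blast
  show ?thesis
  proof (intro exI[of _ "min \<delta> (t/2)"] conjI ballI impI allI)
    show "min \<delta> (t/2) > 0" using \<delta> t by simp
    fix s x assume s: "s \<in> {0<..1}" and st: "\<bar>s - t\<bar> < min \<delta> (t/2)"
    show "norm (heat s f x - heat t f x) \<le> e * wgt \<theta> x"
    proof (cases "s = t")
      case False
      have "\<bar>s - t\<bar> < t/2" using st by simp
      moreover have "t - s \<le> \<bar>s - t\<bar>" using abs_ge_minus_self[of "s - t"] by simp
      ultimately have "s \<ge> t/2" by linarith
      then have om: "\<omega> s \<le> e / (A + 1)" using d[of s] False s st by (auto simp: dist_real_def)
      have s': "0 < s" "s \<le> 1" using s by auto
      have i: "integrable lebesgue (\<lambda>y. heat_kernel s (x - y) *\<^sub>R f y)" if "0 < s" "s \<le> 1" for s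
        using heat_kernel_moment(1)[OF that \<theta>, where 'a='a] by (intro convolution_dominated(1)[OF \<theta> _ _ f(1)]) auto
      have "heat s f x - heat t f x = (LINT y|lebesgue. ?k s (x - y) *\<^sub>R f y)"
        using i[OF s'] i[OF t] s' t by (simp add: heat_def scaleR_diff_left)
      also have "norm \<dots> \<le> A * \<omega> s * wgt \<theta> x"
        unfolding \<omega>_def by (rule convolution_dominated(2)[OF \<theta> _ ki[OF s'] f(1)]) measurable
      also have "\<dots> \<le> A * (e / (A + 1)) * wgt \<theta> x"
        using om f(2) by (intro mult_right_mono mult_left_mono) auto
      also have "\<dots> \<le> e * wgt \<theta> x"
        using f(2) e by (intro mult_right_mono) (auto simp: field_simps)
      finally show ?thesis .
    qed (use e in simp)
  qed
qed

text \<open>The Gaussian transform at z = 0 with \<sigma> = 1/4, for which exp(-\<sigma>|\<xi>|^2)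
  is the unnormalized kernel at time 1.\<close>

lemma integral_heat_kernel_1: "(\<integral>z. heat_kernel 1 (z::'a::euclidean_space) \<partial>lborel) = 1"
proof -
  have "complex_of_real (\<integral>\<xi>. exp (- (1/4) * (norm (\<xi>::'a))\<^sup>2) \<partial>lborel) = (\<integral>\<xi>. cis (\<xi> \<bullet> 0) * complex_of_real (exp (- (1/4) * (norm (\<xi>::'a))\<^sup>2)) \<partial>lborel)"
    by (simp only: inner_zero_right cis_zero mult_1_left integral_complex_of_real)
  also have "\<dots> = complex_of_real ((2 * pi) ^ DIM('a) * gE DIM('a) (1/4) (norm (0::'a)))"
    by (rule gauss_fourier) simp
  finally have e: "(\<integral>\<xi>. exp (- (1/4) * (norm (\<xi>::'a))\<^sup>2) \<partial>lborel) = (2 * pi) ^ DIM('a) * gE DIM('a) (1/4) (norm (0::'a))"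
    by (simp only: of_real_eq_iff)
  have "heat_kernel 1 z = (1 / sqrt (4 * pi) ^ DIM('a)) * exp (- (1/4) * (norm z)\<^sup>2)" for z :: 'a
    by (simp add: heat_kernel_gE gE_def)
  then have "(\<integral>z. heat_kernel 1 (z::'a) \<partial>lborel) = (1 / sqrt (4 * pi) ^ DIM('a)) * (\<integral>\<xi>. exp (- (1/4) * (norm (\<xi>::'a))\<^sup>2) \<partial>lborel)"
    by (simp only: integral_mult_right_zero)
  also have "\<dots> = (2 * pi / (sqrt pi * sqrt (4 * pi))) ^ DIM('a)"
    unfolding e by (simp add: gE_def power_divide power_mult_distrib mult_ac)
  also have "2 * pi / (sqrt pi * sqrt (4 * pi)) = 1"
    by (simp add: real_sqrt_mult)
  finally show ?thesis by simp
qed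

text \<open>Convergence to the initial value as \<open>t \<rightarrow> 0\<close> is proved by moving the heat kernel onto the test function.\<close>

definition heat_dual :: "('a::euclidean_space \<Rightarrow> real) \<Rightarrow> real \<Rightarrow> 'a \<Rightarrow> real" where
  "heat_dual \<phi> t y = (\<integral>x. \<phi> x * heat_kernel t (x - y) \<partial>lborel)"

text \<open>After the substitution the kernel is the fixed one at time 1 and t occurs only in the
  argument of \<phi>, so that continuity of \<phi> and dominated convergence give the limit t
  \<rightarrow> 0.\<close>

lemma heat_dual_eq:
  fixes \<phi> :: "'a::euclidean_space \<Rightarrow> real"
  assumes [measurable]: "\<phi> \<in> borel_measurable borel" and t: "t > 0"
  shows "heat_dual \<phi> t y = (\<integral>z. \<phi> (y + sqrt t *\<^sub>R z) * heat_kernel 1 z \<partial>lborel)"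
proof -
  have s: "sqrt t \<noteq> 0" using t by simp
  have "heat_dual \<phi> t y = \<bar>sqrt t\<bar> ^ DIM('a) *\<^sub>R (\<integral>z. \<phi> (y + sqrt t *\<^sub>R z) * heat_kernel t (y + sqrt t *\<^sub>R z - y) \<partial>lborel)"
    unfolding heat_dual_def by (rule integral_affine[OF s]) measurable
  also have "\<dots> = (\<integral>z. \<bar>sqrt t\<bar> ^ DIM('a) *\<^sub>R (\<phi> (y + sqrt t *\<^sub>R z) * heat_kernel t (y + sqrt t *\<^sub>R z - y)) \<partial>lborel)"
    by (simp only: integral_scaleR_right)
  also have "\<dots> = (\<integral>z. \<phi> (y + sqrt t *\<^sub>R z) * heat_kernel 1 z \<partial>lborel)"
    using heat_kernel_scale[OF t, where 'a='a, symmetric] t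
    by (intro Bochner_Integration.integral_cong refl) (simp add: mult_ac)
  finally show ?thesis .
qed

lemma heat_dual_integrand_le:
  fixes \<phi> :: "'a::euclidean_space \<Rightarrow> real"
  assumes \<phi>: "\<And>x. \<bar>\<phi> x\<bar> \<le> M * wgt p x" and p: "p \<ge> 0" and t: "0 < t" "t \<le> 1"
  shows "\<bar>\<phi> (y + sqrt t *\<^sub>R z) * heat_kernel 1 z\<bar> \<le> M * wgt p y * (heat_kernel 1 z * (1 + norm z) powr p)"
proof -
  have M: "0 \<le> M" using order_trans[OF abs_ge_zero \<phi>[of 0]] wgt_pos[of p "0::'a"] by (simp add: zero_le_mult_iff)
  have "sqrt t * norm z \<le> 1 * norm z" using t by (intro mult_right_mono) auto
  then have pw: "(1 + norm (y - (y + sqrt t *\<^sub>R z))) powr p \<le> (1 + norm z) powr p"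
    using p t by (intro powr_mono2) (auto intro: add_nonneg_nonneg)
  have "\<bar>\<phi> (y + sqrt t *\<^sub>R z)\<bar> \<le> M * wgt p (y + sqrt t *\<^sub>R z)" by (rule \<phi>)
  also have "\<dots> \<le> M * ((1 + norm (y - (y + sqrt t *\<^sub>R z))) powr p * wgt p y)"
    by (intro mult_left_mono wgt_submult p M)
  also have "\<dots> \<le> M * ((1 + norm z) powr p * wgt p y)"
    by (intro mult_left_mono mult_right_mono pw M) auto
  finally have "\<bar>\<phi> (y + sqrt t *\<^sub>R z)\<bar> * heat_kernel 1 z \<le> M * ((1 + norm z) powr p * wgt p y) * heat_kernel 1 z"
    by (rule mult_right_mono) simp
  then show ?thesis by (simp add: abs_mult mult_ac)
qed

lemma heat_dual_le:
  fixes \<phi> :: "'a::euclidean_space \<Rightarrow> real"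
  assumes [measurable]: "\<phi> \<in> borel_measurable borel" and \<phi>: "\<And>x. \<bar>\<phi> x\<bar> \<le> M * wgt p x" and p: "p \<ge> 0" and t: "0 < t" "t \<le> 1"
  shows "\<bar>heat_dual \<phi> t y\<bar> \<le> M * (\<integral>z. heat_kernel 1 (z::'a) * (1 + norm z) powr p \<partial>lborel) * wgt p y"
proof -
  note le = heat_dual_integrand_le[OF \<phi> p t, of y]
  have g: "integrable lborel (\<lambda>z::'a. M * wgt p y * (heat_kernel 1 z * (1 + norm z) powr p))"
    by (intro integrable_mult_right heat_kernel_moment_integrable)
  have i: "integrable lborel (\<lambda>z. \<phi> (y + sqrt t *\<^sub>R z) * heat_kernel 1 z)"
    by (rule Bochner_Integration.integrable_bound[OF g])
       (measurable, intro AE_I2, use le in \<open>auto intro: order_trans[OF _ abs_ge_self]\<close>)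
  have "norm (heat_dual \<phi> t y) \<le> (\<integral>z. M * wgt p y * (heat_kernel 1 (z::'a) * (1 + norm z) powr p) \<partial>lborel)"
    unfolding heat_dual_eq[OF assms(1) t(1)]
    by (rule norm_integral_le_AE[OF i g]) (use le in auto)
  also have "\<dots> = M * wgt p y * (\<integral>z. heat_kernel 1 (z::'a) * (1 + norm z) powr p \<partial>lborel)"
    by (rule integral_mult_right_zero)
  finally show ?thesis by (simp add: mult_ac)
qed

lemma heat_dual_tendsto:
  fixes \<phi> :: "'a::euclidean_space \<Rightarrow> real"
  assumes c: "continuous_on UNIV \<phi>" and \<phi>: "\<And>x. \<bar>\<phi> x\<bar> \<le> M * wgt p x" and p: "p \<ge> 0"
    and X: "\<And>n. 0 < X n" "\<And>n. X n \<le> 1" "X \<longlonglongrightarrow> 0"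
  shows "(\<lambda>n. heat_dual \<phi> (X n) y) \<longlonglongrightarrow> \<phi> y"
proof -
  have m [measurable]: "\<phi> \<in> borel_measurable borel" by (rule borel_measurable_continuous_onI[OF c])
  have "(\<lambda>n. \<integral>z. \<phi> (y + sqrt (X n) *\<^sub>R z) * heat_kernel 1 z \<partial>lborel) \<longlonglongrightarrow> (\<integral>z. \<phi> y * heat_kernel 1 (z::'a) \<partial>lborel)"
  proof (rule integral_dominated_convergence)
    show "integrable lborel (\<lambda>z::'a. M * wgt p y * (heat_kernel 1 z * (1 + norm z) powr p))"
      by (intro integrable_mult_right heat_kernel_moment_integrable)
    show "AE z in lborel. (\<lambda>n. \<phi> (y + sqrt (X n) *\<^sub>R z) * heat_kernel 1 z) \<longlonglongrightarrow> \<phi> y * heat_kernel 1 z"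
    proof (rule AE_I2)
      fix z :: 'a
      have "(\<lambda>n. y + sqrt (X n) *\<^sub>R z) \<longlonglongrightarrow> y + sqrt 0 *\<^sub>R z"
        by (intro tendsto_intros X)
      then have "(\<lambda>n. \<phi> (y + sqrt (X n) *\<^sub>R z)) \<longlonglongrightarrow> \<phi> y"
        using c by (auto intro: continuous_on_tendsto_compose)
      then show "(\<lambda>n. \<phi> (y + sqrt (X n) *\<^sub>R z) * heat_kernel 1 z) \<longlonglongrightarrow> \<phi> y * heat_kernel 1 z"
        by (intro tendsto_intros)
    qed
    show "AE z in lborel. norm (\<phi> (y + sqrt (X n) *\<^sub>R z) * heat_kernel 1 z) \<le> M * wgt p y * (heat_kernel 1 z * (1 + norm z) powr p)" for n
      using heat_dual_integrand_le[OF \<phi> p X(1) X(2)] by (intro AE_I2) (simp add: real_norm_def)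
  qed measurable
  then show ?thesis
    unfolding heat_dual_eq[OF m X(1)] by (simp add: integral_heat_kernel_1)
qed

text \<open>Fubini on the mixed product. Absolute integrability comes from that of \<phi> and of the
  heat kernel, f being bounded by A almost everywhere.\<close>

lemma integral_heat_test:
  fixes \<phi> :: "'a::euclidean_space \<Rightarrow> real" and f :: "'a \<Rightarrow> 'a"
  assumes \<phi>m [measurable]: "\<phi> \<in> borel_measurable borel" and \<phi>: "\<And>x. \<bar>\<phi> x\<bar> \<le> M * wgt p x" and p: "p > real DIM('a)"
    and \<theta>: "\<theta> \<ge> 0" and f: "dominated \<theta> A f" "0 \<le> A" and t: "0 < t" "t \<le> 1"
  shows "(LINT x|lebesgue. \<phi> x *\<^sub>R heat t f x) = (LINT y|lebesgue. heat_dual \<phi> t y *\<^sub>R f y)"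
    and "(\<lambda>y. heat_dual \<phi> t y) \<in> borel_measurable lebesgue"
proof -
  interpret P: pair_sigma_finite "lborel :: 'a measure" "lebesgue :: 'a measure"
    by (rule pair_sigma_finite_lborel_lebesgue)
  have fm [measurable]: "f \<in> borel_measurable lebesgue" using f by (simp add: dominated_def)
  have idm: "(\<lambda>y::'a. y) \<in> borel_measurable lebesgue" by (rule measurable_completion) simp
  have ms [measurable]: "(\<lambda>p. snd p) \<in> borel_measurable (lborel \<Otimes>\<^sub>M (lebesgue :: 'a measure))"
    "(\<lambda>p. f (snd p)) \<in> borel_measurable (lborel \<Otimes>\<^sub>M (lebesgue :: 'a measure))"
    "(\<lambda>p. fst p) \<in> borel_measurable ((lborel :: 'a measure) \<Otimes>\<^sub>M (lebesgue :: 'a measure))"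
    by (rule measurable_compose[OF measurable_snd idm], rule measurable_compose[OF measurable_snd fm], rule measurable_compose[OF measurable_fst]) simp
  define J where "J = (\<integral>z. heat_kernel t (z::'a) \<partial>lborel)"
  have hk: "integrable lborel (\<lambda>z::'a. heat_kernel t z)"
  proof -
    have "1 + norm z \<noteq> 0" for z :: 'a by (smt (verit) norm_ge_zero)
    then show ?thesis using heat_kernel_moment(1)[OF t order_refl, where 'a='a] by simp
  qed
  have hky: "integrable lebesgue (\<lambda>y. heat_kernel t (x - y))" "(LINT y|lebesgue. heat_kernel t (x - y)) = J" for x :: 'a
    using integrable_reflect_translate[of "heat_kernel t" x] hk
    by (simp_all add: integrable_completion integral_completion J_def)
  have ip: "integrable lborel (\<lambda>x. \<phi> x)"
  proof (rule Bochner_Integration.integrable_bound)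
    show "integrable lborel (\<lambda>x::'a. M * wgt p x)" using p by (intro integrable_mult_right integrable_wgt)
    show "AE x in lborel. norm (\<phi> x) \<le> norm (M * wgt p x)"
      using \<phi> by (intro AE_I2) (auto intro: order_trans[OF _ abs_ge_self])
  qed measurable
  let ?g = "\<lambda>q. A * \<phi> (fst q) * heat_kernel t (fst q - snd q)"
  have gm: "?g \<in> borel_measurable (lborel \<Otimes>\<^sub>M lebesgue)" by measurable
  have gi: "integrable (lborel \<Otimes>\<^sub>M lebesgue) ?g"
  proof (rule P.Fubini_integrable[OF gm])
    have "(LINT y|lebesgue. norm (?g (x, y))) = A * \<bar>\<phi> x\<bar> * J" for x
    proof -
      have "(LINT y|lebesgue. norm (?g (x, y))) = (LINT y|lebesgue. (A * \<bar>\<phi> x\<bar>) * heat_kernel t (x - y))"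
        using f(2) by (intro Bochner_Integration.integral_cong refl) (simp add: abs_mult)
      then show ?thesis by (simp only: integral_mult_right_zero hky(2))
    qed
    then show "integrable lborel (\<lambda>x. LINT y|lebesgue. norm (?g (x, y)))"
      using ip by simp
    show "AE x in lborel. integrable lebesgue (\<lambda>y. ?g (x, y))"
      using hky(1) by (intro AE_I2) (simp add: mult.assoc)
  qed
  let ?h = "\<lambda>q. (\<phi> (fst q) * heat_kernel t (fst q - snd q)) *\<^sub>R f (snd q)"
  have hm: "?h \<in> borel_measurable (lborel \<Otimes>\<^sub>M lebesgue)" by measurable
  have hi: "integrable (lborel \<Otimes>\<^sub>M lebesgue) ?h"
  proof (rule Bochner_Integration.integrable_bound[OF gi hm])
    have "AE y in lebesgue. norm (f y) \<le> A"
    proof -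
      have "AE y in lebesgue. norm (f y) \<le> A * wgt \<theta> y" using f by (simp add: dominated_def)
      then show ?thesis
      proof eventually_elim
        case (elim y)
        then show ?case using mult_left_mono[OF wgt_le_1[OF \<theta>, of y] f(2)] by simp
      qed
    qed
    then have ae: "AE x in lborel. AE y in lebesgue. norm (f (snd (x::'a, y))) \<le> A" by simp
    \<comment> \<open>The bound on f fails only on a null set in y, which has to be turned into a
      null set of the product.\<close>
    have "AE q in lborel \<Otimes>\<^sub>M lebesgue. norm (f (snd (q :: 'a \<times> 'a))) \<le> A"
      by (rule P.AE_pair_measure[OF _ ae]) measurable
    then show "AE q in lborel \<Otimes>\<^sub>M lebesgue. norm (?h q) \<le> norm (?g q)"
    proof eventually_elim
      case (elim q)
      have "norm (?h q) \<le> \<bar>\<phi> (fst q) * heat_kernel t (fst q - snd q)\<bar> * A"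
        using elim by (simp add: mult_left_mono)
      then show ?case using f(2) by (simp add: abs_mult mult_ac)
    qed
  qed
  have hi': "integrable (lborel \<Otimes>\<^sub>M lebesgue) (\<lambda>(x, y). (\<phi> x * heat_kernel t (x - y)) *\<^sub>R f y)"
    using hi by (simp add: case_prod_beta')
  have mh: "(\<lambda>x. \<phi> x *\<^sub>R heat t f x) \<in> borel_measurable lborel"
    using heat_measurable[OF fm t(1)] by measurable
  have "(LINT x|lebesgue. \<phi> x *\<^sub>R heat t f x) = (\<integral>x. \<phi> x *\<^sub>R heat t f x \<partial>lborel)"
    by (rule integral_completion[OF mh])
  also have "\<dots> = (\<integral>x. (LINT y|lebesgue. (\<phi> x * heat_kernel t (x - y)) *\<^sub>R f y) \<partial>lborel)"
    using t by (simp add: heat_def flip: scaleR_scaleR)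
  also have "\<dots> = (LINT y|lebesgue. (\<integral>x. (\<phi> x * heat_kernel t (x - y)) *\<^sub>R f y \<partial>lborel))"
    by (rule P.Fubini_integral[OF hi', symmetric])
  also have "\<dots> = (LINT y|lebesgue. heat_dual \<phi> t y *\<^sub>R f y)"
  proof (intro Bochner_Integration.integral_cong refl)
    fix y
    have "integrable lborel (\<lambda>x. \<phi> x * heat_kernel t (x - y))"
    proof (rule Bochner_Integration.integrable_bound)
      have "integrable lborel (\<lambda>x. heat_kernel t (- y + 1 *\<^sub>R x))"
        by (subst integrable_affine_iff) (use hk in auto)
      then show "integrable lborel (\<lambda>x. M * heat_kernel t (x - y))" by (intro integrable_mult_right) simp
      show "AE x in lborel. norm (\<phi> x * heat_kernel t (x - y)) \<le> norm (M * heat_kernel t (x - y))"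
      proof (rule AE_I2)
        fix x
        have M0: "0 \<le> M" using order_trans[OF abs_ge_zero \<phi>[of 0]] wgt_pos[of p "0::'a"] by (simp add: zero_le_mult_iff)
        have "\<bar>\<phi> x\<bar> \<le> M * 1" using order_trans[OF \<phi>[of x] mult_left_mono[OF wgt_le_1 M0]] p by simp
        then have "\<bar>\<phi> x\<bar> * heat_kernel t (x - y) \<le> M * heat_kernel t (x - y)" by (simp add: mult_right_mono)
        then show "norm (\<phi> x * heat_kernel t (x - y)) \<le> norm (M * heat_kernel t (x - y))" using M0 by (simp add: abs_mult)
      qed
    qed measurable
    then show "(\<integral>x. (\<phi> x * heat_kernel t (x - y)) *\<^sub>R f y \<partial>lborel) = heat_dual \<phi> t y *\<^sub>R f y"
      unfolding heat_dual_def by (rule integral_scaleR_left)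
  qed
  finally show "(LINT x|lebesgue. \<phi> x *\<^sub>R heat t f x) = (LINT y|lebesgue. heat_dual \<phi> t y *\<^sub>R f y)" .
  have "(\<lambda>y. heat_dual \<phi> t y) \<in> borel_measurable lborel"
    unfolding heat_dual_def by (intro lborel.borel_measurable_lebesgue_integral) measurable
  then show "(\<lambda>y. heat_dual \<phi> t y) \<in> borel_measurable lebesgue"
    by (rule measurable_completion)
qed

lemma tendsto_heat_test:
  fixes \<phi> :: "'a::euclidean_space \<Rightarrow> real" and f :: "'a \<Rightarrow> 'a"
  assumes c: "continuous_on UNIV \<phi>" and \<phi>: "\<And>x. \<bar>\<phi> x\<bar> \<le> M * wgt p x" and p: "p > real DIM('a)"
    and \<theta>: "\<theta> \<ge> 0" and f: "dominated \<theta> A f" "0 \<le> A"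
  shows "((\<lambda>t. LINT x|lebesgue. \<phi> x *\<^sub>R heat t f x) \<longlongrightarrow> (LINT x|lebesgue. \<phi> x *\<^sub>R f x)) (at_right 0)"
  unfolding tendsto_at_iff_sequentially comp_def
proof (intro allI impI)
  fix X :: "nat \<Rightarrow> real" assume X: "\<forall>i. X i \<in> {0<..} - {0}" and X0: "X \<longlonglongrightarrow> 0"
  have m [measurable]: "\<phi> \<in> borel_measurable borel" by (rule borel_measurable_continuous_onI[OF c])
  have fm: "f \<in> borel_measurable lebesgue" using f by (simp add: dominated_def)
  have ml: "\<phi> \<in> borel_measurable lebesgue" by (rule measurable_completion) simp
  have "eventually (\<lambda>n. X n < 1) sequentially" using X0 by (rule order_tendstoD) simp
  then obtain N where N: "\<And>n. n \<ge> N \<Longrightarrow> X n < 1" by (auto simp: eventually_sequentially)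
  \<comment> \<open>A tail of the sequence, along which all times are at most 1.\<close>
  define Y where "Y n = X (n + N)" for n
  have Y: "\<And>n. 0 < Y n" "\<And>n. Y n \<le> 1" using X N by (auto simp: Y_def less_imp_le)
  have Y0: "Y \<longlonglongrightarrow> 0" unfolding Y_def by (rule LIMSEQ_ignore_initial_segment[OF X0])
  define I where "I = (\<integral>z. heat_kernel 1 (z::'a) * (1 + norm z) powr p \<partial>lborel)"
  have p0: "p \<ge> 0" using p by simp
  have "(\<lambda>n. LINT y|lebesgue. heat_dual \<phi> (Y n) y *\<^sub>R f y) \<longlonglongrightarrow> (LINT y|lebesgue. \<phi> y *\<^sub>R f y)"
  proof (rule integral_dominated_convergence)
    show "(\<lambda>y. \<phi> y *\<^sub>R f y) \<in> borel_measurable lebesgue" by (intro borel_measurable_scaleR ml fm)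
    show "(\<lambda>y. heat_dual \<phi> (Y n) y *\<^sub>R f y) \<in> borel_measurable lebesgue" for n
      by (intro borel_measurable_scaleR fm integral_heat_test(2)[OF m \<phi> p \<theta> f Y(1) Y(2)])
    show "integrable lebesgue (\<lambda>y::'a. M * I * A * wgt p y)"
      using integrable_wgt[OF p] by (intro integrable_mult_right) (simp add: integrable_completion)
    show "AE y in lebesgue. (\<lambda>n. heat_dual \<phi> (Y n) y *\<^sub>R f y) \<longlonglongrightarrow> \<phi> y *\<^sub>R f y"
      by (intro AE_I2 tendsto_intros heat_dual_tendsto[OF c \<phi> p0 Y Y0])
    show "AE y in lebesgue. norm (heat_dual \<phi> (Y n) y *\<^sub>R f y) \<le> M * I * A * wgt p y" for n
    proof -
      have "AE y in lebesgue. norm (f y) \<le> A * wgt \<theta> y" using f by (simp add: dominated_def)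
      then show ?thesis
      proof eventually_elim
        case (elim y)
        then have fA: "norm (f y) \<le> A" using mult_left_mono[OF wgt_le_1[OF \<theta>, of y] f(2)] by simp
        have d: "\<bar>heat_dual \<phi> (Y n) y\<bar> \<le> M * I * wgt p y"
          unfolding I_def by (rule heat_dual_le[OF m \<phi> p0 Y(1) Y(2)])
        have "\<bar>heat_dual \<phi> (Y n) y\<bar> * norm (f y) \<le> (M * I * wgt p y) * A"
          using d fA by (intro mult_mono) (auto intro: order_trans[OF abs_ge_zero d])
        then show ?case by (simp add: mult_ac)
      qed
    qed
  qed
  then have "(\<lambda>n. LINT x|lebesgue. \<phi> x *\<^sub>R heat (Y n) f x) \<longlonglongrightarrow> (LINT y|lebesgue. \<phi> y *\<^sub>R f y)"
    by (simp only: integral_heat_test(1)[OF m \<phi> p \<theta> f Y(1) Y(2)])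
  then show "(\<lambda>n. LINT x|lebesgue. \<phi> x *\<^sub>R heat (X n) f x) \<longlonglongrightarrow> (LINT y|lebesgue. \<phi> y *\<^sub>R f y)"
    unfolding Y_def by (rule LIMSEQ_offset)
qed

text \<open>Compact support gives any prescribed decay: the continuous function |\<phi>| (1+|x|)^p
  is bounded on the support.\<close>

lemma test_function_facts:
  fixes \<phi> :: "'a::euclidean_space \<Rightarrow> real"
  assumes "test_function U \<phi>"
  shows "continuous_on UNIV \<phi>" and "\<exists>M. \<forall>x. \<bar>\<phi> x\<bar> \<le> M * wgt p x" and "\<And>x. x \<notin> U \<Longrightarrow> \<phi> x = 0"
proof -
  have "Ck 0 \<phi>" using assms unfolding test_function_def by blast
  then show c: "continuous_on UNIV \<phi>" by simp
  let ?K = "closure {x. \<phi> x \<noteq> 0}"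
  have K: "compact ?K" "?K \<subseteq> U" using assms by (auto simp: test_function_def)
  have out: "\<phi> x = 0" if "x \<notin> ?K" for x using that closure_subset[of "{x. \<phi> x \<noteq> 0}"] by auto
  show "\<phi> x = 0" if "x \<notin> U" for x using out K that by blast
  have "continuous_on ?K (\<lambda>x. \<bar>\<phi> x\<bar> * (1 + norm x) powr p)"
  proof (intro continuous_intros continuous_on_subset[OF c])
    show "\<forall>x\<in>?K. 1 + norm x \<noteq> 0" by (smt (verit) norm_ge_zero)
  qed auto
  then have "bounded ((\<lambda>x. \<bar>\<phi> x\<bar> * (1 + norm x) powr p) ` ?K)"
    by (intro compact_imp_bounded compact_continuous_image K)
  then obtain M where M: "\<And>x. x \<in> ?K \<Longrightarrow> \<bar>\<bar>\<phi> x\<bar> * (1 + norm x) powr p\<bar> \<le> M"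
    unfolding bounded_iff by auto
  show "\<exists>M. \<forall>x. \<bar>\<phi> x\<bar> \<le> M * wgt p x"
  proof (intro exI[of _ "max M 0"] allI)
    fix x
    show "\<bar>\<phi> x\<bar> \<le> max M 0 * wgt p x"
    proof (cases "x \<in> ?K")
      case True
      then have "(1 + norm x) powr p * \<bar>\<phi> x\<bar> \<le> max M 0" using M[OF True] by (simp add: mult.commute)
      then show ?thesis by (rule iffD1[OF le_wgt_iff])
    next
      case False
      then have "\<phi> x = 0" by (rule out)
      then show ?thesis by simp
    qed
  qed
qed

section \<open>Existence and uniqueness\<close>

text \<open>The everywhere counterpart of \<open>admissible\<close>: Borel measurability and bounds
  at every x. The Picard map preserves it, and limits can be taken pointwise without choosing
  representatives.\<close>

definition regular :: "real \<Rightarrow> real \<Rightarrow> real \<Rightarrow> (real \<Rightarrow> 'a::euclidean_space \<times> real \<Rightarrow> 'a \<times> real) \<Rightarrow> bool" where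
  "regular \<theta> T R u \<longleftrightarrow> (\<forall>t\<in>{0<..<T}. u t \<in> borel_measurable borel \<and> (\<forall>x. norm (u t x) \<le> R * wgt \<theta> x) \<and>
     (\<forall>\<epsilon>>0. \<exists>\<delta>>0. \<forall>s\<in>{0<..<T}. \<bar>s - t\<bar> < \<delta> \<longrightarrow> (\<forall>x. norm (u s x - u t x) \<le> \<epsilon> * wgt \<theta> x)))"

lemma borel_measurable_half_space:
  fixes f :: "'a::euclidean_space \<times> real \<Rightarrow> 'b::topological_space"
  assumes "f \<in> borel_measurable borel"
  shows "f \<in> borel_measurable (lebesgue_on half_space)"
  using assms by (intro measurable_restrict_space1 measurable_completion) simp

lemma norm_extend_le:
  assumes "\<And>x. norm (v x) \<le> A * wgt \<theta> x"
  shows "norm (extend v x) \<le> A * wgt \<theta> x"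
  using assms[of x] assms[of "reflect x"] order_trans[OF norm_ge_zero assms[of x]] by (simp add: extend_def)

lemma regular_admissible:
  fixes u :: "real \<Rightarrow> 'a::euclidean_space \<times> real \<Rightarrow> 'a \<times> real"
  assumes u: "regular \<theta> T R u" and R: "0 \<le> R"
  shows "admissible \<theta> T R (\<lambda>s. extend (u s))"
  unfolding admissible_def
proof (intro conjI ballI allI impI R)
  fix s assume s: "s \<in> {0<..<T}"
  have m: "u s \<in> borel_measurable borel" and b: "\<And>x. norm (u s x) \<le> R * wgt \<theta> x" using u s by (auto simp: regular_def)
  show "dominated \<theta> R (extend (u s))"
    by (rule dominated_extend[OF borel_measurable_half_space[OF m] _ R]) (use b in auto)
  fix \<epsilon> :: real assume "\<epsilon> > 0"
  then obtain \<delta> where \<delta>: "\<delta> > 0" "\<And>r x. r \<in> {0<..<T} \<Longrightarrow> \<bar>r - s\<bar> < \<delta> \<Longrightarrow> norm (u r x - u s x) \<le> \<epsilon> * wgt \<theta> x"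
    using u s unfolding regular_def by meson
  show "\<exists>\<delta>>0. \<forall>r\<in>{0<..<T}. \<bar>r - s\<bar> < \<delta> \<longrightarrow> (AE y in lebesgue. norm (extend (u r) y - extend (u s) y) \<le> \<epsilon> * wgt \<theta> y)"
  proof (intro exI[of _ \<delta>] conjI ballI impI \<delta>(1) AE_I2)
    fix r y assume "r \<in> {0<..<T}" "\<bar>r - s\<bar> < \<delta>"
    then show "norm (extend (u r) y - extend (u s) y) \<le> \<epsilon> * wgt \<theta> y"
      unfolding extend_diff by (intro norm_extend_le \<delta>(2))
  qed
qed

text \<open>A three-epsilon argument; it works because the distance to the n-th term is uniform in t
  and proportional to the weight.\<close>

lemma regular_limit:
  fixes u :: "nat \<Rightarrow> real \<Rightarrow> 'a::euclidean_space \<times> real \<Rightarrow> 'a \<times> real"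
  assumes un: "\<And>n. regular \<theta> T R (u n)" and B: "B \<longlonglongrightarrow> 0"
    and le: "\<And>n t x. t \<in> {0<..<T} \<Longrightarrow> norm (v t x - u n t x) \<le> B n * wgt \<theta> x"
  shows "regular \<theta> T R v"
  unfolding regular_def
proof (intro ballI conjI allI impI)
  fix t assume t: "t \<in> {0<..<T}"
  have conv: "(\<lambda>n. u n t x) \<longlonglongrightarrow> v t x" for x
  proof (rule LIM_zero_cancel, rule tendsto_norm_zero_cancel, rule tendsto_sandwich)
    show "eventually (\<lambda>n. 0 \<le> norm (u n t x - v t x)) sequentially" by simp
    show "eventually (\<lambda>n. norm (u n t x - v t x) \<le> B n * wgt \<theta> x) sequentially"
      using le[OF t, of x] by (simp add: norm_minus_commute)
    show "(\<lambda>n. B n * wgt \<theta> x) \<longlonglongrightarrow> 0" using tendsto_mult_right[OF B, of "wgt \<theta> x"] by simp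
  qed simp
  show "v t \<in> borel_measurable borel"
    by (rule borel_measurable_LIMSEQ_metric[OF _ conv]) (use un t in \<open>auto simp: regular_def\<close>)
  have "norm (u n t x) \<le> R * wgt \<theta> x" for n x
    using un[of n] t unfolding regular_def by blast
  then show "norm (v t x) \<le> R * wgt \<theta> x" for x :: "'a \<times> real"
    by (intro LIMSEQ_le_const2[OF tendsto_norm[OF conv]]) auto
  fix \<epsilon> :: real assume e: "\<epsilon> > 0"
  then have "eventually (\<lambda>n. B n < \<epsilon> / 3) sequentially" using B by (intro order_tendstoD) auto
  then obtain n where n: "B n < \<epsilon> / 3" by (auto simp: eventually_sequentially)
  have "\<epsilon> / 3 > 0" using e by simp
  then obtain \<delta> where \<delta>: "\<delta> > 0" "\<And>s x. s \<in> {0<..<T} \<Longrightarrow> \<bar>s - t\<bar> < \<delta> \<Longrightarrow> norm (u n s x - u n t x) \<le> \<epsilon> / 3 * wgt \<theta> x"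
    using un[of n] t unfolding regular_def by meson
  show "\<exists>\<delta>>0. \<forall>s\<in>{0<..<T}. \<bar>s - t\<bar> < \<delta> \<longrightarrow> (\<forall>x. norm (v s x - v t x) \<le> \<epsilon> * wgt \<theta> x)"
  proof (intro exI[of _ \<delta>] conjI ballI impI allI \<delta>(1))
    fix s and x :: "'a \<times> real" assume s: "s \<in> {0<..<T}" "\<bar>s - t\<bar> < \<delta>"
    have b: "B n * wgt \<theta> x \<le> \<epsilon> / 3 * wgt \<theta> x" using n by (intro mult_right_mono) auto
    have "v s x - v t x = (v s x - u n s x) + (u n s x - u n t x) + (u n t x - v t x)" by simp
    also have "norm \<dots> \<le> norm (v s x - u n s x) + norm (u n s x - u n t x) + norm (u n t x - v t x)"
      by (intro order_trans[OF norm_triangle_ineq] add_mono norm_triangle_ineq order_refl)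
    also have "\<dots> \<le> \<epsilon> / 3 * wgt \<theta> x + \<epsilon> / 3 * wgt \<theta> x + \<epsilon> / 3 * wgt \<theta> x"
    proof (intro add_mono)
      show "norm (v s x - u n s x) \<le> \<epsilon> / 3 * wgt \<theta> x" by (rule order_trans[OF le[OF s(1)] b])
      show "norm (u n s x - u n t x) \<le> \<epsilon> / 3 * wgt \<theta> x" by (rule \<delta>(2)[OF s])
      show "norm (u n t x - v t x) \<le> \<epsilon> / 3 * wgt \<theta> x"
        using order_trans[OF le[OF t] b] by (simp only: norm_minus_commute)
    qed
    finally show "norm (v s x - v t x) \<le> \<epsilon> * wgt \<theta> x" by (simp add: algebra_simps)
  qed
qed

text \<open>R is twice the bound for the heat evolution, plus 1 so that R \<ge> 1. The constant 8 in
  the condition on T makes the contraction factor 2 C (R+R) sqrt T at most 1/2 and the Duhamel term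
  at most R/4 times the weight, so the ball of radius R is preserved. The assumption
  \<open>\<theta>_le\<close> lets decay of order d+1 count as decay of order \<theta>.\<close>

locale half_space_problem = oseen_bounds \<theta> C W for \<theta> C and W :: "'a::euclidean_space \<times> real \<Rightarrow> real" +
  fixes a :: "'a \<times> real \<Rightarrow> 'a \<times> real" and A R T :: real
  assumes \<theta>_le: "\<theta> \<le> real DIM('a \<times> real) + 1"
    and a_dom: "dominated \<theta> A (extend a)" and A: "0 \<le> A"
    and R: "R = 2 * (A * (\<integral>z. heat_kernel 1 (z :: 'a \<times> real) * (1 + norm z) powr \<theta> \<partial>lborel)) + 1"
    and T: "0 < T" "T \<le> 1" "8 * C * R * sqrt T \<le> 1"
begin

lemma \<theta>_nonneg: "0 \<le> \<theta>"
  using two_theta by simp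

lemma W_le_wgt: "W x \<le> wgt \<theta> x"
  unfolding W_def by (rule wgt_mono) (use \<theta>_le in simp)

lemma heat_moment_nonneg: "0 \<le> (\<integral>z. heat_kernel 1 (z :: 'a \<times> real) * (1 + norm z) powr \<theta> \<partial>lborel)"
  by (intro integral_nonneg_AE) simp

lemma R_ge_1: "R \<ge> 1"
  using heat_moment_nonneg A by (simp add: R)

lemma neumann_heat_le: "0 < t \<Longrightarrow> t \<le> 1 \<Longrightarrow> norm (neumann_heat t a x) \<le> R / 2 * wgt \<theta> x"
proof -
  assume t: "0 < t" "t \<le> 1"
  have "norm (neumann_heat t a x) \<le> A * (\<integral>z. heat_kernel 1 (z :: 'a \<times> real) * (1 + norm z) powr \<theta> \<partial>lborel) * wgt \<theta> x"
    unfolding neumann_heat_def by (rule heat_bound[OF \<theta>_nonneg a_dom A t])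
  also have "\<dots> \<le> R / 2 * wgt \<theta> x" by (intro mult_right_mono) (auto simp: R)
  finally show ?thesis .
qed

definition picard :: "(real \<Rightarrow> 'a \<times> real \<Rightarrow> 'a \<times> real) \<Rightarrow> real \<Rightarrow> 'a \<times> real \<Rightarrow> 'a \<times> real" where
  "picard u t x = neumann_heat t a x - duhamel (\<lambda>s. extend (u s)) t x"

lemma sqrt_le_T: "0 \<le> t \<Longrightarrow> t \<le> T \<Longrightarrow> t powr (1/2) \<le> sqrt T"
  by (simp add: powr_half_sqrt)

lemma regular_neumann_heat: "regular \<theta> T R (\<lambda>t. neumann_heat t a)"
  unfolding regular_def
proof (intro ballI conjI allI impI)
  fix t assume t: "t \<in> {0<..<T}"
  then have t': "0 < t" "t \<le> 1" using T by auto
  show "neumann_heat t a \<in> borel_measurable borel"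
    unfolding neumann_heat_def by (rule heat_measurable) (use a_dom t' in \<open>auto simp: dominated_def\<close>)
  show "norm (neumann_heat t a x) \<le> R * wgt \<theta> x" for x
  proof -
    have "R / 2 * wgt \<theta> x \<le> R * wgt \<theta> x" using R_ge_1 by (intro mult_right_mono) auto
    then show ?thesis using neumann_heat_le[OF t', of x] by simp
  qed
  fix \<epsilon> :: real assume "\<epsilon> > 0"
  from heat_time_continuous[OF \<theta>_nonneg a_dom A t' this]
  obtain \<delta> where "\<delta> > 0" "\<forall>s\<in>{0<..1}. \<bar>s - t\<bar> < \<delta> \<longrightarrow> (\<forall>x. norm (heat s (extend a) x - heat t (extend a) x) \<le> \<epsilon> * wgt \<theta> x)"
    by blast
  then show "\<exists>\<delta>>0. \<forall>s\<in>{0<..<T}. \<bar>s - t\<bar> < \<delta> \<longrightarrow> (\<forall>x. norm (neumann_heat s a x - neumann_heat t a x) \<le> \<epsilon> * wgt \<theta> x)"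
    using T by (intro exI[of _ \<delta>]) (auto simp: neumann_heat_def)
qed

lemma duhamel_le:
  assumes u: "regular \<theta> T R u" and t: "0 \<le> t" "t \<le> T"
  shows "norm (duhamel (\<lambda>s. extend (u s)) t x) \<le> 2 * C * R\<^sup>2 * t powr (1/2) * W x"
    and "norm (duhamel (\<lambda>s. extend (u s)) t x) \<le> R / 2 * wgt \<theta> x"
proof -
  have R0: "R \<ge> 0" using R_ge_1 by simp
  show 1: "norm (duhamel (\<lambda>s. extend (u s)) t x) \<le> 2 * C * R\<^sup>2 * t powr (1/2) * W x"
    by (rule duhamel_integrable(2)[OF regular_admissible[OF u R0]]) (use t T in auto)
  also have "\<dots> \<le> 2 * C * R\<^sup>2 * sqrt T * wgt \<theta> x"
    using C_pos T sqrt_le_T[OF t] by (intro mult_mono mult_left_mono W_le_wgt) auto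
  also have "2 * C * R\<^sup>2 * sqrt T = (8 * C * R * sqrt T) * (R / 4)" by (simp add: power2_eq_square)
  also have "\<dots> * wgt \<theta> x \<le> 1 * (R / 4) * wgt \<theta> x"
    using T(3) R0 by (intro mult_right_mono) auto
  also have "\<dots> \<le> R / 2 * wgt \<theta> x" using R0 by (intro mult_right_mono) auto
  finally show "norm (duhamel (\<lambda>s. extend (u s)) t x) \<le> R / 2 * wgt \<theta> x" .
qed

lemma regular_picard:
  assumes u: "regular \<theta> T R u"
  shows "regular \<theta> T R (picard u)"
  unfolding regular_def
proof (intro ballI conjI allI impI)
  have R0: "R \<ge> 0" using R_ge_1 by simp
  note adm = regular_admissible[OF u R0]
  fix t assume t: "t \<in> {0<..<T}"
  then have t': "0 < t" "t \<le> 1" "0 \<le> t" "t \<le> T" using T by auto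
  have "duhamel (\<lambda>s. extend (u s)) t \<in> borel_measurable borel"
    by (intro borel_measurable_continuous_onI continuous_duhamel[OF adm] t')
  moreover have "neumann_heat t a \<in> borel_measurable borel" using regular_neumann_heat t by (simp add: regular_def)
  ultimately show "picard u t \<in> borel_measurable borel" unfolding picard_def[abs_def] by simp
  show "norm (picard u t x) \<le> R * wgt \<theta> x" for x
    using norm_triangle_ineq4[of "neumann_heat t a x" "duhamel (\<lambda>s. extend (u s)) t x"]
      neumann_heat_le[OF t'(1,2), of x] duhamel_le(2)[OF u t'(3,4), of x]
    by (simp add: picard_def)
  fix \<epsilon> :: real assume e: "\<epsilon> > 0"
  define K where "K = 6 * C * R\<^sup>2"
  have K: "K > 0" using C_pos R_ge_1 by (simp add: K_def)
  \<comment> \<open>The fourth power inverts the Hoelder exponent 1/4 in time of the Duhamel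
    term.\<close>
  define \<eta> where "\<eta> = (\<epsilon> / (2 * K)) ^ 4"
  have p: "\<epsilon> / (2 * K) > 0" using e K by simp
  have \<eta>0: "\<eta> > 0" unfolding \<eta>_def using p by (rule zero_less_power)
  have "\<eta> = (\<epsilon> / (2 * K)) powr (real 4)" unfolding \<eta>_def by (rule powr_realpow[OF p, symmetric])
  then have "\<eta> powr (1/4) = (\<epsilon> / (2 * K)) powr (real 4 * (1/4))" by (simp only: powr_powr)
  then have \<eta>: "\<eta> powr (1/4) = \<epsilon> / (2 * K)" using p e K by simp
  have "\<epsilon> / 2 > 0" using e by simp
  then obtain \<delta> where \<delta>: "\<delta> > 0" "\<And>s x. s \<in> {0<..<T} \<Longrightarrow> \<bar>s - t\<bar> < \<delta> \<Longrightarrow> norm (neumann_heat s a x - neumann_heat t a x) \<le> \<epsilon> / 2 * wgt \<theta> x"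
    using regular_neumann_heat t unfolding regular_def by meson
  have D: "norm (duhamel (\<lambda>s. extend (u s)) s' x - duhamel (\<lambda>s. extend (u s)) s x) \<le> \<epsilon> / 2 * wgt \<theta> x"
    if "0 < s" "s < s'" "s' < T" "s' - s < \<eta>" for s s' x
  proof -
    have "norm (duhamel (\<lambda>s. extend (u s)) s' x - duhamel (\<lambda>s. extend (u s)) s x) \<le> 6 * C * R\<^sup>2 * (s' - s) powr (1/4) * W x"
      by (rule duhamel_time_diff_le[OF adm]) (use that T in auto)
    also have "\<dots> \<le> K * \<eta> powr (1/4) * wgt \<theta> x"
      unfolding K_def using that C_pos by (intro mult_mono mult_left_mono W_le_wgt powr_mono2) auto
    also have "K * \<eta> powr (1/4) = \<epsilon> / 2" unfolding \<eta> using K by simp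
    finally show ?thesis .
  qed
  show "\<exists>\<delta>>0. \<forall>s\<in>{0<..<T}. \<bar>s - t\<bar> < \<delta> \<longrightarrow> (\<forall>x. norm (picard u s x - picard u t x) \<le> \<epsilon> * wgt \<theta> x)"
  proof (intro exI[of _ "min \<delta> \<eta>"] conjI ballI impI allI)
    show "min \<delta> \<eta> > 0" using \<delta> \<eta>0 by simp
    fix s x assume s: "s \<in> {0<..<T}" and st: "\<bar>s - t\<bar> < min \<delta> \<eta>"
    have d: "norm (duhamel (\<lambda>s. extend (u s)) s x - duhamel (\<lambda>s. extend (u s)) t x) \<le> \<epsilon> / 2 * wgt \<theta> x"
    proof (cases s t rule: linorder_cases)
      case less
      then have "t - s < \<eta>" using st by simp
      with less D[of s t x] s t show ?thesis by (simp add: norm_minus_commute)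
    next
      case equal
      then show ?thesis using e by simp
    next
      case greater
      then have "s - t < \<eta>" using st by simp
      with greater D[of t s x] s t show ?thesis by simp
    qed
    have h: "norm (neumann_heat s a x - neumann_heat t a x) \<le> \<epsilon> / 2 * wgt \<theta> x"
      using \<delta>(2)[OF s] st by simp
    have "picard u s x - picard u t x = (neumann_heat s a x - neumann_heat t a x) - (duhamel (\<lambda>s. extend (u s)) s x - duhamel (\<lambda>s. extend (u s)) t x)"
      by (simp add: picard_def)
    also have "norm \<dots> \<le> \<epsilon> / 2 * wgt \<theta> x + \<epsilon> / 2 * wgt \<theta> x"
      by (rule order_trans[OF norm_triangle_ineq4 add_mono[OF h d]])
    finally show "norm (picard u s x - picard u t x) \<le> \<epsilon> * wgt \<theta> x" by (simp add: algebra_simps)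
  qed
qed

lemma picard_contraction:
  assumes u: "regular \<theta> T R u" and v: "regular \<theta> T R v" and D: "0 \<le> D"
    and uv: "\<And>t x. t \<in> {0<..<T} \<Longrightarrow> norm (u t x - v t x) \<le> D * wgt \<theta> x" and t: "0 \<le> t" "t \<le> T"
  shows "norm (picard u t x - picard v t x) \<le> D / 2 * wgt \<theta> x"
proof -
  have R0: "R \<ge> 0" using R_ge_1 by simp
  have "norm (duhamel (\<lambda>s. extend (u s)) t x - duhamel (\<lambda>s. extend (v s)) t x) \<le> 2 * C * (R + R) * D * t powr (1/2) * W x"
  proof (rule duhamel_diff_le_const[OF regular_admissible[OF u R0] regular_admissible[OF v R0] _ _ _ _ D])
    fix s assume "s \<in> {0<..<t}"
    then have "s \<in> {0<..<T}" using t by simp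
    then show "AE y in lebesgue. norm (extend (u s) y - extend (v s) y) \<le> D * wgt \<theta> y"
      unfolding extend_diff by (intro AE_I2 norm_extend_le uv)
  qed (use t T in auto)
  also have "\<dots> \<le> 2 * C * (R + R) * D * sqrt T * wgt \<theta> x"
    using C_pos T sqrt_le_T[OF t] R0 D by (intro mult_mono mult_left_mono W_le_wgt) auto
  also have "2 * C * (R + R) * D * sqrt T = (8 * C * R * sqrt T) * (D / 2)" by simp
  also have "\<dots> * wgt \<theta> x \<le> 1 * (D / 2) * wgt \<theta> x" using T(3) D by (intro mult_right_mono) auto
  finally show ?thesis by (simp add: picard_def norm_minus_commute)
qed

definition picard_seq :: "nat \<Rightarrow> real \<Rightarrow> 'a \<times> real \<Rightarrow> 'a \<times> real" where
  "picard_seq n = (picard ^^ n) (\<lambda>t. neumann_heat t a)"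

lemma picard_seq_Suc: "picard_seq (Suc n) = picard (picard_seq n)"
  by (simp add: picard_seq_def)

lemma regular_picard_seq: "regular \<theta> T R (picard_seq n)"
proof (induction n)
  case 0
  then show ?case using regular_neumann_heat by (simp add: picard_seq_def)
next
  case (Suc n)
  then show ?case unfolding picard_seq_Suc by (rule regular_picard)
qed

lemma picard_seq_diff:
  "0 \<le> t \<Longrightarrow> t \<le> T \<Longrightarrow> norm (picard_seq (Suc n) t x - picard_seq n t x) \<le> R * (1/2) ^ n * wgt \<theta> x"
proof (induction n arbitrary: t x)
  case 0
  have "norm (picard_seq (Suc 0) t x - picard_seq 0 t x) = norm (duhamel (\<lambda>s. extend (neumann_heat s a)) t x)"
    by (simp add: picard_seq_def picard_def)
  also have "\<dots> \<le> R / 2 * wgt \<theta> x" by (rule duhamel_le(2)[OF regular_neumann_heat 0])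
  also have "\<dots> \<le> R * (1/2) ^ 0 * wgt \<theta> x" using R_ge_1 by (intro mult_right_mono) auto
  finally show ?case .
next
  case (Suc n)
  have "norm (picard (picard_seq (Suc n)) t x - picard (picard_seq n) t x) \<le> (R * (1/2) ^ n) / 2 * wgt \<theta> x"
    using R_ge_1 by (intro picard_contraction regular_picard_seq Suc) auto
  then show ?case by (simp add: picard_seq_Suc)
qed

text \<open>The geometric sum is kept as an exact difference of powers so that the induction on k
  closes.\<close>

lemma picard_seq_diff_add:
  assumes t: "0 \<le> t" "t \<le> T"
  shows "norm (picard_seq (n + k) t x - picard_seq n t x) \<le> 2 * R * ((1/2) ^ n - (1/2) ^ (n + k)) * wgt \<theta> x"
proof (induction k)
  case (Suc k)
  have "norm (picard_seq (n + Suc k) t x - picard_seq n t x) \<le> norm (picard_seq (Suc (n + k)) t x - picard_seq (n + k) t x) + norm (picard_seq (n + k) t x - picard_seq n t x)"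
    using norm_triangle_ineq[of "picard_seq (Suc (n + k)) t x - picard_seq (n + k) t x" "picard_seq (n + k) t x - picard_seq n t x"] by simp
  also have "\<dots> \<le> R * (1/2) ^ (n + k) * wgt \<theta> x + 2 * R * ((1/2) ^ n - (1/2) ^ (n + k)) * wgt \<theta> x"
    by (intro add_mono picard_seq_diff t Suc)
  also have "\<dots> = 2 * R * ((1/2) ^ n - (1/2) ^ (n + Suc k)) * wgt \<theta> x" by (simp add: algebra_simps)
  finally show ?case .
qed simp

definition solution :: "real \<Rightarrow> 'a \<times> real \<Rightarrow> 'a \<times> real" where
  "solution t x = lim (\<lambda>n. picard_seq n t x)"

lemma picard_seq_diff_le:
  assumes t: "0 \<le> t" "t \<le> T" and mn: "n \<le> m"
  shows "norm (picard_seq m t x - picard_seq n t x) \<le> 2 * R * (1/2) ^ n * wgt \<theta> x"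
proof -
  have "norm (picard_seq m t x - picard_seq n t x) \<le> 2 * R * ((1/2) ^ n - (1/2) ^ m) * wgt \<theta> x"
    using picard_seq_diff_add[OF t, of n "m - n" x] mn by simp
  also have "\<dots> \<le> 2 * R * (1/2) ^ n * wgt \<theta> x"
    using R_ge_1 by (intro mult_right_mono mult_left_mono) auto
  finally show ?thesis .
qed

lemma half_power_tendsto: "(\<lambda>n. K * (1/2) ^ n) \<longlonglongrightarrow> (0::real)"
  using tendsto_mult_left[OF LIMSEQ_realpow_zero[of "1/2"], of K] by simp

lemma picard_seq_tendsto:
  assumes t: "0 \<le> t" "t \<le> T"
  shows "(\<lambda>n. picard_seq n t x) \<longlonglongrightarrow> solution t x"
proof -
  have "Cauchy (\<lambda>n. picard_seq n t x)"
  proof (rule metric_CauchyI)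
    fix e :: real assume "e > 0"
    then have "eventually (\<lambda>n. (2 * R * wgt \<theta> x) * (1/2) ^ n < e / 2) sequentially"
      using half_power_tendsto[of "2 * R * wgt \<theta> x"] by (intro order_tendstoD) auto
    then obtain N where N: "(2 * R * wgt \<theta> x) * (1/2) ^ N < e / 2" by (auto simp: eventually_sequentially)
    show "\<exists>M. \<forall>m\<ge>M. \<forall>n\<ge>M. dist (picard_seq m t x) (picard_seq n t x) < e"
    proof (intro exI[of _ N] allI impI)
      fix m n assume mn: "m \<ge> N" "n \<ge> N"
      have "dist (picard_seq m t x) (picard_seq n t x) \<le> dist (picard_seq m t x) (picard_seq N t x) + dist (picard_seq n t x) (picard_seq N t x)"
        by (rule dist_triangle2)
      also have "\<dots> \<le> 2 * R * (1/2) ^ N * wgt \<theta> x + 2 * R * (1/2) ^ N * wgt \<theta> x"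
        unfolding dist_norm by (intro add_mono picard_seq_diff_le t mn)
      also have "\<dots> < e" using N by (simp add: mult_ac)
      finally show "dist (picard_seq m t x) (picard_seq n t x) < e" .
    qed
  qed
  then show ?thesis unfolding solution_def by (simp add: Cauchy_convergent_iff convergent_LIMSEQ_iff)
qed

lemma solution_diff_le:
  assumes t: "0 \<le> t" "t \<le> T"
  shows "norm (solution t x - picard_seq n t x) \<le> 2 * R * (1/2) ^ n * wgt \<theta> x"
proof (rule LIMSEQ_le_const2)
  show "(\<lambda>m. norm (picard_seq m t x - picard_seq n t x)) \<longlonglongrightarrow> norm (solution t x - picard_seq n t x)"
    by (intro tendsto_intros picard_seq_tendsto t)
  show "\<exists>N. \<forall>m\<ge>N. norm (picard_seq m t x - picard_seq n t x) \<le> 2 * R * (1/2) ^ n * wgt \<theta> x"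
    using picard_seq_diff_le[OF t] by (intro exI[of _ n]) auto
qed

lemma regular_solution: "regular \<theta> T R solution"
proof (rule regular_limit[OF regular_picard_seq half_power_tendsto[of "2 * R"]])
  show "norm (solution t x - picard_seq n t x) \<le> 2 * R * (1/2) ^ n * wgt \<theta> x" if "t \<in> {0<..<T}" for n t x
    using that by (intro solution_diff_le) auto
qed

text \<open>The shifted sequence tends to \<open>solution\<close> and, by contraction, to
  \<open>picard solution\<close>. The identity holds at every point, not only almost
  everywhere.\<close>

lemma solution_eq:
  assumes t: "0 \<le> t" "t \<le> T"
  shows "solution t x = neumann_heat t a x - duhamel (\<lambda>s. extend (solution s)) t x"
proof -
  have "(\<lambda>n. picard_seq (Suc n) t x) \<longlonglongrightarrow> picard solution t x"
  proof (rule LIM_zero_cancel, rule tendsto_norm_zero_cancel, rule tendsto_sandwich)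
    show "eventually (\<lambda>n. 0 \<le> norm (picard_seq (Suc n) t x - picard solution t x)) sequentially" by simp
    show "eventually (\<lambda>n. norm (picard_seq (Suc n) t x - picard solution t x) \<le> (R * wgt \<theta> x) * (1/2) ^ n) sequentially"
    proof (intro always_eventually allI)
      fix n
      have "norm (picard (picard_seq n) t x - picard solution t x) \<le> (2 * R * (1/2) ^ n) / 2 * wgt \<theta> x"
      proof (rule picard_contraction[OF regular_picard_seq regular_solution _ _ t])
        show "norm (picard_seq n s y - solution s y) \<le> 2 * R * (1/2) ^ n * wgt \<theta> y" if "s \<in> {0<..<T}" for s y
          using solution_diff_le[of s y n] that by (simp add: norm_minus_commute)
      qed (use R_ge_1 in simp)
      then show "norm (picard_seq (Suc n) t x - picard solution t x) \<le> (R * wgt \<theta> x) * (1/2) ^ n"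
        by (simp add: picard_seq_Suc mult_ac)
    qed
    show "(\<lambda>n. (R * wgt \<theta> x) * (1/2) ^ n) \<longlonglongrightarrow> 0" by (rule half_power_tendsto)
  qed simp
  moreover have "(\<lambda>n. picard_seq (Suc n) t x) \<longlonglongrightarrow> solution t x"
    using picard_seq_tendsto[OF t] by (rule LIMSEQ_Suc)
  ultimately show ?thesis unfolding picard_def[symmetric] by (rule LIMSEQ_unique[symmetric])
qed

end

section \<open>Identification with the Fourier formulation and membership in
  \<open>Cw\<close>\<close>

lemma nonneg_of_le_wgt: "0 \<le> M * wgt p x \<Longrightarrow> 0 \<le> M"
  using wgt_pos[of p x] by (simp add: zero_le_mult_iff)

text \<open>An essential supremum over a null space would be -\<infinity>; the bound rests on the
  half space being open and nonempty, hence not negligible. It gives the lower half of limits in the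
  extended reals.\<close>

lemma Linf_norm_nonneg:
  fixes f :: "'a::euclidean_space \<times> real \<Rightarrow> 'a \<times> real"
  shows "0 \<le> Linf_norm \<theta> f"
proof (rule ccontr)
  let ?g = "\<lambda>x. ereal ((1 + norm x) powr \<theta> * norm (f x))"
  assume "\<not> 0 \<le> Linf_norm \<theta> f"
  then have neg: "Linf_norm \<theta> f < 0" by simp
  have "AE x in lebesgue_on half_space. ?g x \<le> Linf_norm \<theta> f"
    unfolding Linf_norm_def by (rule esssup_AE)
  moreover have "\<not> ?g x \<le> Linf_norm \<theta> f" for x
  proof -
    have "Linf_norm \<theta> f < ?g x" by (rule less_le_trans[OF neg]) simp
    then show ?thesis by simp
  qed
  ultimately have "AE x in lebesgue_on (half_space :: ('a \<times> real) set). False" by simp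
  then have "AE x in lebesgue. x \<notin> (half_space :: ('a \<times> real) set)" by (simp add: AE_half_space_iff)
  then have "(half_space :: ('a \<times> real) set) \<in> null_sets lebesgue"
    by (subst (asm) AE_iff_null_sets[symmetric]) auto
  then have "negligible (half_space :: ('a \<times> real) set)" by (simp add: negligible_iff_null_sets)
  moreover have "open (half_space :: ('a \<times> real) set)"
    unfolding half_space_def by (intro open_Collect_less continuous_intros)
  moreover have "(0, 1) \<in> (half_space :: ('a \<times> real) set)" by (simp add: half_space_def)
  ultimately show False using open_not_negligible by blast
qed

lemma neumann_nonlinear_oconv:
  assumes "\<tau> > 0" "dominated \<theta> A (extend v)" "2 * \<theta> > real DIM('a::euclidean_space \<times> real)"
  shows "neumann_nonlinear \<tau> v (x :: 'a \<times> real) = oconv \<tau> (extend v) x"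
  unfolding neumann_nonlinear_def oconv_def
  using assms(2) by (intro neumann_nonlinear_eq(2)[OF assms(1) _ dominated_square_integrable[OF assms(2,3)]]) (simp add: dominated_def)

lemma duhamel_neumann:
  fixes v :: "real \<Rightarrow> 'a::euclidean_space \<times> real \<Rightarrow> 'a \<times> real"
  assumes v: "\<And>s. s \<in> {0<..<t} \<Longrightarrow> dominated \<theta> A (extend (v s))" and \<theta>: "2 * \<theta> > real DIM('a \<times> real)"
  shows "set_integrable lebesgue {0<..<t} (\<lambda>s. neumann_nonlinear (t - s) (v s) x) \<longleftrightarrow> set_integrable lebesgue {0<..<t} (\<lambda>s. oconv (t - s) (extend (v s)) x)"
    and "(LINT s:{0<..<t}|lebesgue. neumann_nonlinear (t - s) (v s) x) = duhamel (\<lambda>s. extend (v s)) t x"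
proof -
  have e: "indicator {0<..<t} s *\<^sub>R neumann_nonlinear (t - s) (v s) x = indicator {0<..<t} s *\<^sub>R oconv (t - s) (extend (v s)) x" for s
  proof (cases "s \<in> {0<..<t}")
    case True
    then show ?thesis using neumann_nonlinear_oconv[OF _ v[OF True] \<theta>, of "t - s" x] by simp
  qed simp
  show "set_integrable lebesgue {0<..<t} (\<lambda>s. neumann_nonlinear (t - s) (v s) x) \<longleftrightarrow> set_integrable lebesgue {0<..<t} (\<lambda>s. oconv (t - s) (extend (v s)) x)"
    unfolding set_integrable_def e ..
  show "(LINT s:{0<..<t}|lebesgue. neumann_nonlinear (t - s) (v s) x) = duhamel (\<lambda>s. extend (v s)) t x"
    unfolding set_lebesgue_integral_def duhamel_def e ..
qed

lemma set_integral_test_function: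
  fixes f :: "'a::euclidean_space \<times> real \<Rightarrow> 'a \<times> real"
  assumes "test_function half_space \<phi>"
  shows "(LINT x:half_space|lebesgue. \<phi> x *\<^sub>R f x) = (LINT x|lebesgue. \<phi> x *\<^sub>R f x)"
  unfolding set_lebesgue_integral_def
  using test_function_facts(3)[OF assms] by (intro Bochner_Integration.integral_cong refl) (auto simp: indicator_def)

text \<open>Trades an exponential for the power -1/4, which combines with the singularity of order
  -1/2 to the still integrable order -3/4.\<close>

lemma exp_minus_powr_le:
  assumes "x > (0::real)"
  shows "exp (- x) \<le> x powr (-1/4)"
proof -
  have "x powr (1/4) \<le> exp x"
  proof (cases "x \<le> 1")
    case True
    then have "x powr (1/4) \<le> 1 powr (1/4)" using assms by (intro powr_mono2) auto
    also have "\<dots> \<le> exp x" using assms by simp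
    finally show ?thesis .
  next
    case False
    then have "x powr (1/4) \<le> x powr 1" by (intro powr_mono) auto
    also have "x powr 1 = x" using assms by simp
    also have "x \<le> exp x" using exp_ge_add_one_self[of x] by linarith
    finally show ?thesis .
  qed
  then have "inverse (exp x) \<le> inverse (x powr (1/4))" using assms by (intro le_imp_inverse_le) auto
  moreover have "x powr (-1/4) = inverse (x powr (1/4))" using powr_minus[of x "1/4"] by simp
  ultimately show ?thesis by (simp add: exp_minus)
qed

lemma regularD: "regular \<theta> T R u \<Longrightarrow> 0 < t \<Longrightarrow> t < T \<Longrightarrow> norm (u t x) \<le> R * wgt \<theta> x"
  unfolding regular_def by (metis greaterThanLessThan_iff)

context half_space_problem
begin

lemma two_theta_gt: "2 * \<theta> > real DIM('a \<times> real)"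
  using two_theta by simp

text \<open>At t = 0 the time integral runs over the empty set and \<open>heat 0\<close> is the
  identity; on the half space the value is a(x).\<close>

lemma solution_0: "solution 0 x = extend a x"
  using solution_eq[of 0 x] T by (simp add: neumann_heat_def heat_def duhamel_def set_lebesgue_integral_def)

lemma solution_measurable:
  assumes t: "0 \<le> t" "t < T"
  shows "solution t \<in> borel_measurable (lebesgue_on half_space)"
proof (cases "t = 0")
  case True
  have "extend a \<in> borel_measurable lebesgue" using a_dom by (simp add: dominated_def)
  moreover have "solution 0 = extend a" by (rule ext) (rule solution_0)
  ultimately show ?thesis unfolding True by (simp add: measurable_restrict_space1)
next
  case False
  then show ?thesis using regular_solution t by (intro borel_measurable_half_space) (auto simp: regular_def)
qed

lemma solution_bound:
  assumes t: "0 \<le> t" "t < T"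
  shows "AE x in lebesgue_on half_space. norm (solution t x) \<le> max A R * wgt \<theta> x"
proof (cases "t = 0")
  case True
  have "AE x in lebesgue. norm (extend a x) \<le> A * wgt \<theta> x" using a_dom by (simp add: dominated_def)
  then have "AE x in lebesgue_on half_space. norm (extend a x) \<le> A * wgt \<theta> x"
    unfolding AE_half_space_iff by eventually_elim simp
  then show ?thesis
  proof eventually_elim
    case (elim x)
    have "A * wgt \<theta> x \<le> max A R * wgt \<theta> x" by (intro mult_right_mono) auto
    with elim show ?case unfolding True solution_0 by (rule order_trans)
  qed
next
  case False
  show ?thesis
  proof (rule AE_I2)
    fix x
    have "norm (solution t x) \<le> R * wgt \<theta> x" using t False by (intro regularD[OF regular_solution]) auto
    also have "\<dots> \<le> max A R * wgt \<theta> x" by (intro mult_right_mono) auto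
    finally show "norm (solution t x) \<le> max A R * wgt \<theta> x" .
  qed
qed

text \<open>The heat part converges by \<open>tendsto_heat_test\<close> on the whole space, since
  \<phi> is supported in the half space. The Duhamel part is O(t^(1/2)) uniformly in x, and \<phi>
  decays fast enough to be integrable.\<close>

lemma solution_test:
  assumes \<phi>: "test_function half_space \<phi>"
  shows "((\<lambda>t. LINT x:half_space|lebesgue. \<phi> x *\<^sub>R solution t x) \<longlongrightarrow> (LINT x:half_space|lebesgue. \<phi> x *\<^sub>R solution 0 x)) (at_right 0)"
proof -
  let ?p = "real (DIM('a \<times> real) + 1)"
  have R0: "R \<ge> 0" using R_ge_1 by simp
  note adm = regular_admissible[OF regular_solution R0]
  have c: "continuous_on UNIV \<phi>" by (rule test_function_facts(1)[OF \<phi>])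
  obtain M where M: "\<And>x. \<bar>\<phi> x\<bar> \<le> M * wgt ?p x" using test_function_facts(2)[OF \<phi>] by blast
  have \<phi>m: "\<phi> \<in> borel_measurable borel" by (rule borel_measurable_continuous_onI[OF c])
  have M0: "M \<ge> 0" by (rule nonneg_of_le_wgt[OF order_trans[OF abs_ge_zero M[of 0]]])
  let ?D = "\<lambda>t. duhamel (\<lambda>s. extend (solution s)) t"
  have iw: "integrable lebesgue (\<lambda>x::'a \<times> real. wgt ?p x)"
    using integrable_wgt[of ?p, where 'a="'a \<times> real"] by (simp add: integrable_completion)
  define J where "J = (LINT x|lebesgue. wgt ?p (x::'a \<times> real))"
  have J: "J \<ge> 0" unfolding J_def by (intro integral_nonneg_AE) simp
  have ev: "eventually (\<lambda>t. 0 < t \<and> t < T) (at_right 0)"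
    using T by (simp add: eventually_at_right_field) (use T in \<open>auto intro!: exI[of _ T]\<close>)
  have D: "integrable lebesgue (\<lambda>x. \<phi> x *\<^sub>R ?D t x) \<and> norm (LINT x|lebesgue. \<phi> x *\<^sub>R ?D t x) \<le> (M * (2 * C * R\<^sup>2) * J) * t powr (1/2)" if t: "0 < t" "t < T" for t
  proof -
    have t': "0 \<le> t" "t \<le> T" "t \<le> 1" using t T by auto
    have Dm: "(\<lambda>x. \<phi> x *\<^sub>R ?D t x) \<in> borel_measurable lebesgue"
      by (intro measurable_completion) (use \<phi>m borel_measurable_continuous_onI[OF continuous_duhamel[OF adm t']] in measurable)
    have b: "norm (\<phi> x *\<^sub>R ?D t x) \<le> (M * (2 * C * R\<^sup>2 * t powr (1/2))) * wgt ?p x" for x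
    proof -
      have "norm (?D t x) \<le> 2 * C * R\<^sup>2 * t powr (1/2) * W x" by (rule duhamel_le(1)[OF regular_solution t'(1,2)])
      also have "\<dots> \<le> 2 * C * R\<^sup>2 * t powr (1/2) * 1" using C_pos by (intro mult_left_mono W_le_1) auto
      finally have "\<bar>\<phi> x\<bar> * norm (?D t x) \<le> (M * wgt ?p x) * (2 * C * R\<^sup>2 * t powr (1/2))"
        using M[of x] M0 by (intro mult_mono) auto
      then show ?thesis by (simp add: mult_ac)
    qed
    have g: "integrable lebesgue (\<lambda>x::'a \<times> real. (M * (2 * C * R\<^sup>2 * t powr (1/2))) * wgt ?p x)"
      by (intro integrable_mult_right iw)
    have i: "integrable lebesgue (\<lambda>x. \<phi> x *\<^sub>R ?D t x)"
      by (rule Bochner_Integration.integrable_bound[OF g Dm]) (use b in \<open>auto intro!: AE_I2 intro: order_trans[OF _ abs_ge_self]\<close>)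
    have "norm (LINT x|lebesgue. \<phi> x *\<^sub>R ?D t x) \<le> (LINT x|lebesgue. (M * (2 * C * R\<^sup>2 * t powr (1/2))) * wgt ?p (x::'a \<times> real))"
      by (rule norm_integral_le_AE[OF i g]) (intro AE_I2 b)
    also have "\<dots> = (M * (2 * C * R\<^sup>2 * t powr (1/2))) * J" unfolding J_def by (rule integral_mult_right_zero)
    finally show ?thesis using i by (simp add: mult_ac)
  qed
  have L: "((\<lambda>t. LINT x|lebesgue. \<phi> x *\<^sub>R ?D t x) \<longlongrightarrow> 0) (at_right 0)"
  proof (rule tendsto_norm_zero_cancel, rule tendsto_sandwich)
    show "eventually (\<lambda>t. 0 \<le> norm (LINT x|lebesgue. \<phi> x *\<^sub>R ?D t x)) (at_right 0)" by simp
    show "eventually (\<lambda>t. norm (LINT x|lebesgue. \<phi> x *\<^sub>R ?D t x) \<le> (M * (2 * C * R\<^sup>2) * J) * t powr (1/2)) (at_right 0)"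
      using ev by eventually_elim (use D in blast)
    have "((\<lambda>t. t powr (1/2)) \<longlongrightarrow> 0 powr (1/2)) (at_right (0::real))"
    proof (rule tendsto_powr')
      have "eventually (\<lambda>t. 0 \<le> t) (at_right (0::real))"
        using eventually_at_right_less[of "0::real"] by eventually_elim simp
      then show "0 \<noteq> (0::real) \<or> 0 < (1/2::real) \<and> eventually (\<lambda>t. 0 \<le> t) (at_right (0::real))" by simp
    qed (auto intro: tendsto_ident_at)
    then have "((\<lambda>t. (M * (2 * C * R\<^sup>2) * J) * t powr (1/2)) \<longlongrightarrow> (M * (2 * C * R\<^sup>2) * J) * 0 powr (1/2)) (at_right 0)"
      by (rule tendsto_mult_left)
    then show "((\<lambda>t. (M * (2 * C * R\<^sup>2) * J) * t powr (1/2)) \<longlongrightarrow> 0) (at_right 0)" by simp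
  qed simp
  have H: "((\<lambda>t. LINT x|lebesgue. \<phi> x *\<^sub>R heat t (extend a) x) \<longlongrightarrow> (LINT x|lebesgue. \<phi> x *\<^sub>R extend a x)) (at_right 0)"
    by (rule tendsto_heat_test[OF c M _ \<theta>_nonneg a_dom A]) simp
  have "((\<lambda>t. (LINT x|lebesgue. \<phi> x *\<^sub>R heat t (extend a) x) - (LINT x|lebesgue. \<phi> x *\<^sub>R ?D t x)) \<longlongrightarrow> (LINT x|lebesgue. \<phi> x *\<^sub>R extend a x) - 0) (at_right 0)"
    by (rule tendsto_diff[OF H L])
  moreover have "eventually (\<lambda>t. (LINT x|lebesgue. \<phi> x *\<^sub>R heat t (extend a) x) - (LINT x|lebesgue. \<phi> x *\<^sub>R ?D t x) = (LINT x|lebesgue. \<phi> x *\<^sub>R solution t x)) (at_right 0)"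
    using ev
  proof eventually_elim
    case (elim t)
    have hm: "heat t (extend a) \<in> borel_measurable borel" using regular_neumann_heat elim by (simp add: regular_def neumann_heat_def)
    have hi: "integrable lebesgue (\<lambda>x. \<phi> x *\<^sub>R heat t (extend a) x)"
    proof (rule Bochner_Integration.integrable_bound)
      show "integrable lebesgue (\<lambda>x::'a \<times> real. (M * R) * wgt ?p x)" by (intro integrable_mult_right iw)
      show "(\<lambda>x. \<phi> x *\<^sub>R heat t (extend a) x) \<in> borel_measurable lebesgue"
        by (intro measurable_completion) (use \<phi>m hm in measurable)
      show "AE x in lebesgue. norm (\<phi> x *\<^sub>R heat t (extend a) x) \<le> norm ((M * R) * wgt ?p x)"
      proof (rule AE_I2)
        fix x
        have "norm (heat t (extend a) x) \<le> R * wgt \<theta> x"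
          using regularD[OF regular_neumann_heat, of t x] elim by (simp add: neumann_heat_def)
        also have "\<dots> \<le> R * 1" using R0 by (intro mult_left_mono wgt_le_1 \<theta>_nonneg)
        finally have "\<bar>\<phi> x\<bar> * norm (heat t (extend a) x) \<le> (M * wgt ?p x) * R"
          using M[of x] M0 by (intro mult_mono) auto
        then show "norm (\<phi> x *\<^sub>R heat t (extend a) x) \<le> norm ((M * R) * wgt ?p x)" using M0 R0 by (simp add: mult_ac)
      qed
    qed
    have "(LINT x|lebesgue. \<phi> x *\<^sub>R solution t x) = (LINT x|lebesgue. \<phi> x *\<^sub>R heat t (extend a) x - \<phi> x *\<^sub>R ?D t x)"
      using solution_eq[of t] elim by (intro Bochner_Integration.integral_cong refl) (simp add: neumann_heat_def scaleR_diff_right)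
    also have "\<dots> = (LINT x|lebesgue. \<phi> x *\<^sub>R heat t (extend a) x) - (LINT x|lebesgue. \<phi> x *\<^sub>R ?D t x)"
      using hi D elim by (intro Bochner_Integration.integral_diff) auto
    finally show ?case by simp
  qed
  ultimately have "((\<lambda>t. LINT x|lebesgue. \<phi> x *\<^sub>R solution t x) \<longlongrightarrow> (LINT x|lebesgue. \<phi> x *\<^sub>R extend a x) - 0) (at_right 0)"
    by (rule Lim_transform_eventually)
  then show ?thesis
    by (simp add: set_integral_test_function[OF \<phi>] solution_0)
qed

lemma solution_Cw: "solution \<in> Cw T \<theta>"
  unfolding Cw_def mem_Collect_eq
proof (intro conjI ballI allI impI)
  show "solution t \<in> Linf \<theta>" if "t \<in> {0..<T}" for t
    using that by (intro LinfI[OF solution_measurable solution_bound]) auto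
  show "((\<lambda>s. Linf_norm \<theta> (\<lambda>x. solution s x - solution t x)) \<longlongrightarrow> 0) (at t)" if t: "t \<in> {0<..<T}" for t
  proof (rule order_tendstoI)
    fix e :: ereal assume "e < 0"
    then show "eventually (\<lambda>s. e < Linf_norm \<theta> (\<lambda>x. solution s x - solution t x)) (at t)"
      by (intro always_eventually allI) (rule less_le_trans[OF _ Linf_norm_nonneg])
  next
    fix e :: ereal assume "0 < e"
    then obtain \<epsilon> where \<epsilon>: "0 < \<epsilon>" "ereal \<epsilon> < e" by (metis ereal_dense2 ereal_less(2) zero_ereal_def)
    obtain \<delta> where \<delta>: "\<delta> > 0" "\<And>s x. s \<in> {0<..<T} \<Longrightarrow> \<bar>s - t\<bar> < \<delta> \<Longrightarrow> norm (solution s x - solution t x) \<le> \<epsilon> * wgt \<theta> x"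
      using regular_solution t \<epsilon>(1) unfolding regular_def by meson
    \<comment> \<open>Besides \<delta>, the radius keeps s inside (0, T).\<close>
    have le: "Linf_norm \<theta> (\<lambda>x. solution s x - solution t x) < e" if s: "dist s t < min \<delta> (min t (T - t))" for s
    proof -
      have s': "s \<in> {0<..<T}" "\<bar>s - t\<bar> < \<delta>" using s by (auto simp: dist_real_def abs_less_iff)
      have "Linf_norm \<theta> (\<lambda>x. solution s x - solution t x) \<le> ereal \<epsilon>"
        using s' t \<delta>(2)[OF s'] by (subst Linf_norm_le_iff) (auto intro!: borel_measurable_diff solution_measurable)
      then show ?thesis using \<epsilon>(2) by (rule le_less_trans)
    qed
    show "eventually (\<lambda>s. Linf_norm \<theta> (\<lambda>x. solution s x - solution t x) < e) (at t)"
      unfolding eventually_at using le \<delta>(1) t by (intro exI[of _ "min \<delta> (min t (T - t))"]) auto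
  qed
  show "((\<lambda>t. LINT x:half_space|lebesgue. \<phi> x *\<^sub>R solution t x) \<longlongrightarrow> (LINT x:half_space|lebesgue. \<phi> x *\<^sub>R solution 0 x)) (at_right 0)"
    if "test_function half_space \<phi>" for \<phi>
    by (rule solution_test[OF that])
  show "\<exists>C::real. \<forall>t\<in>{0..T'}. Linf_norm \<theta> (solution t) \<le> ereal C" if "T' \<in> {0..<T}" for T'
    using that by (intro exI[of _ "max A R"] ballI Linf_norm_le_iff[THEN iffD2, OF solution_measurable solution_bound]) auto
qed

lemma NS_solution_solution: "NS_solution a \<theta> T solution"
  unfolding NS_solution_def
proof (intro conjI solution_Cw ballI AE_I2)
  fix t x assume t: "t \<in> {0..<T}"
  have R0: "R \<ge> 0" using R_ge_1 by simp
  note adm = regular_admissible[OF regular_solution R0]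
  have dom: "dominated \<theta> R (extend (solution s))" if "s \<in> {0<..<t}" for s
    using adm that t by (auto simp: admissible_def)
  note N = duhamel_neumann[where v=solution and t=t and x=x and A=R, OF dom two_theta_gt]
  show "set_integrable lebesgue {0<..<t} (\<lambda>s. neumann_nonlinear (t - s) (solution s) x)"
    using N(1) duhamel_integrable(1)[OF adm, of t x] t T by auto
  show "solution t x = neumann_heat t a x - (LINT s:{0<..<t}|lebesgue. neumann_nonlinear (t - s) (solution s) x)"
    using N(2) solution_eq[of t x] t by simp
qed

section \<open>Uniqueness in the class \<open>Cw\<close>\<close>

lemma NS_solution_facts:
  assumes v: "NS_solution a \<theta> T v" and T': "0 < T'" "T' < T"
  shows "\<exists>K\<ge>0. admissible \<theta> T' K (\<lambda>s. extend (v s)) \<and> (\<forall>s\<in>{0..T'}. (AE x in lebesgue_on half_space. norm (v s x) \<le> K * wgt \<theta> x))"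
proof -
  have cw: "v \<in> Cw T \<theta>" using v by (simp add: NS_solution_def)
  have m: "v s \<in> borel_measurable (lebesgue_on half_space)" if "0 \<le> s" "s < T" for s
    using cw that by (auto simp: Cw_def Linf_def)
  obtain K0 where K0: "\<And>s. s \<in> {0..T'} \<Longrightarrow> Linf_norm \<theta> (v s) \<le> ereal K0"
    using cw T' unfolding Cw_def by force
  define K where "K = max K0 0"
  have K: "AE x in lebesgue_on half_space. norm (v s x) \<le> K * wgt \<theta> x" if "s \<in> {0..T'}" for s
  proof -
    have "Linf_norm \<theta> (v s) \<le> ereal K" using K0[OF that] by (rule order_trans) (simp add: K_def)
    then show ?thesis using that T' by (subst Linf_norm_le_iff[symmetric]) (auto intro: m)
  qed
  have "admissible \<theta> T' K (\<lambda>s. extend (v s))"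
    unfolding admissible_def
  proof (intro conjI ballI allI impI)
    show "0 \<le> K" by (simp add: K_def)
    fix s assume s: "s \<in> {0<..<T'}"
    show "dominated \<theta> K (extend (v s))"
      using s T' K[of s] by (intro dominated_extend m) (auto simp: K_def)
    fix \<epsilon> :: real assume e: "\<epsilon> > 0"
    have "((\<lambda>r. Linf_norm \<theta> (\<lambda>x. v r x - v s x)) \<longlongrightarrow> 0) (at s)"
      using cw s T' by (auto simp: Cw_def)
    then have "eventually (\<lambda>r. Linf_norm \<theta> (\<lambda>x. v r x - v s x) < ereal \<epsilon>) (at s)"
      using e by (intro order_tendstoD) auto
    then obtain \<delta> where \<delta>: "\<delta> > 0" "\<And>r. r \<noteq> s \<Longrightarrow> dist r s < \<delta> \<Longrightarrow> Linf_norm \<theta> (\<lambda>x. v r x - v s x) < ereal \<epsilon>"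
      unfolding eventually_at by blast
    show "\<exists>\<delta>>0. \<forall>r\<in>{0<..<T'}. \<bar>r - s\<bar> < \<delta> \<longrightarrow> (AE y in lebesgue. norm (extend (v r) y - extend (v s) y) \<le> \<epsilon> * wgt \<theta> y)"
    proof (intro exI[of _ \<delta>] conjI ballI impI \<delta>(1))
      fix r assume r: "r \<in> {0<..<T'}" "\<bar>r - s\<bar> < \<delta>"
      have "AE x in lebesgue_on half_space. norm (v r x - v s x) \<le> \<epsilon> * wgt \<theta> x"
      proof (cases "r = s")
        case True
        then show ?thesis using e by simp
      next
        case False
        then have "Linf_norm \<theta> (\<lambda>x. v r x - v s x) \<le> ereal \<epsilon>" using \<delta>(2) r by (auto simp: dist_real_def less_imp_le)
        then show ?thesis using r s T' by (subst (asm) Linf_norm_le_iff) (auto intro!: borel_measurable_diff m)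
      qed
      then show "AE y in lebesgue. norm (extend (v r) y - extend (v s) y) \<le> \<epsilon> * wgt \<theta> y"
        unfolding extend_diff by (rule AE_extend_le) (use e in simp)
    qed
  qed
  then show ?thesis using K by (intro exI[of _ K]) (auto simp: K_def)
qed

lemma NS_solution_eq_duhamel:
  assumes v: "NS_solution a \<theta> T v" and adm: "admissible \<theta> T' K (\<lambda>s. extend (v s))" and s: "0 \<le> s" "s \<le> T'" "s < T"
  shows "AE x in lebesgue_on half_space. v s x = neumann_heat s a x - duhamel (\<lambda>s. extend (v s)) s x"
proof -
  have "AE x in lebesgue_on half_space. v s x = neumann_heat s a x - (LINT r:{0<..<s}|lebesgue. neumann_nonlinear (s - r) (v r) x)"
    using v s unfolding NS_solution_def by auto
  then show ?thesis
  proof eventually_elim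
    case (elim x)
    have "(LINT r:{0<..<s}|lebesgue. neumann_nonlinear (s - r) (v r) x) = duhamel (\<lambda>s. extend (v s)) s x"
      by (rule duhamel_neumann(2)[OF _ two_theta_gt, where A=K]) (use adm s in \<open>auto simp: admissible_def\<close>)
    with elim show ?case by simp
  qed
qed

text \<open>The factor exp(-\<mu>(s-r)) is small unless r is close to s, and
  \<open>exp_minus_powr_le\<close> turns this into the gain \<mu>^(-1/4), uniformly for s \<le>
  1.\<close>

lemma exp_weight_integral:
  fixes \<mu> s B :: real
  assumes l: "\<mu> > 0" and s: "0 \<le> s" "s \<le> 1" and B: "B \<ge> 0"
  shows "set_integrable lebesgue {0<..<s} (\<lambda>r. B * exp (\<mu> * r) * (s - r) powr (-1/2))"
    and "(LINT r:{0<..<s}|lebesgue. B * exp (\<mu> * r) * (s - r) powr (-1/2)) \<le> 4 * \<mu> powr (-1/4) * B * exp (\<mu> * s)"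
proof -
  let ?f = "\<lambda>r. B * exp (\<mu> * r) * (s - r) powr (-1/2)"
  let ?g = "\<lambda>r. (B * exp (\<mu> * s) * \<mu> powr (-1/4)) * (s - r) powr (-3/4)"
  have c: "continuous_on {0<..<s} ?f" by (intro continuous_intros) auto
  have g: "set_integrable lebesgue {0<..<s} ?g" by (intro set_integrable_mult_right quarter_integral s)
  have le: "norm (?f r) \<le> ?g r" if r: "r \<in> {0<..<s}" for r
  proof -
    have p: "\<mu> * (s - r) > 0" using r l by simp
    have "exp (\<mu> * r) = exp (\<mu> * s) * exp (- (\<mu> * (s - r)))"
      by (simp add: exp_add[symmetric] algebra_simps)
    also have "\<dots> \<le> exp (\<mu> * s) * (\<mu> * (s - r)) powr (-1/4)"
      by (intro mult_left_mono exp_minus_powr_le p) auto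
    also have "(\<mu> * (s - r)) powr (-1/4) = \<mu> powr (-1/4) * (s - r) powr (-1/4)"
      by (rule powr_mult)
    finally have "?f r \<le> B * (exp (\<mu> * s) * (\<mu> powr (-1/4) * (s - r) powr (-1/4))) * (s - r) powr (-1/2)"
      using B by (intro mult_right_mono mult_left_mono) auto
    also have "\<dots> = (B * exp (\<mu> * s) * \<mu> powr (-1/4)) * ((s - r) powr (-1/4) * (s - r) powr (-1/2))"
      by (simp only: mult_ac)
    also have "(s - r) powr (-1/4) * (s - r) powr (-1/2) = (s - r) powr (-3/4)"
      by (simp add: powr_add[symmetric])
    finally show ?thesis using B by simp
  qed
  note D = set_integral_dominated[OF _ c g le]
  show "set_integrable lebesgue {0<..<s} ?f" by (rule D) auto
  have "(LINT r:{0<..<s}|lebesgue. ?f r) \<le> norm (LINT r:{0<..<s}|lebesgue. ?f r)" by simp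
  also have "\<dots> \<le> (LINT r:{0<..<s}|lebesgue. ?g r)" by (rule D) auto
  also have "\<dots> = (B * exp (\<mu> * s) * \<mu> powr (-1/4)) * (4 * s powr (1/4))"
    by (simp only: set_integral_mult_right quarter_integral(2)[OF s(1)])
  also have "\<dots> \<le> (B * exp (\<mu> * s) * \<mu> powr (-1/4)) * (4 * 1)"
  proof -
    have "s powr (1/4) \<le> 1 powr (1/4)" using s by (intro powr_mono2) auto
    then show ?thesis using B by (intro mult_left_mono) auto
  qed
  finally show "(LINT r:{0<..<s}|lebesgue. ?f r) \<le> 4 * \<mu> powr (-1/4) * B * exp (\<mu> * s)"
    by (simp only: mult_ac mult_1_right)
qed

text \<open>With the weight \<open>exp (- \<mu> t)\<close> and \<open>\<mu>\<close> large the integral equation contracts differences on all of \<open>[0, T']\<close>,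
  however large the second solution is.\<close>

lemma solution_unique:
  assumes v: "NS_solution a \<theta> T v" and t: "0 \<le> t" "t < T"
  shows "AE x in lebesgue_on half_space. v t x = solution t x"
proof -
  \<comment> \<open>A time strictly between t and T, because \<open>Cw\<close> bounds the second
    solution only on intervals [0, T'] with T' < T.\<close>
  define T' where "T' = (t + T) / 2"
  have T': "0 < T'" "T' < T" "t \<le> T'" using t T by (auto simp: T'_def)
  obtain K where K: "K \<ge> 0" and adm: "admissible \<theta> T' K (\<lambda>s. extend (v s))"
    and vb: "\<And>s. s \<in> {0..T'} \<Longrightarrow> AE x in lebesgue_on half_space. norm (v s x) \<le> K * wgt \<theta> x"
    using NS_solution_facts[OF v T'(1,2)] by blast
  have R0: "R \<ge> 0" using R_ge_1 by simp
  have radm: "admissible \<theta> T' R (\<lambda>s. extend (solution s))"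
  proof -
    have "regular \<theta> T' R solution" using regular_solution T' unfolding regular_def by force
    then show ?thesis by (rule regular_admissible[OF _ R0])
  qed
  \<comment> \<open>With \<mu> = q^4 the gain \<mu>^(-1/4) is 1/q, and the contraction factor 4 C
    (R+K) \<mu>^(-1/4) becomes exactly 1/2.\<close>
  define q where "q = 8 * C * (R + K)"
  have q: "q > 0" using C_pos R_ge_1 K by (simp add: q_def)
  define \<mu> where "\<mu> = q ^ 4"
  have l: "\<mu> > 0" unfolding \<mu>_def using q by simp
  have lq: "\<mu> powr (-1/4) = 1 / q"
  proof -
    have "\<mu> = q powr (real 4)" unfolding \<mu>_def by (rule powr_realpow[OF q, symmetric])
    then have "\<mu> powr (-1/4) = q powr (real 4 * (-1/4))" by (simp only: powr_powr)
    then show ?thesis using q by (simp add: powr_minus_divide)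
  qed
  \<comment> \<open>The induction starts from the sum of the two size bounds, and each step through
    the integral equation halves the constant.\<close>
  have main: "\<forall>s\<in>{0..T'}. AE x in lebesgue_on half_space. norm (solution s x - v s x) \<le> ((K + max A R) * (1/2) ^ n) * exp (\<mu> * s) * wgt \<theta> x" for n
  proof (induction n)
    case 0
    show ?case
    proof
      fix s assume s: "s \<in> {0..T'}"
      then have "0 \<le> s" "s < T" using T' by auto
      from vb[OF s] solution_bound[OF this]
      show "AE x in lebesgue_on half_space. norm (solution s x - v s x) \<le> ((K + max A R) * (1/2) ^ 0) * exp (\<mu> * s) * wgt \<theta> x"
      proof eventually_elim
        case (elim x)
        have "norm (solution s x - v s x) \<le> (K + max A R) * wgt \<theta> x"
          using norm_triangle_ineq4[of "solution s x" "v s x"] elim by (simp add: distrib_right)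
        also have "\<dots> \<le> ((K + max A R) * exp (\<mu> * s)) * wgt \<theta> x"
        proof -
          have "1 \<le> exp (\<mu> * s)" using l s by simp
          then have "(K + max A R) * 1 \<le> (K + max A R) * exp (\<mu> * s)" using K A by (intro mult_left_mono) auto
          then show ?thesis by (intro mult_right_mono) auto
        qed
        finally show ?case by simp
      qed
    qed
  next
    case (Suc n)
    define B where "B = (K + max A R) * (1/2) ^ n"
    have B: "B \<ge> 0" using K A by (simp add: B_def)
    show ?case
    proof
      fix s assume s: "s \<in> {0..T'}"
      then have s': "0 \<le> s" "s \<le> T'" "s < T" "s \<le> 1" "s \<le> T" using T' T by auto
      have D: "norm (duhamel (\<lambda>s. extend (solution s)) s x - duhamel (\<lambda>s. extend (v s)) s x) \<le> B / 2 * exp (\<mu> * s) * wgt \<theta> x" for x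
      proof -
        have "norm (duhamel (\<lambda>s. extend (solution s)) s x - duhamel (\<lambda>s. extend (v s)) s x)
           \<le> C * (R + K) * (LINT r:{0<..<s}|lebesgue. B * exp (\<mu> * r) * (s - r) powr (-1/2)) * W x"
        proof (rule duhamel_diff_le[OF radm adm s'(1,2,4)])
          fix r assume r: "r \<in> {0<..<s}"
          then have "r \<in> {0..T'}" using s' by simp
          then have "AE x in lebesgue_on half_space. norm (solution r x - v r x) \<le> B * exp (\<mu> * r) * wgt \<theta> x"
            using Suc by (simp add: B_def)
          then show "AE y in lebesgue. norm (extend (solution r) y - extend (v r) y) \<le> B * exp (\<mu> * r) * wgt \<theta> y"
            unfolding extend_diff by (rule AE_extend_le) (use B in simp)
          show "0 \<le> B * exp (\<mu> * r)" using B by simp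
        qed (rule exp_weight_integral(1)[OF l s'(1,4) B])
        also have "\<dots> \<le> C * (R + K) * (4 * \<mu> powr (-1/4) * B * exp (\<mu> * s)) * wgt \<theta> x"
          using C_pos R0 K B by (intro mult_mono mult_left_mono W_le_wgt exp_weight_integral(2)[OF l s'(1,4) B]) auto
        also have "C * (R + K) * (4 * \<mu> powr (-1/4) * B * exp (\<mu> * s)) = (q / 2 * \<mu> powr (-1/4)) * B * exp (\<mu> * s)"
          by (simp add: q_def)
        also have "q / 2 * \<mu> powr (-1/4) = 1 / 2" unfolding lq using q by simp
        finally show ?thesis by simp
      qed
      from NS_solution_eq_duhamel[OF v adm s'(1,2,3)]
      show "AE x in lebesgue_on half_space. norm (solution s x - v s x) \<le> ((K + max A R) * (1/2) ^ Suc n) * exp (\<mu> * s) * wgt \<theta> x"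
      proof eventually_elim
        case (elim x)
        have "solution s x - v s x = - (duhamel (\<lambda>s. extend (solution s)) s x - duhamel (\<lambda>s. extend (v s)) s x)"
          unfolding elim solution_eq[OF s'(1,5)] by simp
        then have "norm (solution s x - v s x) = norm (duhamel (\<lambda>s. extend (solution s)) s x - duhamel (\<lambda>s. extend (v s)) s x)"
          by (simp only: norm_minus_cancel)
        then show ?case using D[of x] by (simp add: B_def)
      qed
    qed
  qed
  \<comment> \<open>The exceptional null sets, one for each n, are united before n tends to
    infinity.\<close>
  have "AE x in lebesgue_on half_space. \<forall>n. norm (solution t x - v t x) \<le> ((K + max A R) * (1/2) ^ n) * exp (\<mu> * t) * wgt \<theta> x"
    unfolding AE_all_countable using main t T' by auto
  then show ?thesis
  proof eventually_elim
    case (elim x)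
    have "norm (solution t x - v t x) \<le> 0"
    proof (rule LIMSEQ_le_const)
      show "(\<lambda>n. ((K + max A R) * exp (\<mu> * t) * wgt \<theta> x) * (1/2) ^ n) \<longlonglongrightarrow> 0" by (rule half_power_tendsto)
      show "\<exists>N. \<forall>n\<ge>N. norm (solution t x - v t x) \<le> ((K + max A R) * exp (\<mu> * t) * wgt \<theta> x) * (1/2) ^ n"
        using elim by (intro exI[of _ 0]) (simp add: mult_ac)
    qed
    then show ?case by simp
  qed
qed

end

section \<open>The asymptotic profile\<close>

lemma oseen0_diff_le:
  fixes z w w' :: "'a::euclidean_space"
  shows "norm (oseen0 z w - oseen0 z w') \<le> (norm z * \<bar>gG DIM('a) 0 0 (norm z)\<bar> + norm z ^ 3 * \<bar>gG DIM('a) 1 0 (norm z)\<bar>) * ((norm w + norm w') * norm (w - w'))"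
  using norm_oseen_form_diff_le[of "gG DIM('a) 0 0 (norm z)" "gG DIM('a) 1 0 (norm z)" 0 z w w'] by (simp add: oseen0_def)

lemma oseen0_measurable:
  fixes f :: "'b \<Rightarrow> 'a::euclidean_space"
  assumes [measurable]: "f \<in> borel_measurable M"
  shows "(\<lambda>y. oseen0 z (f y)) \<in> borel_measurable M"
  unfolding oseen0_def oseen_form_def by measurable

text \<open>What remains of \<open>oconv\<close> once y is dropped from x - y and \<tau> is set to
  0: a homogeneous function of x whose coefficients are integrals of products of components of
  f.\<close>

definition oseen0_moment :: "'a::euclidean_space \<Rightarrow> ('a \<Rightarrow> 'a) \<Rightarrow> 'a" where
  "oseen0_moment x f = (LINT y|lebesgue. oseen0 x (f y))"

lemma oseen0_moment_integrable:
  fixes f :: "'a::euclidean_space \<Rightarrow> 'a"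
  assumes f: "dominated \<theta> A f" and \<theta>: "2 * \<theta> > real DIM('a)"
  shows "integrable lebesgue (\<lambda>y. oseen0 x (f y))"
proof -
  define c where "c = norm x * \<bar>gG DIM('a) 0 0 (norm x)\<bar> + norm x ^ 3 * \<bar>gG DIM('a) 1 0 (norm x)\<bar>"
  show ?thesis
  proof (rule Bochner_Integration.integrable_bound)
    show "integrable lebesgue (\<lambda>y. c * (norm (f y))\<^sup>2)"
      by (intro integrable_mult_right dominated_square_integrable[OF f \<theta>])
    show "(\<lambda>y. oseen0 x (f y)) \<in> borel_measurable lebesgue"
      using f by (intro oseen0_measurable) (simp add: dominated_def)
    show "AE y in lebesgue. norm (oseen0 x (f y)) \<le> norm (c * (norm (f y))\<^sup>2)"
    proof (rule AE_I2)
      fix y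
      have "norm (oseen0 x (f y)) \<le> c * (norm (f y))\<^sup>2"
        using oseen0_diff_le[of x "f y" 0] by (simp add: c_def oseen0_def oseen_form_def power2_eq_square)
      then show "norm (oseen0 x (f y)) \<le> norm (c * (norm (f y))\<^sup>2)"
        by (rule order_trans) simp
    qed
  qed
qed

text \<open>In the near region |y| \<le> |x|/2 the kernel is replaced by its limit, and then y is
  dropped from its argument. In the far region no cancellation is used: the two kernels are
  estimated separately, and the decay of w in y supplies the decay in x. The term \<open>pk\<close>
  has to stay because the Oseen kernel is concentrated near y = x, which lies in the far
  region.\<close>

lemma oseen_kernel_asymptotics:
  fixes q \<theta> :: real
  assumes q: "0 \<le> q" "q \<le> real DIM('a::euclidean_space) + 2" "q \<le> 2 * \<theta>" and \<theta>: "2 * \<theta> \<ge> 1"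
  shows "\<exists>K>0. \<forall>\<tau>\<in>{0<..1}. \<forall>x y w :: 'a. \<forall>A\<ge>0. norm x \<ge> 1 \<longrightarrow> norm w \<le> A * wgt \<theta> y \<longrightarrow>
     norm (oseen \<tau> (x - y) w - oseen0 x w) \<le> K * A\<^sup>2 * norm x powr (- q) * (wgt (2 * \<theta> - 1) y + pk \<tau> (x - y))"
proof -
  let ?d = "DIM('a)"
  obtain K0 where K0: "K0 > 0" and k0: "\<And>\<tau> (z::'a) w w'. \<tau> > 0 \<Longrightarrow> norm (oseen \<tau> z w - oseen \<tau> z w') \<le> K0 * pk \<tau> z * ((norm w + norm w') * norm (w - w'))"
    using oseen_diff_le by blast
  obtain K1 where K1: "K1 > 0" and k1': "\<forall>\<tau>>0. \<forall>z w :: 'a. z \<noteq> 0 \<longrightarrow> norm (oseen \<tau> z w - oseen0 z w) \<le> K1 * \<tau> / norm z ^ (?d + 3) * (norm w)\<^sup>2"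
    using oseen_oseen0_le[where 'a='a] by (elim exE conjE) (rule that)
  obtain K2 where K2: "K2 > 0" and k2': "\<forall>x y w :: 'a. x \<noteq> 0 \<longrightarrow> norm y \<le> norm x / 2 \<longrightarrow> norm (oseen0 (x - y) w - oseen0 x w) \<le> K2 * norm y / norm x ^ (?d + 2) * (norm w)\<^sup>2"
    using oseen0_lipschitz[where 'a='a] by (elim exE conjE) (rule that)
  obtain K3 where K3: "K3 > 0" and k3': "\<forall>z w :: 'a. norm (oseen0 z w) \<le> K3 / norm z ^ (?d + 1) * (norm w)\<^sup>2"
    using oseen0_le[where 'a='a] by (elim exE conjE) (rule that)
  \<comment> \<open>\<open>K1\<close> and \<open>K2\<close> belong to the two replacements in the
    near region, \<open>K0\<close> and \<open>K3\<close> to the two kernels in the far region. The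
    powers of 2 come from |x-y| \<ge> |x|/2 and from |y| > |x|/2.\<close>
  define K where "K = K0 * 2 powr q + K1 * 2 ^ (?d + 3) + K2 + 2 * K3"
  have Kpos: "K > 0" unfolding K_def using K0 K1 K2 K3 by (intro add_pos_pos mult_pos_pos) auto
  show ?thesis
  proof (intro exI[of _ K] conjI Kpos ballI allI impI)
    fix \<tau> A :: real and x y w :: 'a
    assume t: "\<tau> \<in> {0<..1}" and A: "A \<ge> 0" and x: "norm x \<ge> 1" and w: "norm w \<le> A * wgt \<theta> y"
    have t0: "\<tau> > 0" using t by simp
    have x0: "x \<noteq> 0" using x by auto
    define X where "X = norm x powr (- q)"
    have X: "X > 0" using x0 by (simp add: X_def)
    have w2: "(norm w)\<^sup>2 \<le> A\<^sup>2 * wgt (2 * \<theta>) y"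
    proof -
      have "(norm w)\<^sup>2 \<le> (A * wgt \<theta> y)\<^sup>2" using w by (intro power_mono) auto
      also have "\<dots> = A\<^sup>2 * wgt (2 * \<theta>) y" using wgt_add[of \<theta> y \<theta>] by (simp add: power2_eq_square mult_ac)
      finally show ?thesis .
    qed
    \<comment> \<open>One power of |y| is spent, which lowers the weight to 2\<theta> - 1. It pays
      for the Lipschitz step in the near region and, through |x| \<le> 2 (1+|y|), for the power of
      |x| that the limit kernel lacks in the far region.\<close>
    have w1: "(1 + norm y) * wgt (2 * \<theta>) y = wgt (2 * \<theta> - 1) y"
    proof -
      have "(1 + norm y) powr 1 * wgt (2 * \<theta>) y = (1 + norm y) powr 1 * (wgt 1 y * wgt (2 * \<theta> - 1) y)"
        by (simp only: wgt_add) simp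
      also have "\<dots> = ((1 + norm y) powr 1 * wgt 1 y) * wgt (2 * \<theta> - 1) y" by (simp only: mult.assoc)
      also have "\<dots> = wgt (2 * \<theta> - 1) y" by (simp only: wgt_inverse mult_1_left)
      finally show ?thesis by (simp add: powr_one)
    qed
    have Xd: "1 / norm x ^ (?d + 2) \<le> X"
    proof -
      have "norm x powr (- real (?d + 2)) \<le> X" unfolding X_def using q x by (intro powr_mono) auto
      moreover have "norm x powr (- real (?d + 2)) = 1 / norm x ^ (?d + 2)"
        using x0 by (subst powr_minus_divide, subst powr_realpow) auto
      ultimately show ?thesis by simp
    qed
    have pk0: "pk \<tau> (x - y) > 0" by (rule pk_pos[OF t0])
    define P where "P = A\<^sup>2 * X * wgt (2 * \<theta> - 1) y"
    define Q where "Q = A\<^sup>2 * X * pk \<tau> (x - y)"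
    have PQ: "P \<ge> 0" "Q \<ge> 0" using X pk0 by (auto simp: P_def Q_def)
    have "norm (oseen \<tau> (x - y) w - oseen0 x w) \<le> (K1 * 2 ^ (?d + 3) + K2 + 2 * K3) * P + K0 * 2 powr q * Q"
    proof (cases "norm y \<le> norm x / 2")
      case True
      have z: "norm (x - y) \<ge> norm x / 2" using True norm_triangle_ineq2[of x y] by simp
      have z0: "x - y \<noteq> 0" using z x by auto
      have "norm (oseen \<tau> (x - y) w - oseen0 (x - y) w) \<le> K1 * \<tau> / norm (x - y) ^ (?d + 3) * (norm w)\<^sup>2"
        using k1' t0 z0 by blast
      \<comment> \<open>One of the d+3 powers is discarded, by |x| \<ge> 1 and \<tau> \<le>
        1.\<close>
      also have "\<dots> \<le> K1 * 2 ^ (?d + 3) / norm x ^ (?d + 2) * (norm w)\<^sup>2"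
      proof (intro mult_right_mono)
        have "(norm x / 2) ^ (?d + 3) \<le> norm (x - y) ^ (?d + 3)" using z by (intro power_mono) auto
        then have "1 / norm (x - y) ^ (?d + 3) \<le> 1 / (norm x / 2) ^ (?d + 3)"
          using x0 z0 by (intro divide_left_mono mult_pos_pos zero_less_power) (simp_all only: zero_less_norm_iff, auto)
        also have "\<dots> = 2 ^ (?d + 3) / (norm x ^ (?d + 2) * norm x)" by (simp add: power_divide eval_nat_numeral mult_ac)
        also have "\<dots> \<le> 2 ^ (?d + 3) / (norm x ^ (?d + 2) * 1)"
          using x x0 by (intro divide_left_mono mult_left_mono mult_pos_pos) auto
        finally have "1 / norm (x - y) ^ (?d + 3) \<le> 2 ^ (?d + 3) / norm x ^ (?d + 2)" by simp
        then have "(K1 * \<tau>) * (1 / norm (x - y) ^ (?d + 3)) \<le> (K1 * 1) * (2 ^ (?d + 3) / norm x ^ (?d + 2))"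
          using K1 t by (intro mult_mono) auto
        then show "K1 * \<tau> / norm (x - y) ^ (?d + 3) \<le> K1 * 2 ^ (?d + 3) / norm x ^ (?d + 2)" by simp
      qed simp
      finally have a: "norm (oseen \<tau> (x - y) w - oseen0 (x - y) w) \<le> K1 * 2 ^ (?d + 3) / norm x ^ (?d + 2) * (norm w)\<^sup>2" .
      have b: "norm (oseen0 (x - y) w - oseen0 x w) \<le> K2 * norm y / norm x ^ (?d + 2) * (norm w)\<^sup>2"
        using k2' x0 True by blast
      have "oseen \<tau> (x - y) w - oseen0 x w = (oseen \<tau> (x - y) w - oseen0 (x - y) w) + (oseen0 (x - y) w - oseen0 x w)" by simp
      also have "norm \<dots> \<le> K1 * 2 ^ (?d + 3) / norm x ^ (?d + 2) * (norm w)\<^sup>2 + K2 * norm y / norm x ^ (?d + 2) * (norm w)\<^sup>2"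
        by (rule order_trans[OF norm_triangle_ineq add_mono[OF a b]])
      also have "\<dots> = (1 / norm x ^ (?d + 2)) * ((K1 * 2 ^ (?d + 3) + K2 * norm y) * (norm w)\<^sup>2)"
        by (simp add: algebra_simps add_divide_distrib)
      also have "\<dots> \<le> X * (((K1 * 2 ^ (?d + 3) + K2) * (1 + norm y)) * (A\<^sup>2 * wgt (2 * \<theta>) y))"
      proof (intro mult_mono Xd w2)
        have "0 \<le> K1 * 2 ^ (?d + 3) * norm y" using K1 by simp
        then show "K1 * 2 ^ (?d + 3) + K2 * norm y \<le> (K1 * 2 ^ (?d + 3) + K2) * (1 + norm y)"
          using K2 by (simp add: algebra_simps)
      qed (use X K1 K2 in auto)
      also have "\<dots> = (K1 * 2 ^ (?d + 3) + K2) * (A\<^sup>2 * X * ((1 + norm y) * wgt (2 * \<theta>) y))" by (simp only: mult_ac)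
      also have "\<dots> = (K1 * 2 ^ (?d + 3) + K2) * P" unfolding w1 P_def ..
      also have "\<dots> \<le> (K1 * 2 ^ (?d + 3) + K2 + 2 * K3) * P + K0 * 2 powr q * Q"
      proof -
        have "0 \<le> 2 * K3 * P" "0 \<le> K0 * 2 powr q * Q" using K3 K0 PQ by auto
        then show ?thesis by (simp add: distrib_right)
      qed
      finally show ?thesis .
    next
      case False
      then have y: "norm x / 2 < norm y" by simp
      have xp: "0 < norm x / 2" using x0 by simp
      have "wgt (2 * \<theta>) y \<le> wgt q y" by (rule wgt_mono[OF q(3)])
      also have "\<dots> \<le> (norm x / 2) powr (- q)"
        unfolding wgt_def using y xp q(1) by (intro powr_mono2') auto
      also have "\<dots> = 2 powr q * X"
      proof -
        have "(norm x / 2) powr (- q) = norm x powr (- q) / 2 powr (- q)" by (rule powr_divide)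
        also have "\<dots> = 2 powr q * X" by (simp add: X_def powr_minus divide_inverse)
        finally show ?thesis .
      qed
      finally have far: "wgt (2 * \<theta>) y \<le> 2 powr q * X" .
      have "norm (oseen \<tau> (x - y) w) \<le> K0 * pk \<tau> (x - y) * (norm w)\<^sup>2"
        using k0[OF t0, of "x - y" w 0] by (simp add: power2_eq_square)
      also have "\<dots> \<le> K0 * pk \<tau> (x - y) * (A\<^sup>2 * (2 powr q * X))"
        using K0 pk0 by (intro mult_left_mono order_trans[OF w2] far) auto
      also have "\<dots> = K0 * 2 powr q * Q" by (simp only: Q_def mult_ac)
      finally have a: "norm (oseen \<tau> (x - y) w) \<le> K0 * 2 powr q * Q" .
      have "norm (oseen0 x w) \<le> K3 / norm x ^ (?d + 1) * (norm w)\<^sup>2" using k3' by blast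
      also have "K3 / norm x ^ (?d + 1) = K3 * norm x * (1 / norm x ^ (?d + 2))" using x0 by simp
      also have "K3 * norm x * (1 / norm x ^ (?d + 2)) * (norm w)\<^sup>2 \<le> K3 * (2 * (1 + norm y)) * X * (A\<^sup>2 * wgt (2 * \<theta>) y)"
        using K3 y x0 X by (intro mult_mono mult_left_mono Xd w2) (auto simp: less_imp_le)
      also have "\<dots> = 2 * K3 * (A\<^sup>2 * X * ((1 + norm y) * wgt (2 * \<theta>) y))" by (simp only: mult_ac)
      also have "\<dots> = 2 * K3 * P" unfolding w1 P_def ..
      finally have b: "norm (oseen0 x w) \<le> 2 * K3 * P" .
      have "norm (oseen \<tau> (x - y) w - oseen0 x w) \<le> K0 * 2 powr q * Q + 2 * K3 * P"
        by (rule order_trans[OF norm_triangle_ineq4 add_mono[OF a b]])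
      also have "\<dots> \<le> (K1 * 2 ^ (?d + 3) + K2 + 2 * K3) * P + K0 * 2 powr q * Q"
      proof -
        have "0 \<le> (K1 * 2 ^ (?d + 3) + K2) * P" using K1 K2 PQ by auto
        then show ?thesis by (simp add: distrib_right)
      qed
      finally show ?thesis .
    qed
    also have "\<dots> \<le> K * P + K * Q"
      using PQ K0 K1 K2 K3 by (intro add_mono mult_right_mono) (auto simp: K_def)
    also have "\<dots> = K * A\<^sup>2 * norm x powr (- q) * (wgt (2 * \<theta> - 1) y + pk \<tau> (x - y))"
      by (simp add: P_def Q_def X_def algebra_simps)
    finally show "norm (oseen \<tau> (x - y) w - oseen0 x w) \<le> K * A\<^sup>2 * norm x powr (- q) * (wgt (2 * \<theta> - 1) y + pk \<tau> (x - y))" .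
  qed
qed

text \<open>Integration of the pointwise estimate over y. The strict inequality 2\<theta> > d+1
  makes \<open>wgt (2 * \<theta> - 1)\<close> integrable, and \<open>pk\<close> contributes
  \<tau>^(-1/2).\<close>

lemma oconv_asymptotics:
  fixes q \<theta> :: real
  assumes q: "0 \<le> q" "q \<le> real DIM('a::euclidean_space) + 2" "q \<le> 2 * \<theta>" and \<theta>: "2 * \<theta> > real DIM('a) + 1"
  shows "\<exists>K>0. \<forall>\<tau>\<in>{0<..1}. \<forall>(f::'a \<Rightarrow> 'a) A x. dominated \<theta> A f \<longrightarrow> 0 \<le> A \<longrightarrow> norm x \<ge> 1 \<longrightarrow>
     norm (oconv \<tau> f x - oseen0_moment x f) \<le> K * A\<^sup>2 * norm x powr (- q) * \<tau> powr (-1/2)"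
proof -
  have \<theta>1: "2 * \<theta> \<ge> 1" and \<theta>d: "2 * \<theta> > real DIM('a)" and \<theta>p: "2 * \<theta> - 1 > real DIM('a)" using \<theta> by auto
  obtain K where K: "K > 0" and kb: "\<forall>\<tau>\<in>{0<..1}. \<forall>x y w :: 'a. \<forall>A\<ge>0. norm x \<ge> 1 \<longrightarrow> norm w \<le> A * wgt \<theta> y \<longrightarrow>
     norm (oseen \<tau> (x - y) w - oseen0 x w) \<le> K * A\<^sup>2 * norm x powr (- q) * (wgt (2 * \<theta> - 1) y + pk \<tau> (x - y))"
    using oseen_kernel_asymptotics[OF q \<theta>1] by (elim exE conjE) (rule that)
  define I where "I = (\<integral>z. wgt (DIM('a) + 1) (z::'a) \<partial>lborel)"
  define J where "J = (\<integral>z. wgt (2 * \<theta> - 1) (z::'a) \<partial>lborel)"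
  have IJ: "I \<ge> 0" "J \<ge> 0" unfolding I_def J_def by (auto intro: integral_nonneg_AE)
  show ?thesis
  proof (intro exI[of _ "K * (J + I + 1)"] conjI ballI allI impI)
    show "K * (J + I + 1) > 0" using K IJ by simp
    fix \<tau> A :: real and f :: "'a \<Rightarrow> 'a" and x :: 'a
    assume t: "\<tau> \<in> {0<..1}" and f: "dominated \<theta> A f" and A: "0 \<le> A" and x: "norm x \<ge> 1"
    have t0: "\<tau> > 0" using t by simp
    have i1: "integrable lebesgue (\<lambda>y. oseen \<tau> (x - y) (f y))"
      by (rule neumann_nonlinear_eq(1)[OF t0 _ dominated_square_integrable[OF f \<theta>d]]) (use f in \<open>simp add: dominated_def\<close>)
    have i2: "integrable lebesgue (\<lambda>y. oseen0 x (f y))" by (rule oseen0_moment_integrable[OF f \<theta>d])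
    define c where "c = K * A\<^sup>2 * norm x powr (- q)"
    have c: "c \<ge> 0" using K by (simp add: c_def)
    let ?g = "\<lambda>y. c * (wgt (2 * \<theta> - 1) y + pk \<tau> (x - y))"
    have ipk: "integrable lborel (\<lambda>y. pk \<tau> (x - y))"
      by (subst integrable_reflect_translate) (auto simp: pk_integrable t0)
    have iw: "integrable lborel (\<lambda>y::'a. wgt (2 * \<theta> - 1) y)" by (rule integrable_wgt[OF \<theta>p])
    have gb: "integrable lborel ?g" using ipk iw by auto
    have gm: "?g \<in> borel_measurable lborel" by measurable
    have g: "integrable lebesgue ?g" using gb integrable_completion[OF gm] by blast
    have "AE y in lebesgue. norm (f y) \<le> A * wgt \<theta> y" using f by (simp add: dominated_def)
    then have le: "AE y in lebesgue. norm (oseen \<tau> (x - y) (f y) - oseen0 x (f y)) \<le> ?g y"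
      by eventually_elim (use kb t A x in \<open>auto simp: c_def\<close>)
    have "norm (oconv \<tau> f x - oseen0_moment x f) = norm (LINT y|lebesgue. oseen \<tau> (x - y) (f y) - oseen0 x (f y))"
      unfolding oconv_def oseen0_moment_def using i1 i2 by simp
    also have "\<dots> \<le> (LINT y|lebesgue. ?g y)"
      by (rule norm_integral_le_AE[OF _ g le]) (intro Bochner_Integration.integrable_diff i1 i2)
    also have "\<dots> = (\<integral>y. ?g y \<partial>lborel)" by (rule integral_completion[OF gm])
    also have "\<dots> = c * (J + I / sqrt \<tau>)"
      using ipk iw integrable_reflect_translate(2)[of "pk \<tau>" x] pk_integrable(2)[OF t0, where 'a='a]
      by (simp add: I_def J_def)
    also have "\<dots> \<le> c * ((J + I + 1) * (1 / sqrt \<tau>))"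
    proof (intro mult_left_mono c)
      have s: "1 \<le> 1 / sqrt \<tau>" using t by simp
      have "J * 1 \<le> J * (1 / sqrt \<tau>)" by (rule mult_left_mono[OF s IJ(2)])
      then show "J + I / sqrt \<tau> \<le> (J + I + 1) * (1 / sqrt \<tau>)" using s by (simp add: add_divide_distrib)
    qed
    also have "1 / sqrt \<tau> = \<tau> powr (-1/2)" by (rule powr_minus_half[OF t0, symmetric])
    finally show "norm (oconv \<tau> f x - oseen0_moment x f) \<le> K * (J + I + 1) * A\<^sup>2 * norm x powr (- q) * \<tau> powr (-1/2)"
      by (simp only: c_def mult_ac)
  qed
qed

lemma oseen0_moment_diff_le:
  fixes f g :: "'a::euclidean_space \<Rightarrow> 'a"
  assumes f: "dominated \<theta> A f" and g: "dominated \<theta> A g" and A: "0 \<le> A" and \<theta>: "2 * \<theta> > real DIM('a)"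
    and fg: "AE y in lebesgue. norm (f y - g y) \<le> e * wgt \<theta> y" and e: "0 \<le> e"
  shows "norm (oseen0_moment x f - oseen0_moment x g) \<le> (norm x * \<bar>gG DIM('a) 0 0 (norm x)\<bar> + norm x ^ 3 * \<bar>gG DIM('a) 1 0 (norm x)\<bar>)
     * (2 * A * (\<integral>z. wgt (2 * \<theta>) (z::'a) \<partial>lborel)) * e"
proof -
  define c where "c = norm x * \<bar>gG DIM('a) 0 0 (norm x)\<bar> + norm x ^ 3 * \<bar>gG DIM('a) 1 0 (norm x)\<bar>"
  have c: "c \<ge> 0" by (simp add: c_def)
  note i = oseen0_moment_integrable[OF f \<theta>, of x] oseen0_moment_integrable[OF g \<theta>, of x]
  let ?h = "\<lambda>y::'a. (c * (2 * A) * e) * wgt (2 * \<theta>) y"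
  have h: "integrable lebesgue ?h"
    using integrable_wgt[OF \<theta>] by (intro integrable_mult_right) (simp add: integrable_completion)
  have "AE y in lebesgue. norm (f y) \<le> A * wgt \<theta> y" "AE y in lebesgue. norm (g y) \<le> A * wgt \<theta> y"
    using f g by (auto simp: dominated_def)
  with fg have le: "AE y in lebesgue. norm (oseen0 x (f y) - oseen0 x (g y)) \<le> ?h y"
  proof eventually_elim
    case (elim y)
    have "norm (oseen0 x (f y) - oseen0 x (g y)) \<le> c * ((norm (f y) + norm (g y)) * norm (f y - g y))"
      unfolding c_def by (rule oseen0_diff_le)
    also have "\<dots> \<le> c * ((A * wgt \<theta> y + A * wgt \<theta> y) * (e * wgt \<theta> y))"
      using elim A e by (intro mult_left_mono[OF _ c] mult_mono add_mono) auto
    also have "\<dots> = (c * (2 * A) * e) * (wgt \<theta> y * wgt \<theta> y)" by (simp add: algebra_simps)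
    finally show ?case by (simp add: wgt_add)
  qed
  have "norm (oseen0_moment x f - oseen0_moment x g) = norm (LINT y|lebesgue. oseen0 x (f y) - oseen0 x (g y))"
    unfolding oseen0_moment_def using i by simp
  also have "\<dots> \<le> (LINT y|lebesgue. ?h y)"
    by (rule norm_integral_le_AE[OF _ h le]) (intro Bochner_Integration.integrable_diff i)
  also have "\<dots> = (c * (2 * A) * e) * (\<integral>z. wgt (2 * \<theta>) (z::'a) \<partial>lborel)"
    by (simp add: integral_completion)
  finally show ?thesis by (simp only: c_def mult_ac)
qed

text \<open>Continuity in s provides the measurability for integrating the leading term over time; x
  is fixed, so the Lipschitz constant \<open>L\<close> may depend on it.\<close>

lemma continuous_oseen0_moment:
  fixes u :: "real \<Rightarrow> 'a::euclidean_space \<Rightarrow> 'a"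
  assumes u: "admissible \<theta> T R u" and \<theta>: "2 * \<theta> > real DIM('a)"
  shows "continuous_on {0<..<T} (\<lambda>s. oseen0_moment x (u s))"
  unfolding continuous_on_iff
proof (intro ballI allI impI)
  fix s e :: real assume s: "s \<in> {0<..<T}" and e: "e > 0"
  have R: "R \<ge> 0" using u by (simp add: admissible_def)
  define L where "L = (norm x * \<bar>gG DIM('a) 0 0 (norm x)\<bar> + norm x ^ 3 * \<bar>gG DIM('a) 1 0 (norm x)\<bar>) * (2 * R * (\<integral>z. wgt (2 * \<theta>) (z::'a) \<partial>lborel))"
  have L: "L \<ge> 0" unfolding L_def using R by (intro mult_nonneg_nonneg add_nonneg_nonneg integral_nonneg_AE) auto
  define \<epsilon> where "\<epsilon> = e / (L + 1)"
  have \<epsilon>: "\<epsilon> > 0" using e L by (simp add: \<epsilon>_def)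
  obtain \<delta> where \<delta>: "\<delta> > 0" and c: "\<And>r. r \<in> {0<..<T} \<Longrightarrow> \<bar>r - s\<bar> < \<delta> \<Longrightarrow> AE y in lebesgue. norm (u r y - u s y) \<le> \<epsilon> * wgt \<theta> y"
    using u s \<epsilon> unfolding admissible_def by blast
  show "\<exists>d>0. \<forall>r\<in>{0<..<T}. dist r s < d \<longrightarrow> dist (oseen0_moment x (u r)) (oseen0_moment x (u s)) < e"
  proof (intro exI[of _ \<delta>] conjI ballI impI \<delta>)
    fix r assume r: "r \<in> {0<..<T}" and d: "dist r s < \<delta>"
    have "norm (oseen0_moment x (u r) - oseen0_moment x (u s)) \<le> L * \<epsilon>"
      unfolding L_def using r s u \<epsilon> d
      by (intro oseen0_moment_diff_le[OF _ _ R \<theta>] c) (auto simp: admissible_def dist_real_def)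
    also have "\<dots> < (L + 1) * \<epsilon>" using \<epsilon> by simp
    also have "\<dots> = e" using L by (simp add: \<epsilon>_def)
    finally show "dist (oseen0_moment x (u r)) (oseen0_moment x (u s)) < e" by (simp add: dist_norm)
  qed
qed

text \<open>Averaging over the reflection cancels the products of a tangential and the normal velocity component,
  which would otherwise contribute a multiple of \<open>x\<^sub>d\<close> to the tangential components and of \<open>x'\<close> to the normal one.\<close>

definition oseen0_sym :: "'a::euclidean_space \<times> real \<Rightarrow> 'a \<times> real \<Rightarrow> 'a \<times> real" where
  "oseen0_sym x w = (1/2) *\<^sub>R (oseen0 x w + oseen0 x (reflect w))"

lemma oseen0_sym_le:
  fixes x w :: "'a::euclidean_space \<times> real"
  assumes x: "x \<noteq> 0"
  defines "c \<equiv> (gG DIM('a \<times> real) 0 0 1 + gG DIM('a \<times> real) 1 0 1) / norm x ^ (DIM('a \<times> real) + 2)"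
  shows "norm (fst (oseen0_sym x w)) \<le> c * norm (fst x) * (norm w)\<^sup>2"
    and "norm (snd (oseen0_sym x w)) \<le> c * norm (snd x) * (norm w)\<^sup>2"
proof -
  let ?d = "DIM('a \<times> real)"
  define g0 where "g0 = gG ?d 0 0 1 / norm x ^ (?d + 2)"
  define g1 where "g1 = gG ?d 1 0 1 / norm x ^ (?d + 4)"
  have g: "g0 \<ge> 0" "g1 \<ge> 0" by (simp_all add: g0_def g1_def gG_nonneg)
  define p where "p = fst x \<bullet> fst w"
  define q where "q = snd x * snd w"
  define n where "n = w \<bullet> w"
  have n: "n = (norm w)\<^sup>2" by (simp add: n_def power2_norm_eq_inner)
  have n0: "n \<ge> 0" by (simp add: n)
  have xw: "x \<bullet> w = p + q" "x \<bullet> reflect w = p - q" by (simp_all add: inner_prod_def p_def q_def reflect_def)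
  have rr: "reflect w \<bullet> reflect w = n" by (simp add: inner_prod_def n_def reflect_def)
  have cc: "c = g0 + g1 * (norm x)\<^sup>2"
    using x by (simp add: c_def g0_def g1_def add_divide_distrib power_add eval_nat_numeral)
  have fw: "norm (fst w) \<le> norm w" "norm (snd w) \<le> norm w" "norm (fst x) \<le> norm x" "norm (snd x) \<le> norm x"
    by (metis norm_fst_le norm_snd_le prod.collapse)+
  have p1: "\<bar>p\<bar> \<le> norm (fst x) * norm (fst w)" unfolding p_def by (rule Cauchy_Schwarz_ineq2)
  have q1: "\<bar>q\<bar> = norm (snd x) * norm (snd w)" by (simp add: q_def abs_mult)
  have pf: "\<bar>p\<bar> * norm (fst w) \<le> norm (fst x) * n"
  proof -
    have "\<bar>p\<bar> * norm (fst w) \<le> (norm (fst x) * norm (fst w)) * norm (fst w)" using p1 by (rule mult_right_mono) simp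
    also have "\<dots> \<le> norm (fst x) * (norm w * norm w)"
      unfolding mult.assoc using fw by (intro mult_left_mono mult_mono) auto
    finally show ?thesis by (simp add: n power2_eq_square)
  qed
  have qs: "\<bar>q\<bar> * norm (snd w) \<le> norm (snd x) * n"
  proof -
    have "\<bar>q\<bar> * norm (snd w) = norm (snd x) * (norm (snd w) * norm (snd w))" by (simp only: q1 mult.assoc)
    also have "\<dots> \<le> norm (snd x) * (norm w * norm w)" using fw by (intro mult_left_mono mult_mono) auto
    finally show ?thesis by (simp add: n power2_eq_square)
  qed
  have pq: "p\<^sup>2 + q\<^sup>2 \<le> 2 * ((norm x)\<^sup>2 * n)"
  proof -
    have "\<bar>p\<bar> \<le> norm x * norm w" using p1 mult_mono[OF fw(3) fw(1)] by simp
    then have "p\<^sup>2 \<le> (norm x * norm w)\<^sup>2" using power_mono[of "\<bar>p\<bar>" "norm x * norm w" 2] by simp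
    moreover have "\<bar>q\<bar> \<le> norm x * norm w" using q1 mult_mono[OF fw(4) fw(2)] by simp
    then have "q\<^sup>2 \<le> (norm x * norm w)\<^sup>2" using power_mono[of "\<bar>q\<bar>" "norm x * norm w" 2] by simp
    ultimately show ?thesis by (simp add: power_mult_distrib n)
  qed
  have S: "oseen0_sym x w = (1/2) *\<^sub>R (oseen_form g0 g1 0 x w + oseen_form g0 g1 0 x (reflect w))"
    unfolding oseen0_sym_def oseen0_power[OF x] g0_def g1_def ..
  \<comment> \<open>In the average the term with q times the tangential part of w, the term with p
    times the normal part, and the cross term 2pq of the square all cancel. The survivors carry p,
    controlled by |x'|, or x' itself; in the normal component q or x_d.\<close>
  have 1: "fst (oseen0_sym x w) = (g0 / 2 * p) *\<^sub>R fst w + (g0 / 4 * n - g1 / 8 * (p\<^sup>2 + q\<^sup>2)) *\<^sub>R fst x"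
    unfolding S oseen_form_def xw rr n_def[symmetric]
    by (rule euclidean_eqI) (simp add: reflect_def inner_add_left inner_diff_left algebra_simps add_divide_distrib power2_eq_square)
  have 2: "snd (oseen0_sym x w) = (g0 / 2 * q) * snd w + (g0 / 4 * n - g1 / 8 * (p\<^sup>2 + q\<^sup>2)) * snd x"
    unfolding S oseen_form_def xw rr n_def[symmetric]
    by (simp add: reflect_def algebra_simps add_divide_distrib power2_eq_square)
  have k: "\<bar>g0 / 4 * n - g1 / 8 * (p\<^sup>2 + q\<^sup>2)\<bar> \<le> g0 / 4 * n + g1 / 4 * ((norm x)\<^sup>2 * n)"
  proof -
    have "g1 / 8 * (p\<^sup>2 + q\<^sup>2) \<le> g1 / 8 * (2 * ((norm x)\<^sup>2 * n))" using g pq by (intro mult_left_mono) auto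
    moreover have "0 \<le> g1 / 8 * (p\<^sup>2 + q\<^sup>2)" "0 \<le> g0 / 4 * n" "0 \<le> g1 / 8 * (2 * ((norm x)\<^sup>2 * n))" using g n0 by auto
    ultimately show ?thesis by (simp add: abs_le_iff algebra_simps)
  qed
  have fin: "g0 / 2 * (m * n) + (g0 / 4 * n + g1 / 4 * ((norm x)\<^sup>2 * n)) * m \<le> c * m * (norm w)\<^sup>2" if "m \<ge> 0" for m
  proof -
    have "0 \<le> g0 * (m * n)" "0 \<le> g1 * (norm x)\<^sup>2 * (m * n)" using g n0 that by auto
    moreover have "c * m * (norm w)\<^sup>2 = g0 * (m * n) + g1 * (norm x)\<^sup>2 * (m * n)" by (simp add: cc n algebra_simps)
    moreover have "g0 / 2 * (m * n) + (g0 / 4 * n + g1 / 4 * ((norm x)\<^sup>2 * n)) * m = 3/4 * (g0 * (m * n)) + 1/4 * (g1 * (norm x)\<^sup>2 * (m * n))"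
      by (simp add: algebra_simps)
    ultimately show ?thesis by linarith
  qed
  have "norm (fst (oseen0_sym x w)) \<le> norm ((g0 / 2 * p) *\<^sub>R fst w) + norm ((g0 / 4 * n - g1 / 8 * (p\<^sup>2 + q\<^sup>2)) *\<^sub>R fst x)"
    unfolding 1 by (rule norm_triangle_ineq)
  also have "\<dots> = g0 / 2 * (\<bar>p\<bar> * norm (fst w)) + \<bar>g0 / 4 * n - g1 / 8 * (p\<^sup>2 + q\<^sup>2)\<bar> * norm (fst x)"
    using g by (simp add: abs_mult)
  also have "\<dots> \<le> g0 / 2 * (norm (fst x) * n) + (g0 / 4 * n + g1 / 4 * ((norm x)\<^sup>2 * n)) * norm (fst x)"
    using g pf k by (intro add_mono mult_left_mono mult_right_mono) auto
  finally show "norm (fst (oseen0_sym x w)) \<le> c * norm (fst x) * (norm w)\<^sup>2" using fin[of "norm (fst x)"] by simp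
  have "norm (snd (oseen0_sym x w)) \<le> norm ((g0 / 2 * q) * snd w) + norm ((g0 / 4 * n - g1 / 8 * (p\<^sup>2 + q\<^sup>2)) * snd x)"
    unfolding 2 by (rule norm_triangle_ineq)
  also have "\<dots> = g0 / 2 * (\<bar>q\<bar> * norm (snd w)) + \<bar>g0 / 4 * n - g1 / 8 * (p\<^sup>2 + q\<^sup>2)\<bar> * norm (snd x)"
    using g by (simp add: abs_mult)
  also have "\<dots> \<le> g0 / 2 * (norm (snd x) * n) + (g0 / 4 * n + g1 / 4 * ((norm x)\<^sup>2 * n)) * norm (snd x)"
    using g qs k by (intro add_mono mult_left_mono mult_right_mono) auto
  finally show "norm (snd (oseen0_sym x w)) \<le> c * norm (snd x) * (norm w)\<^sup>2" using fin[of "norm (snd x)"] by simp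
qed

lemma oseen0_moment_le:
  fixes f :: "'a::euclidean_space \<Rightarrow> 'a"
  assumes f: "dominated \<theta> A f" and A: "0 \<le> A" and \<theta>: "2 * \<theta> > real DIM('a)"
  shows "norm (oseen0_moment x f) \<le> (norm x * \<bar>gG DIM('a) 0 0 (norm x)\<bar> + norm x ^ 3 * \<bar>gG DIM('a) 1 0 (norm x)\<bar>)
     * (2 * A * (\<integral>z. wgt (2 * \<theta>) (z::'a) \<partial>lborel)) * A"
proof -
  have z: "oseen0_moment x (\<lambda>_. 0 :: 'a) = 0" by (simp add: oseen0_moment_def oseen0_def oseen_form_def)
  have "dominated \<theta> A (\<lambda>_. 0 :: 'a)" using A by (simp add: dominated_def)
  moreover have "AE y in lebesgue. norm (f y - 0) \<le> A * wgt \<theta> y" using f by (simp add: dominated_def)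
  ultimately show ?thesis using oseen0_moment_diff_le[OF f _ A \<theta> _ A, of "\<lambda>_. 0" x] by (simp add: z)
qed

lemma oseen0_moment_scale:
  "c > 0 \<Longrightarrow> oseen0_moment (c *\<^sub>R x) f = (1 / c ^ (DIM('a::euclidean_space) + 1)) *\<^sub>R oseen0_moment (x :: 'a) f"
  by (simp only: oseen0_moment_def oseen0_homogeneous integral_scaleR_right)

section \<open>Parity of the reflected field\<close>

lemma extend_reflect: "extend v (reflect x) = reflect (extend v x)"
  by (auto simp: extend_def reflect_def zero_prod_def)

lemma extend_borel_measurable:
  fixes v :: "'a::euclidean_space \<times> real \<Rightarrow> 'a \<times> real"
  assumes [measurable]: "v \<in> borel_measurable borel"
  shows "extend v \<in> borel_measurable borel"
proof -
  have [measurable]: "Measurable.pred borel (\<lambda>x::'a \<times> real. snd x > 0)" "Measurable.pred borel (\<lambda>x::'a \<times> real. snd x < 0)"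
    unfolding pred_def by (simp_all, (intro borel_open open_Collect_less continuous_intros)+)
  show ?thesis unfolding extend_def[abs_def] by measurable
qed

text \<open>Substituting \<open>reflect y\<close> for y and using \<open>extend_reflect\<close>
  shows that the moment does not change when the values of the field are reflected. It therefore
  equals the integral of \<open>oseen0_sym\<close>, for which the anisotropic bounds hold at every
  y.\<close>

lemma oseen0_moment_extend_le:
  fixes v :: "'a::euclidean_space \<times> real \<Rightarrow> 'a \<times> real"
  assumes v: "v \<in> borel_measurable borel" "\<And>x. norm (v x) \<le> A * wgt \<theta> x"
    and \<theta>: "2 * \<theta> > real DIM('a \<times> real)" and x: "x \<noteq> 0"
  defines "B \<equiv> (gG DIM('a \<times> real) 0 0 1 + gG DIM('a \<times> real) 1 0 1) / norm x ^ (DIM('a \<times> real) + 2)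
      * (A\<^sup>2 * (\<integral>z. wgt (2 * \<theta>) (z :: 'a \<times> real) \<partial>lborel))"
  shows "norm (fst (oseen0_moment x (extend v))) \<le> B * norm (fst x)"
    and "norm (snd (oseen0_moment x (extend v))) \<le> B * norm (snd x)"
proof -
  let ?w = "extend v"
  define c where "c = (gG DIM('a \<times> real) 0 0 1 + gG DIM('a \<times> real) 1 0 1) / norm x ^ (DIM('a \<times> real) + 2)"
  have c: "c \<ge> 0" by (simp add: c_def gG_nonneg)
  have wm: "?w \<in> borel_measurable borel" by (rule extend_borel_measurable[OF v(1)])
  have rm: "(\<lambda>y. reflect (?w y)) \<in> borel_measurable borel" by (rule measurable_compose[OF wm reflect_borel_measurable])
  have wb: "norm (?w y) \<le> A * wgt \<theta> y" for y by (rule norm_extend_le[OF v(2)])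
  have dw: "dominated \<theta> A ?w" using wm wb by (auto simp: dominated_def intro: measurable_completion)
  have dr: "dominated \<theta> A (\<lambda>y. reflect (?w y))" using rm wb by (auto simp: dominated_def intro: measurable_completion)
  have m1: "(\<lambda>y. oseen0 x (?w y)) \<in> borel_measurable lborel" using wm by (intro oseen0_measurable) simp
  have m2: "(\<lambda>y. oseen0 x (reflect (?w y))) \<in> borel_measurable lborel" using rm by (intro oseen0_measurable) simp
  have i1: "integrable lborel (\<lambda>y. oseen0 x (?w y))"
    using oseen0_moment_integrable[OF dw \<theta>] integrable_completion[OF m1] by blast
  have i2: "integrable lborel (\<lambda>y. oseen0 x (reflect (?w y)))"
    using oseen0_moment_integrable[OF dr \<theta>] integrable_completion[OF m2] by blast
  let ?M = "oseen0_moment x ?w"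
  have M1: "?M = (\<integral>y. oseen0 x (?w y) \<partial>lborel)" unfolding oseen0_moment_def by (rule integral_completion[OF m1])
  have M2: "?M = (\<integral>y. oseen0 x (reflect (?w y)) \<partial>lborel)"
    unfolding M1 using integral_lborel_reflect[of "\<lambda>y. oseen0 x (?w y)"] m1 by (simp add: extend_reflect)
  have isym: "integrable lborel (\<lambda>y. oseen0_sym x (?w y))" unfolding oseen0_sym_def using i1 i2 by simp
  have Ms: "?M = (\<integral>y. oseen0_sym x (?w y) \<partial>lborel)"
  proof -
    have "(\<integral>y. oseen0_sym x (?w y) \<partial>lborel) = (1/2) *\<^sub>R ((\<integral>y. oseen0 x (?w y) \<partial>lborel) + (\<integral>y. oseen0 x (reflect (?w y)) \<partial>lborel))"
      unfolding oseen0_sym_def using i1 i2 by simp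
    also have "\<dots> = (1/2) *\<^sub>R (?M + ?M)" by (simp only: M1[symmetric] M2[symmetric])
    also have "\<dots> = ?M" by (simp add: scaleR_2[symmetric])
    finally show ?thesis by simp
  qed
  \<comment> \<open>Stated for a bounded linear map p so that both projections are treated at
    once.\<close>
  have comp: "norm (p ?M) \<le> B * m"
    if p: "bounded_linear p" and b: "\<And>w. norm (p (oseen0_sym x w)) \<le> c * m * (norm w)\<^sup>2" and m: "0 \<le> m"
    for p :: "'a \<times> real \<Rightarrow> 'v::{banach, second_countable_topology}" and m
  proof -
    have g: "integrable lborel (\<lambda>y::'a \<times> real. (c * m * A\<^sup>2) * wgt (2 * \<theta>) y)" by (intro integrable_mult_right integrable_wgt \<theta>)
    have le: "norm (p (oseen0_sym x (?w y))) \<le> (c * m * A\<^sup>2) * wgt (2 * \<theta>) y" for y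
    proof -
      have "(norm (?w y))\<^sup>2 \<le> (A * wgt \<theta> y)\<^sup>2" using wb by (intro power_mono) auto
      also have "\<dots> = A\<^sup>2 * wgt (2 * \<theta>) y" using wgt_add[of \<theta> y \<theta>] by (simp add: power2_eq_square mult_ac)
      finally have "c * m * (norm (?w y))\<^sup>2 \<le> c * m * (A\<^sup>2 * wgt (2 * \<theta>) y)" using c m by (intro mult_left_mono) auto
      then show ?thesis using b[of "?w y"] by (simp add: mult_ac)
    qed
    have "norm (p ?M) = norm (\<integral>y. p (oseen0_sym x (?w y)) \<partial>lborel)" unfolding Ms by (subst integral_bounded_linear[OF p isym]) simp
    also have "\<dots> \<le> (\<integral>y. (c * m * A\<^sup>2) * wgt (2 * \<theta>) (y :: 'a \<times> real) \<partial>lborel)"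
      by (rule norm_integral_le_AE[OF integrable_bounded_linear[OF p isym] g]) (intro AE_I2 le)
    also have "\<dots> = (c * m * A\<^sup>2) * (\<integral>z. wgt (2 * \<theta>) (z :: 'a \<times> real) \<partial>lborel)" by (rule integral_mult_right_zero)
    finally show ?thesis by (simp add: B_def c_def mult_ac)
  qed
  show "norm (fst ?M) \<le> B * norm (fst x)"
    by (rule comp[OF bounded_linear_fst]) (use oseen0_sym_le(1)[OF x] in \<open>auto simp: c_def\<close>)
  show "norm (snd ?M) \<le> B * norm (snd x)"
    by (rule comp[OF bounded_linear_snd]) (use oseen0_sym_le(2)[OF x] in \<open>auto simp: c_def\<close>)
qed

section \<open>The profile of the constructed solution\<close>

context half_space_problem
begin

definition profile :: "real \<Rightarrow> 'a \<times> real \<Rightarrow> 'a \<times> real" where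
  "profile t x = - (LINT s:{0<..<t}|lebesgue. oseen0_moment x (extend (solution s)))"

lemma solution_admissible: "admissible \<theta> T R (\<lambda>s. extend (solution s))"
  using regular_admissible[OF regular_solution] R_ge_1 by simp

lemma solution_dominated: "0 < s \<Longrightarrow> s < T \<Longrightarrow> dominated \<theta> R (extend (solution s))"
  using solution_admissible by (auto simp: admissible_def)

lemma set_integrable_const: "set_integrable lebesgue {0<..<t::real} (\<lambda>_. c :: real)"
proof -
  have "emeasure lborel {0<..<t} < \<infinity>" by (cases "0 \<le> t") auto
  then show ?thesis unfolding set_integrable_def by (intro integrable_scaleR_left) (auto simp: integrable_indicator_iff)
qed

lemma oseen0_moment_set_integrable:
  assumes t: "t < T"
  shows "set_integrable lebesgue {0<..<t} (\<lambda>s. oseen0_moment x (extend (solution s)))"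
proof (rule set_integral_dominated(1)[OF _ _ set_integrable_const])
  show "continuous_on {0<..<t} (\<lambda>s. oseen0_moment x (extend (solution s)))"
    by (rule continuous_on_subset[OF continuous_oseen0_moment[OF solution_admissible two_theta_gt]]) (use t in auto)
  show "norm (oseen0_moment x (extend (solution s))) \<le> (norm x * \<bar>gG DIM('a \<times> real) 0 0 (norm x)\<bar> + norm x ^ 3 * \<bar>gG DIM('a \<times> real) 1 0 (norm x)\<bar>)
     * (2 * R * (\<integral>z. wgt (2 * \<theta>) (z::'a \<times> real) \<partial>lborel)) * R" if "s \<in> {0<..<t}" for s
    using that t R_ge_1 by (intro oseen0_moment_le[OF solution_dominated _ two_theta_gt]) auto
qed auto

lemma profile_homogeneous:
  assumes r: "r > 0"
  shows "profile t (r *\<^sub>R x) = r powr (- (real DIM('a \<times> real) + 1)) *\<^sub>R profile t x"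
proof -
  let ?c = "1 / r ^ (DIM('a \<times> real) + 1)"
  have "profile t (r *\<^sub>R x) = ?c *\<^sub>R profile t x"
    by (simp only: profile_def oseen0_moment_scale[OF r] set_integral_scaleR_right scaleR_minus_right)
  also have "?c = r powr (- (real DIM('a \<times> real) + 1))"
  proof -
    have "r powr (- real (DIM('a \<times> real) + 1)) = ?c" by (subst powr_minus_divide, subst powr_realpow[OF r]) simp
    then show ?thesis by (simp add: add.commute)
  qed
  finally show ?thesis .
qed

text \<open>The slice bounds are integrated over a time interval of length t < T \<le> 1, and the
  solution is bounded by R times the weight at all times in (0, T); hence \<open>B\<close> does not
  depend on t.\<close>

lemma profile_le:
  obtains B where "\<And>t x. 0 \<le> t \<Longrightarrow> t < T \<Longrightarrow> x \<noteq> 0 \<Longrightarrow> norm (fst (profile t x)) \<le> B * norm (fst x) * norm x powr (- (real DIM('a \<times> real) + 2))"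
    "\<And>t x. 0 \<le> t \<Longrightarrow> t < T \<Longrightarrow> x \<noteq> 0 \<Longrightarrow> norm (snd (profile t x)) \<le> B * norm (snd x) * norm x powr (- (real DIM('a \<times> real) + 2))"
proof -
  define B where "B = (gG DIM('a \<times> real) 0 0 1 + gG DIM('a \<times> real) 1 0 1) * (R\<^sup>2 * (\<integral>z. wgt (2 * \<theta>) (z :: 'a \<times> real) \<partial>lborel))"
  have B: "B \<ge> 0" unfolding B_def by (intro mult_nonneg_nonneg add_nonneg_nonneg integral_nonneg_AE) (auto simp: gG_nonneg)
  have pw: "1 / norm x ^ (DIM('a \<times> real) + 2) = norm x powr (- (real DIM('a \<times> real) + 2))" if "x \<noteq> 0" for x :: "'a \<times> real"
  proof -
    have "norm x powr (- real (DIM('a \<times> real) + 2)) = 1 / norm x ^ (DIM('a \<times> real) + 2)"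
      using that by (subst powr_minus_divide, subst powr_realpow) auto
    then show ?thesis by (simp add: add.commute)
  qed
  have main: "norm (p (profile t x)) \<le> B * m * norm x powr (- (real DIM('a \<times> real) + 2))"
    if p: "bounded_linear p" and t: "0 \<le> t" "t < T" and x: "x \<noteq> 0" and m: "0 \<le> m"
      and b: "\<And>v. v \<in> borel_measurable borel \<Longrightarrow> (\<And>x. norm (v x) \<le> R * wgt \<theta> x) \<Longrightarrow> norm (p (oseen0_moment x (extend v)))
        \<le> (gG DIM('a \<times> real) 0 0 1 + gG DIM('a \<times> real) 1 0 1) / norm x ^ (DIM('a \<times> real) + 2)
      * (R\<^sup>2 * (\<integral>z. wgt (2 * \<theta>) (z :: 'a \<times> real) \<partial>lborel)) * m"
    for p :: "'a \<times> real \<Rightarrow> 'v::{banach, second_countable_topology}" and m t x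
  proof -
    define D where "D = B * m * norm x powr (- (real DIM('a \<times> real) + 2))"
    have D0: "D \<ge> 0" using B m by (simp add: D_def)
    have le: "norm (p (oseen0_moment x (extend (solution s)))) \<le> D" if s: "s \<in> {0<..<t}" for s
    proof -
      have "norm (p (oseen0_moment x (extend (solution s)))) \<le> (gG DIM('a \<times> real) 0 0 1 + gG DIM('a \<times> real) 1 0 1) / norm x ^ (DIM('a \<times> real) + 2)
      * (R\<^sup>2 * (\<integral>z. wgt (2 * \<theta>) (z :: 'a \<times> real) \<partial>lborel)) * m"
        using s t by (intro b regularD[OF regular_solution]) (use regular_solution in \<open>auto simp: regular_def\<close>)
      also have "\<dots> = D" unfolding D_def B_def pw[OF x, symmetric] by simp
      finally show ?thesis .
    qed
    have i: "integrable lebesgue (\<lambda>s. indicator {0<..<t} s *\<^sub>R oseen0_moment x (extend (solution s)))"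
      using oseen0_moment_set_integrable[OF t(2), of x] by (simp add: set_integrable_def)
    have "p (profile t x) = - (\<integral>s. p (indicator {0<..<t} s *\<^sub>R oseen0_moment x (extend (solution s))) \<partial>lebesgue)"
      unfolding profile_def set_lebesgue_integral_def integral_bounded_linear[OF p i]
      by (rule linear_neg[OF bounded_linear.linear[OF p]])
    then have "norm (p (profile t x)) = norm (\<integral>s. p (indicator {0<..<t} s *\<^sub>R oseen0_moment x (extend (solution s))) \<partial>lebesgue)"
      by (simp only: norm_minus_cancel)
    also have "\<dots> \<le> (\<integral>s. indicator {0<..<t} s *\<^sub>R D \<partial>lebesgue)"
    proof (rule norm_integral_le_AE[OF integrable_bounded_linear[OF p i]])
      show "integrable lebesgue (\<lambda>s. indicator {0<..<t} s *\<^sub>R D)" using set_integrable_const[of t D] by (simp add: set_integrable_def)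
      show "AE s in lebesgue. norm (p (indicator {0<..<t} s *\<^sub>R oseen0_moment x (extend (solution s)))) \<le> indicator {0<..<t} s *\<^sub>R D"
        using le by (intro AE_I2) (simp add: indicator_def linear_0[OF bounded_linear.linear[OF p]])
    qed
    also have "\<dots> = t * D" using t by simp
    also have "\<dots> \<le> 1 * D" using t T D0 by (intro mult_right_mono) auto
    finally show ?thesis by (simp add: D_def)
  qed
  show thesis
  proof (rule that[of B])
    fix t and x :: "'a \<times> real" assume t: "0 \<le> t" "t < T" and x: "x \<noteq> 0"
    show "norm (fst (profile t x)) \<le> B * norm (fst x) * norm x powr (- (real DIM('a \<times> real) + 2))"
    proof (rule main[OF bounded_linear_fst t x norm_ge_zero])
      fix v :: "'a \<times> real \<Rightarrow> 'a \<times> real"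
      assume "v \<in> borel_measurable borel" "\<And>x. norm (v x) \<le> R * wgt \<theta> x"
      note oseen0_moment_extend_le(1)[OF this two_theta_gt x]
      then show "norm (fst (oseen0_moment x (extend v))) \<le> (gG DIM('a \<times> real) 0 0 1 + gG DIM('a \<times> real) 1 0 1) / norm x ^ (DIM('a \<times> real) + 2)
        * (R\<^sup>2 * (\<integral>z. wgt (2 * \<theta>) (z :: 'a \<times> real) \<partial>lborel)) * norm (fst x)" .
    qed
    show "norm (snd (profile t x)) \<le> B * norm (snd x) * norm x powr (- (real DIM('a \<times> real) + 2))"
    proof (rule main[OF bounded_linear_snd t x norm_ge_zero])
      fix v :: "'a \<times> real \<Rightarrow> 'a \<times> real"
      assume "v \<in> borel_measurable borel" "\<And>x. norm (v x) \<le> R * wgt \<theta> x"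
      note oseen0_moment_extend_le(2)[OF this two_theta_gt x]
      then show "norm (snd (oseen0_moment x (extend v))) \<le> (gG DIM('a \<times> real) 0 0 1 + gG DIM('a \<times> real) 1 0 1) / norm x ^ (DIM('a \<times> real) + 2)
        * (R\<^sup>2 * (\<integral>z. wgt (2 * \<theta>) (z :: 'a \<times> real) \<partial>lborel)) * norm (snd x)" .
    qed
  qed
qed

text \<open>Integrates \<open>oconv_asymptotics\<close> over the elapsed times, where the singular
  factor contributes 2 t^(1/2) \<le> 2. The outcome holds at every point with |x| \<ge> 1, and its
  constant is independent of t.\<close>

lemma solution_asymptotics:
  assumes q: "0 \<le> q" "q \<le> real DIM('a \<times> real) + 2" "q \<le> 2 * \<theta>" and \<theta>: "2 * \<theta> > real DIM('a \<times> real) + 1"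
  obtains K where "\<And>t x. 0 \<le> t \<Longrightarrow> t < T \<Longrightarrow> 1 \<le> norm x \<Longrightarrow>
    norm (solution t x - (neumann_heat t a x + profile t x)) \<le> K * norm x powr (- q)"
proof -
  obtain K where K: "K > 0" and kb': "\<forall>\<tau>\<in>{0<..1}. \<forall>(f::'a \<times> real \<Rightarrow> 'a \<times> real) A x. dominated \<theta> A f \<longrightarrow> 0 \<le> A \<longrightarrow> norm x \<ge> 1 \<longrightarrow>
     norm (oconv \<tau> f x - oseen0_moment x f) \<le> K * A\<^sup>2 * norm x powr (- q) * \<tau> powr (-1/2)"
    using oconv_asymptotics[OF q \<theta>] by (elim exE conjE) (rule that)
  show thesis
  proof (rule that[of "2 * K * R\<^sup>2"])
    fix t and x :: "'a \<times> real" assume t: "0 \<le> t" "t < T" and x: "1 \<le> norm x"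
    let ?u = "\<lambda>s. extend (solution s)"
    let ?S = "{0<..<t}"
    define D where "D = K * R\<^sup>2 * norm x powr (- q)"
    have D: "D \<ge> 0" using K by (simp add: D_def)
    have t': "t \<le> T" "t \<le> 1" using t T by auto
    have i1: "set_integrable lebesgue ?S (\<lambda>s. oconv (t - s) (?u s) x)"
      by (rule duhamel_integrable(1)[OF solution_admissible t(1) t'])
    note i2 = oseen0_moment_set_integrable[OF t(2), of x]
    have e: "solution t x - (neumann_heat t a x + profile t x) = - (LINT s:?S|lebesgue. oconv (t - s) (?u s) x - oseen0_moment x (?u s))"
      unfolding solution_eq[OF t(1) t'(1)] profile_def duhamel_def set_integral_diff(2)[OF i1 i2] by simp
    have "norm (LINT s:?S|lebesgue. oconv (t - s) (?u s) x - oseen0_moment x (?u s)) \<le> (\<integral>s. indicator ?S s *\<^sub>R (D * (t - s) powr (-1/2)) \<partial>lebesgue)"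
      unfolding set_lebesgue_integral_def
    proof (rule norm_integral_le_AE)
      show "integrable lebesgue (\<lambda>s. indicator ?S s *\<^sub>R (oconv (t - s) (?u s) x - oseen0_moment x (?u s)))"
        using set_integral_diff(1)[OF i1 i2] by (simp only: set_integrable_def)
      show "integrable lebesgue (\<lambda>s. indicator ?S s *\<^sub>R (D * (t - s) powr (-1/2)))"
        using set_integrable_mult_right[OF half_integral(1)[OF t(1)], of D] by (simp only: set_integrable_def)
      show "AE s in lebesgue. norm (indicator ?S s *\<^sub>R (oconv (t - s) (?u s) x - oseen0_moment x (?u s))) \<le> indicator ?S s *\<^sub>R (D * (t - s) powr (-1/2))"
      proof (rule AE_I2)
        fix s
        show "norm (indicator ?S s *\<^sub>R (oconv (t - s) (?u s) x - oseen0_moment x (?u s))) \<le> indicator ?S s *\<^sub>R (D * (t - s) powr (-1/2))"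
        proof (cases "s \<in> ?S")
          case True
          then have "norm (oconv (t - s) (?u s) x - oseen0_moment x (?u s)) \<le> D * (t - s) powr (-1/2)"
          proof -
            have "t - s \<in> {0<..1}" "dominated \<theta> R (?u s)" "0 \<le> R"
              using True t t' R_ge_1 by (auto intro: solution_dominated)
            then show ?thesis unfolding D_def using kb' x by blast
          qed
          then show ?thesis using True by simp
        qed simp
      qed
    qed
    also have "\<dots> = D * (2 * t powr (1/2))"
      using set_integral_mult_right[of lebesgue ?S D "\<lambda>s. (t - s) powr (-1/2)"] half_integral(2)[OF t(1)]
      by (simp only: set_lebesgue_integral_def)
    also have "\<dots> \<le> D * (2 * 1)"
    proof -
      have "t powr (1/2) \<le> 1 powr (1/2)" using t t' by (intro powr_mono2) auto
      then show ?thesis using D by (intro mult_left_mono) auto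
    qed
    finally show "norm (solution t x - (neumann_heat t a x + profile t x)) \<le> 2 * K * R\<^sup>2 * norm x powr (- q)"
      unfolding e by (simp add: D_def mult_ac)
  qed
qed

end

theorem proposition3p10:
  fixes a :: "(real ^ 'n) \<times> real \<Rightarrow> (real ^ 'n) \<times> real" and \<theta> :: real and d :: nat
  assumes d: "d = DIM((real ^ 'n) \<times> real)"
    and \<theta>: "\<theta> > (real d + 1) / 2"
    and a: "a \<in> Linf \<theta>"
    and div_a: "div_free a"
    and trace_a: "normal_trace_zero a"
  shows "\<exists>T>0. \<exists>u. NS_solution a (min \<theta> (real d + 1)) T u \<and>
    (\<forall>v. NS_solution a (min \<theta> (real d + 1)) T v \<longrightarrow>
       (\<forall>t\<in>{0..<T}. AE x in lebesgue_on half_space. v t x = u t x)) \<and>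
    (\<exists>H :: real \<Rightarrow> (real ^ 'n) \<times> real \<Rightarrow> (real ^ 'n) \<times> real.
       bigO_t T (\<lambda>x. norm x powr min (2 * \<theta>) (real d + 2))
         (\<lambda>t x. u t x - (neumann_heat t a x + H t x)) \<and>
       (\<forall>t\<in>{0..<T}. \<forall>x\<in>half_space. \<forall>r>0.
          H t (r *\<^sub>R x) = r powr (- (real d + 1)) *\<^sub>R H t x) \<and>
       (\<exists>C. \<forall>t\<in>{0..<T}. \<forall>x\<in>half_space.
          (\<forall>j. \<bar>fst (H t x) $ j\<bar> \<le> C * norm (fst x) * norm x powr (- (real d + 2))) \<and>
          \<bar>snd (H t x)\<bar> \<le> C * \<bar>snd x\<bar> * norm x powr (- (real d + 2))))"
proof -
  define \<theta>' where "\<theta>' = min \<theta> (real d + 1)"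
  define q where "q = min (2 * \<theta>) (real d + 2)"
  have th: "2 * \<theta>' \<ge> real DIM((real ^ 'n) \<times> real) + 1" "2 * \<theta>' > real DIM((real ^ 'n) \<times> real) + 1" "\<theta>' \<le> real DIM((real ^ 'n) \<times> real) + 1"
    using \<theta> unfolding \<theta>'_def d by (auto simp: min_def)
  \<comment> \<open>Truncating the exponent does not harm the remainder: 2(d+1) \<ge> d+2, so q
    \<le> 2 min(\<theta>, d+1).\<close>
  have q: "0 \<le> q" "q \<le> real DIM((real ^ 'n) \<times> real) + 2" "q \<le> 2 * \<theta>'"
    using \<theta> unfolding \<theta>'_def q_def d by (auto simp: min_def)
  obtain A where A: "0 \<le> A" and am: "a \<in> borel_measurable (lebesgue_on half_space)"
    and ab: "AE x in lebesgue_on half_space. norm (a x) \<le> A * wgt \<theta> x"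
    by (rule LinfD[OF a])
  have "AE x in lebesgue_on half_space. norm (a x) \<le> A * wgt \<theta>' x"
    using ab
  proof eventually_elim
    case (elim x)
    have "A * wgt \<theta> x \<le> A * wgt \<theta>' x" by (intro mult_left_mono wgt_mono A) (simp add: \<theta>'_def)
    with elim show ?case by (rule order_trans)
  qed
  then have dom: "dominated \<theta>' A (extend a)" by (rule dominated_extend[OF am _ A])
  obtain C where ob: "oseen_bounds \<theta>' C (wgt (real (DIM((real ^ 'n) \<times> real) + 1)) :: (real ^ 'n) \<times> real \<Rightarrow> real)"
    using oseen_bounds_exist[OF th(1)] by (elim exE) (rule that)
  interpret B: oseen_bounds \<theta>' C "wgt (real (DIM((real ^ 'n) \<times> real) + 1)) :: (real ^ 'n) \<times> real \<Rightarrow> real" by (rule ob)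
  define R where "R = 2 * (A * (\<integral>z. heat_kernel 1 (z :: (real ^ 'n) \<times> real) * (1 + norm z) powr \<theta>' \<partial>lborel)) + 1"
  have R: "R \<ge> 1" unfolding R_def using A by (simp add: integral_nonneg_AE)
  \<comment> \<open>The second entry solves 8 C R sqrt T = 1; the first keeps all elapsed times at
    most 1, the range of the slice estimates.\<close>
  define T where "T = min 1 ((1 / (8 * C * R))\<^sup>2)"
  have CR: "8 * C * R > 0" using B.C_pos R by simp
  have T: "0 < T" "T \<le> 1" "8 * C * R * sqrt T \<le> 1"
  proof -
    show "0 < T" "T \<le> 1" using CR by (auto simp: T_def)
    have "sqrt T \<le> sqrt ((1 / (8 * C * R))\<^sup>2)" unfolding T_def by (rule real_sqrt_le_mono) simp
    also have "\<dots> = 1 / (8 * C * R)" using CR by (simp only: real_sqrt_abs) simp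
    finally have "(8 * C * R) * sqrt T \<le> (8 * C * R) * (1 / (8 * C * R))" using CR by (intro mult_left_mono) auto
    then show "8 * C * R * sqrt T \<le> 1" using CR by (simp split: if_splits)
  qed
  interpret P: half_space_problem \<theta>' C "wgt (real (DIM((real ^ 'n) \<times> real) + 1)) :: (real ^ 'n) \<times> real \<Rightarrow> real" a A R T
    by unfold_locales (use th dom A R_def T in auto)
  obtain K where K: "\<And>t x. 0 \<le> t \<Longrightarrow> t < T \<Longrightarrow> 1 \<le> norm x \<Longrightarrow>
    norm (P.solution t x - (neumann_heat t a x + P.profile t x)) \<le> K * norm x powr (- q)"
    using P.solution_asymptotics[OF q th(2)] by blast
  obtain B where B: "\<And>t x. 0 \<le> t \<Longrightarrow> t < T \<Longrightarrow> x \<noteq> 0 \<Longrightarrow> norm (fst (P.profile t x)) \<le> B * norm (fst x) * norm x powr (- (real DIM((real ^ 'n) \<times> real) + 2))"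
    "\<And>t x. 0 \<le> t \<Longrightarrow> t < T \<Longrightarrow> x \<noteq> 0 \<Longrightarrow> norm (snd (P.profile t x)) \<le> B * norm (snd x) * norm x powr (- (real DIM((real ^ 'n) \<times> real) + 2))"
    using P.profile_le by blast
  have O: "bigO_t T (\<lambda>x. norm x powr q) (\<lambda>t x. P.solution t x - (neumann_heat t a x + P.profile t x))"
    unfolding bigO_t_def
  \<comment> \<open>The estimate starts at radius 1, and the constant function \<open>K\<close> is
    trivially locally bounded in t.\<close>
  proof (intro exI[of _ 1] exI[of _ "\<lambda>_. K"] conjI ballI AE_I2 impI)
    fix t x assume t: "t \<in> {0..<T}" and x: "1 \<le> norm (x :: (real ^ 'n) \<times> real)"
    have "norm x powr q * norm (P.solution t x - (neumann_heat t a x + P.profile t x)) \<le> norm x powr q * (K * norm x powr (- q))"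
      using K[of t x] t x by (intro mult_left_mono) auto
    also have "\<dots> = K * (norm x powr q * norm x powr (- q))" by (simp only: mult_ac)
    also have "norm x powr q * norm x powr (- q) = 1" using x by (subst powr_add[symmetric]) auto
    finally show "norm (norm x powr q *\<^sub>R (P.solution t x - (neumann_heat t a x + P.profile t x))) \<le> K" by simp
  qed (simp add: image_constant_conv)
  have hom: "\<forall>t\<in>{0..<T}. \<forall>x\<in>half_space. \<forall>r>0. P.profile t (r *\<^sub>R x) = r powr (- (real d + 1)) *\<^sub>R P.profile t x"
    unfolding d using P.profile_homogeneous by auto
  have comp: "(\<forall>j. \<bar>fst (P.profile t x) $ j\<bar> \<le> B * norm (fst x) * norm x powr (- (real d + 2))) \<and>
          \<bar>snd (P.profile t x)\<bar> \<le> B * \<bar>snd x\<bar> * norm x powr (- (real d + 2))"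
    if t: "t \<in> {0..<T}" and x: "x \<in> half_space" for t x
  proof -
    have x0: "x \<noteq> 0" using x by (auto simp: half_space_def)
    have "\<bar>fst (P.profile t x) $ j\<bar> \<le> norm (fst (P.profile t x))" for j by (rule component_le_norm_cart)
    then show ?thesis unfolding d using B[OF _ _ x0, of t] t order_trans by fastforce
  qed
  show ?thesis
    unfolding \<theta>'_def[symmetric] q_def[symmetric]
    using T(1) P.NS_solution_solution P.solution_unique O hom comp
    by (intro exI[of _ T] exI[of _ P.solution] exI[of _ P.profile] exI[of _ B] conjI allI impI ballI) auto
qed

end
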